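(* Let $k\geq1$ and $\lambda\in X_+$. Assume that $\hat{\mathscr{E}}^{k-1}_{\lambda,k-1}$ is an irreducible $\tilde{\mathfrak g}_{k-1}$-module. Let $\hat M_k=\hat M_k(\lambda)\subset\hat{\mathscr{E}}^0_{\lambda,k}$ be the unique maximal proper $\hat{\mathfrak g}_k$-submodule. Then $\hat M_k$ is also maximal among the proper $\tilde{\mathfrak g}_k$-submodules of $\hat{\mathscr{E}}^0_{\lambda,k}$. Thus $\hat{\mathscr{E}}^{k}_{\lambda,k}$ is an irreducible $\tilde{\mathfrak g}_k$-module as well. Hence, by induction (with no assumption), $\hat{\mathscr{E}}^{k}_{\lambda,k}$ is an irreducible $\tilde{\mathfrak g}_k$-module for every $k\geq0$ and $\lambda\in X_+$. Thus, for any $k\ge0$, taking $\mathscr{E}^{k}_{\lambda,k}$ to be $\hat{\mathscr{E}}^{k}_{\lambda,k}$, $$\mathscr{E}^{k'}_{\lambda,k}=\hat{\mathscr{E}}^{k'}_{\lambda,k}\quad\text{(as $\tilde{\mathfrak g}_k$-modules) for any }\lambda\in X_+\text{ and }0\leq k'\leq k.$$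
   Context: $\mathfrak g$ is a simple Lie algebra over $\mathbb{C}$ with Cartan subalgebra $\mathfrak t$, highest root $\theta$, dual Coxeter number $h^\vee$; $X_+$ is the set of dominant integral weights and $V(\lambda)$ the irreducible finite-dimensional $\mathfrak g$-module of highest weight $\lambda\in X_+$. $\langle\,,\,\rangle$ is the invariant form on $\mathfrak g$ normalized so that $\langle\theta,\theta\rangle=2$ on $\mathfrak t^*$. $p$ is a fixed prime. For $k\ge 0$ let $A_k=\mathbb{C}[t_1^{\pm1},\dots,t_k^{\pm1}]$, ${\bf t}^{\bf n}=t_1^{n_1}\cdots t_k^{n_k}$, and $$\tilde{\mathfrak g}_k=(\mathfrak g\otimes A_k)\oplus\bigoplus_{i=1}^k\mathbb{C}c_i,\qquad \hat{\mathfrak g}_k=\tilde{\mathfrak g}_k\oplus\bigoplus_{i=1}^k\mathbb{C}d_i,$$ with $c_i$ central, $[x\otimes{\bf t}^{\bf n},y\otimes{\bf t}^{\bf m}]=[x,y]\otimes{\bf t}^{{\bf n}+{\bf m}}+\delta_{{\bf n}+{\bf m},0}\langle x,y\rangle\sum_i n_ic_i$, $[d_i,x\otimes{\bf t}^{\bf n}]=n_i\,x\otimes{\bf t}^{\bf n}$, $[d_i,d_j]=[d_i,c_j]=0$. For $k\ge1$ let $A_k^+=\mathbb{C}[t_1^{\pm1},\dots,t_{k-1}^{\pm1},t_k]$, $\tilde{\mathfrak g}_k^+=(\mathfrak g\otimes A_k^+)\oplus\bigoplus_{i=1}^k\mathbb{C}c_i$, $\hat{\mathfrak g}_k^+=\tilde{\mathfrak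 g}_k^+\oplus\bigoplus_{i=1}^k\mathbb{C}d_i$. Induction: given a $\tilde{\mathfrak g}_{k-1}$-module (resp. $\hat{\mathfrak g}_{k-1}$-module) $M$ on which $c_i$ acts by $-p^i-h^\vee$ for $1\le i\le k-1$, regard $M$ as a $\tilde{\mathfrak g}_k^+$-module (resp. $\hat{\mathfrak g}_k^+$-module) by letting $\mathfrak g\otimes t_kA_k^+$ act by zero, $c_k$ act by $-p^k-h^\vee$ (and, in the hat case, $d_k$ act by zero), and set $\mathrm{Ind}^k_{k-1}(M)=U(\tilde{\mathfrak g}_k)\otimes_{U(\tilde{\mathfrak g}_k^+)}M$ (resp. $U(\hat{\mathfrak g}_k)\otimes_{U(\hat{\mathfrak g}_k^+)}M$). The $\hat{\mathfrak g}_k$-modules $\hat{\mathscr{E}}^{j}_{\lambda,k}$, $0\le j\le k$, are defined inductively: $\hat{\mathscr{E}}^0_{\lambda,0}=V(\lambda)$; for $k\ge1$ and $0\le j\le k-1$, $\hat{\mathscr{E}}^{j}_{\lambda,k}=\mathrm{Ind}^k_{k-1}(\hat{\mathscr{E}}^{j}_{\lambda,k-1})$; and $\hat{\mathscr{E}}^{k}_{\lambda,k}=\hat{\mathscr{E}}^0_{\lambda,k}/\hat M_k$ is the unique irreducible quotient of $\hat{\mathscr{E}}^0_{\lambda,k}$ as a $\hat{\mathfrak g}_k$-module, where $\hat M_k$ is the sum of all proper $\hat{\mathfrak g}_k$-submodules (which is itself proper). The $\tilde{\mathfrak g}_k$-modules $\mathscr{E}^{k'}_{\lambda,k}$, $0\le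 k'\le k$, are defined by: $\mathscr{E}^0_{\lambda,0}=V(\lambda)$; for $k\ge1$ and $0\le k'\le k-1$, $\mathscr{E}^{k'}_{\lambda,k}=\mathrm{Ind}^k_{k-1}(\mathscr{E}^{k'}_{\lambda,k-1})$; and for $k\geq 1$, $\mathscr{E}^{k}_{\lambda,k}$ is a chosen irreducible $\tilde{\mathfrak g}_k$-module quotient of $\mathscr{E}^0_{\lambda,k}$, the choice here being $\hat{\mathscr{E}}^{k}_{\lambda,k}$ regarded as a $\tilde{\mathfrak g}_k$-module. *)

theory Defs
  imports
    Complex_Main
    "HOL-Library.Poly_Mapping"
    "HOL-Library.Product_Plus"
    "HOL-Computational_Algebra.Primes"
    "HOL-Algebra.QuotRing"
    "HOL-Algebra.Module"
begin

section \<open>Simple Lie algebras\<close>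

text \<open>
  Lie algebras are complex vector spaces on a type; modules over them (below) are records with a
  carrier, because the modules that occur are built by recursion and do not each fill a type.
\<close>

locale lie_algebra = vector_space scale
  for scale :: "complex \<Rightarrow> 'g::ab_group_add \<Rightarrow> 'g" +
  fixes bracket :: "'g \<Rightarrow> 'g \<Rightarrow> 'g"
  assumes bracket_linear_left: "Vector_Spaces.linear scale scale (\<lambda>x. bracket x y)"
    and bracket_linear_right: "Vector_Spaces.linear scale scale (\<lambda>y. bracket x y)"
    and bracket_alternating: "bracket x x = 0"
    and jacobi: "bracket x (bracket y z) + bracket y (bracket z x) + bracket z (bracket x y) = 0"
begin

definition is_subalgebra :: "'g set \<Rightarrow> bool" where
  "is_subalgebra S \<longleftrightarrow> subspace S \<and> (\<forall>x\<in>S. \<forall>y\<in>S. bracket x y \<in> S)"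

definition is_ideal :: "'g set \<Rightarrow> bool" where
  "is_ideal S \<longleftrightarrow> subspace S \<and> (\<forall>x. \<forall>y\<in>S. bracket x y \<in> S)"

primrec lower_central :: "'g set \<Rightarrow> nat \<Rightarrow> 'g set" where
  "lower_central S 0 = S"
| "lower_central S (Suc n) = span {bracket x y |x y. x \<in> S \<and> y \<in> lower_central S n}"

definition is_cartan :: "'g set \<Rightarrow> bool" where
  "is_cartan t \<longleftrightarrow> is_subalgebra t \<and> (\<exists>n. lower_central t n = {0}) \<and>
     (\<forall>x. (\<forall>y\<in>t. bracket x y \<in> t) \<longrightarrow> x \<in> t)"

text \<open>Linear functionals on \<open>t\<close> are represented by functions vanishing outside \<open>t\<close>.\<close>

definition dual :: "'g set \<Rightarrow> ('g \<Rightarrow> complex) set" where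
  "dual t = {\<alpha>. (\<forall>x\<in>t. \<forall>y\<in>t. \<alpha> (x + y) = \<alpha> x + \<alpha> y) \<and>
     (\<forall>c. \<forall>x\<in>t. \<alpha> (scale c x) = c * \<alpha> x) \<and> (\<forall>x. x \<notin> t \<longrightarrow> \<alpha> x = 0)}"

definition root_space :: "'g set \<Rightarrow> ('g \<Rightarrow> complex) \<Rightarrow> 'g set" where
  "root_space t \<alpha> = {x. \<forall>y\<in>t. bracket y x = scale (\<alpha> y) x}"

definition roots :: "'g set \<Rightarrow> ('g \<Rightarrow> complex) set" where
  "roots t = {\<alpha> \<in> dual t. \<alpha> \<noteq> (\<lambda>_. 0) \<and> root_space t \<alpha> \<noteq> {0}}"

definition nat_combs :: "('g \<Rightarrow> complex) set \<Rightarrow> ('g \<Rightarrow> complex) set" where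
  "nat_combs \<Delta> = {\<lambda>x. \<Sum>\<alpha>\<in>\<Delta>. of_nat (n \<alpha>) * \<alpha> x |n. True}"

definition is_base :: "'g set \<Rightarrow> ('g \<Rightarrow> complex) set \<Rightarrow> bool" where
  "is_base t \<Delta> \<longleftrightarrow> finite \<Delta> \<and> \<Delta> \<subseteq> roots t \<and>
     (\<forall>u. (\<forall>x. (\<Sum>\<alpha>\<in>\<Delta>. u \<alpha> * \<alpha> x) = 0) \<longrightarrow> (\<forall>\<alpha>\<in>\<Delta>. u \<alpha> = (0::complex))) \<and>
     (\<forall>\<beta>\<in>roots t. \<beta> \<in> nat_combs \<Delta> \<or> (\<lambda>x. - \<beta> x) \<in> nat_combs \<Delta>)"

definition pos_roots :: "'g set \<Rightarrow> ('g \<Rightarrow> complex) set \<Rightarrow> ('g \<Rightarrow> complex) set" where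
  "pos_roots t \<Delta> = roots t \<inter> nat_combs \<Delta>"

definition is_highest_root :: "'g set \<Rightarrow> ('g \<Rightarrow> complex) set \<Rightarrow> ('g \<Rightarrow> complex) \<Rightarrow> bool" where
  "is_highest_root t \<Delta> \<theta> \<longleftrightarrow> \<theta> \<in> roots t \<and> (\<forall>\<beta>\<in>roots t. (\<lambda>x. \<theta> x - \<beta> x) \<in> nat_combs \<Delta>)"

definition is_invariant_form :: "('g \<Rightarrow> 'g \<Rightarrow> complex) \<Rightarrow> bool" where
  "is_invariant_form form \<longleftrightarrow>
     (\<forall>x. Vector_Spaces.linear scale (*) (form x)) \<and> (\<forall>x y. form x y = form y x) \<and>
     (\<forall>x y z. form (bracket x y) z = form x (bracket y z))"

text \<open>The identification of the dual of \<open>t\<close> with \<open>t\<close> given by a form nondegenerate on \<open>t\<close>, and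
  the form transferred along it.\<close>

definition dual_vector :: "('g \<Rightarrow> 'g \<Rightarrow> complex) \<Rightarrow> 'g set \<Rightarrow> ('g \<Rightarrow> complex) \<Rightarrow> 'g" where
  "dual_vector form t \<alpha> = (THE x. x \<in> t \<and> (\<forall>y\<in>t. form x y = \<alpha> y))"

definition dual_form ::
    "('g \<Rightarrow> 'g \<Rightarrow> complex) \<Rightarrow> 'g set \<Rightarrow> ('g \<Rightarrow> complex) \<Rightarrow> ('g \<Rightarrow> complex) \<Rightarrow> complex" where
  "dual_form form t \<alpha> \<beta> = form (dual_vector form t \<alpha>) (dual_vector form t \<beta>)"

definition coroot :: "('g \<Rightarrow> 'g \<Rightarrow> complex) \<Rightarrow> 'g set \<Rightarrow> ('g \<Rightarrow> complex) \<Rightarrow> 'g" where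
  "coroot form t \<alpha> = scale (2 / dual_form form t \<alpha> \<alpha>) (dual_vector form t \<alpha>)"

definition rho :: "'g set \<Rightarrow> ('g \<Rightarrow> complex) set \<Rightarrow> 'g \<Rightarrow> complex" where
  "rho t \<Delta> x = (\<Sum>\<beta>\<in>pos_roots t \<Delta>. \<beta> x) / 2"

text \<open>The dual Coxeter number is one plus the value of \<open>\<rho>\<close> at the coroot of the highest root.\<close>

definition dual_coxeter ::
    "('g \<Rightarrow> 'g \<Rightarrow> complex) \<Rightarrow> 'g set \<Rightarrow> ('g \<Rightarrow> complex) set \<Rightarrow> ('g \<Rightarrow> complex) \<Rightarrow> complex" where
  "dual_coxeter form t \<Delta> \<theta> = 1 + rho t \<Delta> (coroot form t \<theta>)"

definition is_dominant_integral ::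
    "('g \<Rightarrow> 'g \<Rightarrow> complex) \<Rightarrow> 'g set \<Rightarrow> ('g \<Rightarrow> complex) set \<Rightarrow> ('g \<Rightarrow> complex) \<Rightarrow> bool" where
  "is_dominant_integral form t \<Delta> lam \<longleftrightarrow>
     lam \<in> dual t \<and> (\<forall>\<alpha>\<in>\<Delta>. lam (coroot form t \<alpha>) \<in> \<nat>)"

end

locale simple_lie_algebra = lie_algebra +
  assumes finite_dim: "\<exists>B. finite B \<and> span B = UNIV"
    and nonabelian: "\<exists>x y. bracket x y \<noteq> 0"
    and simple: "is_ideal S \<Longrightarrow> S = {0} \<or> S = UNIV"

locale simple_lie_setup = simple_lie_algebra +
  fixes form :: "'a \<Rightarrow> 'a \<Rightarrow> complex"
    and t :: "'a set" and \<Delta> :: "('a \<Rightarrow> complex) set" and \<theta> :: "'a \<Rightarrow> complex"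
  assumes cartan: "is_cartan t"
    and base: "is_base t \<Delta>"
    and highest_root: "is_highest_root t \<Delta> \<theta>"
    and invariant_form: "is_invariant_form form"
    and normalized: "dual_form form t \<theta> \<theta> = 2"


section \<open>Modules over Lie algebras\<close>

record 'x lie_struct =
  lie_carrier :: "'x set"
  lie_scale :: "complex \<Rightarrow> 'x \<Rightarrow> 'x"
  lie_bracket :: "'x \<Rightarrow> 'x \<Rightarrow> 'x"

definition complex_ring :: "complex ring" where
  "complex_ring = \<lparr>carrier = UNIV, mult = (*), one = 1, zero = 0, add = (+)\<rparr>"

text \<open>The fields \<open>mult\<close> and \<open>one\<close>, which module records inherit from rings, play no role for modules.\<close>

record ('x, 'm) lie_rep = "(complex, 'm) module" +
  act :: "'x \<Rightarrow> 'm \<Rightarrow> 'm"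

definition mk_rep ::
    "'m set \<Rightarrow> 'm \<Rightarrow> ('m \<Rightarrow> 'm \<Rightarrow> 'm) \<Rightarrow> (complex \<Rightarrow> 'm \<Rightarrow> 'm) \<Rightarrow> ('x \<Rightarrow> 'm \<Rightarrow> 'm) \<Rightarrow> ('x, 'm) lie_rep" where
  "mk_rep C z a s f =
     \<lparr>carrier = C, mult = (\<lambda>_ _. z), one = z, zero = z, add = a, smult = s, act = f\<rparr>"

definition is_lie_module :: "'x::ab_group_add lie_struct \<Rightarrow> ('x, 'm) lie_rep \<Rightarrow> bool" where
  "is_lie_module L M \<longleftrightarrow> module complex_ring M \<and>
     (\<forall>x\<in>lie_carrier L. \<forall>m\<in>carrier M. act M x m \<in> carrier M) \<and>
     (\<forall>x\<in>lie_carrier L. \<forall>m\<in>carrier M. \<forall>n\<in>carrier M.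
        act M x (m \<oplus>\<^bsub>M\<^esub> n) = act M x m \<oplus>\<^bsub>M\<^esub> act M x n) \<and>
     (\<forall>x\<in>lie_carrier L. \<forall>c. \<forall>m\<in>carrier M. act M x (c \<odot>\<^bsub>M\<^esub> m) = c \<odot>\<^bsub>M\<^esub> act M x m) \<and>
     (\<forall>x\<in>lie_carrier L. \<forall>y\<in>lie_carrier L. \<forall>m\<in>carrier M.
        act M (x + y) m = act M x m \<oplus>\<^bsub>M\<^esub> act M y m) \<and>
     (\<forall>x\<in>lie_carrier L. \<forall>c. \<forall>m\<in>carrier M. act M (lie_scale L c x) m = c \<odot>\<^bsub>M\<^esub> act M x m) \<and>
     (\<forall>x\<in>lie_carrier L. \<forall>y\<in>lie_carrier L. \<forall>m\<in>carrier M.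
        act M (lie_bracket L x y) m = act M x (act M y m) \<ominus>\<^bsub>M\<^esub> act M y (act M x m))"

definition is_lie_submodule :: "'x lie_struct \<Rightarrow> ('x, 'm) lie_rep \<Rightarrow> 'm set \<Rightarrow> bool" where
  "is_lie_submodule L M N \<longleftrightarrow> submodule N complex_ring M \<and>
     (\<forall>x\<in>lie_carrier L. \<forall>m\<in>N. act M x m \<in> N)"

definition is_irreducible :: "'x::ab_group_add lie_struct \<Rightarrow> ('x, 'm) lie_rep \<Rightarrow> bool" where
  "is_irreducible L M \<longleftrightarrow> is_lie_module L M \<and> carrier M \<noteq> {\<zero>\<^bsub>M\<^esub>} \<and>
     (\<forall>N. is_lie_submodule L M N \<longrightarrow> N = {\<zero>\<^bsub>M\<^esub>} \<or> N = carrier M)"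

definition is_maximal_submodule :: "'x lie_struct \<Rightarrow> ('x, 'm) lie_rep \<Rightarrow> 'm set \<Rightarrow> bool" where
  "is_maximal_submodule L M N \<longleftrightarrow> is_lie_submodule L M N \<and> N \<noteq> carrier M \<and>
     (\<forall>N'. is_lie_submodule L M N' \<and> N' \<noteq> carrier M \<and> N \<subseteq> N' \<longrightarrow> N' = N)"

definition lie_hom ::
    "'x lie_struct \<Rightarrow> ('x, 'm) lie_rep \<Rightarrow> ('x, 'n) lie_rep \<Rightarrow> ('m \<Rightarrow> 'n) set" where
  "lie_hom L M N = {f \<in> carrier M \<rightarrow> carrier N.
     (\<forall>m\<in>carrier M. \<forall>m'\<in>carrier M. f (m \<oplus>\<^bsub>M\<^esub> m') = f m \<oplus>\<^bsub>N\<^esub> f m') \<and>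
     (\<forall>c. \<forall>m\<in>carrier M. f (c \<odot>\<^bsub>M\<^esub> m) = c \<odot>\<^bsub>N\<^esub> f m) \<and>
     (\<forall>x\<in>lie_carrier L. \<forall>m\<in>carrier M. f (act M x m) = act N x (f m))}"

definition lie_isomorphic ::
    "'x lie_struct \<Rightarrow> ('x, 'm) lie_rep \<Rightarrow> ('x, 'n) lie_rep \<Rightarrow> bool" where
  "lie_isomorphic L M N \<longleftrightarrow> (\<exists>f\<in>lie_hom L M N. bij_betw f (carrier M) (carrier N))"

definition is_quotient_of ::
    "'x lie_struct \<Rightarrow> ('x, 'n) lie_rep \<Rightarrow> ('x, 'm) lie_rep \<Rightarrow> bool" where
  "is_quotient_of L N M \<longleftrightarrow> (\<exists>f\<in>lie_hom L M N. f ` carrier M = carrier N)"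

definition lin_hull :: "(complex, 'm, 'z) module_scheme \<Rightarrow> 'm set \<Rightarrow> 'm set" where
  "lin_hull M X = \<Inter>{N. submodule N complex_ring M \<and> X \<subseteq> N}"

definition sum_proper_submodules :: "'x lie_struct \<Rightarrow> ('x, 'm) lie_rep \<Rightarrow> 'm set" where
  "sum_proper_submodules L M = lin_hull M (\<Union>{N. is_lie_submodule L M N \<and> N \<noteq> carrier M})"

definition quotient_rep :: "('x, 'm) lie_rep \<Rightarrow> 'm set \<Rightarrow> ('x, 'm set) lie_rep" where
  "quotient_rep M N = mk_rep (a_rcosets\<^bsub>M\<^esub> N) N (set_add M)
     (\<lambda>c A. \<Union>a\<in>A. N +>\<^bsub>M\<^esub> (c \<odot>\<^bsub>M\<^esub> a)) (\<lambda>x A. \<Union>a\<in>A. N +>\<^bsub>M\<^esub> act M x a)"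

definition head :: "'x lie_struct \<Rightarrow> ('x, 'm) lie_rep \<Rightarrow> ('x, 'm set) lie_rep" where
  "head L M = quotient_rep M (sum_proper_submodules L M)"

definition transport :: "('m \<Rightarrow> 'n) \<Rightarrow> ('x, 'm) lie_rep \<Rightarrow> ('x, 'n) lie_rep" where
  "transport f M = (let g = inv_into (carrier M) f in
     mk_rep (f ` carrier M) (f \<zero>\<^bsub>M\<^esub>) (\<lambda>a b. f (g a \<oplus>\<^bsub>M\<^esub> g b)) (\<lambda>c a. f (c \<odot>\<^bsub>M\<^esub> g a))
       (\<lambda>x a. f (act M x (g a))))"

lemma lie_isomorphic_transport:
  assumes "is_lie_module L M" and inj: "inj_on f (carrier M)"
  shows "lie_isomorphic L M (transport f M)"
proof -
  have mod: "module complex_ring M" using assms(1) by (simp add: is_lie_module_def)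
  then interpret module complex_ring M .
  have "f \<in> lie_hom L M (transport f M)"
    using assms(1) unfolding is_lie_module_def lie_hom_def transport_def mk_rep_def Let_def
    by (auto simp: inv_into_f_f[OF inj])
  then show ?thesis
    unfolding lie_isomorphic_def using inj
    by (auto simp: bij_betw_def transport_def mk_rep_def Let_def)
qed

definition is_highest_weight_module ::
    "(complex \<Rightarrow> 'g \<Rightarrow> 'g) \<Rightarrow> ('g \<Rightarrow> 'g \<Rightarrow> 'g) \<Rightarrow> 'g set \<Rightarrow> ('g \<Rightarrow> complex) set \<Rightarrow> ('g \<Rightarrow> complex) \<Rightarrow>
      ('g::ab_group_add, 'v) lie_rep \<Rightarrow> bool" where
  "is_highest_weight_module scale bracket t \<Delta> lam V \<longleftrightarrow>
     is_irreducible \<lparr>lie_carrier = UNIV, lie_scale = scale, lie_bracket = bracket\<rparr> V \<and>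
     (\<exists>B. finite B \<and> B \<subseteq> carrier V \<and> lin_hull V B = carrier V) \<and>
     (\<exists>v\<in>carrier V. v \<noteq> \<zero>\<^bsub>V\<^esub> \<and> (\<forall>y\<in>t. act V y v = lam y \<odot>\<^bsub>V\<^esub> v) \<and>
        (\<forall>\<alpha>\<in>lie_algebra.pos_roots scale bracket t \<Delta>.
           \<forall>x\<in>lie_algebra.root_space scale bracket t \<alpha>. act V x v = \<zero>\<^bsub>V\<^esub>))"


section \<open>Universal enveloping algebras\<close>

text \<open>With concatenation as monoid operation on words, \<open>'x list \<Rightarrow>\<^sub>0 complex\<close> is the free associative
  complex algebra on the set \<open>'x\<close>.\<close>

instantiation list :: (type) monoid_add
begin
definition zero_list :: "'a list" where "zero_list = []"
definition plus_list :: "'a list \<Rightarrow> 'a list \<Rightarrow> 'a list" where "plus_list = (@)"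
instance by standard (simp_all add: zero_list_def plus_list_def)
end

definition free_alg :: "'x set \<Rightarrow> ('x list \<Rightarrow>\<^sub>0 complex) ring" where
  "free_alg S =
     \<lparr>carrier = {f. Poly_Mapping.keys f \<subseteq> lists S}, mult = (*), one = 1, zero = 0, add = (+)\<rparr>"

definition letter :: "'x \<Rightarrow> 'x list \<Rightarrow>\<^sub>0 complex" where
  "letter x = Poly_Mapping.single [x] 1"

definition const :: "complex \<Rightarrow> 'x list \<Rightarrow>\<^sub>0 complex" where
  "const c = Poly_Mapping.single [] c"

text \<open>The first two families of relations cut the free algebra on the set \<open>L\<close> down to the tensor
  algebra of the vector space \<open>L\<close>.\<close>

definition uea_relations :: "'x::ab_group_add lie_struct \<Rightarrow> ('x list \<Rightarrow>\<^sub>0 complex) set" where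
  "uea_relations L =
     {letter (x + y) - letter x - letter y |x y. x \<in> lie_carrier L \<and> y \<in> lie_carrier L} \<union>
     {letter (lie_scale L c x) - const c * letter x |c x. x \<in> lie_carrier L} \<union>
     {letter x * letter y - letter y * letter x - letter (lie_bracket L x y) |x y.
        x \<in> lie_carrier L \<and> y \<in> lie_carrier L}"

definition uea_ideal :: "'x::ab_group_add lie_struct \<Rightarrow> ('x list \<Rightarrow>\<^sub>0 complex) set" where
  "uea_ideal L = genideal (free_alg (lie_carrier L)) (uea_relations L)"

definition uea_class ::
    "'x::ab_group_add lie_struct \<Rightarrow> ('x list \<Rightarrow>\<^sub>0 complex) \<Rightarrow> ('x list \<Rightarrow>\<^sub>0 complex) set" where
  "uea_class L f = uea_ideal L +>\<^bsub>free_alg (lie_carrier L)\<^esub> f"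

definition uea :: "'x::ab_group_add lie_struct \<Rightarrow> (complex, ('x list \<Rightarrow>\<^sub>0 complex) set) module" where
  "uea L = (let Q = free_alg (lie_carrier L) Quot uea_ideal L in
     \<lparr>carrier = carrier Q, mult = mult Q, one = \<one>\<^bsub>Q\<^esub>, zero = \<zero>\<^bsub>Q\<^esub>, add = add Q,
      smult = (\<lambda>c u. uea_class L (const c) \<otimes>\<^bsub>Q\<^esub> u)\<rparr>)"

text \<open>For a subalgebra \<open>P\<close> of \<open>L\<close>: the homomorphism from the enveloping algebra of \<open>P\<close> to that of \<open>L\<close>,
  and the action of the enveloping algebra of \<open>P\<close> on a \<open>P\<close>-module. Both are computed on a
  representative of the class.\<close>

definition uea_map ::
    "'x::ab_group_add lie_struct \<Rightarrow> ('x list \<Rightarrow>\<^sub>0 complex) set \<Rightarrow> ('x list \<Rightarrow>\<^sub>0 complex) set" where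
  "uea_map L s = uea_class L (SOME f. f \<in> s)"

definition uea_act :: "('x, 'm) lie_rep \<Rightarrow> ('x list \<Rightarrow>\<^sub>0 complex) set \<Rightarrow> 'm \<Rightarrow> 'm" where
  "uea_act M s m = (let f = (SOME f. f \<in> s) in
     finsum M (\<lambda>w. Poly_Mapping.lookup f w \<odot>\<^bsub>M\<^esub> foldr (act M) w m) (Poly_Mapping.keys f))"


section \<open>Tensor products and induced modules\<close>

definition free_module :: "'b set \<Rightarrow> (complex, 'b \<Rightarrow>\<^sub>0 complex) module" where
  "free_module B = \<lparr>carrier = {f. Poly_Mapping.keys f \<subseteq> B}, mult = (\<lambda>_ _. 0), one = 0, zero = 0,
     add = (+), smult = (\<lambda>c. Poly_Mapping.map (\<lambda>z. c * z))\<rparr>"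

text \<open>The tensor product over the ring \<open>S\<close> of a right module \<open>A\<close> and a left module \<open>B\<close> is the quotient
  of the free vector space on pairs by the following subspace; \<open>ra\<close> and \<open>la\<close> are the actions of \<open>S\<close>.\<close>

definition tensor_kernel ::
    "'s set \<Rightarrow> (complex, 'a, 'y) module_scheme \<Rightarrow> ('a \<Rightarrow> 's \<Rightarrow> 'a) \<Rightarrow>
      (complex, 'b, 'z) module_scheme \<Rightarrow> ('s \<Rightarrow> 'b \<Rightarrow> 'b) \<Rightarrow> ('a \<times> 'b \<Rightarrow>\<^sub>0 complex) set" where
  "tensor_kernel S A ra B la =
     (let e = (\<lambda>a b. Poly_Mapping.single (a, b) (1::complex)) in
      lin_hull (free_module (carrier A \<times> carrier B))
       ({e (a \<oplus>\<^bsub>A\<^esub> a') b - e a b - e a' b |a a' b. a \<in> carrier A \<and> a' \<in> carrier A \<and> b \<in> carrier B} \<union>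
        {e a (b \<oplus>\<^bsub>B\<^esub> b') - e a b - e a b' |a b b'. a \<in> carrier A \<and> b \<in> carrier B \<and> b' \<in> carrier B} \<union>
        {e (c \<odot>\<^bsub>A\<^esub> a) b - Poly_Mapping.single (a, b) c |c a b. a \<in> carrier A \<and> b \<in> carrier B} \<union>
        {e a (c \<odot>\<^bsub>B\<^esub> b) - Poly_Mapping.single (a, b) c |c a b. a \<in> carrier A \<and> b \<in> carrier B} \<union>
        {e (ra a s) b - e a (la s b) |s a b. s \<in> S \<and> a \<in> carrier A \<and> b \<in> carrier B}))"

definition pairs_rep ::
    "'x::ab_group_add lie_struct \<Rightarrow> ('x, 'm) lie_rep \<Rightarrow>
      ('x, ('x list \<Rightarrow>\<^sub>0 complex) set \<times> 'm \<Rightarrow>\<^sub>0 complex) lie_rep" where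
  "pairs_rep L M = (let F = free_module (carrier (uea L) \<times> carrier M) in
     mk_rep (carrier F) \<zero>\<^bsub>F\<^esub> (add F) (smult F)
       (\<lambda>x f. \<Sum>(u, m)\<in>Poly_Mapping.keys f. Poly_Mapping.single
          (uea_class L (letter x) \<otimes>\<^bsub>uea L\<^esub> u, m) (Poly_Mapping.lookup f (u, m))))"

text \<open>The \<open>L\<close>-module \<open>U(L) \<otimes> M\<close>, tensor product over \<open>U(P)\<close>, for a \<open>P\<close>-module \<open>M\<close>.\<close>

definition induced ::
    "'x::ab_group_add lie_struct \<Rightarrow> 'x lie_struct \<Rightarrow> ('x, 'm) lie_rep \<Rightarrow>
      ('x, (('x list \<Rightarrow>\<^sub>0 complex) set \<times> 'm \<Rightarrow>\<^sub>0 complex) set) lie_rep" where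
  "induced L P M = quotient_rep (pairs_rep L M)
     (tensor_kernel (carrier (uea P)) (uea L) (\<lambda>u s. u \<otimes>\<^bsub>uea L\<^esub> uea_map L s) M (uea_act M))"

text \<open>
  Induction and quotients change the type of the elements. To iterate them, every module is copied
  along an injection into the following type; such injections exist by the two lemmas below,
  so that the copy is isomorphic to the original.
\<close>

datatype ('x, 'v) universe =
  Base 'v | Comb "(complex \<times> ('x list \<Rightarrow>\<^sub>0 complex) \<times> ('x, 'v) universe) list"

definition realize :: "('x, 'm) lie_rep \<Rightarrow> ('x, ('x, 'v) universe) lie_rep" where
  "realize M = transport (SOME f. inj_on f (carrier M)) M"

lemma a_rcosets_eq_image: "a_rcosets\<^bsub>M\<^esub> N = (\<lambda>a. N +>\<^bsub>M\<^esub> a) ` carrier M"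
  by (auto simp: A_RCOSETS_def')

lemma ex_inj_on_quotient_rep:
  fixes M :: "('x, ('x, 'v) universe) lie_rep"
  shows "\<exists>f :: _ \<Rightarrow> ('x, 'v) universe. inj_on f (carrier (quotient_rep M N))"
  unfolding quotient_rep_def mk_rep_def a_rcosets_eq_image
  by (auto intro: inj_on_inv_into)

lemma ex_inj_on_induced:
  fixes M :: "('x::ab_group_add, ('x, 'v) universe) lie_rep"
  shows "\<exists>f :: _ \<Rightarrow> ('x, 'v) universe. inj_on f (carrier (induced L P M))"
proof -
  let ?U = "carrier (uea L)"
  let ?F = "{f :: ('x list \<Rightarrow>\<^sub>0 complex) set \<times> ('x, 'v) universe \<Rightarrow>\<^sub>0 complex. Poly_Mapping.keys f \<subseteq> ?U \<times> carrier M}"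
  have "?U = uea_class L ` carrier (free_alg (lie_carrier L))"
    by (simp add: uea_def FactRing_def a_rcosets_eq_image uea_class_def[abs_def] Let_def)
  then obtain r :: "_ \<Rightarrow> 'x list \<Rightarrow>\<^sub>0 complex" where r: "inj_on r ?U"
    by (metis inj_on_inv_into order_refl)
  define enc where "enc f = (SOME xs. set xs =
      (\<lambda>q. (Poly_Mapping.lookup f q, r (fst q), snd q)) ` Poly_Mapping.keys f)"
    for f :: "('x list \<Rightarrow>\<^sub>0 complex) set \<times> ('x, 'v) universe \<Rightarrow>\<^sub>0 complex"
  have enc: "set (enc f) = (\<lambda>q. (Poly_Mapping.lookup f q, r (fst q), snd q)) ` Poly_Mapping.keys f"
    for f
    unfolding enc_def by (rule someI_ex) (simp add: finite_list)
  have "inj_on (\<lambda>f. Comb (enc f)) ?F"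
  proof (rule inj_onI)
    fix f g assume f: "f \<in> ?F" and g: "g \<in> ?F" and "Comb (enc f) = Comb (enc g)"
    then have eq: "(\<lambda>q. (Poly_Mapping.lookup f q, r (fst q), snd q)) ` Poly_Mapping.keys f =
        (\<lambda>q. (Poly_Mapping.lookup g q, r (fst q), snd q)) ` Poly_Mapping.keys g"
      by (metis enc universe.inject(2))
    have key: "Poly_Mapping.lookup h' q = Poly_Mapping.lookup h q"
      if "h \<in> ?F" "h' \<in> ?F" "q \<in> Poly_Mapping.keys h" and
        "(\<lambda>q. (Poly_Mapping.lookup h q, r (fst q), snd q)) ` Poly_Mapping.keys h =
         (\<lambda>q. (Poly_Mapping.lookup h' q, r (fst q), snd q)) ` Poly_Mapping.keys h'" for h h' q
    proof -
      from that(3,4) obtain q' where q': "q' \<in> Poly_Mapping.keys h'"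
        "Poly_Mapping.lookup h q = Poly_Mapping.lookup h' q'" "r (fst q) = r (fst q')" "snd q = snd q'"
        by (smt (verit) imageE imageI prod.inject)
      have "fst q \<in> ?U" "fst q' \<in> ?U"
        using that(1-3) q'(1) by fastforce+
      then have "fst q = fst q'" using r q'(3) by (auto dest: inj_onD)
      then have "q = q'" using q'(4) by (simp add: prod_eq_iff)
      then show ?thesis using q'(2) by simp
    qed
    show "f = g"
    proof (rule poly_mapping_eqI)
      fix q
      show "Poly_Mapping.lookup f q = Poly_Mapping.lookup g q"
        using key[OF f g _ eq] key[OF g f _ eq[symmetric]]
        by (metis in_keys_iff)
    qed
  qed
  moreover obtain i where "i ` carrier (induced L P M) \<subseteq> ?F" "inj_on i (carrier (induced L P M))"
  proof -
    have "carrier (pairs_rep L M) = ?F"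
      by (simp add: pairs_rep_def free_module_def mk_rep_def Let_def)
    then obtain N where "carrier (induced L P M) = (\<lambda>a. N +>\<^bsub>pairs_rep L M\<^esub> a) ` ?F"
      unfolding induced_def quotient_rep_def mk_rep_def a_rcosets_eq_image by simp
    then show thesis
      using that[of "inv_into ?F (\<lambda>a. N +>\<^bsub>pairs_rep L M\<^esub> a)"]
      by (metis (lifting) inj_on_inv_into inv_into_into image_subsetI order_refl)
  qed
  ultimately have "inj_on ((\<lambda>f. Comb (enc f)) \<circ> i) (carrier (induced L P M))"
    by (meson comp_inj_on inj_on_subset)
  then show ?thesis by blast
qed


section \<open>Toroidal Lie algebras\<close>

text \<open>
  An element \<open>(a, c, d)\<close> stands for the sum of all \<open>a\<^sub>n \<otimes> t\<^sup>n\<close>, \<open>c\<^sub>i c\<^sub>i\<close> and \<open>d\<^sub>i d\<^sub>i\<close>. All the algebras are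
  subalgebras of one with infinitely many variables, so that the one in \<open>k - 1\<close> variables is
  contained in the one in \<open>k\<close> variables.
\<close>

type_synonym 'g toroidal = "((nat \<Rightarrow>\<^sub>0 int) \<Rightarrow>\<^sub>0 'g) \<times> (nat \<Rightarrow>\<^sub>0 complex) \<times> (nat \<Rightarrow>\<^sub>0 complex)"

definition toroidal_scale ::
    "(complex \<Rightarrow> 'g \<Rightarrow> 'g) \<Rightarrow> complex \<Rightarrow> 'g::ab_group_add toroidal \<Rightarrow> 'g toroidal" where
  "toroidal_scale scale z = (\<lambda>(a, c, d).
     (Poly_Mapping.map (scale z) a, Poly_Mapping.map (\<lambda>y. z * y) c, Poly_Mapping.map (\<lambda>y. z * y) d))"

definition pairing :: "(nat \<Rightarrow>\<^sub>0 complex) \<Rightarrow> (nat \<Rightarrow>\<^sub>0 int) \<Rightarrow> complex" where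
  "pairing d n = (\<Sum>i\<in>Poly_Mapping.keys d. Poly_Mapping.lookup d i * of_int (Poly_Mapping.lookup n i))"

definition toroidal_bracket ::
    "(complex \<Rightarrow> 'g \<Rightarrow> 'g) \<Rightarrow> ('g \<Rightarrow> 'g \<Rightarrow> 'g) \<Rightarrow> ('g \<Rightarrow> 'g \<Rightarrow> complex) \<Rightarrow>
      'g::ab_group_add toroidal \<Rightarrow> 'g toroidal \<Rightarrow> 'g toroidal" where
  "toroidal_bracket scale bracket form = (\<lambda>(a, c, d) (a', c', d').
     ((\<Sum>n\<in>Poly_Mapping.keys a. \<Sum>m\<in>Poly_Mapping.keys a'. Poly_Mapping.single (n + m)
          (bracket (Poly_Mapping.lookup a n) (Poly_Mapping.lookup a' m)))
        + (\<Sum>m\<in>Poly_Mapping.keys a'. Poly_Mapping.single m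
             (scale (pairing d m) (Poly_Mapping.lookup a' m)))
        - (\<Sum>n\<in>Poly_Mapping.keys a. Poly_Mapping.single n
             (scale (pairing d' n) (Poly_Mapping.lookup a n))),
      (\<Sum>n\<in>Poly_Mapping.keys a. Poly_Mapping.map
          (\<lambda>j. form (Poly_Mapping.lookup a n) (Poly_Mapping.lookup a' (- n)) * of_int j) n),
      0))"

definition exponents :: "nat \<Rightarrow> (nat \<Rightarrow>\<^sub>0 int) set" where
  "exponents k = {n. Poly_Mapping.keys n \<subseteq> {1..k}}"

definition hat_carrier :: "nat \<Rightarrow> 'g::ab_group_add toroidal set" where
  "hat_carrier k = {(a, c, d). Poly_Mapping.keys a \<subseteq> exponents k \<and>
     Poly_Mapping.keys c \<subseteq> {1..k} \<and> Poly_Mapping.keys d \<subseteq> {1..k}}"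

definition tilde_carrier :: "nat \<Rightarrow> 'g::ab_group_add toroidal set" where
  "tilde_carrier k = {(a, c, d) \<in> hat_carrier k. d = 0}"

definition plus_part :: "nat \<Rightarrow> 'g::ab_group_add toroidal set" where
  "plus_part k = {(a, c, d). \<forall>n\<in>Poly_Mapping.keys a. Poly_Mapping.lookup n k \<ge> 0}"

definition toroidal ::
    "(complex \<Rightarrow> 'g \<Rightarrow> 'g) \<Rightarrow> ('g \<Rightarrow> 'g \<Rightarrow> 'g) \<Rightarrow> ('g \<Rightarrow> 'g \<Rightarrow> complex) \<Rightarrow>
      'g::ab_group_add toroidal set \<Rightarrow> 'g toroidal lie_struct" where
  "toroidal scale bracket form S = \<lparr>lie_carrier = S, lie_scale = toroidal_scale scale,
     lie_bracket = toroidal_bracket scale bracket form\<rparr>"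

text \<open>The projection to the algebra in \<open>k - 1\<close> variables: it kills the terms divisible by \<open>t\<^sub>k\<close>, and
  \<open>c\<^sub>k\<close> and \<open>d\<^sub>k\<close>.\<close>

definition project :: "nat \<Rightarrow> 'g::ab_group_add toroidal \<Rightarrow> 'g toroidal" where
  "project k = (\<lambda>(a, c, d).
     (Poly_Mapping.mapp (\<lambda>n x. if Poly_Mapping.lookup n k = 0 then x else 0) a,
      Poly_Mapping.update k 0 c, Poly_Mapping.update k 0 d))"

text \<open>A module in \<open>k - 1\<close> variables regarded as a module over the plus part in \<open>k\<close> variables, with
  \<open>c\<^sub>k\<close> acting by \<open>lev\<close>. The formula needs no condition on how \<open>c\<^sub>i\<close> acts for \<open>i < k\<close>.\<close>

definition inflate :: "complex \<Rightarrow> nat \<Rightarrow> ('g::ab_group_add toroidal, 'm) lie_rep \<Rightarrow>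
    ('g toroidal, 'm) lie_rep" where
  "inflate lev k M = M\<lparr>act := (\<lambda>x m.
     act M (project k x) m \<oplus>\<^bsub>M\<^esub> (lev * Poly_Mapping.lookup (fst (snd x)) k) \<odot>\<^bsub>M\<^esub> m)\<rparr>"

definition level :: "nat \<Rightarrow> complex \<Rightarrow> nat \<Rightarrow> complex" where
  "level p h k = - (of_nat p ^ k) - h"

definition Ind_hat where
  "Ind_hat scale bracket form p h k M =
     induced (toroidal scale bracket form (hat_carrier k))
       (toroidal scale bracket form (hat_carrier k \<inter> plus_part k)) (inflate (level p h k) k M)"

definition Ind_tilde where
  "Ind_tilde scale bracket form p h k M =
     induced (toroidal scale bracket form (tilde_carrier k))
       (toroidal scale bracket form (tilde_carrier k \<inter> plus_part k)) (inflate (level p h k) k M)"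

definition base_module :: "('g::ab_group_add, 'v) lie_rep \<Rightarrow>
    ('g toroidal, ('g toroidal, 'v) universe) lie_rep" where
  "base_module V = transport Base (mk_rep (carrier V) \<zero>\<^bsub>V\<^esub> (add V) (smult V)
     (\<lambda>(a, c, d). act V (Poly_Mapping.lookup a 0)))"

text \<open>\<open>E_hat \<dots> k j\<close> is the module with lower index \<open>k\<close> and upper index \<open>j\<close>; it is meaningful
  for \<open>j \<le> k\<close>.\<close>

fun E_hat ::
    "(complex \<Rightarrow> 'g \<Rightarrow> 'g) \<Rightarrow> ('g \<Rightarrow> 'g \<Rightarrow> 'g) \<Rightarrow> ('g \<Rightarrow> 'g \<Rightarrow> complex) \<Rightarrow> nat \<Rightarrow> complex \<Rightarrow>
      ('g::ab_group_add, 'v) lie_rep \<Rightarrow> nat \<Rightarrow> nat \<Rightarrow>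
      ('g toroidal, ('g toroidal, 'v) universe) lie_rep" where
  "E_hat scale bracket form p h V 0 j = base_module V"
| "E_hat scale bracket form p h V (Suc k) j =
     (if j \<le> k then realize (Ind_hat scale bracket form p h (Suc k) (E_hat scale bracket form p h V k j))
      else realize (head (toroidal scale bracket form (hat_carrier (Suc k)))
             (E_hat scale bracket form p h V (Suc k) 0)))"

text \<open>\<open>C k\<close> is the chosen irreducible quotient in \<open>k\<close> variables, for \<open>k \<ge> 1\<close>.\<close>

fun E_tilde ::
    "(complex \<Rightarrow> 'g \<Rightarrow> 'g) \<Rightarrow> ('g \<Rightarrow> 'g \<Rightarrow> 'g) \<Rightarrow> ('g \<Rightarrow> 'g \<Rightarrow> complex) \<Rightarrow> nat \<Rightarrow> complex \<Rightarrow>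
      ('g::ab_group_add, 'v) lie_rep \<Rightarrow> (nat \<Rightarrow> ('g toroidal, ('g toroidal, 'v) universe) lie_rep) \<Rightarrow>
      nat \<Rightarrow> nat \<Rightarrow> ('g toroidal, ('g toroidal, 'v) universe) lie_rep" where
  "E_tilde scale bracket form p h V C 0 j = base_module V"
| "E_tilde scale bracket form p h V C (Suc k) j =
     (if j \<le> k
      then realize (Ind_tilde scale bracket form p h (Suc k) (E_tilde scale bracket form p h V C k j))
      else C (Suc k))"

end

theory Submission
  imports Defs
begin

text \<open>
  Write \<open>L\<close> for the algebra with derivations in \<open>k + 1\<close> variables, graded by the degree in the last
  variable, \<open>I\<close> for the module induced from \<open>M\<close> (the module with upper index \<open>0\<close> in \<open>k\<close> variables),
  and \<open>j : M \<rightarrow> I\<close> for the canonical map. Elements of positive degree annihilate the image of \<open>j\<close>, so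
  \<open>I\<close> is graded in nonpositive degrees, its component in degree zero is the image of \<open>j\<close>, and the last
  derivation acts on each component by its degree. The theorem is proved by induction on \<open>k\<close>, the
  statement of the induction being that the maximal submodule for the algebra with derivations is also
  maximal for the algebra without them (\<open>MK_maximal\<close>, \<open>Eh_maximal\<close>).

  The induction step is an argument of raising degrees. Submodules for \<open>L\<close> are graded (\<open>graded_hat\<close>), but
  a submodule \<open>S\<close> for the algebra without derivations need not be. Suppose that \<open>S\<close> strictly
  contains the maximal \<open>L\<close>-submodule \<open>MK\<close>, and take \<open>v\<close> in \<open>S\<close> outside \<open>MK\<close>. The component \<open>g\<close> of \<open>v\<close>
  in the lowest degree may be assumed to lie outside \<open>MK\<close>. If its degree is negative, some homogeneous
  element \<open>y\<close> of positive degree has \<open>y g\<close> outside \<open>MK\<close> (\<open>ex_raising\<close>): otherwise \<open>g\<close> would generate,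
  modulo \<open>MK\<close>, a proper \<open>L\<close>-submodule, living in degrees up to that of \<open>g\<close>, and hence lie in \<open>MK\<close>.
  Such a \<open>y\<close> contains no derivation, so \<open>y v\<close> is again in \<open>S\<close>; as \<open>MK\<close> is graded, \<open>y v\<close> is outside
  \<open>MK\<close>. Repeating this leads to an element of \<open>S\<close> of degree zero, that is, in the image of \<open>j\<close>
  (\<open>reach_top\<close>). The preimage of \<open>S\<close> under \<open>j\<close> then strictly contains the maximal submodule of \<open>M\<close>,
  which is maximal without derivations by induction. So \<open>S\<close> contains the image of \<open>j\<close>, which generates
  \<open>I\<close> even without derivations (\<open>tilde_generates\<close>).

  Two facts about induced modules enter. The map \<open>j\<close> is injective (\<open>ex_injective_hom\<close>). This
  follows from the universal property once \<open>M\<close> is embedded, compatibly with the nonnegative part of \<open>L\<close>, in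
  some \<open>L\<close>-module; a module coinduced from the nonpositive part contains such a copy of \<open>M\<close>, and it can be
  written down concretely because the nonpositive and the positive part are complementary subalgebras.
  Inducing with and without derivations gives the same module for the algebra without derivations
  (\<open>tilde_hat_isomorphic\<close>): by its universal property the module induced without derivations carries
  operators with the right commutators, so it is a module for \<open>L\<close>.

  Irreducibility of the quotient follows from maximality, and \<open>tilde_hat_isomorphic\<close>, applied at each
  step of the recursion, identifies the two families of modules (\<open>Et_isomorphic\<close>).
\<close>


section \<open>Linear algebra over records\<close>

text \<open>
  The modules are records, whose equations no simplification procedure for vector spaces can decide.
  Each of them is therefore embedded linearly in a space of finitely supported functions, with
  scalar multiplication \<open>psc\<close>, and an equation in the module is checked on the images. The free modules
  of the tensor product construction are such function spaces from the start.
\<close>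

definition psc :: "complex \<Rightarrow> ('b \<Rightarrow>\<^sub>0 complex) \<Rightarrow> ('b \<Rightarrow>\<^sub>0 complex)" where
  "psc c = Poly_Mapping.map (\<lambda>z. c * z)"

lemma lookup_psc [simp]: "Poly_Mapping.lookup (psc c f) k = c * Poly_Mapping.lookup f k"
  by (simp add: psc_def Poly_Mapping.map.rep_eq when_def)

lemma psc_single [simp]: "psc c (Poly_Mapping.single k z) = Poly_Mapping.single k (c * z)"
  by (rule poly_mapping_eqI) (simp add: lookup_single when_def)

lemma keys_psc: "Poly_Mapping.keys (psc c f) \<subseteq> Poly_Mapping.keys f"
  by (auto simp: in_keys_iff)

interpretation ps: vector_space psc
  by standard (rule poly_mapping_eqI; simp add: lookup_add algebra_simps)+

lemma poly_mapping_as_sum: "f = (\<Sum>k\<in>Poly_Mapping.keys f. Poly_Mapping.single k (Poly_Mapping.lookup f k))"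
proof (rule poly_mapping_eqI)
  fix k
  show "Poly_Mapping.lookup f k = Poly_Mapping.lookup (\<Sum>k\<in>Poly_Mapping.keys f. Poly_Mapping.single k (Poly_Mapping.lookup f k)) k"
    by (cases "k \<in> Poly_Mapping.keys f")
      (auto simp: lookup_sum lookup_single when_def in_keys_iff sum.delta if_distrib cong: if_cong)
qed

lemma poly_mapping_additive_induct [consumes 1, case_names zero single add]:
  fixes f :: "'b \<Rightarrow>\<^sub>0 'a::comm_monoid_add"
  assumes keys: "Poly_Mapping.keys f \<subseteq> A"
    and zero: "P 0"
    and single: "\<And>k z. k \<in> A \<Longrightarrow> P (Poly_Mapping.single k z)"
    and add: "\<And>f g. Poly_Mapping.keys f \<subseteq> A \<Longrightarrow> Poly_Mapping.keys g \<subseteq> A \<Longrightarrow> P f \<Longrightarrow> P g \<Longrightarrow> P (f + g)"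
  shows "P f"
proof -
  have "P (\<Sum>k\<in>B. Poly_Mapping.single k (Poly_Mapping.lookup f k)) \<and>
      Poly_Mapping.keys (\<Sum>k\<in>B. Poly_Mapping.single k (Poly_Mapping.lookup f k)) \<subseteq> A"
    if "finite B" "B \<subseteq> A" for B
    using that
  proof (induction rule: finite_induct)
    case (insert k B)
    have "Poly_Mapping.keys (Poly_Mapping.single k (Poly_Mapping.lookup f k)) \<subseteq> A"
      using insert.prems by auto
    then show ?case
      using insert add[OF _ _ single] by (auto dest!: subsetD[OF Poly_Mapping.keys_add])
  qed (simp add: zero)
  from this[OF finite_keys keys] show ?thesis by (simp flip: poly_mapping_as_sum)
qed

text \<open>The linear extension of a function on the basis of a free vector space.\<close>

definition lext :: "('b \<Rightarrow> ('c \<Rightarrow>\<^sub>0 complex)) \<Rightarrow> ('b \<Rightarrow>\<^sub>0 complex) \<Rightarrow> ('c \<Rightarrow>\<^sub>0 complex)" where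
  "lext \<phi> f = (\<Sum>k\<in>Poly_Mapping.keys f. psc (Poly_Mapping.lookup f k) (\<phi> k))"

lemma sum_keys_superset:
  assumes "finite B" "Poly_Mapping.keys f \<subseteq> B" "\<And>k. \<psi> k 0 = 0"
  shows "(\<Sum>k\<in>Poly_Mapping.keys f. \<psi> k (Poly_Mapping.lookup f k)) = (\<Sum>k\<in>B. \<psi> k (Poly_Mapping.lookup f k))"
  using assms by (intro sum.mono_neutral_left) (auto simp: in_keys_iff)

lemma sum_keys_add:
  assumes zero: "\<And>k. \<psi> k 0 = 0" and add: "\<And>k x y. \<psi> k (x + y) = \<psi> k x + \<psi> k y"
  shows "(\<Sum>k\<in>Poly_Mapping.keys (f + g). \<psi> k (Poly_Mapping.lookup (f + g) k)) =
    (\<Sum>k\<in>Poly_Mapping.keys f. \<psi> k (Poly_Mapping.lookup f k)) + (\<Sum>k\<in>Poly_Mapping.keys g. \<psi> k (Poly_Mapping.lookup g k))"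
proof -
  let ?B = "Poly_Mapping.keys f \<union> Poly_Mapping.keys g"
  have "Poly_Mapping.keys (f + g) \<subseteq> ?B" by (rule Poly_Mapping.keys_add)
  then show ?thesis
    by (subst (1 2 3) sum_keys_superset[of ?B]) (simp_all add: zero add lookup_add sum.distrib)
qed

lemma sum_keys_single:
  assumes "\<And>k. \<psi> k 0 = 0"
  shows "(\<Sum>k\<in>Poly_Mapping.keys (Poly_Mapping.single l z). \<psi> k (Poly_Mapping.lookup (Poly_Mapping.single l z) k)) = \<psi> l z"
  using assms by (cases "z = 0") simp_all

lemma lext_zero [simp]: "lext \<phi> 0 = 0"
  by (simp add: lext_def)

lemma lext_add: "lext \<phi> (f + g) = lext \<phi> f + lext \<phi> g"
  unfolding lext_def by (rule sum_keys_add) (simp_all add: ps.scale_left_distrib)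

lemma lext_single [simp]: "lext \<phi> (Poly_Mapping.single k z) = psc z (\<phi> k)"
  unfolding lext_def by (rule sum_keys_single) simp

lemma lext_psc: "lext \<phi> (psc c f) = psc c (lext \<phi> f)"
proof -
  have "(\<Sum>k\<in>Poly_Mapping.keys (psc c f). psc (Poly_Mapping.lookup (psc c f) k) (\<phi> k)) =
      (\<Sum>k\<in>Poly_Mapping.keys f. psc (Poly_Mapping.lookup (psc c f) k) (\<phi> k))"
    by (rule sum_keys_superset) (simp_all add: keys_psc)
  then show ?thesis by (simp add: lext_def ps.scale_sum_right)
qed

lemma lext_diff: "lext \<phi> (f - g) = lext \<phi> f - lext \<phi> g"
  by (metis add_diff_cancel_right' diff_add_cancel lext_add)


subsection \<open>Coordinates\<close>

lemma complex_ring_simps [simp]: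
  "carrier complex_ring = UNIV" "x \<oplus>\<^bsub>complex_ring\<^esub> y = x + y" "x \<otimes>\<^bsub>complex_ring\<^esub> y = x * y"
  "\<one>\<^bsub>complex_ring\<^esub> = 1" "\<zero>\<^bsub>complex_ring\<^esub> = 0"
  by (simp_all add: complex_ring_def)

lemma cring_complex_ring: "cring complex_ring"
proof (rule cringI)
  show "abelian_group complex_ring"
    by (rule abelian_groupI) (auto simp: algebra_simps intro: exI[of _ "- _"] add.right_inverse)
  show "comm_monoid complex_ring" by (rule comm_monoidI) (auto simp: algebra_simps)
qed (auto simp: algebra_simps)

text \<open>
  A linear embedding \<open>\<iota>\<close> into a function space, with a linear retraction \<open>e\<close> defined on the whole space.
\<close>

definition is_coords ::
    "(complex, 'm, 'z) module_scheme \<Rightarrow> ('m \<Rightarrow> 'm \<Rightarrow>\<^sub>0 complex) \<Rightarrow> (('m \<Rightarrow>\<^sub>0 complex) \<Rightarrow> 'm) \<Rightarrow> bool" where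
  "is_coords M \<iota> e \<longleftrightarrow> (\<forall>m\<in>carrier M. e (\<iota> m) = m) \<and> (\<forall>v. e v \<in> carrier M) \<and>
     (\<forall>m\<in>carrier M. \<forall>n\<in>carrier M. \<iota> (m \<oplus>\<^bsub>M\<^esub> n) = \<iota> m + \<iota> n) \<and>
     (\<forall>c. \<forall>m\<in>carrier M. \<iota> (c \<odot>\<^bsub>M\<^esub> m) = psc c (\<iota> m)) \<and>
     (\<forall>v w. e (v + w) = e v \<oplus>\<^bsub>M\<^esub> e w) \<and> (\<forall>c v. e (psc c v) = c \<odot>\<^bsub>M\<^esub> e v)"

lemma complement_projection:
  fixes Z :: "('b \<Rightarrow>\<^sub>0 complex) set"
  assumes "ps.subspace Z"
  shows "\<exists>\<pi>. Vector_Spaces.linear psc psc \<pi> \<and> (\<forall>z\<in>Z. \<pi> z = 0) \<and> (\<forall>v. v - \<pi> v \<in> Z)"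
proof -
  interpret vector_space_pair psc psc ..
  obtain B where B: "B \<subseteq> Z" "ps.independent B" "Z \<subseteq> ps.span B"
    using ps.maximal_independent_subset by blast
  define B' where "B' = ps.extend_basis B"
  have B': "B \<subseteq> B'" "ps.independent B'" "ps.span B' = UNIV"
    unfolding B'_def using ps.extend_basis_superset ps.independent_extend_basis ps.span_extend_basis B(2)
    by auto
  \<comment> \<open>A basis of \<open>Z\<close> is extended to a basis of the whole space, and \<open>\<pi>\<close> kills the vectors of the former.\<close>
  define \<pi> where "\<pi> = construct B' (\<lambda>b. if b \<in> B then 0 else b)"
  have lin: "Vector_Spaces.linear psc psc \<pi>"
    unfolding \<pi>_def by (rule linear_construct[OF B'(2)])
  then interpret l: Vector_Spaces.linear psc psc \<pi> .
  have basis: "\<pi> b = (if b \<in> B then 0 else b)" if "b \<in> B'" for b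
    unfolding \<pi>_def by (rule construct_basis[OF B'(2) that])
  have "\<pi> z = 0" if "z \<in> Z" for z
  proof -
    have "z \<in> ps.span B" using that B(3) by blast
    then show ?thesis
      by (rule l.eq_0_on_span[rotated]) (use basis B'(1) in auto)
  qed
  moreover have "v - \<pi> v \<in> Z" for v
  proof -
    have "v \<in> ps.span B'" by (simp add: B'(3))
    then show ?thesis
    proof (induction rule: ps.span_induct_alt)
      case base then show ?case by (simp add: l.zero ps.subspace_0[OF assms])
    next
      case (step c b y)
      have "b - \<pi> b \<in> Z" using step(1) basis B(1) ps.subspace_0[OF assms] by auto
      then have "psc c (b - \<pi> b) + (y - \<pi> y) \<in> Z"
        using step assms by (intro ps.subspace_add ps.subspace_scale)
      then show ?case by (simp add: l.add l.scale ps.scale_right_diff_distrib algebra_simps)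
    qed
  qed
  ultimately show ?thesis using lin by blast
qed

text \<open>
  A module is a quotient of the free vector space on its own elements, and a linear complement of the
  kernel provides the embedding.
\<close>

lemma ex_coords:
  fixes M :: "(complex, 'm, 'z) module_scheme"
  assumes "module complex_ring M"
  shows "\<exists>\<iota> e. is_coords M \<iota> e"
proof -
  interpret module complex_ring M by fact
  let ?C = "carrier M"
  \<comment> \<open>Evaluation of formal linear combinations of elements. Intersecting with the carrier makes it total.\<close>
  define e where "e f = finsum M (\<lambda>m. Poly_Mapping.lookup f m \<odot>\<^bsub>M\<^esub> m) (Poly_Mapping.keys f \<inter> ?C)"
    for f :: "'m \<Rightarrow>\<^sub>0 complex"
  have e_super: "e f = finsum M (\<lambda>m. Poly_Mapping.lookup f m \<odot>\<^bsub>M\<^esub> m) B"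
    if "finite B" "Poly_Mapping.keys f \<inter> ?C \<subseteq> B" "B \<subseteq> ?C" for f B
    unfolding e_def using that
    by (intro M.add.finprod_mono_neutral_cong_left) (use smult_l_null in \<open>auto simp: in_keys_iff\<close>)
  have e_closed: "e f \<in> ?C" for f
    unfolding e_def by (rule M.finsum_closed) auto
  have e_add: "e (f + g) = e f \<oplus>\<^bsub>M\<^esub> e g" for f g
  proof -
    let ?B = "(Poly_Mapping.keys f \<union> Poly_Mapping.keys g) \<inter> ?C"
    have "e (f + g) = finsum M (\<lambda>m. Poly_Mapping.lookup (f + g) m \<odot>\<^bsub>M\<^esub> m) ?B"
      using Poly_Mapping.keys_add[of f g] by (intro e_super) auto
    also have "\<dots> = finsum M (\<lambda>m. Poly_Mapping.lookup f m \<odot>\<^bsub>M\<^esub> m \<oplus>\<^bsub>M\<^esub> Poly_Mapping.lookup g m \<odot>\<^bsub>M\<^esub> m) ?B"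
      by (rule M.finsum_cong') (use smult_l_distr in \<open>auto simp: lookup_add\<close>)
    also have "\<dots> = finsum M (\<lambda>m. Poly_Mapping.lookup f m \<odot>\<^bsub>M\<^esub> m) ?B \<oplus>\<^bsub>M\<^esub> finsum M (\<lambda>m. Poly_Mapping.lookup g m \<odot>\<^bsub>M\<^esub> m) ?B"
      by (rule M.finsum_addf) auto
    finally show ?thesis by (subst (2 3) e_super[of ?B]) auto
  qed
  have e_psc: "e (psc c f) = c \<odot>\<^bsub>M\<^esub> e f" for c f
  proof -
    let ?B = "Poly_Mapping.keys f \<inter> ?C"
    have "e (psc c f) = finsum M (\<lambda>m. Poly_Mapping.lookup (psc c f) m \<odot>\<^bsub>M\<^esub> m) ?B"
      using keys_psc[of c f] by (intro e_super) auto
    also have "\<dots> = finsum M (\<lambda>m. c \<odot>\<^bsub>M\<^esub> (Poly_Mapping.lookup f m \<odot>\<^bsub>M\<^esub> m)) ?B"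
      by (rule M.finsum_cong') (use smult_assoc1 in auto)
    also have "\<dots> = c \<odot>\<^bsub>M\<^esub> e f"
      unfolding e_def by (rule finsum_smult_ldistr[symmetric]) auto
    finally show ?thesis .
  qed
  have e_single: "e (Poly_Mapping.single m 1) = m" if "m \<in> ?C" for m
  proof -
    have "e (Poly_Mapping.single m 1) = finsum M (\<lambda>k. Poly_Mapping.lookup (Poly_Mapping.single m 1) k \<odot>\<^bsub>M\<^esub> k) {m}"
      using that by (intro e_super) auto
    then show ?thesis using that by (simp add: smult_one[simplified])
  qed
  have e0: "e 0 = \<zero>\<^bsub>M\<^esub>" by (simp add: e_def)
  \<comment> \<open>Two combinations with the same value differ by an element of \<open>Z\<close>, hence agree under \<open>\<pi>\<close>.\<close>
  define Z where "Z = {f. e f = \<zero>\<^bsub>M\<^esub>}"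
  have "ps.subspace Z"
    by (rule ps.subspaceI) (auto simp: Z_def e0 e_add e_psc)
  from complement_projection[OF this] obtain \<pi> where
    lin: "Vector_Spaces.linear psc psc \<pi>" and z: "\<And>z. z \<in> Z \<Longrightarrow> \<pi> z = 0" and c: "\<And>v. v - \<pi> v \<in> Z"
    by blast
  interpret l: Vector_Spaces.linear psc psc \<pi> by (rule lin)
  have e_\<pi>: "e (\<pi> v) = e v" for v
  proof -
    have "e v = e (v - \<pi> v) \<oplus>\<^bsub>M\<^esub> e (\<pi> v)" by (simp flip: e_add)
    then show ?thesis using c[of v] by (simp add: Z_def e_closed)
  qed
  have \<pi>_eq: "\<pi> v = \<pi> w" if "e v = e w" for v w
  proof -
    have "e v = e (v - w) \<oplus>\<^bsub>M\<^esub> e w" by (simp flip: e_add)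
    then have "v - w \<in> Z" using that e_closed by (simp add: Z_def M.add.l_cancel_one')
    then show ?thesis using z[of "v - w"] by (simp add: l.diff)
  qed
  have e_single': "e (Poly_Mapping.single m c) = c \<odot>\<^bsub>M\<^esub> m" if "m \<in> ?C" for m c
    using e_psc[of c "Poly_Mapping.single m 1"] e_single[OF that] by simp
  have one: "1 \<odot>\<^bsub>M\<^esub> m = m" if "m \<in> ?C" for m using smult_one[OF that] by simp
  let ?\<iota> = "\<lambda>m. \<pi> (Poly_Mapping.single m 1)"
  have "is_coords M ?\<iota> e"
    unfolding is_coords_def
    by (auto simp: one e_\<pi> e_single e_single' e_closed e_add e_psc simp flip: l.add l.scale intro!: \<pi>_eq)
  then show ?thesis by blast
qed

definition crd :: "(complex, 'm, 'z) module_scheme \<Rightarrow> 'm \<Rightarrow> 'm \<Rightarrow>\<^sub>0 complex" where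
  "crd M = (SOME \<iota>. \<exists>e. is_coords M \<iota> e)"

definition uncrd :: "(complex, 'm, 'z) module_scheme \<Rightarrow> ('m \<Rightarrow>\<^sub>0 complex) \<Rightarrow> 'm" where
  "uncrd M = (SOME e. is_coords M (crd M) e)"

text \<open>
  The simplification rules of this locale push \<open>crd M\<close> through all module operations; together with
  \<open>crd_eqI\<close> they reduce module equations to equations in a vector space.
\<close>

locale cmod =
  fixes M :: "(complex, 'm, 'z) module_scheme" (structure)
  assumes module: "module complex_ring M"
begin

lemma coords: "is_coords M (crd M) (uncrd M)"
proof -
  have "\<exists>e. is_coords M (crd M) e"
    unfolding crd_def
    by (rule someI_ex[of "\<lambda>\<iota>. \<exists>e. is_coords M \<iota> e", OF ex_coords[OF module]])
  then show ?thesis unfolding uncrd_def by (rule someI_ex)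
qed

lemma uncrd_crd [simp]: "m \<in> carrier M \<Longrightarrow> uncrd M (crd M m) = m"
  and uncrd_closed [simp]: "uncrd M v \<in> carrier M"
  and crd_add [simp]: "m \<in> carrier M \<Longrightarrow> n \<in> carrier M \<Longrightarrow> crd M (m \<oplus> n) = crd M m + crd M n"
  and crd_smult [simp]: "m \<in> carrier M \<Longrightarrow> crd M (c \<odot> m) = psc c (crd M m)"
  and uncrd_add: "uncrd M (v + w) = uncrd M v \<oplus> uncrd M w"
  and uncrd_psc: "uncrd M (psc c v) = c \<odot> uncrd M v"
  using coords by (auto simp: is_coords_def)

lemma crd_eqI: "m \<in> carrier M \<Longrightarrow> n \<in> carrier M \<Longrightarrow> crd M m = crd M n \<Longrightarrow> m = n"
  by (metis uncrd_crd)

lemma abelian_group: "abelian_group M"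
  using module by (simp add: module_def)

lemma add_in [simp]: "m \<in> carrier M \<Longrightarrow> n \<in> carrier M \<Longrightarrow> m \<oplus> n \<in> carrier M"
  and zero_in [simp]: "\<zero> \<in> carrier M"
  and minus_in [simp]: "m \<in> carrier M \<Longrightarrow> n \<in> carrier M \<Longrightarrow> m \<ominus> n \<in> carrier M"
  and uminus_in [simp]: "m \<in> carrier M \<Longrightarrow> \<ominus> m \<in> carrier M"
proof -
  interpret abelian_group M by (rule abelian_group)
  show "m \<in> carrier M \<Longrightarrow> n \<in> carrier M \<Longrightarrow> m \<oplus> n \<in> carrier M"
    "\<zero> \<in> carrier M"
    "m \<in> carrier M \<Longrightarrow> n \<in> carrier M \<Longrightarrow> m \<ominus> n \<in> carrier M"
    "m \<in> carrier M \<Longrightarrow> \<ominus> m \<in> carrier M" by simp_all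
qed

lemma smult_in [simp]: "m \<in> carrier M \<Longrightarrow> c \<odot> m \<in> carrier M"
  using module.smult_closed[OF module] by simp

lemma crd_zero [simp]: "crd M \<zero> = 0"
proof -
  interpret abelian_group M by (rule abelian_group)
  have "crd M \<zero> = crd M \<zero> + crd M \<zero>" by (metis crd_add zero_in l_zero)
  then show ?thesis by simp
qed

lemma crd_uminus [simp]: "m \<in> carrier M \<Longrightarrow> crd M (\<ominus> m) = - crd M m"
proof -
  interpret abelian_group M by (rule abelian_group)
  assume m: "m \<in> carrier M"
  then have "crd M (\<ominus> m) + crd M m = 0"
    by (metis crd_add crd_zero uminus_in l_neg)
  then show ?thesis by (simp add: eq_neg_iff_add_eq_0)
qed

lemma crd_minus [simp]: "m \<in> carrier M \<Longrightarrow> n \<in> carrier M \<Longrightarrow> crd M (m \<ominus> n) = crd M m - crd M n"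
  by (simp add: a_minus_def)

lemma crd_inject: "m \<in> carrier M \<Longrightarrow> n \<in> carrier M \<Longrightarrow> crd M m = crd M n \<longleftrightarrow> m = n"
  by (metis uncrd_crd)

lemma uncrd_zero [simp]: "uncrd M 0 = \<zero>"
  by (metis crd_zero uncrd_crd zero_in)

lemma crd_finsum:
  assumes "finite A" "\<And>a. a \<in> A \<Longrightarrow> g a \<in> carrier M"
  shows "finsum M g A \<in> carrier M \<and> crd M (finsum M g A) = (\<Sum>a\<in>A. crd M (g a))"
proof -
  interpret abelian_group M by (rule abelian_group)
  show ?thesis using assms by (induction rule: finite_induct) auto
qed

lemma submodule_iff:
  "submodule N complex_ring M \<longleftrightarrow> N \<subseteq> carrier M \<and> \<zero> \<in> N \<and>
     (\<forall>a\<in>N. \<forall>b\<in>N. a \<oplus> b \<in> N) \<and> (\<forall>c. \<forall>a\<in>N. c \<odot> a \<in> N)"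
proof -
  interpret module complex_ring M by (rule module)
  show ?thesis
  proof
    assume s: "submodule N complex_ring M"
    have "\<zero> \<in> N" using s by (simp add: submodule_def subgroup_def)
    then show "N \<subseteq> carrier M \<and> \<zero> \<in> N \<and> (\<forall>a\<in>N. \<forall>b\<in>N. a \<oplus> b \<in> N) \<and> (\<forall>c. \<forall>a\<in>N. c \<odot> a \<in> N)"
      using submoduleE[OF s] by auto
  next
    assume n: "N \<subseteq> carrier M \<and> \<zero> \<in> N \<and> (\<forall>a\<in>N. \<forall>b\<in>N. a \<oplus> b \<in> N) \<and> (\<forall>c. \<forall>a\<in>N. c \<odot> a \<in> N)"
    have "\<ominus> a = (- 1) \<odot> a" if "a \<in> N" for a
      using that n by (intro crd_eqI) auto
    then show "submodule N complex_ring M" using n by (intro submoduleI) auto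
  qed
qed

lemma submodule_subset: "submodule N complex_ring M \<Longrightarrow> a \<in> N \<Longrightarrow> a \<in> carrier M"
  and submodule_zero: "submodule N complex_ring M \<Longrightarrow> \<zero> \<in> N"
  and submodule_add: "submodule N complex_ring M \<Longrightarrow> a \<in> N \<Longrightarrow> b \<in> N \<Longrightarrow> a \<oplus> b \<in> N"
  and submodule_smult: "submodule N complex_ring M \<Longrightarrow> a \<in> N \<Longrightarrow> c \<odot> a \<in> N"
  by (auto simp: submodule_iff)

lemma submodule_minus:
  assumes "submodule N complex_ring M" "a \<in> N" "b \<in> N"
  shows "a \<ominus> b \<in> N"
proof -
  note c = submodule_subset[OF assms(1)]
  have "a \<ominus> b = a \<oplus> (- 1) \<odot> b" using assms c by (intro crd_eqI) auto
  then show ?thesis using assms by (simp add: submodule_add submodule_smult)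
qed

lemma submodule_cancel:
  assumes "submodule N complex_ring M" "a \<oplus> b \<in> N" "a \<in> carrier M" "b \<in> N"
  shows "a \<in> N"
proof -
  note c = submodule_subset[OF assms(1)]
  have "a = (a \<oplus> b) \<ominus> b" using assms c by (intro crd_eqI) auto
  then show ?thesis using submodule_minus assms by metis
qed

lemma submodule_lin_hull:
  assumes "X \<subseteq> carrier M"
  shows "submodule (lin_hull M X) complex_ring M" "X \<subseteq> lin_hull M X"
    "submodule N complex_ring M \<Longrightarrow> X \<subseteq> N \<Longrightarrow> lin_hull M X \<subseteq> N"
proof -
  have c: "submodule (carrier M) complex_ring M" by (simp add: submodule_iff)
  then have "carrier M \<in> {N. submodule N complex_ring M \<and> X \<subseteq> N}" using assms by simp
  then show "submodule (lin_hull M X) complex_ring M"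
    unfolding lin_hull_def by (subst submodule_iff) (auto simp: submodule_zero submodule_add submodule_smult)
  show "X \<subseteq> lin_hull M X" "submodule N complex_ring M \<Longrightarrow> X \<subseteq> N \<Longrightarrow> lin_hull M X \<subseteq> N"
    by (auto simp: lin_hull_def)
qed

end

lemma cmodI:
  assumes add: "\<And>a b. a \<in> carrier M \<Longrightarrow> b \<in> carrier M \<Longrightarrow> a \<oplus>\<^bsub>M\<^esub> b \<in> carrier M"
    and zero: "\<zero>\<^bsub>M\<^esub> \<in> carrier M"
    and smult: "\<And>c a. a \<in> carrier M \<Longrightarrow> c \<odot>\<^bsub>M\<^esub> a \<in> carrier M"
    and assoc: "\<And>a b c. a \<in> carrier M \<Longrightarrow> b \<in> carrier M \<Longrightarrow> c \<in> carrier M \<Longrightarrow>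
      (a \<oplus>\<^bsub>M\<^esub> b) \<oplus>\<^bsub>M\<^esub> c = a \<oplus>\<^bsub>M\<^esub> (b \<oplus>\<^bsub>M\<^esub> c)"
    and comm: "\<And>a b. a \<in> carrier M \<Longrightarrow> b \<in> carrier M \<Longrightarrow> a \<oplus>\<^bsub>M\<^esub> b = b \<oplus>\<^bsub>M\<^esub> a"
    and zero_left: "\<And>a. a \<in> carrier M \<Longrightarrow> \<zero>\<^bsub>M\<^esub> \<oplus>\<^bsub>M\<^esub> a = a"
    and neg: "\<And>a. a \<in> carrier M \<Longrightarrow> (- 1) \<odot>\<^bsub>M\<^esub> a \<oplus>\<^bsub>M\<^esub> a = \<zero>\<^bsub>M\<^esub>"
    and distl: "\<And>c d a. a \<in> carrier M \<Longrightarrow> (c + d) \<odot>\<^bsub>M\<^esub> a = c \<odot>\<^bsub>M\<^esub> a \<oplus>\<^bsub>M\<^esub> d \<odot>\<^bsub>M\<^esub> a"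
    and distr: "\<And>c a b. a \<in> carrier M \<Longrightarrow> b \<in> carrier M \<Longrightarrow> c \<odot>\<^bsub>M\<^esub> (a \<oplus>\<^bsub>M\<^esub> b) = c \<odot>\<^bsub>M\<^esub> a \<oplus>\<^bsub>M\<^esub> c \<odot>\<^bsub>M\<^esub> b"
    and smult2: "\<And>c d a. a \<in> carrier M \<Longrightarrow> (c * d) \<odot>\<^bsub>M\<^esub> a = c \<odot>\<^bsub>M\<^esub> (d \<odot>\<^bsub>M\<^esub> a)"
    and one: "\<And>a. a \<in> carrier M \<Longrightarrow> 1 \<odot>\<^bsub>M\<^esub> a = a"
  shows "cmod M"
proof (rule cmod.intro, rule moduleI)
  show "abelian_group M"
    using neg smult by (intro abelian_groupI) (auto simp: add zero assoc zero_left intro: comm)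
qed (simp_all add: assms cring_complex_ring)


section \<open>Modules over Lie algebras\<close>

definition substruct :: "'x lie_struct \<Rightarrow> 'x lie_struct \<Rightarrow> bool" where
  "substruct P L \<longleftrightarrow> lie_carrier P \<subseteq> lie_carrier L \<and> lie_scale P = lie_scale L \<and> lie_bracket P = lie_bracket L"

definition struct_closed :: "'x::ab_group_add lie_struct \<Rightarrow> bool" where
  "struct_closed L \<longleftrightarrow> (\<forall>x\<in>lie_carrier L. \<forall>y\<in>lie_carrier L.
     x + y \<in> lie_carrier L \<and> lie_bracket L x y \<in> lie_carrier L) \<and>
     (\<forall>c. \<forall>x\<in>lie_carrier L. lie_scale L c x \<in> lie_carrier L)"

lemma is_lie_module_substruct: "substruct P L \<Longrightarrow> is_lie_module L M \<Longrightarrow> is_lie_module P M"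
  unfolding is_lie_module_def substruct_def by (simp add: subset_iff)

lemma is_lie_submodule_substruct: "substruct P L \<Longrightarrow> is_lie_submodule L M N \<Longrightarrow> is_lie_submodule P M N"
  unfolding is_lie_submodule_def substruct_def by (simp add: subset_iff)

lemma lie_hom_substruct: "substruct P L \<Longrightarrow> f \<in> lie_hom L M N \<Longrightarrow> f \<in> lie_hom P M N"
  unfolding lie_hom_def substruct_def by (simp add: subset_iff)

locale lie_mod =
  fixes L :: "'x::ab_group_add lie_struct" and M :: "('x, 'm) lie_rep" (structure)
  assumes lie_module: "is_lie_module L M"
begin

sublocale cmod M
  using lie_module by (intro cmod.intro) (simp add: is_lie_module_def)

lemma act_in [simp]: "x \<in> lie_carrier L \<Longrightarrow> m \<in> carrier M \<Longrightarrow> act M x m \<in> carrier M"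
  and act_add [simp]: "x \<in> lie_carrier L \<Longrightarrow> m \<in> carrier M \<Longrightarrow> n \<in> carrier M \<Longrightarrow>
    act M x (m \<oplus> n) = act M x m \<oplus> act M x n"
  and act_smult [simp]: "x \<in> lie_carrier L \<Longrightarrow> m \<in> carrier M \<Longrightarrow> act M x (c \<odot> m) = c \<odot> act M x m"
  and act_add_left: "x \<in> lie_carrier L \<Longrightarrow> y \<in> lie_carrier L \<Longrightarrow> m \<in> carrier M \<Longrightarrow>
    act M (x + y) m = act M x m \<oplus> act M y m"
  and act_scale_left: "x \<in> lie_carrier L \<Longrightarrow> m \<in> carrier M \<Longrightarrow> act M (lie_scale L c x) m = c \<odot> act M x m"
  and act_bracket: "x \<in> lie_carrier L \<Longrightarrow> y \<in> lie_carrier L \<Longrightarrow> m \<in> carrier M \<Longrightarrow>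
    act M (lie_bracket L x y) m = act M x (act M y m) \<ominus> act M y (act M x m)"
  using lie_module by (auto simp: is_lie_module_def)

lemma act_zero [simp]: "x \<in> lie_carrier L \<Longrightarrow> act M x \<zero> = \<zero>"
proof -
  assume x: "x \<in> lie_carrier L"
  have "crd M (act M x (0 \<odot> \<zero>)) = 0" using x by (simp del: act_smult add: act_smult)
  moreover have "0 \<odot> \<zero> = \<zero>" by (rule crd_eqI) simp_all
  ultimately show ?thesis using x by (intro crd_eqI) simp_all
qed

lemma act_commute: "x \<in> lie_carrier L \<Longrightarrow> y \<in> lie_carrier L \<Longrightarrow> lie_bracket L x y \<in> lie_carrier L \<Longrightarrow>
    m \<in> carrier M \<Longrightarrow> act M x (act M y m) = act M y (act M x m) \<oplus> act M (lie_bracket L x y) m"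
  by (rule crd_eqI) (simp_all add: act_bracket)

lemma is_lie_submodule_iff:
  "is_lie_submodule L M N \<longleftrightarrow> N \<subseteq> carrier M \<and> \<zero> \<in> N \<and>
     (\<forall>a\<in>N. \<forall>b\<in>N. a \<oplus> b \<in> N) \<and> (\<forall>c. \<forall>a\<in>N. c \<odot> a \<in> N) \<and> (\<forall>x\<in>lie_carrier L. \<forall>m\<in>N. act M x m \<in> N)"
  by (auto simp: is_lie_submodule_def submodule_iff)

lemma is_lie_submodule_carrier: "is_lie_submodule L M (carrier M)"
  by (auto simp: is_lie_submodule_iff)

lemma is_lie_submodule_zero: "is_lie_submodule L M {\<zero>}"
proof -
  have "\<zero> \<oplus> \<zero> = \<zero>" by (rule crd_eqI) simp_all
  moreover have "c \<odot> \<zero> = \<zero>" for c by (rule crd_eqI) simp_all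
  ultimately show ?thesis by (auto simp: is_lie_submodule_iff)
qed

text \<open>
  The linear hull of a union of stable sets is stable, as the elements that a given \<open>x\<close> maps into the hull
  form a linear subspace containing the union. That this sum is again proper is special to the modules
  considered below.
\<close>

lemma sum_proper_submodule: "is_lie_submodule L M (sum_proper_submodules L M)"
  and proper_subset_sum: "is_lie_submodule L M N \<Longrightarrow> N \<noteq> carrier M \<Longrightarrow> N \<subseteq> sum_proper_submodules L M"
proof -
  let ?X = "\<Union>{N. is_lie_submodule L M N \<and> N \<noteq> carrier M}"
  let ?S = "sum_proper_submodules L M"
  have X: "?X \<subseteq> carrier M" by (auto simp: is_lie_submodule_iff)
  note hull = submodule_lin_hull[OF X, folded sum_proper_submodules_def]
  have stable: "act M x w \<in> ?S" if x: "x \<in> lie_carrier L" and "w \<in> ?S" for x w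
  proof -
    have "?X \<subseteq> {w \<in> ?S. act M x w \<in> ?S}"
    proof
      fix w assume "w \<in> ?X"
      then obtain N where N: "is_lie_submodule L M N" "N \<noteq> carrier M" "w \<in> N" by blast
      then have "act M x w \<in> ?X" using x by (auto simp: is_lie_submodule_def)
      then show "w \<in> {w \<in> ?S. act M x w \<in> ?S}" using hull(2) \<open>w \<in> ?X\<close> by blast
    qed
    moreover have "submodule {w \<in> ?S. act M x w \<in> ?S} complex_ring M"
      unfolding submodule_iff
      using submodule_subset[OF hull(1)] submodule_zero[OF hull(1)] submodule_add[OF hull(1)]
        submodule_smult[OF hull(1)] x by auto
    ultimately show ?thesis using hull(3) that by blast
  qed
  show "is_lie_submodule L M ?S"
    using hull(1) stable by (simp add: is_lie_submodule_def)
  show "is_lie_submodule L M N \<Longrightarrow> N \<noteq> carrier M \<Longrightarrow> N \<subseteq> sum_proper_submodules L M"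
    using hull(2) by blast
qed

end

lemma is_lie_moduleI:
  assumes "cmod M"
    and "\<And>x m. x \<in> lie_carrier L \<Longrightarrow> m \<in> carrier M \<Longrightarrow> act M x m \<in> carrier M"
    and "\<And>x m n. x \<in> lie_carrier L \<Longrightarrow> m \<in> carrier M \<Longrightarrow> n \<in> carrier M \<Longrightarrow>
      act M x (m \<oplus>\<^bsub>M\<^esub> n) = act M x m \<oplus>\<^bsub>M\<^esub> act M x n"
    and "\<And>x c m. x \<in> lie_carrier L \<Longrightarrow> m \<in> carrier M \<Longrightarrow> act M x (c \<odot>\<^bsub>M\<^esub> m) = c \<odot>\<^bsub>M\<^esub> act M x m"
    and "\<And>x y m. x \<in> lie_carrier L \<Longrightarrow> y \<in> lie_carrier L \<Longrightarrow> m \<in> carrier M \<Longrightarrow>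
      act M (x + y) m = act M x m \<oplus>\<^bsub>M\<^esub> act M y m"
    and "\<And>x c m. x \<in> lie_carrier L \<Longrightarrow> m \<in> carrier M \<Longrightarrow> act M (lie_scale L c x) m = c \<odot>\<^bsub>M\<^esub> act M x m"
    and "\<And>x y m. x \<in> lie_carrier L \<Longrightarrow> y \<in> lie_carrier L \<Longrightarrow> m \<in> carrier M \<Longrightarrow>
      act M (lie_bracket L x y) m = act M x (act M y m) \<ominus>\<^bsub>M\<^esub> act M y (act M x m)"
  shows "is_lie_module L M"
  using assms by (simp add: is_lie_module_def cmod_def)

lemma lie_hom_closed: "f \<in> lie_hom L M N \<Longrightarrow> m \<in> carrier M \<Longrightarrow> f m \<in> carrier N"
  and lie_hom_add: "f \<in> lie_hom L M N \<Longrightarrow> m \<in> carrier M \<Longrightarrow> m' \<in> carrier M \<Longrightarrow> f (m \<oplus>\<^bsub>M\<^esub> m') = f m \<oplus>\<^bsub>N\<^esub> f m'"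
  and lie_hom_smult: "f \<in> lie_hom L M N \<Longrightarrow> m \<in> carrier M \<Longrightarrow> f (c \<odot>\<^bsub>M\<^esub> m) = c \<odot>\<^bsub>N\<^esub> f m"
  and lie_hom_act: "f \<in> lie_hom L M N \<Longrightarrow> x \<in> lie_carrier L \<Longrightarrow> m \<in> carrier M \<Longrightarrow> f (act M x m) = act N x (f m)"
  by (auto simp: lie_hom_def)

lemmas lie_hom_simps = lie_hom_closed lie_hom_add lie_hom_smult lie_hom_act

lemma lie_homI:
  assumes "\<And>m. m \<in> carrier M \<Longrightarrow> f m \<in> carrier N"
    and "\<And>m m'. m \<in> carrier M \<Longrightarrow> m' \<in> carrier M \<Longrightarrow> f (m \<oplus>\<^bsub>M\<^esub> m') = f m \<oplus>\<^bsub>N\<^esub> f m'"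
    and "\<And>c m. m \<in> carrier M \<Longrightarrow> f (c \<odot>\<^bsub>M\<^esub> m) = c \<odot>\<^bsub>N\<^esub> f m"
    and "\<And>x m. x \<in> lie_carrier L \<Longrightarrow> m \<in> carrier M \<Longrightarrow> f (act M x m) = act N x (f m)"
  shows "f \<in> lie_hom L M N"
  using assms by (auto simp: lie_hom_def)

lemma lie_hom_comp: "is_lie_module L M \<Longrightarrow> f \<in> lie_hom L M N \<Longrightarrow> g \<in> lie_hom L N Q \<Longrightarrow> (\<lambda>m. g (f m)) \<in> lie_hom L M Q"
  by (rule lie_homI) (simp_all add: lie_hom_simps)

lemma lie_hom_id: "(\<lambda>m. m) \<in> lie_hom L M M"
  by (rule lie_homI) simp_all

lemma lie_hom_zero:
  assumes "is_lie_module L M" "is_lie_module L N" "f \<in> lie_hom L M N"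
  shows "f \<zero>\<^bsub>M\<^esub> = \<zero>\<^bsub>N\<^esub>"
proof -
  interpret M: lie_mod L M by (rule lie_mod.intro) fact
  interpret N: lie_mod L N by (rule lie_mod.intro) fact
  have "\<zero>\<^bsub>M\<^esub> = 0 \<odot>\<^bsub>M\<^esub> \<zero>\<^bsub>M\<^esub>" by (rule M.crd_eqI) simp_all
  then have "f \<zero>\<^bsub>M\<^esub> = 0 \<odot>\<^bsub>N\<^esub> f \<zero>\<^bsub>M\<^esub>" using lie_hom_smult[OF assms(3)] M.zero_in by metis
  then have "crd N (f \<zero>\<^bsub>M\<^esub>) = crd N (0 \<odot>\<^bsub>N\<^esub> f \<zero>\<^bsub>M\<^esub>)" by (rule arg_cong)
  then show ?thesis using lie_hom_closed[OF assms(3)] by (intro N.crd_eqI) simp_all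
qed

text \<open>
  The two constructions of submodules by which statements about all elements of an induced module are
  reduced to its generators.
\<close>

lemma preimage_submodule:
  assumes "is_lie_module L M" "is_lie_module L N" "f \<in> lie_hom L M N" "is_lie_submodule L N S"
  shows "is_lie_submodule L M {m \<in> carrier M. f m \<in> S}"
proof -
  interpret M: lie_mod L M by (rule lie_mod.intro) fact
  interpret N: lie_mod L N by (rule lie_mod.intro) fact
  show ?thesis
    using assms(3,4) lie_hom_zero[OF assms(1-3)]
    by (auto simp: M.is_lie_submodule_iff N.is_lie_submodule_iff lie_hom_simps)
qed

lemma equalizer_submodule:
  assumes "is_lie_module L M" "is_lie_module L N" "f \<in> lie_hom L M N" "g \<in> lie_hom L M N"
  shows "is_lie_submodule L M {m \<in> carrier M. f m = g m}"
proof -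
  interpret M: lie_mod L M by (rule lie_mod.intro) fact
  show ?thesis
    using assms(3,4) lie_hom_zero[OF assms(1-3)] lie_hom_zero[OF assms(1,2,4)]
    by (auto simp: M.is_lie_submodule_iff lie_hom_simps)
qed

lemma lie_isomorphic_refl: "lie_isomorphic L M M"
  unfolding lie_isomorphic_def using lie_hom_id[of L M] by (auto intro: bij_betw_id[unfolded id_def])

lemma lie_isomorphic_trans:
  assumes "is_lie_module L M" "lie_isomorphic L M N" "lie_isomorphic L N Q"
  shows "lie_isomorphic L M Q"
proof -
  obtain f g where fg: "f \<in> lie_hom L M N" "bij_betw f (carrier M) (carrier N)"
      "g \<in> lie_hom L N Q" "bij_betw g (carrier N) (carrier Q)"
    using assms by (auto simp: lie_isomorphic_def)
  have "bij_betw (\<lambda>m. g (f m)) (carrier M) (carrier Q)"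
    using bij_betw_trans[OF fg(2,4)] by (simp add: comp_def)
  then show ?thesis
    unfolding lie_isomorphic_def using lie_hom_comp[OF assms(1) fg(1,3)] by blast
qed

lemma lie_isomorphicI:
  assumes "f \<in> lie_hom L M N" "g \<in> lie_hom L N M"
    "\<And>m. m \<in> carrier M \<Longrightarrow> g (f m) = m" "\<And>n. n \<in> carrier N \<Longrightarrow> f (g n) = n"
  shows "lie_isomorphic L M N"
  unfolding lie_isomorphic_def
  by (rule bexI[OF _ assms(1)]) (rule bij_betw_byWitness[of _ g], use assms in \<open>auto simp: lie_hom_closed\<close>)

lemma lie_isomorphicE:
  assumes "is_lie_module L M" "lie_isomorphic L M N"
  obtains f g where "f \<in> lie_hom L M N" "g \<in> lie_hom L N M"
    "\<And>m. m \<in> carrier M \<Longrightarrow> g (f m) = m" "\<And>n. n \<in> carrier N \<Longrightarrow> f (g n) = n"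
proof -
  interpret M: lie_mod L M by (rule lie_mod.intro) fact
  obtain f where f: "f \<in> lie_hom L M N" and bij: "bij_betw f (carrier M) (carrier N)"
    using assms by (auto simp: lie_isomorphic_def)
  define g where "g = inv_into (carrier M) f"
  have gf: "g (f m) = m" if "m \<in> carrier M" for m
    unfolding g_def using bij that by (simp add: bij_betw_def)
  have surj: "\<exists>m\<in>carrier M. n = f m" if "n \<in> carrier N" for n
    using bij that by (auto simp: bij_betw_def)
  have "g \<in> lie_hom L N M"
  proof (rule lie_homI)
    fix m n c x
    assume m: "m \<in> carrier N"
    obtain m' where m': "m' \<in> carrier M" "m = f m'" using surj m by blast
    show "g m \<in> carrier M" using m' gf by simp
    have "g (f (c \<odot>\<^bsub>M\<^esub> m')) = c \<odot>\<^bsub>M\<^esub> g (f m')" using m'(1) by (simp add: gf)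
    then show "g (c \<odot>\<^bsub>N\<^esub> m) = c \<odot>\<^bsub>M\<^esub> g m" using m' f by (simp add: lie_hom_smult)
    {
      assume "n \<in> carrier N"
      then obtain n' where n': "n' \<in> carrier M" "n = f n'" using surj by blast
      have "g (f (m' \<oplus>\<^bsub>M\<^esub> n')) = g (f m') \<oplus>\<^bsub>M\<^esub> g (f n')" using m'(1) n'(1) by (simp add: gf)
      then show "g (m \<oplus>\<^bsub>N\<^esub> n) = g m \<oplus>\<^bsub>M\<^esub> g n" using m' n' f by (simp add: lie_hom_add)
    next
      assume x: "x \<in> lie_carrier L"
      have "g (f (act M x m')) = act M x (g (f m'))" using m'(1) x by (simp add: gf)
      then show "g (act N x m) = act M x (g m)" using m' f x by (simp add: lie_hom_act)
    }
  qed
  moreover have "f (g n) = n" if "n \<in> carrier N" for n using surj[OF that] gf by auto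
  ultimately show thesis using that f gf by blast
qed

text \<open>
  The module axioms are equations, so they pass to the image of a structure-preserving map. This serves
  for quotients, for modules copied along an injection and for modules with a changed action.
\<close>

lemma image_cmod:
  assumes "cmod M" and surj: "carrier N = f ` carrier M" and zero: "f \<zero>\<^bsub>M\<^esub> = \<zero>\<^bsub>N\<^esub>"
    and add: "\<And>a b. a \<in> carrier M \<Longrightarrow> b \<in> carrier M \<Longrightarrow> f a \<oplus>\<^bsub>N\<^esub> f b = f (a \<oplus>\<^bsub>M\<^esub> b)"
    and smult: "\<And>c a. a \<in> carrier M \<Longrightarrow> c \<odot>\<^bsub>N\<^esub> f a = f (c \<odot>\<^bsub>M\<^esub> a)"
  shows "cmod N"
proof -
  interpret cmod M by fact
  show ?thesis
  proof (rule cmodI)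
    fix c d x y z
    assume "x \<in> carrier N"
    then obtain a where a: "a \<in> carrier M" "x = f a" using surj by blast
    show "c \<odot>\<^bsub>N\<^esub> x \<in> carrier N" using a by (simp add: surj smult)
    have e: "f u = f v" if "u \<in> carrier M" "v \<in> carrier M" "crd M u = crd M v" for u v
      using crd_eqI that by metis
    show "\<zero>\<^bsub>N\<^esub> \<oplus>\<^bsub>N\<^esub> x = x" using a by (simp add: add flip: zero) (rule e; simp)
    show "- 1 \<odot>\<^bsub>N\<^esub> x \<oplus>\<^bsub>N\<^esub> x = \<zero>\<^bsub>N\<^esub>" using a by (simp add: add smult flip: zero) (rule e; simp)
    show "(c + d) \<odot>\<^bsub>N\<^esub> x = c \<odot>\<^bsub>N\<^esub> x \<oplus>\<^bsub>N\<^esub> d \<odot>\<^bsub>N\<^esub> x"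
      using a by (simp add: add smult) (rule e; simp add: ps.scale_left_distrib)
    show "(c * d) \<odot>\<^bsub>N\<^esub> x = c \<odot>\<^bsub>N\<^esub> (d \<odot>\<^bsub>N\<^esub> x)" using a by (simp add: smult) (rule e; simp)
    show "1 \<odot>\<^bsub>N\<^esub> x = x" using a by (simp add: smult) (rule e; simp)
    assume "y \<in> carrier N"
    then obtain b where b: "b \<in> carrier M" "y = f b" using surj by blast
    show "x \<oplus>\<^bsub>N\<^esub> y \<in> carrier N" using a b by (simp add: surj add)
    show "x \<oplus>\<^bsub>N\<^esub> y = y \<oplus>\<^bsub>N\<^esub> x" using a b by (simp add: add) (rule e; simp)
    show "c \<odot>\<^bsub>N\<^esub> (x \<oplus>\<^bsub>N\<^esub> y) = c \<odot>\<^bsub>N\<^esub> x \<oplus>\<^bsub>N\<^esub> c \<odot>\<^bsub>N\<^esub> y"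
      using a b by (simp add: add smult) (rule e; simp add: ps.scale_right_distrib)
    assume "z \<in> carrier N"
    then obtain c where c: "c \<in> carrier M" "z = f c" using surj by blast
    show "(x \<oplus>\<^bsub>N\<^esub> y) \<oplus>\<^bsub>N\<^esub> z = x \<oplus>\<^bsub>N\<^esub> (y \<oplus>\<^bsub>N\<^esub> z)" using a b c by (simp add: add) (rule e; simp)
  next
    show "\<zero>\<^bsub>N\<^esub> \<in> carrier N" using surj zero_in by (simp flip: zero)
  qed
qed

lemma image_lie_module:
  assumes closed: "struct_closed L" and "is_lie_module L M" and f: "f \<in> lie_hom L M N" and surj: "carrier N = f ` carrier M"
    and zero: "f \<zero>\<^bsub>M\<^esub> = \<zero>\<^bsub>N\<^esub>"
  shows "is_lie_module L N"
proof -
  interpret M: lie_mod L M by (rule lie_mod.intro) fact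
  interpret N: cmod N
    using M.cmod_axioms surj zero
    by (rule image_cmod) (simp_all add: lie_hom_add[OF f] lie_hom_smult[OF f])
  have minus: "f (a \<ominus>\<^bsub>M\<^esub> b) = f a \<ominus>\<^bsub>N\<^esub> f b" if "a \<in> carrier M" "b \<in> carrier M" for a b
  proof -
    have "a = (a \<ominus>\<^bsub>M\<^esub> b) \<oplus>\<^bsub>M\<^esub> b" using that by (intro M.crd_eqI) simp_all
    then have "f a = f (a \<ominus>\<^bsub>M\<^esub> b) \<oplus>\<^bsub>N\<^esub> f b" using lie_hom_add[OF f] that M.minus_in by metis
    then show ?thesis using that f by (intro N.crd_eqI) (simp_all add: lie_hom_closed)
  qed
  show ?thesis
  proof (rule is_lie_moduleI)
    show "cmod N" by (rule N.cmod_axioms)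
  next
    fix x y c m n assume "m \<in> carrier N"
    then obtain m' where m: "m = f m'" "m' \<in> carrier M" using surj by auto
    assume x: "x \<in> lie_carrier L"
    have act: "act N z (f k) = f (act M z k)" if "z \<in> lie_carrier L" "k \<in> carrier M" for z k
      using lie_hom_act[OF f that] by simp
    show "act N x m \<in> carrier N" using x m by (simp add: act lie_hom_closed[OF f])
    show "act N x (c \<odot>\<^bsub>N\<^esub> m) = c \<odot>\<^bsub>N\<^esub> act N x m"
      using x m by (simp add: act flip: lie_hom_smult[OF f])
    show "act N (lie_scale L c x) m = c \<odot>\<^bsub>N\<^esub> act N x m"
      using x m closed by (simp add: act struct_closed_def M.act_scale_left flip: lie_hom_smult[OF f])
    show "act N x (m \<oplus>\<^bsub>N\<^esub> n) = act N x m \<oplus>\<^bsub>N\<^esub> act N x n" if nN: "n \<in> carrier N"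
    proof -
      obtain n' where n: "n = f n'" "n' \<in> carrier M" using surj nN by auto
      show ?thesis using x m n by (simp add: act flip: lie_hom_add[OF f])
    qed
    assume y: "y \<in> lie_carrier L"
    show "act N (x + y) m = act N x m \<oplus>\<^bsub>N\<^esub> act N y m"
      using x y m closed by (simp add: act struct_closed_def M.act_add_left flip: lie_hom_add[OF f])
    show "act N (lie_bracket L x y) m = act N x (act N y m) \<ominus>\<^bsub>N\<^esub> act N y (act N x m)"
      using x y m closed by (simp add: act struct_closed_def M.act_bracket minus)
  qed
qed

lemma transport_simps:
  "carrier (transport f M) = f ` carrier M" "\<zero>\<^bsub>transport f M\<^esub> = f \<zero>\<^bsub>M\<^esub>"
  by (simp_all add: transport_def mk_rep_def Let_def)

lemma transport_hom:
  assumes "is_lie_module L M" "inj_on f (carrier M)"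
  shows "f \<in> lie_hom L M (transport f M)"
proof -
  interpret M: lie_mod L M by (rule lie_mod.intro) fact
  show ?thesis
    by (rule lie_homI) (auto simp: transport_def mk_rep_def Let_def inv_into_f_f[OF assms(2)])
qed

lemma transport_lie_module:
  assumes "struct_closed L" "is_lie_module L M" "inj_on f (carrier M)"
  shows "is_lie_module L (transport f M)"
  by (rule image_lie_module[OF assms(1,2) transport_hom[OF assms(2,3)]]) (simp_all add: transport_simps)


subsection \<open>Quotients\<close>


section \<open>Quotient modules\<close>

context cmod
begin

context
  fixes K
  assumes K: "submodule K complex_ring M"
begin

lemma coset_abelian_subgroup: "abelian_subgroup K M"
  using K by (intro abelian_subgroupI3 additive_subgroupI abelian_group) (simp add: submodule_def)

lemma coset_eq_iff:
  assumes "a \<in> carrier M" "b \<in> carrier M"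
  shows "K +> a = K +> b \<longleftrightarrow> a \<ominus> b \<in> K"
proof -
  interpret K: abelian_subgroup K M by (rule coset_abelian_subgroup)
  have self: "a \<in> K +> a" using assms(1) by (rule K.a_rcos_self)
  show ?thesis
  proof
    assume "K +> a = K +> b"
    then have "a \<in> K +> b" using self by simp
    then obtain h where h: "h \<in> K" "a = h \<oplus> b" by (auto simp: a_r_coset_def')
    have "a \<ominus> b = h" using h assms submodule_subset[OF K] by (intro crd_eqI) auto
    then show "a \<ominus> b \<in> K" using h by simp
  next
    assume ab: "a \<ominus> b \<in> K"
    have "a = (a \<ominus> b) \<oplus> b" using assms by (intro crd_eqI) auto
    then have "a \<in> K +> b" using ab by (auto simp: a_r_coset_def')
    then show "K +> a = K +> b"
      using K.a_repr_independence assms K.a_subgroup by metis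
  qed
qed

lemma coset_self: "a \<in> carrier M \<Longrightarrow> a \<in> K +> a"
  using abelian_subgroup.a_rcos_self[OF coset_abelian_subgroup] .

lemma coset_memD: "b \<in> K +> a \<Longrightarrow> a \<in> carrier M \<Longrightarrow> b \<in> carrier M \<and> K +> b = K +> a"
proof -
  assume b: "b \<in> K +> a" and a: "a \<in> carrier M"
  then obtain h where h: "h \<in> K" "b = h \<oplus> a" by (auto simp: a_r_coset_def')
  then have c: "b \<in> carrier M" using a submodule_subset[OF K] by simp
  have "b \<ominus> a = h" using h a c submodule_subset[OF K] by (intro crd_eqI) auto
  then show ?thesis using coset_eq_iff[OF c a] c h by simp
qed

lemma coset_zero: "K +> \<zero> = K"
  by (rule abelian_group.a_coset_add_zero[OF abelian_group]) (use K in \<open>simp add: submodule_iff\<close>)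

end
end

lemma quotient_rep_carrier: "carrier (quotient_rep M K) = (\<lambda>a. K +>\<^bsub>M\<^esub> a) ` carrier M"
  by (simp add: quotient_rep_def mk_rep_def a_rcosets_eq_image)

lemma quotient_rep_zero: "\<zero>\<^bsub>quotient_rep M K\<^esub> = K"
  by (simp add: quotient_rep_def mk_rep_def)

lemma quotient_rep_add:
  assumes "cmod M" "submodule K complex_ring M" "a \<in> carrier M" "b \<in> carrier M"
  shows "(K +>\<^bsub>M\<^esub> a) \<oplus>\<^bsub>quotient_rep M K\<^esub> (K +>\<^bsub>M\<^esub> b) = K +>\<^bsub>M\<^esub> (a \<oplus>\<^bsub>M\<^esub> b)"
  using abelian_subgroup.a_rcos_sum[OF cmod.coset_abelian_subgroup[OF assms(1,2)] assms(3,4)]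
  by (simp add: quotient_rep_def mk_rep_def)

lemma coset_union_const:
  assumes "cmod M" "submodule K complex_ring M" "a \<in> carrier M"
    and F: "\<And>b. b \<in> carrier M \<Longrightarrow> F b \<in> carrier M" and K: "\<And>k. k \<in> K \<Longrightarrow> F k \<in> K"
    and add: "\<And>a b. a \<in> carrier M \<Longrightarrow> b \<in> carrier M \<Longrightarrow> F (a \<oplus>\<^bsub>M\<^esub> b) = F a \<oplus>\<^bsub>M\<^esub> F b"
  shows "(\<Union>b\<in>K +>\<^bsub>M\<^esub> a. K +>\<^bsub>M\<^esub> F b) = K +>\<^bsub>M\<^esub> F a"
proof -
  interpret cmod M by fact
  have "K +>\<^bsub>M\<^esub> F b = K +>\<^bsub>M\<^esub> F a" if b: "b \<in> K +>\<^bsub>M\<^esub> a" for b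
  proof -
    obtain h where h: "h \<in> K" "b = h \<oplus>\<^bsub>M\<^esub> a" using b by (auto simp: a_r_coset_def')
    have hc: "h \<in> carrier M" using h submodule_subset[OF assms(2)] by simp
    have "F b \<ominus>\<^bsub>M\<^esub> F a = F h" using h hc assms(3) F by (intro crd_eqI) (simp_all add: add)
    then show ?thesis using coset_eq_iff[OF assms(2)] F K h hc assms(3) by simp
  qed
  then show ?thesis using coset_self[OF assms(2,3)] by blast
qed

lemma quotient_rep_smult:
  assumes "cmod M" "submodule K complex_ring M" "a \<in> carrier M"
  shows "c \<odot>\<^bsub>quotient_rep M K\<^esub> (K +>\<^bsub>M\<^esub> a) = K +>\<^bsub>M\<^esub> (c \<odot>\<^bsub>M\<^esub> a)"
proof -
  interpret cmod M by fact
  have "(\<Union>b\<in>K +>\<^bsub>M\<^esub> a. K +>\<^bsub>M\<^esub> (c \<odot>\<^bsub>M\<^esub> b)) = K +>\<^bsub>M\<^esub> (c \<odot>\<^bsub>M\<^esub> a)"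
    by (rule coset_union_const[OF assms])
      (use assms(2) in \<open>auto simp: submodule_smult ps.scale_right_distrib intro: crd_eqI\<close>)
  then show ?thesis by (simp add: quotient_rep_def mk_rep_def)
qed

lemma quotient_rep_act:
  assumes "cmod M" "submodule K complex_ring M" "a \<in> carrier M"
    and "\<And>b. b \<in> carrier M \<Longrightarrow> act M x b \<in> carrier M" and "\<And>k. k \<in> K \<Longrightarrow> act M x k \<in> K"
    and "\<And>a b. a \<in> carrier M \<Longrightarrow> b \<in> carrier M \<Longrightarrow> act M x (a \<oplus>\<^bsub>M\<^esub> b) = act M x a \<oplus>\<^bsub>M\<^esub> act M x b"
  shows "act (quotient_rep M K) x (K +>\<^bsub>M\<^esub> a) = K +>\<^bsub>M\<^esub> (act M x a)"
  using coset_union_const[OF assms] by (simp add: quotient_rep_def mk_rep_def)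

lemma quotient_rep_cmod:
  assumes "cmod M" "submodule K complex_ring M"
  shows "cmod (quotient_rep M K)"
  by (rule image_cmod[OF assms(1), of _ "\<lambda>a. K +>\<^bsub>M\<^esub> a"])
    (simp_all add: quotient_rep_carrier quotient_rep_zero cmod.coset_zero[OF assms]
       quotient_rep_add[OF assms] quotient_rep_smult[OF assms])

lemma quotient_map_hom:
  assumes "is_lie_module L M" "is_lie_submodule L M K"
  shows "(\<lambda>a. K +>\<^bsub>M\<^esub> a) \<in> lie_hom L M (quotient_rep M K)"
proof -
  interpret lie_mod L M by (rule lie_mod.intro) fact
  have K: "submodule K complex_ring M" and st: "\<And>x k. x \<in> lie_carrier L \<Longrightarrow> k \<in> K \<Longrightarrow> act M x k \<in> K"
    using assms(2) by (auto simp: is_lie_submodule_def)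
  show ?thesis
    by (rule lie_homI)
      (auto simp: quotient_rep_carrier quotient_rep_add[OF cmod_axioms K] quotient_rep_smult[OF cmod_axioms K]
         st quotient_rep_act[OF cmod_axioms K])
qed

lemma quotient_lie_module:
  assumes "struct_closed L" "is_lie_module L M" "is_lie_submodule L M K"
  shows "is_lie_module L (quotient_rep M K)"
proof -
  interpret lie_mod L M by (rule lie_mod.intro) fact
  have K: "submodule K complex_ring M" using assms(3) by (simp add: is_lie_submodule_def)
  show ?thesis
    by (rule image_lie_module[OF assms(1,2) quotient_map_hom[OF assms(2,3)]])
      (simp_all add: quotient_rep_carrier quotient_rep_zero coset_zero[OF K])
qed

text \<open>
  The submodules of the quotient are the images of the submodules between \<open>N\<close> and \<open>M\<close>.
\<close>

lemma quotient_irreducible: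
  assumes closed: "struct_closed L" and M: "is_lie_module L M" and max: "is_maximal_submodule L M N"
  shows "is_irreducible L (quotient_rep M N)"
proof -
  interpret lie_mod L M by (rule lie_mod.intro) fact
  let ?\<pi> = "\<lambda>a. N +>\<^bsub>M\<^esub> a" and ?Q = "quotient_rep M N"
  have N: "is_lie_submodule L M N" and proper: "N \<noteq> carrier M"
    using max by (auto simp: is_maximal_submodule_def)
  then have sub: "submodule N complex_ring M" by (simp add: is_lie_submodule_def)
  have Q: "is_lie_module L ?Q" by (rule quotient_lie_module[OF closed M N])
  interpret Q: lie_mod L ?Q by (rule lie_mod.intro) (rule Q)
  have in_N: "?\<pi> a = N \<longleftrightarrow> a \<in> N" if "a \<in> carrier M" for a
  proof -
    have "a \<ominus>\<^bsub>M\<^esub> \<zero>\<^bsub>M\<^esub> = a" using that by (intro crd_eqI) simp_all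
    then show ?thesis using coset_eq_iff[OF sub that zero_in] coset_zero[OF sub] by simp
  qed
  have "S = {N} \<or> S = carrier ?Q" if S: "is_lie_submodule L ?Q S" for S
  proof -
    let ?S = "{m \<in> carrier M. ?\<pi> m \<in> S}"
    have SQ: "S \<subseteq> carrier ?Q" "N \<in> S" using S by (auto simp: Q.is_lie_submodule_iff quotient_rep_zero)
    have "is_lie_submodule L M ?S"
      by (rule preimage_submodule[OF M Q quotient_map_hom[OF M N] S])
    moreover have "N \<subseteq> ?S"
    proof
      fix m assume m: "m \<in> N"
      then have "m \<in> carrier M" by (rule submodule_subset[OF sub])
      moreover from this m have "?\<pi> m = N" using in_N by blast
      ultimately show "m \<in> ?S" using SQ(2) by simp
    qed
    ultimately have "?S = carrier M \<or> ?S = N" using max unfolding is_maximal_submodule_def by blast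
    then show ?thesis
    proof
      assume "?S = carrier M"
      then have "carrier ?Q \<subseteq> S" by (auto simp: quotient_rep_carrier)
      then show ?thesis using SQ by blast
    next
      assume "?S = N"
      then have "s = N" if "s \<in> S" for s
        using that SQ(1) in_N by (auto simp: quotient_rep_carrier)
      then show ?thesis using SQ by blast
    qed
  qed
  moreover have "carrier ?Q \<noteq> {N}"
    using proper in_N submodule_subset[OF sub] by (auto simp: quotient_rep_carrier)
  ultimately show ?thesis by (simp add: is_irreducible_def Q quotient_rep_zero)
qed

lemma irreducible_isomorphic:
  assumes "is_irreducible L M" "is_lie_module L N" "lie_isomorphic L M N"
  shows "is_irreducible L N"
proof -
  have M: "is_lie_module L M" using assms(1) by (simp add: is_irreducible_def)
  interpret M: lie_mod L M by (rule lie_mod.intro) (rule M)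
  interpret N: lie_mod L N by (rule lie_mod.intro) fact
  obtain f g where fg: "f \<in> lie_hom L M N" "g \<in> lie_hom L N M"
    "\<And>m. m \<in> carrier M \<Longrightarrow> g (f m) = m" "\<And>n. n \<in> carrier N \<Longrightarrow> f (g n) = n"
    using lie_isomorphicE[OF M assms(3)] by metis
  note z = lie_hom_zero[OF M assms(2) fg(1)]
  have "S = {\<zero>\<^bsub>N\<^esub>} \<or> S = carrier N" if S: "is_lie_submodule L N S" for S
  proof -
    let ?S = "{m \<in> carrier M. f m \<in> S}"
    have SN: "S \<subseteq> carrier N" "\<zero>\<^bsub>N\<^esub> \<in> S" using S by (auto simp: N.is_lie_submodule_iff)
    have eq: "S = f ` ?S"
      using SN fg(4) lie_hom_closed[OF fg(2)] by (auto simp: image_iff) (metis subsetD)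
    have "?S = {\<zero>\<^bsub>M\<^esub>} \<or> ?S = carrier M"
      using preimage_submodule[OF M assms(2) fg(1) S] assms(1) by (simp add: is_irreducible_def)
    then show ?thesis
    proof
      assume "?S = {\<zero>\<^bsub>M\<^esub>}"
      then show ?thesis using eq z by simp
    next
      assume c: "?S = carrier M"
      have "n \<in> S" if "n \<in> carrier N" for n
        using c fg(4)[OF that] lie_hom_closed[OF fg(2) that] by force
      then show ?thesis using SN by blast
    qed
  qed
  moreover have "carrier N \<noteq> {\<zero>\<^bsub>N\<^esub>}"
  proof
    assume c: "carrier N = {\<zero>\<^bsub>N\<^esub>}"
    have "m = \<zero>\<^bsub>M\<^esub>" if "m \<in> carrier M" for m
      using fg(3)[OF that] fg(3)[OF M.zero_in] lie_hom_closed[OF fg(1) that] c z by simp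
    then show False using assms(1) M.zero_in unfolding is_irreducible_def by blast
  qed
  ultimately show ?thesis using assms(2) by (simp add: is_irreducible_def)
qed


section \<open>Enveloping algebras and induced modules\<close>

lemma keys_mult_lists:
  assumes "Poly_Mapping.keys f \<subseteq> lists S" "Poly_Mapping.keys g \<subseteq> lists S"
  shows "Poly_Mapping.keys (f * g) \<subseteq> lists S"
proof
  fix w assume "w \<in> Poly_Mapping.keys (f * g)"
  then obtain a b where "a \<in> Poly_Mapping.keys f" "b \<in> Poly_Mapping.keys g" "w = a + b"
    using Poly_Mapping.keys_mult[of f g] by blast
  then show "w \<in> lists S" using assms by (auto simp: plus_list_def)
qed

lemma keys_add_subset: "Poly_Mapping.keys f \<subseteq> A \<Longrightarrow> Poly_Mapping.keys g \<subseteq> A \<Longrightarrow> Poly_Mapping.keys (f + g) \<subseteq> A"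
  using Poly_Mapping.keys_add[of f g] by blast

lemma keys_diff_subset:
  fixes f g :: "'b \<Rightarrow>\<^sub>0 'c::cancel_comm_monoid_add"
  shows "Poly_Mapping.keys f \<subseteq> A \<Longrightarrow> Poly_Mapping.keys g \<subseteq> A \<Longrightarrow> Poly_Mapping.keys (f - g) \<subseteq> A"
  by (auto simp: in_keys_iff lookup_minus subset_iff) (metis diff_zero)

lemma free_alg_simps [simp]:
  "carrier (free_alg S) = {f. Poly_Mapping.keys f \<subseteq> lists S}" "f \<otimes>\<^bsub>free_alg S\<^esub> g = f * g"
  "\<one>\<^bsub>free_alg S\<^esub> = 1" "\<zero>\<^bsub>free_alg S\<^esub> = 0" "f \<oplus>\<^bsub>free_alg S\<^esub> g = f + g"
  by (simp_all add: free_alg_def)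

lemma one_poly_list: "(1 :: 'x list \<Rightarrow>\<^sub>0 complex) = Poly_Mapping.single [] 1"
  by (simp add: single_one[symmetric] zero_list_def del: single_one)

lemma ring_free_alg: "ring (free_alg S)"
proof (rule ringI)
  show "abelian_group (free_alg S)"
  proof (rule abelian_groupI)
    fix f assume "f \<in> carrier (free_alg S)"
    then show "\<exists>g\<in>carrier (free_alg S). g \<oplus>\<^bsub>free_alg S\<^esub> f = \<zero>\<^bsub>free_alg S\<^esub>"
      by (intro bexI[of _ "- f"]) (auto simp: in_keys_iff subset_iff)
  qed (simp_all add: keys_add_subset algebra_simps)
  show "Group.monoid (free_alg S)"
    by (rule monoidI) (simp_all add: keys_mult_lists zero_list_def mult.assoc)
qed (simp_all add: algebra_simps)

lemma mult_single_list: "Poly_Mapping.single u (c::complex) * Poly_Mapping.single v d = Poly_Mapping.single (u @ v) (c * d)"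
  by (simp add: mult_single plus_list_def)

text \<open>Scalars in the free algebra are words of length zero, and they are central.\<close>

lemma const_mult: "const c * f = psc c f"
  and const_commute: "const c * f = f * const c"
proof -
  have "Poly_Mapping.keys f \<subseteq> UNIV" by simp
  then have "const c * f = psc c f \<and> const c * f = f * const c"
  proof (induction f rule: poly_mapping_additive_induct)
    case zero
    show ?case by simp
  next
    case (single w d)
    show ?case by (simp add: const_def mult_single_list mult.commute)
  next
    case (add f g)
    then show ?case by (metis distrib_left distrib_right ps.scale_right_distrib)
  qed
  then show "const c * f = psc c f" "const c * f = f * const c" by blast+
qed

lemma const_keys [simp]: "Poly_Mapping.keys (const c) \<subseteq> lists S"
  by (simp add: const_def)

lemma letter_keys: "x \<in> S \<Longrightarrow> Poly_Mapping.keys (letter x) \<subseteq> lists S"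
  by (simp add: letter_def)

abbreviation words :: "'x::ab_group_add lie_struct \<Rightarrow> ('x list \<Rightarrow>\<^sub>0 complex) set" where
  "words L \<equiv> {f. Poly_Mapping.keys f \<subseteq> lists (lie_carrier L)}"

locale closed_struct =
  fixes L :: "'x::ab_group_add lie_struct"
  assumes closed: "struct_closed L"
begin

lemma closed_simps [simp]:
  "x \<in> lie_carrier L \<Longrightarrow> y \<in> lie_carrier L \<Longrightarrow> x + y \<in> lie_carrier L"
  "x \<in> lie_carrier L \<Longrightarrow> y \<in> lie_carrier L \<Longrightarrow> lie_bracket L x y \<in> lie_carrier L"
  "x \<in> lie_carrier L \<Longrightarrow> lie_scale L c x \<in> lie_carrier L"
  using closed by (auto simp: struct_closed_def)

sublocale F: ring "free_alg (lie_carrier L)"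
  by (rule ring_free_alg)

lemma relations_subset: "uea_relations L \<subseteq> words L"
proof
  fix r assume "r \<in> uea_relations L"
  then have "Poly_Mapping.keys r \<subseteq> lists (lie_carrier L)"
    unfolding uea_relations_def
    by (elim UnE CollectE exE conjE)
      (simp_all add: keys_diff_subset keys_mult_lists letter_keys)
  then show "r \<in> words L" by simp
qed

lemma ideal: "ideal (uea_ideal L) (free_alg (lie_carrier L))"
  unfolding uea_ideal_def by (rule F.genideal_ideal) (use relations_subset in simp)

lemma relations_ideal: "uea_relations L \<subseteq> uea_ideal L"
  unfolding uea_ideal_def by (rule F.genideal_self) (use relations_subset in simp)

lemma ideal_minimal:
  assumes "ideal I (free_alg (lie_carrier L))" "uea_relations L \<subseteq> I"
  shows "uea_ideal L \<subseteq> I"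
  unfolding uea_ideal_def by (rule F.genideal_minimal) fact+

sublocale I: ideal "uea_ideal L" "free_alg (lie_carrier L)"
  by (rule ideal)

lemma ideal_minus:
  assumes "i \<in> uea_ideal L" shows "- i \<in> uea_ideal L"
proof -
  have "const (- 1) * i \<in> uea_ideal L"
    using I.I_l_closed[OF assms, of "const (- 1)"] by simp
  then show ?thesis by (simp add: const_mult ps.scale_minus_left)
qed

lemma uea_class_eq: "f - g \<in> uea_ideal L \<Longrightarrow> uea_class L f = uea_class L g"
proof -
  have 1: "{h. \<exists>i\<in>uea_ideal L. h = i + f} \<subseteq> {h. \<exists>i\<in>uea_ideal L. h = i + g}"
    if "f - g \<in> uea_ideal L" for f g
  proof
    fix h assume "h \<in> {h. \<exists>i\<in>uea_ideal L. h = i + f}"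
    then obtain i where "i \<in> uea_ideal L" "h = i + f" by blast
    then have "i + (f - g) \<in> uea_ideal L" "h = (i + (f - g)) + g"
      using I.a_closed[of i "f - g"] that by simp_all
    then show "h \<in> {h. \<exists>i\<in>uea_ideal L. h = i + g}" by blast
  qed
  assume fg: "f - g \<in> uea_ideal L"
  then have "g - f \<in> uea_ideal L" using ideal_minus by fastforce
  then show ?thesis
    using 1[OF fg] 1[of g f] by (auto simp: uea_class_def a_r_coset_def')
qed

lemma uea_class_representative: "f' \<in> uea_class L f \<Longrightarrow> f' - f \<in> uea_ideal L"
  by (auto simp: uea_class_def a_r_coset_def')

lemma some_representative: "(SOME f'. f' \<in> uea_class L f) - f \<in> uea_ideal L"
proof -
  have "0 + f \<in> uea_class L f"
    unfolding uea_class_def a_r_coset_def' free_alg_simps using I.zero_closed by force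
  then have "(SOME f'. f' \<in> uea_class L f) \<in> uea_class L f" by (rule someI)
  then show ?thesis by (rule uea_class_representative)
qed

lemma ideal_subset: "i \<in> uea_ideal L \<Longrightarrow> i \<in> words L"
  using I.a_subset by auto

lemma uea_carrier: "carrier (uea L) = uea_class L ` words L"
  by (auto simp: uea_def FactRing_def a_rcosets_eq_image uea_class_def Let_def)

lemma uea_mult: "f \<in> words L \<Longrightarrow> g \<in> words L \<Longrightarrow> uea_class L f \<otimes>\<^bsub>uea L\<^esub> uea_class L g = uea_class L (f * g)"
  using I.rcoset_mult_add[of f g] by (simp add: uea_def FactRing_def uea_class_def Let_def)

lemma uea_add: "f \<in> words L \<Longrightarrow> g \<in> words L \<Longrightarrow> uea_class L f \<oplus>\<^bsub>uea L\<^esub> uea_class L g = uea_class L (f + g)"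
  using I.a_rcos_sum[of f g] by (simp add: uea_def FactRing_def uea_class_def Let_def)

lemma uea_smult: "f \<in> words L \<Longrightarrow> c \<odot>\<^bsub>uea L\<^esub> uea_class L f = uea_class L (const c * f)"
  using uea_mult[of "const c" f] by (simp add: uea_def Let_def)

end

text \<open>The action of the free algebra on a module.\<close>

definition ev :: "('x, 'm) lie_rep \<Rightarrow> ('x list \<Rightarrow>\<^sub>0 complex) \<Rightarrow> 'm \<Rightarrow> 'm" where
  "ev M f m = finsum M (\<lambda>w. Poly_Mapping.lookup f w \<odot>\<^bsub>M\<^esub> foldr (act M) w m) (Poly_Mapping.keys f)"

lemma uea_act_eq: "uea_act M s m = ev M (SOME f. f \<in> s) m"
  by (simp add: uea_act_def ev_def Let_def)

context lie_mod
begin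

lemma word_in [simp]: "w \<in> lists (lie_carrier L) \<Longrightarrow> m \<in> carrier M \<Longrightarrow> foldr (act M) w m \<in> carrier M"
  by (induction w) auto

lemma word_add: "w \<in> lists (lie_carrier L) \<Longrightarrow> m \<in> carrier M \<Longrightarrow> n \<in> carrier M \<Longrightarrow>
    foldr (act M) w (m \<oplus> n) = foldr (act M) w m \<oplus> foldr (act M) w n"
  by (induction w) auto

lemma word_smult: "w \<in> lists (lie_carrier L) \<Longrightarrow> m \<in> carrier M \<Longrightarrow>
    foldr (act M) w (c \<odot> m) = c \<odot> foldr (act M) w m"
  by (induction w) auto

lemma ev_facts:
  assumes "f \<in> words L" "m \<in> carrier M"
  shows "ev M f m \<in> carrier M \<and> crd M (ev M f m) = lext (\<lambda>w. crd M (foldr (act M) w m)) f"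
proof -
  have w: "foldr (act M) w m \<in> carrier M" if "w \<in> Poly_Mapping.keys f" for w
    using assms word_in[OF _ assms(2), of w] that by blast
  show ?thesis
    using crd_finsum[of "Poly_Mapping.keys f" "\<lambda>w. Poly_Mapping.lookup f w \<odot> foldr (act M) w m"] w
    by (simp add: ev_def lext_def)
qed

lemma ev_in [simp]: "f \<in> words L \<Longrightarrow> m \<in> carrier M \<Longrightarrow> ev M f m \<in> carrier M"
  and crd_ev: "f \<in> words L \<Longrightarrow> m \<in> carrier M \<Longrightarrow> crd M (ev M f m) = lext (\<lambda>w. crd M (foldr (act M) w m)) f"
  using ev_facts by blast+

lemma ev_add: "f \<in> words L \<Longrightarrow> g \<in> words L \<Longrightarrow> m \<in> carrier M \<Longrightarrow> ev M (f + g) m = ev M f m \<oplus> ev M g m"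
  by (rule crd_eqI) (simp_all add: crd_ev lext_add keys_add_subset del: mem_Collect_eq add: mem_Collect_eq)

lemma ev_zero: "m \<in> carrier M \<Longrightarrow> ev M 0 m = \<zero>"
  by (rule crd_eqI) (simp_all add: crd_ev)

lemma ev_single: "w \<in> lists (lie_carrier L) \<Longrightarrow> m \<in> carrier M \<Longrightarrow> ev M (Poly_Mapping.single w c) m = c \<odot> foldr (act M) w m"
  by (rule crd_eqI) (simp_all add: crd_ev)

lemma ev_const_mult: "f \<in> words L \<Longrightarrow> m \<in> carrier M \<Longrightarrow> ev M (const c * f) m = c \<odot> ev M f m"
  using keys_mult_lists[of "const c" "lie_carrier L" f]
  by (intro crd_eqI) (simp_all add: crd_ev lext_psc const_mult)

lemma ev_diff: "f \<in> words L \<Longrightarrow> g \<in> words L \<Longrightarrow> m \<in> carrier M \<Longrightarrow> ev M (f - g) m = ev M f m \<ominus> ev M g m"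
  using keys_diff_subset[of f "lists (lie_carrier L)" g]
  by (intro crd_eqI) (simp_all add: crd_ev lext_diff)

lemma ev_add_right:
  assumes "f \<in> words L" "m \<in> carrier M" "n \<in> carrier M"
  shows "ev M f (m \<oplus> n) = ev M f m \<oplus> ev M f n"
proof -
  have "Poly_Mapping.keys f \<subseteq> lists (lie_carrier L)" using assms(1) by simp
  then show ?thesis
  proof (induction rule: poly_mapping_additive_induct)
    case zero
    show ?case using assms by (intro crd_eqI) (simp_all add: ev_zero)
  next
    case (single w c)
    show ?case using assms single by (intro crd_eqI) (simp_all add: ev_single word_add ps.scale_right_distrib del: lists_eq_set)
  next
    case (add f g)
    then show ?case using assms by (intro crd_eqI) (simp_all add: ev_add keys_add_subset)
  qed
qed

lemma ev_smult_right:
  assumes "f \<in> words L" "m \<in> carrier M"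
  shows "ev M f (c \<odot> m) = c \<odot> ev M f m"
proof -
  have "Poly_Mapping.keys f \<subseteq> lists (lie_carrier L)" using assms(1) by simp
  then show ?thesis
  proof (induction rule: poly_mapping_additive_induct)
    case zero
    show ?case using assms by (intro crd_eqI) (simp_all add: ev_zero)
  next
    case (single w d)
    show ?case using assms single by (intro crd_eqI) (simp_all add: ev_single word_smult mult.commute del: lists_eq_set)
  next
    case (add f g)
    then show ?case using assms by (intro crd_eqI) (simp_all add: ev_add keys_add_subset ps.scale_right_distrib)
  qed
qed

lemma ev_right_zero:
  assumes "f \<in> words L"
  shows "ev M f \<zero> = \<zero>"
proof -
  have "\<zero> = 0 \<odot> \<zero>" by (rule crd_eqI) simp_all
  then have "ev M f \<zero> = 0 \<odot> ev M f \<zero>" using ev_smult_right[OF assms zero_in, of 0] by simp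
  then have "crd M (ev M f \<zero>) = crd M (0 \<odot> ev M f \<zero>)" by (rule arg_cong)
  then show ?thesis using assms by (intro crd_eqI) simp_all
qed

lemma ev_mult:
  assumes "f \<in> words L" "g \<in> words L" "m \<in> carrier M"
  shows "ev M (f * g) m = ev M f (ev M g m)"
proof -
  have f: "Poly_Mapping.keys f \<subseteq> lists (lie_carrier L)" and g: "Poly_Mapping.keys g \<subseteq> lists (lie_carrier L)"
    using assms by simp_all
  note km = keys_mult_lists[of _ "lie_carrier L"]
  have mult_word: "ev M (Poly_Mapping.single u c * g) m = ev M (Poly_Mapping.single u c) (ev M g m)"
    if u: "u \<in> lists (lie_carrier L)" for u c
    using g
  proof (induction rule: poly_mapping_additive_induct)
    case zero
    have "Poly_Mapping.single u c \<in> words L" using u by auto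
    then show ?case using assms by (simp add: ev_zero ev_right_zero)
  next
    case (single v d)
    show ?case using assms u single
      by (intro crd_eqI) (simp_all add: mult_single_list ev_single word_smult del: lists_eq_set)
  next
    case (add g h)
    then show ?case using assms u
      by (simp add: algebra_simps ev_add ev_add_right km del: lists_eq_set)
  qed
  show ?thesis
    using f
  proof (induction rule: poly_mapping_additive_induct)
    case zero
    show ?case using assms by (simp add: ev_zero)
  next
    case (single w c)
    then show ?case by (rule mult_word)
  next
    case (add f h)
    then show ?case using assms
      by (simp add: algebra_simps ev_add km)
  qed
qed

end

lemma ev_hom:
  assumes "is_lie_module L M" "is_lie_module L N" "h \<in> lie_hom L M N" "f \<in> words L" "m \<in> carrier M"
  shows "h (ev M f m) = ev N f (h m)"
proof -
  interpret M: lie_mod L M by (rule lie_mod.intro) fact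
  interpret N: lie_mod L N by (rule lie_mod.intro) fact
  have word: "h (foldr (act M) w m) = foldr (act N) w (h m)" if "w \<in> lists (lie_carrier L)" for w
    using that assms(5) by (induction w) (auto simp: lie_hom_act[OF assms(3)])
  have hm: "h m \<in> carrier N" using assms(3,5) by (rule lie_hom_closed)
  have "Poly_Mapping.keys f \<subseteq> lists (lie_carrier L)" using assms(4) by simp
  then show ?thesis
  proof (induction rule: poly_mapping_additive_induct)
    case zero
    show ?case using assms(5) hm by (simp add: M.ev_zero N.ev_zero lie_hom_zero[OF assms(1-3)])
  next
    case (single w d)
    then show ?case using assms(5) hm
      by (simp add: M.ev_single N.ev_single lie_hom_smult[OF assms(3)] word del: lists_eq_set)
  next
    case (add f g)
    then show ?case using assms(5) hm by (simp add: M.ev_add N.ev_add lie_hom_add[OF assms(3)])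
  qed
qed

locale uea_mod = closed_struct L + lie_mod L M
  for L :: "'x::ab_group_add lie_struct" and M :: "('x, 'm) lie_rep" (structure)
begin

text \<open>
  The elements of the free algebra that annihilate a Lie module form an ideal, and it contains the
  defining relations of the enveloping algebra by the module axioms.
\<close>

lemma ev_ideal:
  assumes "i \<in> uea_ideal L" "m \<in> carrier M"
  shows "ev M i m = \<zero>"
proof -
  \<comment> \<open>Quantifying over all vectors makes the annihilator a two-sided ideal.\<close>
  let ?J = "{f \<in> words L. \<forall>m\<in>carrier M. ev M f m = \<zero>}"
  have zz: "\<zero> \<oplus> \<zero> = \<zero>" by (rule crd_eqI) simp_all
  have "ideal ?J (free_alg (lie_carrier L))"
  proof (rule idealI)
    show "ring (free_alg (lie_carrier L))" by (rule ring_free_alg)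
    show "subgroup ?J (add_monoid (free_alg (lie_carrier L)))"
    proof (rule group.subgroupI)
      show "group (add_monoid (free_alg (lie_carrier L)))" by (rule F.a_group)
      show "?J \<subseteq> carrier (add_monoid (free_alg (lie_carrier L)))" by auto
      show "?J \<noteq> {}" by (auto simp: ev_zero intro!: exI[of _ 0])
      show "a \<otimes>\<^bsub>add_monoid (free_alg (lie_carrier L))\<^esub> b \<in> ?J" if "a \<in> ?J" "b \<in> ?J" for a b
        using that by (simp add: ev_add keys_add_subset zz)
      fix a assume a: "a \<in> ?J"
      have "inv\<^bsub>add_monoid (free_alg (lie_carrier L))\<^esub> a = - a"
        by (rule group.inv_equality[OF F.a_group]) (use a in \<open>auto simp: in_keys_iff subset_iff\<close>)
      moreover have "- a = const (- 1) * a" by (simp add: const_mult ps.scale_minus_left)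
      moreover have "const (- 1) * a \<in> ?J"
        using a keys_mult_lists[of "const (- 1)" "lie_carrier L" a] by (auto simp: ev_const_mult intro!: crd_eqI)
      ultimately show "inv\<^bsub>add_monoid (free_alg (lie_carrier L))\<^esub> a \<in> ?J" by simp
    qed
    show "x \<otimes>\<^bsub>free_alg (lie_carrier L)\<^esub> a \<in> ?J" "a \<otimes>\<^bsub>free_alg (lie_carrier L)\<^esub> x \<in> ?J"
      if "a \<in> ?J" "x \<in> carrier (free_alg (lie_carrier L))" for a x
      using that by (simp_all add: keys_mult_lists ev_mult ev_right_zero)
  qed
  moreover have "uea_relations L \<subseteq> ?J"
  proof
    fix r assume r: "r \<in> uea_relations L"
    have l: "letter x \<in> words L" "letter x * letter y \<in> words L" "const c * letter x \<in> words L"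
      if "x \<in> lie_carrier L" "y \<in> lie_carrier L" for x y c
      using that by (simp_all add: letter_keys keys_mult_lists)
    have evl: "ev M (letter x) m = act M x m" if "x \<in> lie_carrier L" "m \<in> carrier M" for x m
      using that ev_single[of "[x]" m 1] by (simp add: letter_def) (rule crd_eqI; simp)
    have "r \<in> words L" using r relations_subset by blast
    moreover have "ev M r m = \<zero>" if m: "m \<in> carrier M" for m
      using r unfolding uea_relations_def
    proof (elim UnE CollectE exE conjE)
      fix x y assume xy: "r = letter (x + y) - letter x - letter y" "x \<in> lie_carrier L" "y \<in> lie_carrier L"
      note ll = l[OF xy(2,3)] l[OF xy(3,2)] l[OF closed_simps(1)[OF xy(2,3)] xy(2)]
      have "letter (x + y) - letter x \<in> words L" using ll keys_diff_subset[of "letter (x+y)"] by simp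
      then show ?thesis using m xy ll
        by (intro crd_eqI) (simp_all add: ev_diff evl act_add_left keys_diff_subset)
    next
      fix c x assume x: "r = letter (lie_scale L c x) - const c * letter x" "x \<in> lie_carrier L"
      note ll = l[OF x(2,2)] l[OF closed_simps(3)[OF x(2)] x(2)]
      show ?thesis using m x ll
        by (intro crd_eqI) (simp_all add: ev_diff ev_const_mult evl act_scale_left keys_diff_subset)
    next
      fix x y assume xy: "r = letter x * letter y - letter y * letter x - letter (lie_bracket L x y)"
        "x \<in> lie_carrier L" "y \<in> lie_carrier L"
      note ll = l[OF xy(2,3)] l[OF xy(3,2)] l[OF closed_simps(2)[OF xy(2,3)] xy(2)]
      have "letter x * letter y - letter y * letter x \<in> words L" using ll keys_diff_subset[of "letter x * letter y"] by simp
      then show ?thesis using m xy ll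
        by (intro crd_eqI) (simp_all add: ev_diff ev_mult evl act_bracket keys_diff_subset)
    qed
    ultimately show "r \<in> ?J" by simp
  qed
  ultimately have "uea_ideal L \<subseteq> ?J" by (rule ideal_minimal)
  then show ?thesis using assms by blast
qed

text \<open>
  The action of the enveloping algebra is computed on a chosen representative; by \<open>ev_ideal\<close> any
  representative gives the same result.
\<close>

lemma uea_act_class: "f \<in> words L \<Longrightarrow> m \<in> carrier M \<Longrightarrow> uea_act M (uea_class L f) m = ev M f m"
proof -
  assume f: "f \<in> words L" and m: "m \<in> carrier M"
  define f' where "f' = (SOME f'. f' \<in> uea_class L f)"
  have i: "f' - f \<in> uea_ideal L" unfolding f'_def by (rule some_representative)
  have "ev M ((f' - f) + f) m = \<zero> \<oplus> ev M f m"
    using ideal_subset[OF i] f m ev_ideal[OF i m] by (subst ev_add) auto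
  also have "\<dots> = ev M f m" using f m by (intro crd_eqI) simp_all
  finally show ?thesis by (simp add: uea_act_eq f'_def)
qed

end


subsection \<open>Induced modules\<close>

lemma free_module_simps:
  "carrier (free_module B) = {f. Poly_Mapping.keys f \<subseteq> B}" "\<zero>\<^bsub>free_module B\<^esub> = 0"
  "f \<oplus>\<^bsub>free_module B\<^esub> g = f + g" "c \<odot>\<^bsub>free_module B\<^esub> f = psc c f"
  by (simp_all add: free_module_def psc_def)

lemma keys_psc_subset: "Poly_Mapping.keys f \<subseteq> A \<Longrightarrow> Poly_Mapping.keys (psc c f) \<subseteq> A"
  by (rule order_trans[OF keys_psc])

lemma cmod_free_module: "cmod (free_module B)"
  by (rule cmodI) (simp_all add: free_module_simps keys_add_subset keys_psc_subset ps.scale_left_distrib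
      ps.scale_right_distrib algebra_simps)

lemma pairs_rep_simps:
  "carrier (pairs_rep L M) = {f. Poly_Mapping.keys f \<subseteq> carrier (uea L) \<times> carrier M}"
  "\<zero>\<^bsub>pairs_rep L M\<^esub> = 0" "f \<oplus>\<^bsub>pairs_rep L M\<^esub> g = f + g" "c \<odot>\<^bsub>pairs_rep L M\<^esub> f = psc c f"
  by (simp_all add: pairs_rep_def mk_rep_def Let_def free_module_simps)

lemma pairs_rep_act:
  "act (pairs_rep L M) x = lext (\<lambda>(u, m). Poly_Mapping.single (uea_class L (letter x) \<otimes>\<^bsub>uea L\<^esub> u, m) 1)"
  by (auto simp: pairs_rep_def mk_rep_def Let_def lext_def fun_eq_iff intro!: sum.cong split: prod.splits)

lemma cmod_pairs_rep: "cmod (pairs_rep L M)"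
  by (rule cmodI) (simp_all add: pairs_rep_simps keys_add_subset keys_psc_subset ps.scale_left_distrib
      ps.scale_right_distrib algebra_simps)

text \<open>
  Here \<open>U(L) \<otimes> M\<close>, over \<open>U(P)\<close>, is the quotient \<open>Ind\<close> of the free vector space on pairs by the subspace
  \<open>ker\<close>, which is spanned by \<open>gens\<close>; the class of a pair is the pure tensor \<open>tens u m\<close>.
\<close>

locale induction =
  L: closed_struct L + P: uea_mod P M
  for L P :: "'x::ab_group_add lie_struct" and M :: "('x, 'm) lie_rep" +
  assumes sub: "substruct P L"
begin

abbreviation "U \<equiv> carrier (uea L)"

abbreviation "e u m \<equiv> Poly_Mapping.single (u, m) (1::complex)"

abbreviation "cls \<equiv> uea_class L"

abbreviation (input) "lett x \<equiv> uea_class L (letter x)"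

definition ker :: "(('x list \<Rightarrow>\<^sub>0 complex) set \<times> 'm \<Rightarrow>\<^sub>0 complex) set" where
  "ker = tensor_kernel (carrier (uea P)) (uea L) (\<lambda>u s. u \<otimes>\<^bsub>uea L\<^esub> uea_map L s) M (uea_act M)"

abbreviation "Ind \<equiv> induced L P M"

lemma Ind_eq: "Ind = quotient_rep (pairs_rep L M) ker"
  by (simp add: induced_def ker_def)

lemma sub_words: "f \<in> words P \<Longrightarrow> f \<in> words L"
  using sub by (auto simp: substruct_def)

lemma uea_ideal_mono: "uea_ideal P \<subseteq> uea_ideal L"
proof -
  let ?J = "uea_ideal L \<inter> words P"
  have "ideal ?J (free_alg (lie_carrier P))"
  proof (rule idealI)
    show "ring (free_alg (lie_carrier P))" by (rule ring_free_alg)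
    show "subgroup ?J (add_monoid (free_alg (lie_carrier P)))"
    proof (rule group.subgroupI)
      show "group (add_monoid (free_alg (lie_carrier P)))" by (rule P.F.a_group)
      show "?J \<subseteq> carrier (add_monoid (free_alg (lie_carrier P)))" by auto
      show "?J \<noteq> {}" using L.I.zero_closed by (auto intro!: exI[of _ 0])
      show "a \<otimes>\<^bsub>add_monoid (free_alg (lie_carrier P))\<^esub> b \<in> ?J" if "a \<in> ?J" "b \<in> ?J" for a b
        using that L.I.a_closed[of a b] by (simp add: keys_add_subset)
      fix a assume a: "a \<in> ?J"
      have "inv\<^bsub>add_monoid (free_alg (lie_carrier P))\<^esub> a = - a"
        by (rule group.inv_equality[OF P.F.a_group]) (use a in \<open>auto simp: in_keys_iff subset_iff\<close>)
      then show "inv\<^bsub>add_monoid (free_alg (lie_carrier P))\<^esub> a \<in> ?J"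
        using a L.ideal_minus[of a] by (auto simp: in_keys_iff subset_iff)
    qed
    show "x \<otimes>\<^bsub>free_alg (lie_carrier P)\<^esub> a \<in> ?J" "a \<otimes>\<^bsub>free_alg (lie_carrier P)\<^esub> x \<in> ?J"
      if "a \<in> ?J" "x \<in> carrier (free_alg (lie_carrier P))" for a x
      using that sub_words[of x] L.I.I_l_closed[of a x] L.I.I_r_closed[of a x] by (simp_all add: keys_mult_lists)
  qed
  moreover have "uea_relations P \<subseteq> uea_relations L"
  proof -
    have "lie_scale P = lie_scale L" "lie_bracket P = lie_bracket L" "lie_carrier P \<subseteq> lie_carrier L"
      using sub by (auto simp: substruct_def)
    then show ?thesis unfolding uea_relations_def by (intro Un_mono) (simp_all, blast+)
  qed
  then have "uea_relations P \<subseteq> ?J" using L.relations_ideal P.relations_subset by blast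
  ultimately show ?thesis using P.ideal_minimal by blast
qed

lemma uea_map_class: "f \<in> words P \<Longrightarrow> uea_map L (uea_class P f) = cls f"
  unfolding uea_map_def by (rule L.uea_class_eq) (use P.some_representative uea_ideal_mono in blast)

lemma letter_words [simp]: "x \<in> lie_carrier L \<Longrightarrow> letter x \<in> words L"
  by (simp add: letter_keys)

lemma words_mult [simp]: "f \<in> words L \<Longrightarrow> g \<in> words L \<Longrightarrow> f * g \<in> words L"
  by (simp add: keys_mult_lists)

lemma words_add: "f \<in> words L \<Longrightarrow> g \<in> words L \<Longrightarrow> f + g \<in> words L"
  by (simp add: keys_add_subset)

lemma const_words [simp]: "const c \<in> words L"
  by simp

lemma cls_in: "f \<in> words L \<Longrightarrow> cls f \<in> U"
  by (auto simp: L.uea_carrier)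

lemma U_cases: "u \<in> U \<Longrightarrow> (\<And>f. f \<in> words L \<Longrightarrow> u = cls f \<Longrightarrow> thesis) \<Longrightarrow> thesis"
  by (auto simp: L.uea_carrier)

lemma U_mult: "u \<in> U \<Longrightarrow> v \<in> U \<Longrightarrow> u \<otimes>\<^bsub>uea L\<^esub> v \<in> U"
  by (elim U_cases) (simp add: L.uea_mult cls_in del: mem_Collect_eq)

lemma U_add: "u \<in> U \<Longrightarrow> v \<in> U \<Longrightarrow> u \<oplus>\<^bsub>uea L\<^esub> v \<in> U"
  by (elim U_cases) (simp add: L.uea_add cls_in words_add del: mem_Collect_eq)

lemma U_smult: "u \<in> U \<Longrightarrow> c \<odot>\<^bsub>uea L\<^esub> u \<in> U"
  by (elim U_cases) (simp add: L.uea_smult cls_in del: mem_Collect_eq)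

lemma U_assoc: "u \<in> U \<Longrightarrow> v \<in> U \<Longrightarrow> w \<in> U \<Longrightarrow> (u \<otimes>\<^bsub>uea L\<^esub> v) \<otimes>\<^bsub>uea L\<^esub> w = u \<otimes>\<^bsub>uea L\<^esub> (v \<otimes>\<^bsub>uea L\<^esub> w)"
  by (elim U_cases) (simp add: L.uea_mult mult.assoc del: mem_Collect_eq)

lemma U_distr: "u \<in> U \<Longrightarrow> v \<in> U \<Longrightarrow> w \<in> U \<Longrightarrow> u \<otimes>\<^bsub>uea L\<^esub> (v \<oplus>\<^bsub>uea L\<^esub> w) = (u \<otimes>\<^bsub>uea L\<^esub> v) \<oplus>\<^bsub>uea L\<^esub> (u \<otimes>\<^bsub>uea L\<^esub> w)"
  by (elim U_cases) (simp add: L.uea_mult L.uea_add words_add distrib_left del: mem_Collect_eq)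

lemma U_mult_smult: "u \<in> U \<Longrightarrow> v \<in> U \<Longrightarrow> u \<otimes>\<^bsub>uea L\<^esub> (c \<odot>\<^bsub>uea L\<^esub> v) = c \<odot>\<^bsub>uea L\<^esub> (u \<otimes>\<^bsub>uea L\<^esub> v)"
proof (elim U_cases)
  fix f g assume fg: "f \<in> words L" "u = cls f" "g \<in> words L" "v = cls g"
  have "f * (const c * g) = const c * (f * g)" by (metis const_commute mult.assoc)
  then show ?thesis using fg by (simp add: L.uea_mult L.uea_smult del: mem_Collect_eq)
qed

lemma uea_map_in: "s \<in> carrier (uea P) \<Longrightarrow> uea_map L s \<in> U"
  unfolding P.uea_carrier by (elim imageE) (simp add: uea_map_class cls_in sub_words del: mem_Collect_eq)

lemma uea_act_in: "s \<in> carrier (uea P) \<Longrightarrow> m \<in> carrier M \<Longrightarrow> uea_act M s m \<in> carrier M"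
  unfolding P.uea_carrier by (elim imageE) (simp add: P.uea_act_class del: mem_Collect_eq)

definition gens :: "(('x list \<Rightarrow>\<^sub>0 complex) set \<times> 'm \<Rightarrow>\<^sub>0 complex) set" where
  "gens = {e (a \<oplus>\<^bsub>uea L\<^esub> a') b - e a b - e a' b |a a' b. a \<in> U \<and> a' \<in> U \<and> b \<in> carrier M} \<union>
        {e a (b \<oplus>\<^bsub>M\<^esub> b') - e a b - e a b' |a b b'. a \<in> U \<and> b \<in> carrier M \<and> b' \<in> carrier M} \<union>
        {e (c \<odot>\<^bsub>uea L\<^esub> a) b - Poly_Mapping.single (a, b) c |c a b. a \<in> U \<and> b \<in> carrier M} \<union>
        {e a (c \<odot>\<^bsub>M\<^esub> b) - Poly_Mapping.single (a, b) c |c a b. a \<in> U \<and> b \<in> carrier M} \<union>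
        {e (a \<otimes>\<^bsub>uea L\<^esub> uea_map L s) b - e a (uea_act M s b) |s a b. s \<in> carrier (uea P) \<and> a \<in> U \<and> b \<in> carrier M}"

lemma ker_hull: "ker = lin_hull (free_module (U \<times> carrier M)) gens"
  by (simp add: ker_def tensor_kernel_def gens_def Let_def)

lemma e_keys: "u \<in> U \<Longrightarrow> m \<in> carrier M \<Longrightarrow> Poly_Mapping.keys (Poly_Mapping.single (u, m) c) \<subseteq> U \<times> carrier M"
  by auto

lemma gens_subset: "gens \<subseteq> carrier (free_module (U \<times> carrier M))"
proof
  fix g assume "g \<in> gens"
  then have "Poly_Mapping.keys g \<subseteq> U \<times> carrier M"
    unfolding gens_def
    by (elim UnE CollectE exE conjE)
      (simp_all only: keys_diff_subset e_keys U_add U_smult U_mult uea_map_in uea_act_in P.add_in P.smult_in)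
  then show "g \<in> carrier (free_module (U \<times> carrier M))" by (simp add: free_module_simps)
qed

interpretation FM: cmod "free_module (U \<times> carrier M)" by (rule cmod_free_module)

interpretation PR: cmod "pairs_rep L M" by (rule cmod_pairs_rep)

lemma submodule_pairs_iff:
  "submodule N complex_ring (pairs_rep L M) \<longleftrightarrow> submodule N complex_ring (free_module (U \<times> carrier M))"
  unfolding FM.submodule_iff PR.submodule_iff by (simp add: free_module_simps pairs_rep_simps)

lemma ker_submodule: "submodule ker complex_ring (pairs_rep L M)"
  unfolding submodule_pairs_iff ker_hull by (rule FM.submodule_lin_hull) (rule gens_subset)

lemma gens_ker: "gens \<subseteq> ker"
  unfolding ker_hull by (rule FM.submodule_lin_hull) (rule gens_subset)

lemma ker_minimal: "submodule N complex_ring (pairs_rep L M) \<Longrightarrow> gens \<subseteq> N \<Longrightarrow> ker \<subseteq> N"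
  unfolding ker_hull submodule_pairs_iff by (rule FM.submodule_lin_hull(3)[OF gens_subset])

lemma pairs_act_in:
  assumes "x \<in> lie_carrier L" "f \<in> carrier (pairs_rep L M)"
  shows "act (pairs_rep L M) x f \<in> carrier (pairs_rep L M)"
proof -
  have "Poly_Mapping.keys f \<subseteq> U \<times> carrier M" using assms by (simp add: pairs_rep_simps)
  then have "Poly_Mapping.keys (act (pairs_rep L M) x f) \<subseteq> U \<times> carrier M"
  proof (induction f rule: poly_mapping_additive_induct)
    case zero then show ?case by (simp add: pairs_rep_act)
  next
    case (single k z)
    then show ?case using assms U_mult[OF cls_in[OF letter_words]]
      by (auto simp: pairs_rep_act split: if_splits)
  next
    case (add f g)
    then show ?case by (simp add: pairs_rep_act lext_add keys_add_subset)
  qed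
  then show ?thesis by (simp add: pairs_rep_simps)
qed

lemma pairs_act_add: "act (pairs_rep L M) x (f + g) = act (pairs_rep L M) x f + act (pairs_rep L M) x g"
  and pairs_act_psc: "act (pairs_rep L M) x (psc c f) = psc c (act (pairs_rep L M) x f)"
  and pairs_act_diff: "act (pairs_rep L M) x (f - g) = act (pairs_rep L M) x f - act (pairs_rep L M) x g"
  and pairs_act_single: "act (pairs_rep L M) x (Poly_Mapping.single (u, m) c) = Poly_Mapping.single (lett x \<otimes>\<^bsub>uea L\<^esub> u, m) c"
  by (simp_all add: pairs_rep_act lext_add lext_psc lext_diff)

text \<open>
  Left multiplication on the first factor commutes with the right action of \<open>U(P)\<close> on it, so it maps
  generators of the relations to generators.
\<close>

lemma ker_act: "x \<in> lie_carrier L \<Longrightarrow> k \<in> ker \<Longrightarrow> act (pairs_rep L M) x k \<in> ker"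
proof -
  assume x: "x \<in> lie_carrier L" and k: "k \<in> ker"
  let ?N = "{f \<in> carrier (pairs_rep L M). act (pairs_rep L M) x f \<in> ker}"
  have xU: "lett x \<in> U" using x by (simp add: cls_in del: mem_Collect_eq)
  have K: "0 \<in> ker" "\<And>a b. a \<in> ker \<Longrightarrow> b \<in> ker \<Longrightarrow> a + b \<in> ker" "\<And>c a. a \<in> ker \<Longrightarrow> psc c a \<in> ker"
    using ker_submodule unfolding PR.submodule_iff by (simp_all add: pairs_rep_simps)
  have act0: "act (pairs_rep L M) x 0 = 0" by (simp add: pairs_rep_act)
  have "submodule ?N complex_ring (pairs_rep L M)"
    unfolding PR.submodule_iff
    by (simp add: pairs_rep_simps act0 K pairs_act_add pairs_act_psc keys_add_subset keys_psc_subset Collect_mono)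
  moreover have "gens \<subseteq> ?N"
  proof
    fix g assume g: "g \<in> gens"
    from g[unfolded gens_def] have "act (pairs_rep L M) x g \<in> gens"
    proof (elim UnE CollectE exE conjE)
      fix a a' b assume "g = e (a \<oplus>\<^bsub>uea L\<^esub> a') b - e a b - e a' b" "a \<in> U" "a' \<in> U" "b \<in> carrier M"
      then show "act (pairs_rep L M) x g \<in> gens"
        using xU unfolding gens_def by (simp only: pairs_act_diff pairs_act_single U_distr) (blast intro: U_mult)
    next
      fix a b b' assume "g = e a (b \<oplus>\<^bsub>M\<^esub> b') - e a b - e a b'" "a \<in> U" "b \<in> carrier M" "b' \<in> carrier M"
      then show "act (pairs_rep L M) x g \<in> gens"
        using xU unfolding gens_def by (simp only: pairs_act_diff pairs_act_single) (blast intro: U_mult)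
    next
      fix c a b assume "g = e (c \<odot>\<^bsub>uea L\<^esub> a) b - Poly_Mapping.single (a, b) c" "a \<in> U" "b \<in> carrier M"
      then show "act (pairs_rep L M) x g \<in> gens"
        using xU unfolding gens_def by (simp only: pairs_act_diff pairs_act_single U_mult_smult) (blast intro: U_mult)
    next
      fix c a b assume "g = e a (c \<odot>\<^bsub>M\<^esub> b) - Poly_Mapping.single (a, b) c" "a \<in> U" "b \<in> carrier M"
      then show "act (pairs_rep L M) x g \<in> gens"
        using xU unfolding gens_def by (simp only: pairs_act_diff pairs_act_single) (blast intro: U_mult)
    next
      fix s a b assume "g = e (a \<otimes>\<^bsub>uea L\<^esub> uea_map L s) b - e a (uea_act M s b)" "s \<in> carrier (uea P)" "a \<in> U" "b \<in> carrier M"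
      then show "act (pairs_rep L M) x g \<in> gens"
        using xU uea_map_in[of s] unfolding gens_def
        by (simp only: pairs_act_diff pairs_act_single U_assoc[symmetric]) (blast intro: U_mult)
    qed
    then show "g \<in> ?N" using gens_ker gens_subset g by (auto simp: pairs_rep_simps free_module_simps)
  qed
  ultimately show ?thesis using ker_minimal[of ?N] k by blast
qed

definition tens :: "('x list \<Rightarrow>\<^sub>0 complex) set \<Rightarrow> 'm \<Rightarrow> (('x list \<Rightarrow>\<^sub>0 complex) set \<times> 'm \<Rightarrow>\<^sub>0 complex) set" where
  "tens u m = ker +>\<^bsub>pairs_rep L M\<^esub> e u m"

interpretation I: cmod Ind
  unfolding Ind_eq by (rule quotient_rep_cmod[OF cmod_pairs_rep ker_submodule])

lemma e_in: "u \<in> U \<Longrightarrow> m \<in> carrier M \<Longrightarrow> Poly_Mapping.single (u, m) c \<in> carrier (pairs_rep L M)"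
  by (simp add: pairs_rep_simps)

lemma tens_in [simp]: "u \<in> U \<Longrightarrow> m \<in> carrier M \<Longrightarrow> tens u m \<in> carrier Ind"
  by (auto simp: Ind_eq quotient_rep_carrier tens_def e_in)

lemma coset_ker_eq:
  "f \<in> carrier (pairs_rep L M) \<Longrightarrow> g \<in> carrier (pairs_rep L M) \<Longrightarrow> f - g \<in> ker \<Longrightarrow>
    ker +>\<^bsub>pairs_rep L M\<^esub> f = ker +>\<^bsub>pairs_rep L M\<^esub> g"
proof -
  assume f: "f \<in> carrier (pairs_rep L M)" and g: "g \<in> carrier (pairs_rep L M)" and k: "f - g \<in> ker"
  have "f = f - g \<oplus>\<^bsub>pairs_rep L M\<^esub> g" by (simp add: pairs_rep_simps)
  then have "f \<in> ker +>\<^bsub>pairs_rep L M\<^esub> g" using k by (auto simp: a_r_coset_def')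
  then show ?thesis using PR.coset_memD[OF ker_submodule _ g] by blast
qed

lemma psc_coset: "f \<in> carrier (pairs_rep L M) \<Longrightarrow>
    c \<odot>\<^bsub>Ind\<^esub> (ker +>\<^bsub>pairs_rep L M\<^esub> f) = ker +>\<^bsub>pairs_rep L M\<^esub> psc c f"
  unfolding Ind_eq by (subst quotient_rep_smult[OF cmod_pairs_rep ker_submodule]) (simp_all add: pairs_rep_simps)

lemma add_coset: "f \<in> carrier (pairs_rep L M) \<Longrightarrow> g \<in> carrier (pairs_rep L M) \<Longrightarrow>
    (ker +>\<^bsub>pairs_rep L M\<^esub> f) \<oplus>\<^bsub>Ind\<^esub> (ker +>\<^bsub>pairs_rep L M\<^esub> g) = ker +>\<^bsub>pairs_rep L M\<^esub> (f + g)"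
  unfolding Ind_eq by (subst quotient_rep_add[OF cmod_pairs_rep ker_submodule]) (simp_all add: pairs_rep_simps)

lemma act_coset: "x \<in> lie_carrier L \<Longrightarrow> f \<in> carrier (pairs_rep L M) \<Longrightarrow>
    act Ind x (ker +>\<^bsub>pairs_rep L M\<^esub> f) = ker +>\<^bsub>pairs_rep L M\<^esub> act (pairs_rep L M) x f"
  unfolding Ind_eq
  by (rule quotient_rep_act[OF cmod_pairs_rep ker_submodule])
    (simp_all add: pairs_act_in ker_act, simp add: pairs_rep_simps pairs_act_add)

lemma single_in_sum: "u \<in> U \<Longrightarrow> u' \<in> U \<Longrightarrow> m \<in> carrier M \<Longrightarrow> m' \<in> carrier M \<Longrightarrow>
   e u m + e u' m' \<in> carrier (pairs_rep L M)"
  by (simp add: pairs_rep_simps keys_add_subset)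

lemma tens_add_left:
  assumes "u \<in> U" "v \<in> U" "m \<in> carrier M"
  shows "tens (u \<oplus>\<^bsub>uea L\<^esub> v) m = tens u m \<oplus>\<^bsub>Ind\<^esub> tens v m"
proof -
  have "e (u \<oplus>\<^bsub>uea L\<^esub> v) m - e u m - e v m \<in> gens" using assms unfolding gens_def by blast
  then have "e (u \<oplus>\<^bsub>uea L\<^esub> v) m - (e u m + e v m) \<in> ker" using gens_ker by (auto simp: diff_diff_add)
  then have "ker +>\<^bsub>pairs_rep L M\<^esub> e (u \<oplus>\<^bsub>uea L\<^esub> v) m = ker +>\<^bsub>pairs_rep L M\<^esub> (e u m + e v m)"
    by (rule coset_ker_eq[rotated 2]) (use assms in \<open>simp_all add: e_in U_add single_in_sum\<close>)
  then show ?thesis using assms by (simp add: tens_def add_coset e_in)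
qed

lemma tens_add_right:
  assumes "u \<in> U" "m \<in> carrier M" "n \<in> carrier M"
  shows "tens u (m \<oplus>\<^bsub>M\<^esub> n) = tens u m \<oplus>\<^bsub>Ind\<^esub> tens u n"
proof -
  have "e u (m \<oplus>\<^bsub>M\<^esub> n) - e u m - e u n \<in> gens" using assms unfolding gens_def by blast
  then have "e u (m \<oplus>\<^bsub>M\<^esub> n) - (e u m + e u n) \<in> ker" using gens_ker by (auto simp: diff_diff_add)
  then have "ker +>\<^bsub>pairs_rep L M\<^esub> e u (m \<oplus>\<^bsub>M\<^esub> n) = ker +>\<^bsub>pairs_rep L M\<^esub> (e u m + e u n)"
    by (rule coset_ker_eq[rotated 2]) (use assms in \<open>simp_all add: e_in single_in_sum\<close>)
  then show ?thesis using assms by (simp add: tens_def add_coset e_in)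
qed

lemma tens_smult_left:
  assumes "u \<in> U" "m \<in> carrier M"
  shows "tens (c \<odot>\<^bsub>uea L\<^esub> u) m = c \<odot>\<^bsub>Ind\<^esub> tens u m"
proof -
  have "e (c \<odot>\<^bsub>uea L\<^esub> u) m - Poly_Mapping.single (u, m) c \<in> gens" using assms unfolding gens_def by blast
  then have "e (c \<odot>\<^bsub>uea L\<^esub> u) m - psc c (e u m) \<in> ker" using gens_ker by auto
  then have "ker +>\<^bsub>pairs_rep L M\<^esub> e (c \<odot>\<^bsub>uea L\<^esub> u) m = ker +>\<^bsub>pairs_rep L M\<^esub> psc c (e u m)"
    by (rule coset_ker_eq[rotated 2]) (use assms in \<open>simp_all add: e_in U_smult\<close>)
  then show ?thesis using assms by (simp add: tens_def psc_coset e_in)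
qed

lemma tens_smult_right:
  assumes "u \<in> U" "m \<in> carrier M"
  shows "tens u (c \<odot>\<^bsub>M\<^esub> m) = c \<odot>\<^bsub>Ind\<^esub> tens u m"
proof -
  have "e u (c \<odot>\<^bsub>M\<^esub> m) - Poly_Mapping.single (u, m) c \<in> gens" using assms unfolding gens_def by blast
  then have "e u (c \<odot>\<^bsub>M\<^esub> m) - psc c (e u m) \<in> ker" using gens_ker by auto
  then have "ker +>\<^bsub>pairs_rep L M\<^esub> e u (c \<odot>\<^bsub>M\<^esub> m) = ker +>\<^bsub>pairs_rep L M\<^esub> psc c (e u m)"
    by (rule coset_ker_eq[rotated 2]) (use assms in \<open>simp_all add: e_in \<close>)
  then show ?thesis using assms by (simp add: tens_def psc_coset e_in)
qed

lemma tens_balanced: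
  assumes "u \<in> U" "m \<in> carrier M" "s \<in> carrier (uea P)"
  shows "tens (u \<otimes>\<^bsub>uea L\<^esub> uea_map L s) m = tens u (uea_act M s m)"
proof -
  have "e (u \<otimes>\<^bsub>uea L\<^esub> uea_map L s) m - e u (uea_act M s m) \<in> gens" using assms unfolding gens_def by blast
  then have "e (u \<otimes>\<^bsub>uea L\<^esub> uea_map L s) m - e u (uea_act M s m) \<in> ker" using gens_ker by auto
  then have "ker +>\<^bsub>pairs_rep L M\<^esub> e (u \<otimes>\<^bsub>uea L\<^esub> uea_map L s) m = ker +>\<^bsub>pairs_rep L M\<^esub> e u (uea_act M s m)"
    by (rule coset_ker_eq[rotated 2]) (use assms in \<open>simp_all add: e_in U_mult uea_map_in uea_act_in\<close>)
  then show ?thesis using assms by (simp add: tens_def  e_in)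
qed

lemma act_tens: "x \<in> lie_carrier L \<Longrightarrow> u \<in> U \<Longrightarrow> m \<in> carrier M \<Longrightarrow> act Ind x (tens u m) = tens (lett x \<otimes>\<^bsub>uea L\<^esub> u) m"
  unfolding tens_def by (simp add: act_coset e_in pairs_act_single)

lemma tens_span:
  assumes "submodule S complex_ring Ind" "\<And>u m. u \<in> U \<Longrightarrow> m \<in> carrier M \<Longrightarrow> tens u m \<in> S"
  shows "S = carrier Ind"
proof -
  have "ker +>\<^bsub>pairs_rep L M\<^esub> f \<in> S" if "Poly_Mapping.keys f \<subseteq> U \<times> carrier M" for f
    using that
  proof (induction f rule: poly_mapping_additive_induct)
    case zero
    have "ker +>\<^bsub>pairs_rep L M\<^esub> 0 = \<zero>\<^bsub>Ind\<^esub>"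
      using PR.coset_zero[OF ker_submodule] by (simp add: pairs_rep_simps Ind_eq quotient_rep_zero)
    then show ?case using I.submodule_zero[OF assms(1)] by simp
  next
    case (single k z)
    then obtain u m where k: "k = (u, m)" "u \<in> U" "m \<in> carrier M" by auto
    have "z \<odot>\<^bsub>Ind\<^esub> tens u m \<in> S" using assms k I.submodule_smult by blast
    then show ?case using k by (simp add: tens_def psc_coset e_in)
  next
    case (add f g)
    then show ?case using I.submodule_add[OF assms(1) add.IH] by (simp add: add_coset pairs_rep_simps)
  qed
  then have "carrier Ind \<subseteq> S" by (auto simp: Ind_eq quotient_rep_carrier pairs_rep_simps)
  then show ?thesis using I.submodule_subset[OF assms(1)] by blast
qed

lemma Ind_coset_cases: "a \<in> carrier Ind \<Longrightarrow>
    (\<And>f. f \<in> carrier (pairs_rep L M) \<Longrightarrow> a = ker +>\<^bsub>pairs_rep L M\<^esub> f \<Longrightarrow> thesis) \<Longrightarrow> thesis"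
  by (auto simp: Ind_eq quotient_rep_carrier)

lemma coset_in_Ind: "f \<in> carrier (pairs_rep L M) \<Longrightarrow> ker +>\<^bsub>pairs_rep L M\<^esub> f \<in> carrier Ind"
  by (auto simp: Ind_eq quotient_rep_carrier)

lemma Ind_act_in [simp]: "x \<in> lie_carrier L \<Longrightarrow> a \<in> carrier Ind \<Longrightarrow> act Ind x a \<in> carrier Ind"
  by (elim Ind_coset_cases) (simp add: act_coset pairs_act_in coset_in_Ind)

lemma Ind_act_add: "x \<in> lie_carrier L \<Longrightarrow> a \<in> carrier Ind \<Longrightarrow> b \<in> carrier Ind \<Longrightarrow>
    act Ind x (a \<oplus>\<^bsub>Ind\<^esub> b) = act Ind x a \<oplus>\<^bsub>Ind\<^esub> act Ind x b"
proof (elim Ind_coset_cases)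
  fix f g assume "x \<in> lie_carrier L" "f \<in> carrier (pairs_rep L M)" "a = ker +>\<^bsub>pairs_rep L M\<^esub> f"
    "g \<in> carrier (pairs_rep L M)" "b = ker +>\<^bsub>pairs_rep L M\<^esub> g"
  moreover from this have "f + g \<in> carrier (pairs_rep L M)" by (simp add: pairs_rep_simps keys_add_subset)
  ultimately show ?thesis by (simp add: add_coset act_coset pairs_act_in pairs_act_add)
qed

lemma Ind_act_smult: "x \<in> lie_carrier L \<Longrightarrow> a \<in> carrier Ind \<Longrightarrow> act Ind x (c \<odot>\<^bsub>Ind\<^esub> a) = c \<odot>\<^bsub>Ind\<^esub> act Ind x a"
proof (elim Ind_coset_cases)
  fix f assume "x \<in> lie_carrier L" "f \<in> carrier (pairs_rep L M)" "a = ker +>\<^bsub>pairs_rep L M\<^esub> f"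
  moreover from this have "psc c f \<in> carrier (pairs_rep L M)" by (simp add: pairs_rep_simps keys_psc_subset)
  ultimately show ?thesis by (simp add: psc_coset act_coset pairs_act_in pairs_act_psc)
qed

text \<open>The module axioms for \<open>Ind\<close> are equations between linear operators, so that it suffices to verify them
  on pure tensors.\<close>

lemma Ind_linear_eq:
  assumes "a \<in> carrier Ind"
    and F: "\<And>a. a \<in> carrier Ind \<Longrightarrow> F a \<in> carrier Ind" "\<And>a. a \<in> carrier Ind \<Longrightarrow> G a \<in> carrier Ind"
    and add: "\<And>a b. a \<in> carrier Ind \<Longrightarrow> b \<in> carrier Ind \<Longrightarrow> F (a \<oplus>\<^bsub>Ind\<^esub> b) = F a \<oplus>\<^bsub>Ind\<^esub> F b"
       "\<And>a b. a \<in> carrier Ind \<Longrightarrow> b \<in> carrier Ind \<Longrightarrow> G (a \<oplus>\<^bsub>Ind\<^esub> b) = G a \<oplus>\<^bsub>Ind\<^esub> G b"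
    and smult: "\<And>c a. a \<in> carrier Ind \<Longrightarrow> F (c \<odot>\<^bsub>Ind\<^esub> a) = c \<odot>\<^bsub>Ind\<^esub> F a"
       "\<And>c a. a \<in> carrier Ind \<Longrightarrow> G (c \<odot>\<^bsub>Ind\<^esub> a) = c \<odot>\<^bsub>Ind\<^esub> G a"
    and eq: "\<And>u m. u \<in> U \<Longrightarrow> m \<in> carrier M \<Longrightarrow> F (tens u m) = G (tens u m)"
  shows "F a = G a"
proof -
  have z: "\<zero>\<^bsub>Ind\<^esub> = 0 \<odot>\<^bsub>Ind\<^esub> \<zero>\<^bsub>Ind\<^esub>" by (rule I.crd_eqI) simp_all
  have z0: "0 \<odot>\<^bsub>Ind\<^esub> b = \<zero>\<^bsub>Ind\<^esub>" if "b \<in> carrier Ind" for b using that by (intro I.crd_eqI) simp_all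
  have "F \<zero>\<^bsub>Ind\<^esub> = \<zero>\<^bsub>Ind\<^esub>" "G \<zero>\<^bsub>Ind\<^esub> = \<zero>\<^bsub>Ind\<^esub>"
    using smult[OF I.zero_in, of 0] z0 F I.zero_in by metis+
  then have "submodule {a \<in> carrier Ind. F a = G a} complex_ring Ind"
    unfolding I.submodule_iff by (auto simp: add smult)
  then have "{a \<in> carrier Ind. F a = G a} = carrier Ind"
    by (rule tens_span) (simp add: eq)
  then show ?thesis using assms(1) by blast
qed

lemma cls_mult: "f \<in> words L \<Longrightarrow> g \<in> words L \<Longrightarrow> cls f \<otimes>\<^bsub>uea L\<^esub> cls g = cls (f * g)"
  by (rule L.uea_mult)

lemma lett_add: "x \<in> lie_carrier L \<Longrightarrow> y \<in> lie_carrier L \<Longrightarrow> f \<in> words L \<Longrightarrow>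
    lett (x + y) \<otimes>\<^bsub>uea L\<^esub> cls f = (lett x \<otimes>\<^bsub>uea L\<^esub> cls f) \<oplus>\<^bsub>uea L\<^esub> (lett y \<otimes>\<^bsub>uea L\<^esub> cls f)"
proof -
  assume x: "x \<in> lie_carrier L" "y \<in> lie_carrier L" and f: "f \<in> words L"
  have "letter (x + y) - letter x - letter y \<in> uea_relations L" using x unfolding uea_relations_def by blast
  then have "letter (x + y) - (letter x + letter y) \<in> uea_ideal L" using L.relations_ideal by (auto simp: diff_diff_add)
  then have "cls (letter (x + y)) = cls (letter x + letter y)" by (rule L.uea_class_eq)
  then show ?thesis using x f
    by (simp add: cls_mult L.uea_add words_add distrib_right del: mem_Collect_eq)
qed

lemma lett_scale: "x \<in> lie_carrier L \<Longrightarrow> f \<in> words L \<Longrightarrow>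
    lett (lie_scale L c x) \<otimes>\<^bsub>uea L\<^esub> cls f = c \<odot>\<^bsub>uea L\<^esub> (lett x \<otimes>\<^bsub>uea L\<^esub> cls f)"
proof -
  assume x: "x \<in> lie_carrier L" and f: "f \<in> words L"
  have "letter (lie_scale L c x) - const c * letter x \<in> uea_relations L" using x unfolding uea_relations_def by blast
  then have "cls (letter (lie_scale L c x)) = cls (const c * letter x)"
    using L.relations_ideal L.uea_class_eq by blast
  then show ?thesis using x f
    by (simp add: cls_mult L.uea_smult mult.assoc del: mem_Collect_eq)
qed

lemma lett_bracket: "x \<in> lie_carrier L \<Longrightarrow> y \<in> lie_carrier L \<Longrightarrow> f \<in> words L \<Longrightarrow>
    (lett (lie_bracket L x y) \<otimes>\<^bsub>uea L\<^esub> cls f) \<oplus>\<^bsub>uea L\<^esub> (lett y \<otimes>\<^bsub>uea L\<^esub> (lett x \<otimes>\<^bsub>uea L\<^esub> cls f)) =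
    lett x \<otimes>\<^bsub>uea L\<^esub> (lett y \<otimes>\<^bsub>uea L\<^esub> cls f)"
proof -
  assume x: "x \<in> lie_carrier L" "y \<in> lie_carrier L" and f: "f \<in> words L"
  have "letter x * letter y - letter y * letter x - letter (lie_bracket L x y) \<in> uea_relations L"
    using x unfolding uea_relations_def by blast
  then have "letter x * letter y - (letter (lie_bracket L x y) + letter y * letter x) \<in> uea_ideal L"
    using L.relations_ideal by (auto simp: algebra_simps)
  then have "cls (letter x * letter y) = cls (letter (lie_bracket L x y) + letter y * letter x)" by (rule L.uea_class_eq)
  moreover have "lett x \<otimes>\<^bsub>uea L\<^esub> (lett y \<otimes>\<^bsub>uea L\<^esub> cls f) = cls (letter x * letter y) \<otimes>\<^bsub>uea L\<^esub> cls f"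
    using x f by (simp add: cls_mult mult.assoc del: mem_Collect_eq)
  ultimately show ?thesis using x f
    by (simp add: cls_mult L.uea_add words_add distrib_right mult.assoc del: mem_Collect_eq)
qed

theorem induced_lie_module: "is_lie_module L Ind"
proof (rule is_lie_moduleI)
  show "cmod Ind" by (rule I.cmod_axioms)
  fix x y c m n
  assume x: "x \<in> lie_carrier L" and m: "m \<in> carrier Ind"
  show "act Ind x m \<in> carrier Ind" using x m by simp
  show "act Ind x (c \<odot>\<^bsub>Ind\<^esub> m) = c \<odot>\<^bsub>Ind\<^esub> act Ind x m" using x m by (rule Ind_act_smult)
  show "act Ind (lie_scale L c x) m = c \<odot>\<^bsub>Ind\<^esub> act Ind x m"
  proof (rule Ind_linear_eq[OF m])
    fix u m assume um: "u \<in> U" "m \<in> carrier M"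
    from um(1) obtain f where f: "f \<in> words L" "u = cls f" by (rule U_cases)
    have "lett x \<otimes>\<^bsub>uea L\<^esub> u \<in> U" using x um U_mult cls_in letter_words by blast
    then show "act Ind (lie_scale L c x) (tens u m) = c \<odot>\<^bsub>Ind\<^esub> act Ind x (tens u m)"
      using um x lett_scale[OF x f(1), of c] f(2) by (simp add: act_tens tens_smult_left)
  qed (simp add: x Ind_act_add Ind_act_smult; rule I.crd_eqI; simp add: x ps.scale_right_distrib mult.commute)+
  {
    assume n: "n \<in> carrier Ind"
    show "act Ind x (m \<oplus>\<^bsub>Ind\<^esub> n) = act Ind x m \<oplus>\<^bsub>Ind\<^esub> act Ind x n" using x m n by (rule Ind_act_add)
  }
  assume y: "y \<in> lie_carrier L"
  show "act Ind (x + y) m = act Ind x m \<oplus>\<^bsub>Ind\<^esub> act Ind y m"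
  proof (rule Ind_linear_eq[OF m])
    fix u m assume um: "u \<in> U" "m \<in> carrier M"
    from um(1) obtain f where f: "f \<in> words L" "u = cls f" by (rule U_cases)
    have "lett x \<otimes>\<^bsub>uea L\<^esub> u \<in> U" "lett y \<otimes>\<^bsub>uea L\<^esub> u \<in> U"
      using x y um U_mult cls_in letter_words by blast+
    then show "act Ind (x + y) (tens u m) = act Ind x (tens u m) \<oplus>\<^bsub>Ind\<^esub> act Ind y (tens u m)"
      using um x y lett_add[OF x y f(1)] f(2) by (simp add: act_tens tens_add_left)
  qed (simp add: x y Ind_act_add Ind_act_smult; rule I.crd_eqI; simp add: x y ps.scale_right_distrib)+
  show "act Ind (lie_bracket L x y) m = act Ind x (act Ind y m) \<ominus>\<^bsub>Ind\<^esub> act Ind y (act Ind x m)"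
  proof (rule Ind_linear_eq[OF m])
    fix u m assume um: "u \<in> U" "m \<in> carrier M"
    from um(1) obtain f where f: "f \<in> words L" "u = cls f" by (rule U_cases)
    have xU: "lett z \<otimes>\<^bsub>uea L\<^esub> v \<in> U" if "z \<in> lie_carrier L" "v \<in> U" for z v
      using that U_mult cls_in letter_words by blast
    have "act Ind x (act Ind y (tens u m)) = act Ind (lie_bracket L x y) (tens u m) \<oplus>\<^bsub>Ind\<^esub> act Ind y (act Ind x (tens u m))"
      using um x y lett_bracket[OF x y f(1)] f(2) by (simp add: act_tens xU flip: tens_add_left)
    then show "act Ind (lie_bracket L x y) (tens u m) = act Ind x (act Ind y (tens u m)) \<ominus>\<^bsub>Ind\<^esub> act Ind y (act Ind x (tens u m))"
      using um x y by (intro I.crd_eqI) simp_all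
  qed (simp add: x y Ind_act_add Ind_act_smult; rule I.crd_eqI; simp add: x y ps.scale_right_distrib ps.scale_right_diff_distrib)+
qed

end


context lie_mod
begin

lemma ev_letter: "x \<in> lie_carrier L \<Longrightarrow> m \<in> carrier M \<Longrightarrow> ev M (letter x) m = act M x m"
  using ev_single[of "[x]" m 1] unfolding letter_def by (intro crd_eqI) simp_all

lemma ev_one: "m \<in> carrier M \<Longrightarrow> ev M 1 m = m"
  using ev_single[of "[]" m 1] by (intro crd_eqI) (simp_all add: one_poly_list)

end

context induction
begin

definition unit :: "'m \<Rightarrow> (('x list \<Rightarrow>\<^sub>0 complex) set \<times> 'm \<Rightarrow>\<^sub>0 complex) set" where
  "unit m = tens (cls 1) m"

interpretation I: lie_mod L Ind
  by (rule lie_mod.intro) (rule induced_lie_module)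

lemma words_one: "1 \<in> words L"
  by (simp add: one_poly_list)

lemma one_U: "cls 1 \<in> U"
  by (rule cls_in) (rule words_one)

lemma sub_carrier: "x \<in> lie_carrier P \<Longrightarrow> x \<in> lie_carrier L"
  using sub by (auto simp: substruct_def)

lemma unit_hom: "unit \<in> lie_hom P M Ind"
proof (rule lie_homI)
  fix m m' c x assume m: "m \<in> carrier M"
  show "unit m \<in> carrier Ind" using m one_U by (simp add: unit_def)
  show "unit (c \<odot>\<^bsub>M\<^esub> m) = c \<odot>\<^bsub>Ind\<^esub> unit m" using m one_U by (simp add: unit_def tens_smult_right)
  { assume "m' \<in> carrier M"
    then show "unit (m \<oplus>\<^bsub>M\<^esub> m') = unit m \<oplus>\<^bsub>Ind\<^esub> unit m'" using m one_U by (simp add: unit_def tens_add_right) }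
  assume x: "x \<in> lie_carrier P"
  have xP: "letter x \<in> words P" using x by (simp add: letter_keys)
  have xL: "x \<in> lie_carrier L" "letter x \<in> words L" using sub_carrier[OF x] letter_words by blast+
  have s: "uea_class P (letter x) \<in> carrier (uea P)" using xP by (auto simp: P.uea_carrier)
  have "act Ind x (unit m) = tens (cls (letter x)) m"
    using xL m one_U words_one by (simp add: unit_def act_tens cls_mult del: mem_Collect_eq)
  also have "\<dots> = tens (cls 1 \<otimes>\<^bsub>uea L\<^esub> uea_map L (uea_class P (letter x))) m"
    using xL xP words_one by (simp add: uea_map_class cls_mult del: mem_Collect_eq)
  also have "\<dots> = tens (cls 1) (uea_act M (uea_class P (letter x)) m)"
    using one_U m s by (rule tens_balanced)
  also have "\<dots> = unit (act M x m)"
    using xP m x by (simp add: unit_def P.uea_act_class P.ev_letter del: mem_Collect_eq)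
  finally show "unit (act M x m) = act Ind x (unit m)" by simp
qed

text \<open>
  The class of a word \<open>w\<close> gives the tensor \<open>w \<otimes> m\<close>, which is obtained from \<open>1 \<otimes> m\<close> by applying the letters
  of \<open>w\<close> one after the other.
\<close>

lemma unit_generates:
  assumes S: "is_lie_submodule L Ind S" and j: "unit ` carrier M \<subseteq> S"
  shows "S = carrier Ind"
proof (rule tens_span)
  show sub: "submodule S complex_ring Ind" using S by (simp add: is_lie_submodule_def)
  fix u m assume um: "u \<in> U" "m \<in> carrier M"
  obtain f where f: "f \<in> words L" "u = cls f" using um(1) by (rule U_cases)
  have word: "tens (cls (Poly_Mapping.single w 1)) m \<in> S" if "w \<in> lists (lie_carrier L)" for w
    using that
  proof (induction w)
    case Nil
    show ?case using j um(2) by (auto simp: unit_def one_poly_list)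
  next
    case (Cons x w)
    have w: "Poly_Mapping.single w 1 \<in> words L" using Cons by auto
    have "Poly_Mapping.single (x # w) 1 = letter x * Poly_Mapping.single w (1::complex)"
      by (simp add: letter_def mult_single_list)
    then have "tens (cls (Poly_Mapping.single (x # w) 1)) m = act Ind x (tens (cls (Poly_Mapping.single w 1)) m)"
      using w Cons um(2) by (simp add: act_tens cls_in cls_mult del: mem_Collect_eq)
    then show ?case using Cons S by (simp add: is_lie_submodule_def)
  qed
  have "Poly_Mapping.keys f \<subseteq> lists (lie_carrier L)" using f by simp
  then have "tens (cls f) m \<in> S"
  proof (induction f rule: poly_mapping_additive_induct)
    case zero
    have "(0 :: 'x list \<Rightarrow>\<^sub>0 complex) = const 0 * 1" by (simp add: const_def)
    then have "tens (cls 0) m = 0 \<odot>\<^bsub>Ind\<^esub> tens (cls 1) m"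
      using um one_U words_one by (simp flip: tens_smult_left add: L.uea_smult del: mem_Collect_eq)
    moreover have "tens (cls 1) m \<in> S" using j um(2) by (auto simp: unit_def)
    ultimately show ?case using sub I.submodule_smult by metis
  next
    case (single w z)
    have w: "Poly_Mapping.single w 1 \<in> words L" using single by auto
    have "Poly_Mapping.single w z = const z * Poly_Mapping.single w 1" by (simp add: const_mult)
    then have "tens (cls (Poly_Mapping.single w z)) m = z \<odot>\<^bsub>Ind\<^esub> tens (cls (Poly_Mapping.single w 1)) m"
      using w um(2) by (simp flip: tens_smult_left add: L.uea_smult cls_in del: mem_Collect_eq)
    then show ?case using word[OF single] sub I.submodule_smult by metis
  next
    case (add f g)
    then have "tens (cls (f + g)) m = tens (cls f) m \<oplus>\<^bsub>Ind\<^esub> tens (cls g) m"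
      using um(2) by (simp flip: tens_add_left L.uea_add add: cls_in)
    then show ?case using add.IH sub I.submodule_add by metis
  qed
  then show "tens u m \<in> S" using f by simp
qed

text \<open>
  The extension of \<open>h\<close> sends \<open>u \<otimes> m\<close> to \<open>u\<close> applied to \<open>h m\<close>. It is defined by linearity on the free space on
  pairs, in coordinates of \<open>W\<close>, and vanishes on the relations because \<open>h\<close> is a homomorphism
  of \<open>P\<close>-modules.
\<close>

theorem unit_universal:
  fixes W :: "('x, 'w) lie_rep"
  assumes W: "is_lie_module L W" and h: "h \<in> lie_hom P M W"
  shows "\<exists>g\<in>lie_hom L Ind W. \<forall>m\<in>carrier M. g (unit m) = h m"
proof -
  interpret W: uea_mod L W
    using W L.closed_struct_axioms by (intro uea_mod.intro lie_mod.intro)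
  interpret PR: cmod "pairs_rep L M" by (rule cmod_pairs_rep)
  have WP: "is_lie_module P W" by (rule is_lie_module_substruct[OF sub W])
  note hin = lie_hom_closed[OF h]
  \<comment> \<open>Values are taken in coordinates, where \<open>lext\<close> is available.\<close>
  define val where "val = (\<lambda>(u, m). crd W (uea_act W u (h m)))"
  have val: "val (cls f, m) = crd W (ev W f (h m))" if "f \<in> words L" "m \<in> carrier M" for f m
    using that hin by (simp add: val_def W.uea_act_class del: mem_Collect_eq)
  have val_in: "uea_act W u (h m) \<in> carrier W" if "u \<in> U" "m \<in> carrier M" for u m
    using that hin by (elim U_cases) (simp add: W.uea_act_class del: mem_Collect_eq)
  let ?N = "{f \<in> carrier (pairs_rep L M). lext val f = 0}"
  have "ker \<subseteq> ?N"
  proof (rule ker_minimal)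
    show "submodule ?N complex_ring (pairs_rep L M)"
      unfolding PR.submodule_iff
      by (simp add: pairs_rep_simps lext_add lext_psc keys_add_subset keys_psc_subset Collect_mono)
    show "gens \<subseteq> ?N"
    proof
      fix g assume g: "g \<in> gens"
      from g[unfolded gens_def] have "lext val g = 0"
      proof (elim UnE CollectE exE conjE)
        fix a a' b assume g: "g = e (a \<oplus>\<^bsub>uea L\<^esub> a') b - e a b - e a' b" and "a \<in> U" "a' \<in> U" and b: "b \<in> carrier M"
        then obtain f f' where "f \<in> words L" "a = cls f" "f' \<in> words L" "a' = cls f'" by (metis U_cases)
        then show ?thesis using b
          by (simp add: g lext_diff L.uea_add words_add val W.ev_add hin del: mem_Collect_eq)
      next
        fix a b b' assume g: "g = e a (b \<oplus>\<^bsub>M\<^esub> b') - e a b - e a b'" and "a \<in> U" and b: "b \<in> carrier M" "b' \<in> carrier M"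
        then obtain f where "f \<in> words L" "a = cls f" by (metis U_cases)
        then show ?thesis using b
          by (simp add: g lext_diff val W.ev_add_right hin lie_hom_add[OF h] del: mem_Collect_eq)
      next
        fix c a b assume g: "g = e (c \<odot>\<^bsub>uea L\<^esub> a) b - Poly_Mapping.single (a, b) c" and "a \<in> U" and b: "b \<in> carrier M"
        then obtain f where "f \<in> words L" "a = cls f" by (metis U_cases)
        then show ?thesis using b
          by (simp add: g lext_diff L.uea_smult val W.ev_const_mult hin del: mem_Collect_eq)
      next
        fix c a b assume g: "g = e a (c \<odot>\<^bsub>M\<^esub> b) - Poly_Mapping.single (a, b) c" and "a \<in> U" and b: "b \<in> carrier M"
        then obtain f where "f \<in> words L" "a = cls f" by (metis U_cases)
        then show ?thesis using b
          by (simp add: g lext_diff val W.ev_smult_right hin lie_hom_smult[OF h] del: mem_Collect_eq)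
      next
        fix s a b assume g: "g = e (a \<otimes>\<^bsub>uea L\<^esub> uea_map L s) b - e a (uea_act M s b)"
          and s: "s \<in> carrier (uea P)" and "a \<in> U" and b: "b \<in> carrier M"
        then obtain f where f: "f \<in> words L" "a = cls f" by (metis U_cases)
        obtain q where q: "q \<in> words P" "s = uea_class P q" using s by (auto simp: P.uea_carrier)
        have "h (ev M q b) = ev W q (h b)"
          by (rule ev_hom[OF P.lie_module WP h q(1) b])
        then show ?thesis using b f q sub_words[OF q(1)]
          by (simp add: g lext_diff uea_map_class cls_mult P.uea_act_class val W.ev_mult hin del: mem_Collect_eq)
      qed
      then show "g \<in> ?N" using gens_subset g by (auto simp: pairs_rep_simps free_module_simps)
    qed
  qed
  then have ker0: "lext val k = 0" if "k \<in> ker" for k using that by blast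
  define g where "g a = uncrd W (lext val (SOME f. f \<in> carrier (pairs_rep L M) \<and> a = ker +>\<^bsub>pairs_rep L M\<^esub> f))" for a
  have g_coset: "g (ker +>\<^bsub>pairs_rep L M\<^esub> f) = uncrd W (lext val f)" if f: "f \<in> carrier (pairs_rep L M)" for f
  proof -
    define f' where "f' = (SOME f'. f' \<in> carrier (pairs_rep L M) \<and> ker +>\<^bsub>pairs_rep L M\<^esub> f = ker +>\<^bsub>pairs_rep L M\<^esub> f')"
    have f': "f' \<in> carrier (pairs_rep L M) \<and> ker +>\<^bsub>pairs_rep L M\<^esub> f = ker +>\<^bsub>pairs_rep L M\<^esub> f'"
      unfolding f'_def by (rule someI[of _ f]) (simp add: f)
    then have "f' \<in> ker +>\<^bsub>pairs_rep L M\<^esub> f" using PR.coset_self[OF ker_submodule] by blast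
    then obtain k where "k \<in> ker" "f' = k + f" by (auto simp: a_r_coset_def' pairs_rep_simps)
    then show ?thesis by (simp add: g_def flip: f'_def) (simp add: lext_add ker0)
  qed
  have g_tens: "g (tens u m) = uea_act W u (h m)" if "u \<in> U" "m \<in> carrier M" for u m
    using that val_in by (simp add: tens_def g_coset e_in val_def)
  have hom: "g \<in> lie_hom L Ind W"
  proof (rule lie_homI)
    fix a b c x assume "a \<in> carrier Ind"
    then obtain f where f: "f \<in> carrier (pairs_rep L M)" "a = ker +>\<^bsub>pairs_rep L M\<^esub> f" by (rule Ind_coset_cases)
    show "g a \<in> carrier W" using f by (simp add: g_coset)
    have "psc c f \<in> carrier (pairs_rep L M)" using f by (simp add: pairs_rep_simps keys_psc_subset)
    then show "g (c \<odot>\<^bsub>Ind\<^esub> a) = c \<odot>\<^bsub>W\<^esub> g a" using f by (simp add: psc_coset g_coset lext_psc W.uncrd_psc)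
    { assume "b \<in> carrier Ind"
      then obtain q where q: "q \<in> carrier (pairs_rep L M)" "b = ker +>\<^bsub>pairs_rep L M\<^esub> q" by (rule Ind_coset_cases)
      have "f + q \<in> carrier (pairs_rep L M)" using f q by (simp add: pairs_rep_simps keys_add_subset)
      then show "g (a \<oplus>\<^bsub>Ind\<^esub> b) = g a \<oplus>\<^bsub>W\<^esub> g b" using f q by (simp add: add_coset g_coset lext_add W.uncrd_add) }
    assume x: "x \<in> lie_carrier L"
    have "Poly_Mapping.keys f \<subseteq> U \<times> carrier M" using f by (simp add: pairs_rep_simps)
    then have "uncrd W (lext val (act (pairs_rep L M) x f)) = act W x (uncrd W (lext val f))"
    proof (induction f rule: poly_mapping_additive_induct)
      case zero
      then show ?case using x by (simp add: pairs_rep_act)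
    next
      case (single k z)
      then obtain u m where k: "k = (u, m)" "u \<in> U" "m \<in> carrier M" by auto
      then obtain f where f: "f \<in> words L" "u = cls f" by (metis U_cases)
      have "uncrd W (val (cls (letter x) \<otimes>\<^bsub>uea L\<^esub> u, m)) = act W x (uncrd W (val (u, m)))"
        using f k x hin by (simp add: cls_mult val W.ev_mult W.ev_letter del: mem_Collect_eq)
      then show ?case using k x by (simp add: pairs_act_single W.uncrd_psc)
    next
      case (add f q)
      then show ?case using x by (simp add: pairs_act_add lext_add W.uncrd_add)
    qed
    then show "g (act Ind x a) = act W x (g a)"
      using f x by (simp add: act_coset g_coset pairs_act_in)
  qed
  have "g (unit m) = h m" if "m \<in> carrier M" for m
    using that one_U words_one hin by (simp add: unit_def g_tens W.uea_act_class W.ev_one del: mem_Collect_eq)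
  then show ?thesis using hom by blast
qed

end

lemma transport_inverse_hom:
  assumes "is_lie_module L M" "inj_on f (carrier M)"
  shows "inv_into (carrier M) f \<in> lie_hom L (transport f M) M"
proof -
  interpret M: lie_mod L M by (rule lie_mod.intro) fact
  show ?thesis
    by (rule lie_homI) (auto simp: transport_def mk_rep_def Let_def inv_into_f_f[OF assms(2)])
qed

text \<open>The induced module copied into the universe, with the copy of the canonical map.\<close>

locale universe_induction = induction L P M
  for L P :: "'x::ab_group_add lie_struct" and M :: "('x, ('x, 'v) universe) lie_rep"
begin

definition emb :: "(('x list \<Rightarrow>\<^sub>0 complex) set \<times> ('x, 'v) universe \<Rightarrow>\<^sub>0 complex) set \<Rightarrow> ('x, 'v) universe" where
  "emb = (SOME f. inj_on f (carrier Ind))"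

definition j :: "('x, 'v) universe \<Rightarrow> ('x, 'v) universe" where
  "j m = emb (unit m)"

abbreviation "R \<equiv> (realize Ind :: ('x, ('x, 'v) universe) lie_rep)"

lemma emb_inj: "inj_on emb (carrier Ind)"
  unfolding emb_def by (rule someI_ex[of "\<lambda>f. inj_on f (carrier Ind)", OF ex_inj_on_induced])

lemma R_eq: "R = transport emb Ind"
  by (simp add: realize_def emb_def)

lemma R_module: "is_lie_module L R"
  unfolding R_eq by (rule transport_lie_module[OF L.closed induced_lie_module emb_inj])

lemma emb_hom: "emb \<in> lie_hom L Ind R"
  unfolding R_eq by (rule transport_hom[OF induced_lie_module emb_inj])

lemma j_hom: "j \<in> lie_hom P M R"
  using lie_hom_comp[OF P.lie_module unit_hom lie_hom_substruct[OF sub emb_hom]] by (simp add: j_def[abs_def])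

lemma j_generates:
  assumes S: "is_lie_submodule L R S" and j: "\<And>m. m \<in> carrier M \<Longrightarrow> j m \<in> S"
  shows "S = carrier R"
proof -
  have "{a \<in> carrier Ind. emb a \<in> S} = carrier Ind"
    by (rule unit_generates[OF preimage_submodule[OF induced_lie_module R_module emb_hom S]])
      (use j lie_hom_closed[OF unit_hom] in \<open>auto simp: j_def\<close>)
  then have "carrier R \<subseteq> S" by (auto simp: R_eq transport_simps)
  moreover have "S \<subseteq> carrier R"
    using S unfolding lie_mod.is_lie_submodule_iff[OF lie_mod.intro[OF R_module]] by (rule conjunct1)
  ultimately show ?thesis by blast
qed

text \<open>
  From here on, induced modules are used only through this universal property, its uniqueness part
  \<open>hom_ext\<close>, and the fact that the image of \<open>j\<close> generates.
\<close>

lemma j_universal: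
  fixes W :: "('x, 'w) lie_rep"
  assumes W: "is_lie_module L W" and h: "h \<in> lie_hom P M W"
  shows "\<exists>g\<in>lie_hom L R W. \<forall>m\<in>carrier M. g (j m) = h m"
proof -
  obtain g where g: "g \<in> lie_hom L Ind W" and gu: "\<forall>m\<in>carrier M. g (unit m) = h m"
    using unit_universal[OF W h] by (rule bexE)
  let ?i = "inv_into (carrier Ind) emb"
  have i: "?i \<in> lie_hom L R Ind"
    unfolding R_eq by (rule transport_inverse_hom[OF induced_lie_module emb_inj])
  have "(\<lambda>a. g (?i a)) \<in> lie_hom L R W"
    by (rule lie_hom_comp[OF R_module i g])
  moreover have "g (?i (j m)) = h m" if m: "m \<in> carrier M" for m
  proof -
    have "?i (j m) = unit m"
      unfolding j_def by (rule inv_into_f_f[OF emb_inj lie_hom_closed[OF unit_hom m]])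
    then show ?thesis using gu m by simp
  qed
  ultimately show ?thesis by (intro bexI[of _ "\<lambda>a. g (?i a)"]) simp_all
qed

lemma hom_ext:
  fixes W :: "('x, 'w) lie_rep"
  assumes W: "is_lie_module L W" and "f \<in> lie_hom L R W" "g \<in> lie_hom L R W"
    and "\<And>m. m \<in> carrier M \<Longrightarrow> f (j m) = g (j m)" and "a \<in> carrier R"
  shows "f a = g a"
proof -
  have "{a \<in> carrier R. f a = g a} = carrier R"
    by (rule j_generates[OF equalizer_submodule[OF R_module W assms(2,3)]])
      (use assms(4) lie_hom_closed[OF j_hom] in auto)
  then show ?thesis using assms(5) by blast
qed

end


section \<open>Toroidal Lie algebras\<close>

definition cvec :: "complex \<Rightarrow> (nat \<Rightarrow>\<^sub>0 int) \<Rightarrow> (nat \<Rightarrow>\<^sub>0 complex)" where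
  "cvec z n = Poly_Mapping.map (\<lambda>j. z * of_int j) n"

lemma lookup_cvec [simp]: "Poly_Mapping.lookup (cvec z n) i = z * of_int (Poly_Mapping.lookup n i)"
  by (simp add: cvec_def Poly_Mapping.map.rep_eq when_def)

lemma keys_cvec: "Poly_Mapping.keys (cvec z n) \<subseteq> Poly_Mapping.keys n"
  by (auto simp: in_keys_iff)

lemma cvec_zero [simp]: "cvec 0 n = 0"
  by (rule poly_mapping_eqI) simp

lemma pairing_superset:
  assumes "finite B" "Poly_Mapping.keys d \<subseteq> B"
  shows "pairing d n = (\<Sum>i\<in>B. Poly_Mapping.lookup d i * of_int (Poly_Mapping.lookup n i))"
  unfolding pairing_def using assms by (intro sum.mono_neutral_left) (auto simp: in_keys_iff)

lemma pairing_add_left: "pairing (d + d') n = pairing d n + pairing d' n"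
  unfolding pairing_def by (rule sum_keys_add) (simp_all add: algebra_simps)

lemma pairing_add_right: "pairing d (n + m) = pairing d n + pairing d m"
  by (simp add: pairing_def lookup_add sum.distrib algebra_simps)

lemma pairing_zero [simp]: "pairing 0 n = 0" "pairing d 0 = 0"
  by (simp_all add: pairing_def)

lemma pairing_single [simp]: "pairing (Poly_Mapping.single k z) n = z * of_int (Poly_Mapping.lookup n k)"
  by (simp add: pairing_def)

lemma pairing_psc: "pairing (psc z d) n = z * pairing d n"
  using pairing_superset[OF finite_keys keys_psc, of z d n]
  by (simp add: pairing_def sum_distrib_left mult.assoc)

lemma pairing_update: "Poly_Mapping.lookup n k = 0 \<Longrightarrow> pairing (Poly_Mapping.update k 0 d) n = pairing d n"
proof -
  assume n: "Poly_Mapping.lookup n k = 0"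
  have "Poly_Mapping.keys (Poly_Mapping.update k 0 d) \<subseteq> Poly_Mapping.keys d"
    by (auto simp: in_keys_iff lookup_update split: if_splits)
  then have "pairing (Poly_Mapping.update k 0 d) n =
      (\<Sum>i\<in>Poly_Mapping.keys d. Poly_Mapping.lookup (Poly_Mapping.update k 0 d) i * of_int (Poly_Mapping.lookup n i))"
    by (intro pairing_superset) simp
  also have "\<dots> = pairing d n"
    unfolding pairing_def by (rule sum.cong) (use n in \<open>auto simp: lookup_update\<close>)
  finally show ?thesis .
qed

locale toroidal_setup = lie_algebra scale bracket
  for scale :: "complex \<Rightarrow> 'g::ab_group_add \<Rightarrow> 'g" and bracket :: "'g \<Rightarrow> 'g \<Rightarrow> 'g" +
  fixes form :: "'g \<Rightarrow> 'g \<Rightarrow> complex"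
  assumes invariant: "is_invariant_form form"
begin

abbreviation "br \<equiv> toroidal_bracket scale bracket form"
abbreviation "sc \<equiv> toroidal_scale scale"
abbreviation "E n x \<equiv> (Poly_Mapping.single n x, 0 :: nat \<Rightarrow>\<^sub>0 complex, 0 :: nat \<Rightarrow>\<^sub>0 complex)"

lemma bracket_simps [simp]:
  "bracket (x + y) z = bracket x z + bracket y z" "bracket z (x + y) = bracket z x + bracket z y"
  "bracket (scale c x) y = scale c (bracket x y)" "bracket x (scale c y) = scale c (bracket x y)"
  "bracket 0 x = 0" "bracket x 0 = 0"
proof -
  interpret l: Vector_Spaces.linear scale scale "\<lambda>x. bracket x z" for z by (rule bracket_linear_left)
  interpret r: Vector_Spaces.linear scale scale "\<lambda>x. bracket z x" for z by (rule bracket_linear_right)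
  show "bracket (x + y) z = bracket x z + bracket y z" "bracket z (x + y) = bracket z x + bracket z y"
    "bracket (scale c x) y = scale c (bracket x y)" "bracket x (scale c y) = scale c (bracket x y)"
    "bracket 0 x = 0" "bracket x 0 = 0"
    by (rule l.add r.add l.scale r.scale l.zero r.zero)+
qed

lemma bracket_antisym: "bracket x y = - bracket y x"
proof -
  have "bracket (x + y) (x + y) = (bracket x x + bracket y y) + (bracket x y + bracket y x)"
    by (simp add: algebra_simps)
  then have "bracket x y + bracket y x = 0" by (simp only: bracket_alternating) simp
  then show ?thesis by (simp add: eq_neg_iff_add_eq_0)
qed

lemma bracket_uminus: "bracket (- x) y = - bracket x y" "bracket x (- y) = - bracket x y"
  using bracket_simps(3)[of "- 1" x y] bracket_simps(4)[of x "- 1" y] by (simp_all add: scale_minus_left)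

lemma bracket_leibniz: "bracket x (bracket y z) = bracket (bracket x y) z + bracket y (bracket x z)"
proof -
  have "bracket x (bracket y z) + bracket y (bracket z x) + bracket z (bracket x y) = 0" by (rule jacobi)
  moreover have "bracket y (bracket z x) = - bracket y (bracket x z)"
    using bracket_antisym[of z x] by (simp add: bracket_uminus)
  moreover have "bracket z (bracket x y) = - bracket (bracket x y) z" by (rule bracket_antisym)
  ultimately show ?thesis by (simp add: algebra_simps)
qed

lemma form_simps [simp]:
  "form (x + y) z = form x z + form y z" "form z (x + y) = form z x + form z y"
  "form (scale c x) y = c * form x y" "form x (scale c y) = c * form x y"
  "form 0 x = 0" "form x 0 = 0"
  and form_sym: "form x y = form y x"
  and form_invariant: "form (bracket x y) z = form x (bracket y z)"
proof -
  have lin: "Vector_Spaces.linear scale (*) (form z)" for z using invariant by (simp add: is_invariant_form_def)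
  interpret r: Vector_Spaces.linear scale "(*)" "form z" for z by (rule lin)
  have sym: "form x y = form y x" for x y using invariant by (simp add: is_invariant_form_def)
  show "form z (x + y) = form z x + form z y" "form x (scale c y) = c * form x y" "form x 0 = 0"
    by (rule r.add r.scale r.zero)+
  show "form (x + y) z = form x z + form y z" "form (scale c x) y = c * form x y" "form 0 x = 0"
    using r.add r.scale r.zero sym by metis+
  show "form x y = form y x" by (rule sym)
  show "form (bracket x y) z = form x (bracket y z)" using invariant unfolding is_invariant_form_def by blast
qed

lemma form_uminus: "form (- x) y = - form x y" "form x (- y) = - form x y"
  using form_simps(3)[of "- 1" x y] form_simps(4)[of x "- 1" y] by (simp_all add: scale_minus_left)

text \<open>
  The three parts of the toroidal bracket: the bracket of Laurent polynomials with coefficients in \<open>'g\<close>, the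
  action of the derivations on them, and the central cocycle.
\<close>

definition loop_bracket where
  "loop_bracket a a' = (\<Sum>n\<in>Poly_Mapping.keys a. \<Sum>m\<in>Poly_Mapping.keys a'. Poly_Mapping.single (n + m :: nat \<Rightarrow>\<^sub>0 int)
     (bracket (Poly_Mapping.lookup a n) (Poly_Mapping.lookup a' m)))"

definition deriv_action where
  "deriv_action d a = (\<Sum>m\<in>Poly_Mapping.keys a. Poly_Mapping.single m (scale (pairing d m) (Poly_Mapping.lookup a m)))"

definition cocycle where
  "cocycle a a' = (\<Sum>n\<in>Poly_Mapping.keys a. cvec (form (Poly_Mapping.lookup a n) (Poly_Mapping.lookup a' (- n))) n)"

lemma br_eq: "br (a, c, d) (a', c', d') = (loop_bracket a a' + deriv_action d a' - deriv_action d' a, cocycle a a', 0)"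
  by (simp add: toroidal_bracket_def loop_bracket_def deriv_action_def cocycle_def cvec_def)

lemma sc_eq: "sc z (a, c, d) = (Poly_Mapping.map (scale z) a, psc z c, psc z d)"
  by (simp add: toroidal_scale_def psc_def)

lemma lookup_map_scale [simp]: "Poly_Mapping.lookup (Poly_Mapping.map (scale z) a) n = scale z (Poly_Mapping.lookup a n)"
  by (simp add: Poly_Mapping.map.rep_eq when_def)

lemma keys_map_scale: "Poly_Mapping.keys (Poly_Mapping.map (scale z) a) \<subseteq> Poly_Mapping.keys a"
  by (auto simp: in_keys_iff)

lemma loop_bracket_add_left: "loop_bracket (a + b) a' = loop_bracket a a' + loop_bracket b a'"
  unfolding loop_bracket_def by (rule sum_keys_add) (simp_all add: single_add sum.distrib)

lemma loop_bracket_swap: "loop_bracket a a' = (\<Sum>m\<in>Poly_Mapping.keys a'. \<Sum>n\<in>Poly_Mapping.keys a. Poly_Mapping.single (n + m)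
     (bracket (Poly_Mapping.lookup a n) (Poly_Mapping.lookup a' m)))"
  unfolding loop_bracket_def by (rule sum.swap)

lemma loop_bracket_add_right: "loop_bracket a (a' + b) = loop_bracket a a' + loop_bracket a b"
  unfolding loop_bracket_swap by (rule sum_keys_add) (simp_all add: single_add sum.distrib)

lemma loop_bracket_single [simp]: "loop_bracket (Poly_Mapping.single n x) (Poly_Mapping.single m y) = Poly_Mapping.single (n + m) (bracket x y)"
  unfolding loop_bracket_def by (subst sum_keys_single; (subst sum_keys_single)?; simp)

lemma deriv_action_lookup [simp]: "Poly_Mapping.lookup (deriv_action d a) n = scale (pairing d n) (Poly_Mapping.lookup a n)"
  by (cases "n \<in> Poly_Mapping.keys a")
    (auto simp: deriv_action_def lookup_sum lookup_single when_def in_keys_iff if_distrib cong: if_cong)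

lemma deriv_action_add_right: "deriv_action d (a + b) = deriv_action d a + deriv_action d b"
  by (rule poly_mapping_eqI) (simp add: lookup_add scale_right_distrib)

lemma deriv_action_add_left: "deriv_action (d + d') a = deriv_action d a + deriv_action d' a"
  by (rule poly_mapping_eqI) (simp add: lookup_add scale_left_distrib pairing_add_left)

lemma deriv_action_zero [simp]: "deriv_action d 0 = 0" "deriv_action 0 a = 0"
  by (rule poly_mapping_eqI; simp)+

lemma loop_bracket_zero [simp]: "loop_bracket 0 a = 0" "loop_bracket a 0 = 0"
  by (simp_all add: loop_bracket_def)

lemma cocycle_zero [simp]: "cocycle 0 a = 0" "cocycle a 0 = 0"
  by (simp_all add: cocycle_def)

lemma deriv_action_single [simp]: "deriv_action d (Poly_Mapping.single n x) = Poly_Mapping.single n (scale (pairing d n) x)"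
  by (rule poly_mapping_eqI) (simp add: lookup_single when_def)

lemma cvec_add: "cvec (z + w) n = cvec z n + cvec w n"
  by (rule poly_mapping_eqI) (simp add: lookup_add algebra_simps)

lemma cocycle_add_left: "cocycle (a + b) a' = cocycle a a' + cocycle b a'"
  unfolding cocycle_def by (rule sum_keys_add) (simp_all add: cvec_add)

lemma cocycle_add_right: "cocycle a (a' + b) = cocycle a a' + cocycle a b"
  by (simp add: cocycle_def lookup_add cvec_add sum.distrib)

lemma cocycle_single_left: "cocycle (Poly_Mapping.single n x) a' = cvec (form x (Poly_Mapping.lookup a' (- n))) n"
  unfolding cocycle_def by (subst sum_keys_single) simp_all

lemma neg_eq_iff: "(- n = m) \<longleftrightarrow> (n + m = (0 :: nat \<Rightarrow>\<^sub>0 int))"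
  by (metis add.right_inverse add_eq_0_iff)

lemma cocycle_single [simp]: "cocycle (Poly_Mapping.single n x) (Poly_Mapping.single m y) = (if n + m = 0 then cvec (form x y) n else 0)"
  by (auto simp: cocycle_single_left lookup_single when_def neg_eq_iff eq_commute[of m])

lemma br_add_left: "br (X + X') Y = br X Y + br X' Y"
  by (cases X; cases X'; cases Y)
    (simp add: br_eq loop_bracket_add_left deriv_action_add_left deriv_action_add_right cocycle_add_left)

lemma br_add_right: "br Y (X + X') = br Y X + br Y X'"
  by (cases X; cases X'; cases Y)
    (simp add: br_eq loop_bracket_add_right deriv_action_add_left deriv_action_add_right cocycle_add_right)

lemma br_gens:
  "br (Poly_Mapping.single n x, u, 0) (Poly_Mapping.single m y, v, 0) =
    (Poly_Mapping.single (n + m) (bracket x y), if n + m = 0 then cvec (form x y) n else 0, 0)"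
  "br (Poly_Mapping.single n x, u, 0) (0, c, d) = (Poly_Mapping.single n (- scale (pairing d n) x), 0, 0)"
  "br (0, c, d) (Poly_Mapping.single n x, u, 0) = (Poly_Mapping.single n (scale (pairing d n) x), 0, 0)"
  "br (0, c, d) (0, c', d') = 0"
  by (simp_all add: br_eq single_uminus zero_prod_def)

lemma br_center: "br X (0, c, 0) = 0" "br (0, c, 0) X = 0"
  by (cases X; simp add: br_eq zero_prod_def)+

lemma zero_triple [simp]: "(0, 0, 0) = (0 :: 'g toroidal)"
  by (simp add: zero_prod_def)

lemma br_zero [simp]: "br 0 X = 0" "br X 0 = 0"
  using br_center(1)[of X 0] br_center(2)[of 0 X] by simp_all

text \<open>
  All the subalgebras that occur are cut out by conditions on the exponents and on the indices of the
  \<open>c\<^sub>i\<close> and \<open>d\<^sub>i\<close>. As such they are spanned by monomials, which makes induction over generators uniform.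
\<close>

definition box :: "(nat \<Rightarrow>\<^sub>0 int) set \<Rightarrow> nat set \<Rightarrow> nat set \<Rightarrow> 'g toroidal set" where
  "box A C D = {(a, c, d). Poly_Mapping.keys a \<subseteq> A \<and> Poly_Mapping.keys c \<subseteq> C \<and> Poly_Mapping.keys d \<subseteq> D}"

lemma box_induct [consumes 1, case_names E cd add]:
  assumes X: "X \<in> box A C D"
    and E: "\<And>n x. n \<in> A \<Longrightarrow> P (E n x)"
    and cd: "\<And>c d. Poly_Mapping.keys c \<subseteq> C \<Longrightarrow> Poly_Mapping.keys d \<subseteq> D \<Longrightarrow> P (0, c, d)"
    and add: "\<And>X Y. X \<in> box A C D \<Longrightarrow> Y \<in> box A C D \<Longrightarrow> P X \<Longrightarrow> P Y \<Longrightarrow> P (X + Y)"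
  shows "P X"
proof -
  obtain a c d where Xe: "X = (a, c, d)" by (cases X)
  have k: "Poly_Mapping.keys a \<subseteq> A" "Poly_Mapping.keys c \<subseteq> C" "Poly_Mapping.keys d \<subseteq> D"
    using X by (auto simp: box_def Xe)
  from k(1) have "P (a, 0, 0)"
  proof (induction a rule: poly_mapping_additive_induct)
    case zero
    show ?case using cd[of 0 0] by simp
  next
    case (single n x)
    then show ?case by (rule E)
  next
    case (add f g)
    then show ?case using assms(4)[of "(f, 0, 0)" "(g, 0, 0)"] by (simp add: box_def)
  qed
  then have "P ((a, 0, 0) + (0, c, d))"
    using k cd by (intro add) (simp_all add: box_def)
  then show ?thesis by (simp add: Xe)
qed

lemma in_box_UNIV: "X \<in> box UNIV UNIV UNIV"
  by (cases X) (simp add: box_def)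

lemmas toroidal_induct = box_induct[OF in_box_UNIV, consumes 0, case_names E cd add]

lemma br_antisym: "br X Y = - br Y X"
proof (induction X rule: toroidal_induct)
  case (E n x)
  show ?case
  proof (induction Y rule: toroidal_induct)
    case (E m y)
    have "cvec (form x y) n = - cvec (form y x) m" if "n + m = 0"
    proof (rule poly_mapping_eqI)
      fix i
      have "Poly_Mapping.lookup n i = - Poly_Mapping.lookup m i"
        using arg_cong[OF that, of "\<lambda>f. Poly_Mapping.lookup f i"] by (simp add: lookup_add)
      then show "Poly_Mapping.lookup (cvec (form x y) n) i = Poly_Mapping.lookup (- cvec (form y x) m) i"
        by (simp add: form_sym[of x y])
    qed
    then show ?case
      unfolding br_gens bracket_antisym[of x y]
      by (simp add: add.commute[of m n] single_uminus uminus_prod_def)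
  qed (simp_all add: br_gens br_add_left br_add_right single_uminus uminus_prod_def)
next
  case (cd c d)
  show ?case
    by (induction Y rule: toroidal_induct)
      (simp_all add: br_gens br_add_left br_add_right single_uminus uminus_prod_def)
qed (simp add: br_add_left br_add_right)

text \<open>By antisymmetry the Leibniz rule is invariant under permutations of its three arguments, so that
  it suffices to consider generators in one order.\<close>

definition leibniz :: "'g toroidal \<Rightarrow> 'g toroidal \<Rightarrow> 'g toroidal \<Rightarrow> bool" where
  "leibniz X Y Z \<longleftrightarrow> br X (br Y Z) = br (br X Y) Z + br Y (br X Z)"

lemma br_uminus: "br (- X) Y = - br X Y" "br Y (- X) = - br Y X"
  using br_add_left[of X "- X" Y] br_add_right[of Y X "- X"] by (simp_all add: eq_neg_iff_add_eq_0 add.commute)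

lemma leibniz_swap12: "leibniz X Y Z \<Longrightarrow> leibniz Y X Z"
  unfolding leibniz_def by (subst br_antisym[of Y X]) (simp add: br_uminus)

lemma leibniz_swap23: "leibniz X Y Z \<Longrightarrow> leibniz X Z Y"
  unfolding leibniz_def
  by (subst br_antisym[of Z Y], subst br_antisym[of "br X Z" Y], subst br_antisym[of Z "br X Y"]) (simp add: br_uminus)

lemma leibniz_add: "leibniz X Y Z \<Longrightarrow> leibniz X' Y Z \<Longrightarrow> leibniz (X + X') Y Z"
  unfolding leibniz_def by (simp add: br_add_left br_add_right)

lemma leibniz_EEE: "leibniz (E n x) (E m y) (E l z)"
proof -
  have 1: "m + (n + l) = n + m + l" "n + (m + l) = n + m + l" by (simp_all add: algebra_simps)
  have a: "Poly_Mapping.single (n + m + l) (bracket x (bracket y z)) =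
      Poly_Mapping.single (n + m + l) (bracket (bracket x y) z) + Poly_Mapping.single (n + m + l) (bracket y (bracket x z))"
    by (subst bracket_leibniz) (simp add: single_add)
  have "form y (bracket x z) = - form x (bracket y z)"
    unfolding form_invariant[symmetric] by (subst bracket_antisym) (rule form_uminus(1))
  then have c: "cvec (form x (bracket y z)) n = cvec (form (bracket x y) z) (n + m) + cvec (form y (bracket x z)) m"
    by (intro poly_mapping_eqI) (simp add: form_invariant lookup_add algebra_simps)
  show ?thesis
    unfolding leibniz_def br_gens 1 using a c by simp
qed

lemma leibniz_cdEE: "leibniz (0, c, d) (E m y) (E l z)"
proof -
  have a: "Poly_Mapping.single (m + l) (scale (pairing d (m + l)) (bracket y z)) =
      Poly_Mapping.single (m + l) (bracket (scale (pairing d m) y) z) + Poly_Mapping.single (m + l) (bracket y (scale (pairing d l) z))"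
    by (simp add: pairing_add_right scale_left_distrib single_add)
  have c: "cvec (form (scale (pairing d m) y) z) m + cvec (form y (scale (pairing d l) z)) m = 0" if "m + l = 0"
  proof -
    have "pairing d l = - pairing d m"
      using that pairing_add_right[of d m l] by (simp add: eq_neg_iff_add_eq_0 add.commute)
    then show ?thesis by (intro poly_mapping_eqI) (simp add: lookup_add form_uminus algebra_simps)
  qed
  show ?thesis
    unfolding leibniz_def br_gens using a c by simp
qed

lemma leibniz_cdcdE: "leibniz (0, c, d) (0, c', d') (E l z)"
  unfolding leibniz_def br_gens by (simp add: mult.commute)

lemma leibniz_cdcdcd: "leibniz (0, c, d) (0, c', d') (0, c'', d'')"
  unfolding leibniz_def br_gens by simp

lemma leibniz_gen: "leibniz (E n x) (E m y) Z" "leibniz (E n x) (0, c, d) Z" "leibniz (0, c, d) (E n x) Z" "leibniz (0, c, d) (0, c', d') Z"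
proof -
  have add: "leibniz X Y (Z + Z')" if "leibniz X Y Z" "leibniz X Y Z'" for X Y Z Z'
    using that unfolding leibniz_def by (simp add: br_add_right)
  show "leibniz (E n x) (E m y) Z"
    by (induction Z rule: toroidal_induct) (blast intro: add leibniz_EEE leibniz_cdEE leibniz_swap12 leibniz_swap23)+
  show "leibniz (0, c, d) (E n x) Z"
    by (induction Z rule: toroidal_induct) (blast intro: add leibniz_cdEE leibniz_cdcdE leibniz_swap23)+
  then show "leibniz (E n x) (0, c, d) Z"
    by (rule leibniz_swap12)
  show "leibniz (0, c, d) (0, c', d') Z"
    by (induction Z rule: toroidal_induct) (blast intro: add leibniz_cdcdE leibniz_cdcdcd)+
qed

lemma br_leibniz: "br X (br Y Z) = br (br X Y) Z + br Y (br X Z)"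
proof -
  have "leibniz X Y Z"
  proof (induction X rule: toroidal_induct)
    case (E n x)
    show ?case
      by (induction Y rule: toroidal_induct) (blast intro: leibniz_gen leibniz_swap12 leibniz_add)+
  next
    case (cd c d)
    show ?case
      by (induction Y rule: toroidal_induct) (blast intro: leibniz_gen leibniz_swap12 leibniz_add)+
  qed (rule leibniz_add)
  then show ?thesis by (simp add: leibniz_def)
qed

lemma sc_add: "sc z (X + Y) = sc z X + sc z Y"
  by (cases X; cases Y) (auto simp: sc_eq lookup_add scale_right_distrib ps.scale_right_distrib intro!: poly_mapping_eqI)

lemma sc_E: "sc z (E n x) = E n (scale z x)"
  by (auto simp: sc_eq lookup_single when_def intro!: poly_mapping_eqI)

lemma sc_tuple: "sc z (Poly_Mapping.single n x, c, 0) = (Poly_Mapping.single n (scale z x), psc z c, 0)"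
  by (auto simp: sc_eq lookup_single when_def intro!: poly_mapping_eqI)

lemma sc_cd: "sc z (0, c, d) = (0, psc z c, psc z d)"
  by (auto simp: sc_eq intro!: poly_mapping_eqI)

lemma psc_cvec: "psc z (cvec w n) = cvec (z * w) n"
  by (rule poly_mapping_eqI) simp

lemma sc_zero [simp]: "sc z 0 = 0"
  using sc_cd[of z 0 0] by simp

lemma sc_uminus: "sc z (- X) = - sc z X"
  using sc_add[of z X "- X"] by (simp add: eq_neg_iff_add_eq_0 add.commute)

lemma br_scale_left: "br (sc z X) Y = sc z (br X Y)"
proof (induction X rule: toroidal_induct)
  case (E n x)
  show ?case
    by (induction Y rule: toroidal_induct)
      (simp_all add: br_gens sc_E sc_tuple psc_cvec br_add_right sc_add mult.commute scale_minus_right)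
next
  case (cd c d)
  show ?case
    by (induction Y rule: toroidal_induct)
      (simp_all add: br_gens sc_cd sc_tuple pairing_psc br_add_right sc_add)
next
  case (add X X')
  then show ?case by (simp add: br_add_left sc_add)
qed

lemma br_scale_right: "br X (sc z Y) = sc z (br X Y)"
  by (subst (1 2) br_antisym) (simp add: br_scale_left sc_uminus)


subsection \<open>Carriers\<close>

lemma box_add: "X \<in> box A C D \<Longrightarrow> Y \<in> box A C D \<Longrightarrow> X + Y \<in> box A C D"
  by (cases X; cases Y) (simp add: box_def keys_add_subset)

lemma box_zero: "0 \<in> box A C D"
  by (simp add: box_def flip: zero_triple)

lemma box_sc: "X \<in> box A C D \<Longrightarrow> sc z X \<in> box A C D"
  by (cases X) (simp add: box_def sc_eq keys_psc_subset order_trans[OF keys_map_scale])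

lemma box_br:
  assumes A: "\<And>n m. n \<in> A \<Longrightarrow> m \<in> A \<Longrightarrow> n + m \<in> A" and C: "\<And>n. n \<in> A \<Longrightarrow> Poly_Mapping.keys n \<subseteq> C"
    and "X \<in> box A C D" "Y \<in> box A C D'"
  shows "br X Y \<in> box A C {}"
  using assms(3)
proof (induction X rule: box_induct)
  case (E n x)
  show ?case
    using assms(4)
  proof (induction Y rule: box_induct)
    case (E m y)
    then show ?case using A[of n m] C[of n] \<open>n \<in> A\<close> order_trans[OF keys_cvec[of "form x y" n]]
      by (auto simp: box_def br_gens)
  next
    case (cd c d)
    then show ?case using \<open>n \<in> A\<close> by (simp add: box_def br_gens)
  qed (simp add: br_add_right box_add)
next
  case (cd c d)
  show ?case
    using assms(4)
    by (induction Y rule: box_induct) (simp_all add: br_gens br_add_right box_add box_zero, simp_all add: box_def)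
qed (simp add: br_add_left box_add)

lemma exponents_add: "n \<in> exponents k \<Longrightarrow> m \<in> exponents k \<Longrightarrow> n + m \<in> exponents k"
  by (auto simp: exponents_def dest: subsetD[OF Poly_Mapping.keys_add])

lemma hat_carrier_box: "hat_carrier k = box (exponents k) {1..k} {1..k}"
  and tilde_carrier_box: "tilde_carrier k = box (exponents k) {1..k} {}"
  and hat_plus_box: "hat_carrier k \<inter> plus_part k = box (exponents k \<inter> {n. Poly_Mapping.lookup n k \<ge> 0}) {1..k} {1..k}"
  and tilde_plus_box: "tilde_carrier k \<inter> plus_part k = box (exponents k \<inter> {n. Poly_Mapping.lookup n k \<ge> 0}) {1..k} {}"
  by (auto simp: hat_carrier_def tilde_carrier_def plus_part_def box_def)

lemma br_hat: "X \<in> hat_carrier k \<Longrightarrow> Y \<in> hat_carrier k \<Longrightarrow> br X Y \<in> tilde_carrier k"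
  unfolding hat_carrier_box tilde_carrier_box
  by (rule box_br) (auto simp: exponents_add, auto simp: exponents_def)

lemma br_hat_plus: "X \<in> hat_carrier k \<inter> plus_part k \<Longrightarrow> Y \<in> hat_carrier k \<inter> plus_part k \<Longrightarrow>
    br X Y \<in> tilde_carrier k \<inter> plus_part k"
  unfolding hat_plus_box tilde_plus_box
  by (rule box_br) (auto simp: exponents_add lookup_add, auto simp: exponents_def)

lemma tilde_subset_hat: "tilde_carrier k \<subseteq> hat_carrier k"
  by (auto simp: tilde_carrier_def)

lemma toroidal_simps [simp]:
  "lie_carrier (toroidal scale bracket form S) = S" "lie_scale (toroidal scale bracket form S) = sc"
  "lie_bracket (toroidal scale bracket form S) = br"
  by (simp_all add: toroidal_def)

abbreviation "hat k \<equiv> toroidal scale bracket form (hat_carrier k)"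
abbreviation "til k \<equiv> toroidal scale bracket form (tilde_carrier k)"
abbreviation "hatp k \<equiv> toroidal scale bracket form (hat_carrier k \<inter> plus_part k)"
abbreviation "tilp k \<equiv> toroidal scale bracket form (tilde_carrier k \<inter> plus_part k)"

lemma closed_box:
  assumes "S = box A C D" "\<And>X Y. X \<in> S \<Longrightarrow> Y \<in> S \<Longrightarrow> br X Y \<in> S"
  shows "struct_closed (toroidal scale bracket form S)"
  using assms(2) unfolding struct_closed_def toroidal_simps by (simp add: assms(1) box_add box_sc)

lemma closed_toroidal:
  "struct_closed (hat k)" "struct_closed (til k)" "struct_closed (hatp k)" "struct_closed (tilp k)"
proof -
  show "struct_closed (hat k)"
    by (rule closed_box[OF hat_carrier_box]) (use br_hat tilde_subset_hat in blast)
  show "struct_closed (til k)"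
    by (rule closed_box[OF tilde_carrier_box]) (use br_hat tilde_subset_hat in blast)
  show "struct_closed (hatp k)"
    by (rule closed_box[OF hat_plus_box]) (use br_hat_plus tilde_subset_hat in blast)
  show "struct_closed (tilp k)"
    by (rule closed_box[OF tilde_plus_box]) (use br_hat_plus tilde_subset_hat in blast)
qed

lemma substruct_toroidal: "S \<subseteq> S' \<Longrightarrow> substruct (toroidal scale bracket form S) (toroidal scale bracket form S')"
  by (simp add: substruct_def)


subsection \<open>The grading by the degree in the last variable\<close>

abbreviation "dk k \<equiv> ((0, 0, Poly_Mapping.single k 1) :: 'g toroidal)"

text \<open>
  The homogeneous elements, as eigenvectors of the last derivation. A central element and a
  derivation have degree zero; so an element of nonzero degree has no component among the derivations,
  and one of nonnegative degree lies in the plus part.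
\<close>

definition hom_deg :: "nat \<Rightarrow> int \<Rightarrow> 'g toroidal set" where
  "hom_deg k e = {X \<in> hat_carrier k. br (dk k) X = sc (of_int e) X}"

lemma sc_left_distrib: "sc (z + w) X = sc z X + sc w X"
  by (cases X) (auto simp: sc_eq lookup_add scale_left_distrib ps.scale_left_distrib intro!: poly_mapping_eqI)

lemma hom_deg_br:
  assumes "X \<in> hom_deg k e" "Y \<in> hom_deg k f"
  shows "br X Y \<in> hom_deg k (e + f)"
proof -
  have "br (dk k) (br X Y) = br (sc (of_int e) X) Y + br X (sc (of_int f) Y)"
    using assms by (subst br_leibniz) (simp add: hom_deg_def)
  also have "\<dots> = sc (of_int (e + f)) (br X Y)"
    by (simp add: br_scale_left br_scale_right sc_left_distrib)
  finally show ?thesis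
    using assms br_hat[of X k Y] tilde_subset_hat[of k] by (auto simp: hom_deg_def)
qed

lemma E_hom_deg: "n \<in> exponents k \<Longrightarrow> E n x \<in> hom_deg k (Poly_Mapping.lookup n k)"
  by (auto simp: hom_deg_def hat_carrier_def br_gens sc_E)

lemma cd_hom_deg: "(0, c, d) \<in> (hat_carrier k :: 'g toroidal set) \<Longrightarrow> (0, c, d) \<in> hom_deg k 0"
  by (auto simp: hom_deg_def br_gens sc_cd)

lemma hom_degD:
  assumes "(a, c, d) \<in> hom_deg k e"
  shows "n \<in> Poly_Mapping.keys a \<Longrightarrow> Poly_Mapping.lookup n k = e" "e \<noteq> 0 \<Longrightarrow> c = 0" "e \<noteq> 0 \<Longrightarrow> d = 0"
proof -
  have eq: "(deriv_action (Poly_Mapping.single k 1) a, 0, 0) = (Poly_Mapping.map (scale (of_int e)) a, psc (of_int e) c, psc (of_int e) d)"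
    using assms by (simp add: hom_deg_def br_eq sc_eq)
  show "Poly_Mapping.lookup n k = e" if n: "n \<in> Poly_Mapping.keys a"
  proof -
    have "Poly_Mapping.lookup (deriv_action (Poly_Mapping.single k 1) a) n = Poly_Mapping.lookup (Poly_Mapping.map (scale (of_int e)) a) n"
      using eq by simp
    then have "scale (of_int (Poly_Mapping.lookup n k) - of_int e) (Poly_Mapping.lookup a n) = 0"
      by (simp add: scale_left_diff_distrib)
    then show ?thesis using n by (simp add: in_keys_iff)
  qed
  show "c = 0" "d = 0" if "e \<noteq> 0" using eq that ps.scale_eq_0_iff by auto
qed

lemma hom_deg_plus: "X \<in> hom_deg k e \<Longrightarrow> e \<ge> 0 \<Longrightarrow> X \<in> hat_carrier k \<inter> plus_part k"
  using hom_degD(1)[of _ _ _ k e] by (cases X) (auto simp: plus_part_def hom_deg_def)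

lemma hom_deg_tilde: "X \<in> hom_deg k e \<Longrightarrow> e \<noteq> 0 \<Longrightarrow> X \<in> tilde_carrier k"
  using hom_degD(3)[of _ _ _ k e] by (cases X) (auto simp: tilde_carrier_def hom_deg_def)

lemma hom_deg_hat: "X \<in> hom_deg k e \<Longrightarrow> X \<in> hat_carrier k"
  by (simp add: hom_deg_def)

lemma hat_homogeneous_induct [consumes 1, case_names hom add]:
  assumes "X \<in> hat_carrier k" and "\<And>X e. X \<in> hom_deg k e \<Longrightarrow> P X"
    and "\<And>X Y. X \<in> hat_carrier k \<Longrightarrow> Y \<in> hat_carrier k \<Longrightarrow> P X \<Longrightarrow> P Y \<Longrightarrow> P (X + Y)"
  shows "P X"
  using assms(1) unfolding hat_carrier_box
proof (induction X rule: box_induct)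
  case (E n x)
  then show ?case using assms(2) E_hom_deg by blast
next
  case (cd c d)
  then have "(0, c, d) \<in> (hat_carrier k :: 'g toroidal set)" by (simp add: hat_carrier_def)
  then show ?case using assms(2) cd_hom_deg by blast
next
  case (add X Y)
  then show ?case using assms(3) by (simp add: hat_carrier_box)
qed


subsection \<open>Inflation\<close>

lemma update_zero [simp]: "Poly_Mapping.update k 0 0 = 0"
  by (rule poly_mapping_eqI) (simp add: lookup_update)

lemma project_E: "project k (E n (x :: 'g)) = (if Poly_Mapping.lookup n k = 0 then E n x else 0)"
proof -
  have "Poly_Mapping.mapp (\<lambda>n x. if Poly_Mapping.lookup n k = 0 then x else 0) (Poly_Mapping.single n x) =
      (if Poly_Mapping.lookup n k = 0 then Poly_Mapping.single n x else 0)"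
    by (rule poly_mapping_eqI) (auto simp: lookup_mapp lookup_single when_def)
  then show ?thesis by (simp add: project_def)
qed

lemma project_cd: "project k ((0, c, d) :: 'g toroidal) = (0, Poly_Mapping.update k 0 c, Poly_Mapping.update k 0 d)"
  by (auto simp: project_def lookup_mapp intro!: poly_mapping_eqI)

lemma project_add: "project k (X + Y :: 'g toroidal) = project k X + project k Y"
  by (cases X; cases Y)
    (auto simp: project_def lookup_mapp lookup_add lookup_update in_keys_iff when_def intro!: poly_mapping_eqI)

lemma project_zero [simp]: "project k 0 = (0 :: 'g toroidal)"
  using project_add[of k 0 0] by simp

lemma project_sc: "project k (sc z X) = sc z (project k X)"
  by (cases X)
    (auto simp: project_def sc_eq lookup_mapp lookup_update in_keys_iff when_def intro!: poly_mapping_eqI)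

lemma project_id: "(X :: 'g toroidal) \<in> hat_carrier k \<Longrightarrow> project (Suc k) X = X"
proof (unfold hat_carrier_box, induction X rule: box_induct)
  case (E n x)
  then have "Poly_Mapping.lookup n (Suc k) = 0" by (auto simp: exponents_def in_keys_iff)
  then show ?case by (simp add: project_E)
next
  case (cd c d)
  then have "Poly_Mapping.lookup c (Suc k) = 0" "Poly_Mapping.lookup d (Suc k) = 0" by (auto simp: in_keys_iff)
  then show ?case by (auto simp: project_cd lookup_update intro!: poly_mapping_eqI)
qed (simp add: project_add)

definition ck :: "nat \<Rightarrow> 'g toroidal \<Rightarrow> complex" where
  "ck k X = Poly_Mapping.lookup (fst (snd X)) k"

lemma ck_add: "ck k (X + Y) = ck k X + ck k Y"
  and ck_sc: "ck k (sc z X) = z * ck k X"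
  by (cases X; cases Y; simp add: ck_def lookup_add sc_eq)+

lemma ck_hat: "X \<in> hat_carrier k \<Longrightarrow> ck (Suc k) X = 0"
  by (auto simp: ck_def hat_carrier_def in_keys_iff)

lemma project_hat: "(X :: 'g toroidal) \<in> hat_carrier (Suc k) \<Longrightarrow> project (Suc k) X \<in> hat_carrier k"
proof (unfold hat_carrier_box, induction X rule: box_induct)
  case (E n x)
  then have "Poly_Mapping.lookup n (Suc k) = 0 \<Longrightarrow> n \<in> exponents k"
    by (auto simp: exponents_def in_keys_iff le_Suc_eq subset_iff)
  then show ?case by (simp add: project_E box_zero) (simp add: box_def)
next
  case (cd c d)
  then show ?case by (auto simp: project_cd box_def in_keys_iff lookup_update le_Suc_eq split: if_splits)
qed (simp add: project_add box_add)

lemma project_tilde: "(X :: 'g toroidal) \<in> tilde_carrier (Suc k) \<Longrightarrow> project (Suc k) X \<in> tilde_carrier k"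
proof -
  assume X: "X \<in> tilde_carrier (Suc k)"
  then have "project (Suc k) X \<in> hat_carrier k" using project_hat tilde_subset_hat by blast
  moreover have "Poly_Mapping.update (Suc k) 0 0 = (0 :: nat \<Rightarrow>\<^sub>0 complex)"
    by (rule poly_mapping_eqI) (simp add: lookup_update)
  ultimately show ?thesis using X by (auto simp: tilde_carrier_def project_def)
qed

text \<open>On the nonnegative part, and likewise on the nonpositive part, the projection is a homomorphism
  and brackets have no \<open>c\<^sub>k\<close>-component: a sum of two exponents can only have degree zero if both have.\<close>

lemma project_br:
  assumes A: "\<And>n m. n \<in> A \<Longrightarrow> m \<in> A \<Longrightarrow> Poly_Mapping.lookup (n + m) k = 0 \<Longrightarrow> Poly_Mapping.lookup n k = 0"
    and "X \<in> box A UNIV UNIV" "Y \<in> box A UNIV UNIV"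
  shows "project k (br X Y) = br (project k X) (project k Y) \<and> ck k (br X Y) = 0"
  using assms(2)
proof (induction X rule: box_induct)
  case (E n x)
  show ?case
    using assms(3)
  proof (induction Y rule: box_induct)
    case (E m y)
    show ?case
    proof (cases "Poly_Mapping.lookup n k + Poly_Mapping.lookup m k = 0")
      case True
      then have n: "Poly_Mapping.lookup n k = 0" and m: "Poly_Mapping.lookup m k = 0"
        using A[OF \<open>n \<in> A\<close> E] by (simp_all add: lookup_add)
      have p: "project k (Poly_Mapping.single (n + m) u, cvec z n, 0) = (Poly_Mapping.single (n + m) u, cvec z n, 0)" for u z
        using n m by (auto simp: project_def lookup_mapp lookup_single lookup_update lookup_add when_def intro!: poly_mapping_eqI)
      show ?thesis
        using n m p[of _ 0] p by (auto simp: br_gens project_E ck_def lookup_add)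
    next
      case False
      then have "n + m \<noteq> 0" by (auto simp flip: lookup_add)
      moreover have "Poly_Mapping.lookup n k \<noteq> 0 \<or> Poly_Mapping.lookup m k \<noteq> 0" using False by auto
      ultimately show ?thesis using False by (auto simp: br_gens project_E ck_def lookup_add)
    qed
  next
    case (cd c d)
    show ?case by (auto simp: br_gens project_E project_cd ck_def pairing_update)
  next
    case (add Y Y')
    then show ?case by (simp add: br_add_right project_add ck_add)
  qed
next
  case (cd c d)
  show ?case
    using assms(3)
  proof (induction Y rule: box_induct)
    case (E m y)
    show ?case by (auto simp: br_gens project_E project_cd ck_def pairing_update)
  next
    case (cd c' d')
    show ?case by (simp add: br_gens project_cd ck_def)
  next
    case (add Y Y')
    then show ?case by (simp add: br_add_right project_add ck_add)
  qed
next
  case (add X X')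
  then show ?case by (simp add: br_add_left project_add ck_add)
qed

lemma inflate_simps [simp]:
  "carrier (inflate lev k M) = carrier M" "\<zero>\<^bsub>inflate lev k M\<^esub> = \<zero>\<^bsub>M\<^esub>"
  "m \<oplus>\<^bsub>inflate lev k M\<^esub> n = m \<oplus>\<^bsub>M\<^esub> n" "c \<odot>\<^bsub>inflate lev k M\<^esub> m = c \<odot>\<^bsub>M\<^esub> m"
  "act (inflate lev k M) X m = act M (project k X) m \<oplus>\<^bsub>M\<^esub> (lev * ck k X) \<odot>\<^bsub>M\<^esub> m"
  by (simp_all add: inflate_def ck_def)

lemma module_inflate:
  fixes M :: "('g toroidal, 'm) lie_rep"
  assumes "cmod M"
  shows "cmod (inflate lev k M)"
proof -
  from assms interpret cmod M .
  show ?thesis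
    by (rule image_cmod[OF cmod_axioms, where f = "\<lambda>m. m"]) simp_all
qed

text \<open>
  The condition on \<open>A\<close> holds for the exponents of nonnegative degree and for those of nonpositive degree.
  The first is the case needed to define the induced module, the second yields the coinduced one.
\<close>

lemma inflate_lie_module:
  assumes M: "is_lie_module (toroidal scale bracket form S') M"
    and S: "\<And>X. X \<in> S \<Longrightarrow> project k X \<in> S'" "S \<subseteq> box A UNIV UNIV"
    and A: "\<And>n m. n \<in> A \<Longrightarrow> m \<in> A \<Longrightarrow> Poly_Mapping.lookup (n + m) k = 0 \<Longrightarrow> Poly_Mapping.lookup n k = 0"
  shows "is_lie_module (toroidal scale bracket form S) (inflate lev k M)"
proof -
  interpret M: lie_mod "toroidal scale bracket form S'" M by (rule lie_mod.intro) (rule M)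
  interpret I: cmod "inflate lev k M" by (rule module_inflate) (rule M.cmod_axioms)
  have p: "project k X \<in> lie_carrier (toroidal scale bracket form S')" if "X \<in> S" for X using S(1) that by simp
  have addl: "act M (project k X + project k Y) m = act M (project k X) m \<oplus>\<^bsub>M\<^esub> act M (project k Y) m"
    if "X \<in> S" "Y \<in> S" "m \<in> carrier M" for X Y m
    using M.act_add_left p that by blast
  have scl: "act M (sc z (project k X)) m = z \<odot>\<^bsub>M\<^esub> act M (project k X) m" if "X \<in> S" "m \<in> carrier M" for X z m
    using M.act_scale_left[OF p] that by simp
  have minus: "m \<ominus>\<^bsub>inflate lev k M\<^esub> n = m \<ominus>\<^bsub>M\<^esub> n" for m n
    by (simp add: a_minus_def a_inv_def inflate_def)
  have brl: "act M (br (project k X) (project k Y)) m =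
      act M (project k X) (act M (project k Y) m) \<ominus>\<^bsub>M\<^esub> act M (project k Y) (act M (project k X) m)"
    if "X \<in> S" "Y \<in> S" "m \<in> carrier M" for X Y m
    using M.act_bracket[OF p p] that by simp
  have pb: "project k (br X Y) = br (project k X) (project k Y) \<and> ck k (br X Y) = 0" if "X \<in> S" "Y \<in> S" for X Y
    by (rule project_br[OF A subsetD[OF S(2) that(1)] subsetD[OF S(2) that(2)]])
  show ?thesis
  proof (rule is_lie_moduleI)
    show "cmod (inflate lev k M)" by (rule I.cmod_axioms)
  next
    fix X Y m n c
    assume "X \<in> lie_carrier (toroidal scale bracket form S)" "m \<in> carrier (inflate lev k M)"
    then have X: "X \<in> S" and m: "m \<in> carrier M" by simp_all
    show "act (inflate lev k M) X m \<in> carrier (inflate lev k M)" using X m p by simp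
    show "act (inflate lev k M) X (c \<odot>\<^bsub>inflate lev k M\<^esub> m) = c \<odot>\<^bsub>inflate lev k M\<^esub> act (inflate lev k M) X m"
      using X m p by (intro M.crd_eqI) (simp_all add: ps.scale_right_distrib mult.commute)
    show "act (inflate lev k M) (lie_scale (toroidal scale bracket form S) c X) m = c \<odot>\<^bsub>inflate lev k M\<^esub> act (inflate lev k M) X m"
      using X m p by (intro M.crd_eqI) (simp_all add: project_sc ck_sc scl ps.scale_right_distrib algebra_simps)
    { assume "n \<in> carrier (inflate lev k M)"
      then have n: "n \<in> carrier M" by simp
      show "act (inflate lev k M) X (m \<oplus>\<^bsub>inflate lev k M\<^esub> n) =
          act (inflate lev k M) X m \<oplus>\<^bsub>inflate lev k M\<^esub> act (inflate lev k M) X n"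
        using X m n p by (intro M.crd_eqI) (simp_all add: ps.scale_right_distrib algebra_simps) }
    assume "Y \<in> lie_carrier (toroidal scale bracket form S)"
    then have Y: "Y \<in> S" by simp
    show "act (inflate lev k M) (X + Y) m = act (inflate lev k M) X m \<oplus>\<^bsub>inflate lev k M\<^esub> act (inflate lev k M) Y m"
      using X Y m p by (intro M.crd_eqI) (simp_all add: project_add ck_add addl ps.scale_left_distrib algebra_simps)
    show "act (inflate lev k M) (lie_bracket (toroidal scale bracket form S) X Y) m =
       act (inflate lev k M) X (act (inflate lev k M) Y m) \<ominus>\<^bsub>inflate lev k M\<^esub> act (inflate lev k M) Y (act (inflate lev k M) X m)"
    proof -
      let ?x = "act M (project k X)" and ?y = "act M (project k Y)"
      have c: "?x m \<in> carrier M" "?y m \<in> carrier M" "?x (?y m) \<in> carrier M" "?y (?x m) \<in> carrier M"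
        using X Y m p by simp_all
      have "crd M (?x (?y m \<oplus>\<^bsub>M\<^esub> (lev * ck k Y) \<odot>\<^bsub>M\<^esub> m)) = crd M (?x (?y m)) + psc (lev * ck k Y) (crd M (?x m))"
        "crd M (?y (?x m \<oplus>\<^bsub>M\<^esub> (lev * ck k X) \<odot>\<^bsub>M\<^esub> m)) = crd M (?y (?x m)) + psc (lev * ck k X) (crd M (?y m))"
        using X Y m p c by simp_all
      then show ?thesis
        unfolding minus inflate_simps toroidal_simps using pb[OF X Y] X Y m p c brl[OF X Y m]
        by (intro M.crd_eqI) (simp_all add: ps.scale_right_distrib mult.commute)
    qed
  qed
qed

end


section \<open>Injectivity of the canonical map\<close>

text \<open>
  A Lie algebra \<open>L\<close> that is the direct sum of subalgebras \<open>Q\<close> and \<open>N\<close>, with projections \<open>qq\<close> and \<open>nn\<close>, and a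
  \<open>Q\<close>-module with action \<open>\<sigma>\<close>. Its coinduced module, the space of \<open>U(Q)\<close>-linear maps from \<open>U(L)\<close>, should
  be the space of all linear maps on \<open>U(N)\<close>, since \<open>U(L)\<close> is \<open>U(Q) \<otimes> U(N)\<close>. The latter decomposition
  belongs to the Poincare-Birkhoff-Witt theorem, which is bypassed here: a linear map on \<open>U(N)\<close> is
  represented by a function of words in \<open>N\<close>, the action of \<open>L\<close> on such functions is defined by recursion on
  the words, and the module axioms are verified by induction.

  The value \<open>f [n\<^sub>1, \<dots>, n\<^sub>r]\<close> is to be thought of as the value of \<open>n\<^sub>r \<cdots> n\<^sub>1 f\<close> at the empty word; words are in
  reverse order so that the action of \<open>n\<close> in \<open>N\<close> is to prepend it.
\<close>

locale coinduction =
  fixes br :: "'x::ab_group_add \<Rightarrow> 'x \<Rightarrow> 'x" and sc :: "complex \<Rightarrow> 'x \<Rightarrow> 'x"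
    and L N Q :: "'x set" and nn qq :: "'x \<Rightarrow> 'x"
    and \<sigma> :: "'x \<Rightarrow> ('m \<Rightarrow>\<^sub>0 complex) \<Rightarrow> ('m \<Rightarrow>\<^sub>0 complex)"
  assumes br_add: "br (x + y) z = br x z + br y z" "br z (x + y) = br z x + br z y"
    and br_sc: "br (sc c x) y = sc c (br x y)" "br x (sc c y) = sc c (br x y)"
    and br_antisym: "br x y = - br y x"
    and br_leibniz: "br x (br y z) = br (br x y) z + br y (br x z)"
    and sc_zero: "sc 0 x = 0" and sc_uminus: "sc (- 1) x = - x"
    and L_closed: "x \<in> L \<Longrightarrow> y \<in> L \<Longrightarrow> x + y \<in> L" "x \<in> L \<Longrightarrow> y \<in> L \<Longrightarrow> br x y \<in> L" "x \<in> L \<Longrightarrow> sc c x \<in> L"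
    and N_closed: "x \<in> N \<Longrightarrow> y \<in> N \<Longrightarrow> x + y \<in> N" "x \<in> N \<Longrightarrow> y \<in> N \<Longrightarrow> br x y \<in> N" "x \<in> N \<Longrightarrow> sc c x \<in> N"
    and Q_closed: "x \<in> Q \<Longrightarrow> y \<in> Q \<Longrightarrow> x + y \<in> Q" "x \<in> Q \<Longrightarrow> y \<in> Q \<Longrightarrow> br x y \<in> Q" "x \<in> Q \<Longrightarrow> sc c x \<in> Q"
    and N_L: "x \<in> N \<Longrightarrow> x \<in> L" and Q_L: "x \<in> Q \<Longrightarrow> x \<in> L"
    and nn_N: "x \<in> L \<Longrightarrow> nn x \<in> N" and qq_Q: "x \<in> L \<Longrightarrow> qq x \<in> Q"
    and nn_linear: "nn (x + y) = nn x + nn y" "nn (sc c x) = sc c (nn x)"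
    and qq_linear: "qq (x + y) = qq x + qq y" "qq (sc c x) = sc c (qq x)"
    and decomp: "nn x + qq x = x"
    and nn_on_N: "x \<in> N \<Longrightarrow> nn x = x" and qq_on_Q: "x \<in> Q \<Longrightarrow> qq x = x"
    and \<sigma>_add: "q \<in> Q \<Longrightarrow> \<sigma> q (v + w) = \<sigma> q v + \<sigma> q w" and \<sigma>_psc: "q \<in> Q \<Longrightarrow> \<sigma> q (psc c v) = psc c (\<sigma> q v)"
    and \<sigma>_add_left: "q \<in> Q \<Longrightarrow> q' \<in> Q \<Longrightarrow> \<sigma> (q + q') v = \<sigma> q v + \<sigma> q' v"
    and \<sigma>_sc: "q \<in> Q \<Longrightarrow> \<sigma> (sc c q) v = psc c (\<sigma> q v)"
    and \<sigma>_br: "q \<in> Q \<Longrightarrow> q' \<in> Q \<Longrightarrow> \<sigma> (br q q') v = \<sigma> q (\<sigma> q' v) - \<sigma> q' (\<sigma> q v)"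
begin

lemma qq_on_N: "x \<in> N \<Longrightarrow> qq x = 0"
  using decomp[of x] nn_on_N[of x] by simp

lemma nn_on_Q: "x \<in> Q \<Longrightarrow> nn x = 0"
  using decomp[of x] qq_on_Q[of x] by simp

text \<open>
  The value at \<open>w\<close> of \<open>q\<close> in \<open>Q\<close> applied to \<open>f\<close>. At the empty word it is given by \<open>\<sigma>\<close>. At a longer word it
  is forced by the relation \<open>n q = q n - [q, n]\<close>, in which \<open>[q, n]\<close> is split into its parts in \<open>N\<close> and \<open>Q\<close>;
  both act at the shorter word \<open>w\<close>, so the recursion is well founded. \<open>A\<close> below is the action of a general
  element.
\<close>

primrec T :: "'x list \<Rightarrow> 'x \<Rightarrow> ('x list \<Rightarrow> ('m \<Rightarrow>\<^sub>0 complex)) \<Rightarrow> ('m \<Rightarrow>\<^sub>0 complex)" where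
  "T [] q f = \<sigma> q (f [])"
| "T (n # w) q f = T w q (\<lambda>v. f (n # v)) - f (nn (br q n) # w) - T w (qq (br q n)) f"

definition A :: "'x \<Rightarrow> ('x list \<Rightarrow> ('m \<Rightarrow>\<^sub>0 complex)) \<Rightarrow> 'x list \<Rightarrow> ('m \<Rightarrow>\<^sub>0 complex)" where
  "A x f w = f (nn x # w) + T w (qq x) f"

lemma T_Cons: "T (n # w) q f = T w q (\<lambda>v. f (n # v)) - A (br q n) f w"
  by (simp add: A_def)

text \<open>
  A function of words comes from a linear map on \<open>U(N)\<close> if it is linear in each letter and compatible with
  the commutation relations of \<open>N\<close>. The second condition is \<open>Rel\<close>.
\<close>

definition mlin :: "('x list \<Rightarrow> ('m \<Rightarrow>\<^sub>0 complex)) \<Rightarrow> bool" where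
  "mlin f \<longleftrightarrow> (\<forall>u\<in>lists N. \<forall>v\<in>lists N. \<forall>n\<in>N. (\<forall>n'\<in>N. f (u @ (n + n') # v) = f (u @ n # v) + f (u @ n' # v)) \<and>
     (\<forall>c. f (u @ sc c n # v) = psc c (f (u @ n # v))))"

lemma mlinD:
  assumes "mlin f" "u \<in> lists N" "v \<in> lists N" "n \<in> N"
  shows "n' \<in> N \<Longrightarrow> f (u @ (n + n') # v) = f (u @ n # v) + f (u @ n' # v)"
    and "f (u @ sc c n # v) = psc c (f (u @ n # v))"
  using assms unfolding mlin_def by blast+

lemma mlin_hd:
  assumes "mlin f" "v \<in> lists N" "n \<in> N"
  shows "n' \<in> N \<Longrightarrow> f ((n + n') # v) = f (n # v) + f (n' # v)" and "f (sc c n # v) = psc c (f (n # v))"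
  using mlinD[OF assms(1) lists.Nil assms(2,3)] by simp_all

lemma mlin_Cons: "mlin f \<Longrightarrow> m \<in> N \<Longrightarrow> mlin (\<lambda>v. f (m # v))"
  unfolding mlin_def by (metis append_Cons lists.Cons)

lemma N_br_Q [simp]: "q \<in> Q \<Longrightarrow> n \<in> N \<Longrightarrow> br q n \<in> L"
  by (rule L_closed(2)[OF Q_L N_L])

lemma T_cong:
  assumes "w \<in> lists N" "q \<in> Q" "\<And>v. v \<in> lists N \<Longrightarrow> f v = g v"
  shows "T w q f = T w q g"
  using assms
proof (induction w arbitrary: q f g)
  case (Cons n w)
  have "T w q (\<lambda>v. f (n # v)) = T w q (\<lambda>v. g (n # v))"
    using Cons.hyps Cons.prems by (intro Cons.IH) auto
  moreover have "T w (qq (br q n)) f = T w (qq (br q n)) g"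
    using Cons.hyps Cons.prems by (intro Cons.IH qq_Q) auto
  moreover have "f (nn (br q n) # w) = g (nn (br q n) # w)"
    using Cons.hyps Cons.prems nn_N[of "br q n"] by auto
  ultimately show ?case by simp
qed simp

lemma T_fun_add: "w \<in> lists N \<Longrightarrow> q \<in> Q \<Longrightarrow> T w q (\<lambda>v. f v + g v) = T w q f + T w q g"
proof (induction w arbitrary: q f g)
  case (Cons n w)
  then show ?case using qq_Q[of "br q n"] by simp
qed (simp add: \<sigma>_add)

lemma T_fun_psc: "w \<in> lists N \<Longrightarrow> q \<in> Q \<Longrightarrow> T w q (\<lambda>v. psc c (f v)) = psc c (T w q f)"
proof (induction w arbitrary: q f)
  case (Cons n w)
  then show ?case using qq_Q[of "br q n"] by (simp add: ps.scale_right_diff_distrib)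
qed (simp add: \<sigma>_psc)

lemma T_fun_diff: "w \<in> lists N \<Longrightarrow> q \<in> Q \<Longrightarrow> T w q (\<lambda>v. f v - g v) = T w q f - T w q g"
  using T_fun_add[of w q "\<lambda>v. f v - g v" g] by simp

lemma T_fun_zero: "w \<in> lists N \<Longrightarrow> q \<in> Q \<Longrightarrow> T w q (\<lambda>v. 0) = 0"
  using T_fun_psc[of w q 0 "\<lambda>v. 0"] by simp

lemma T_left:
  assumes "w \<in> lists N" "q \<in> Q" "mlin f"
  shows "q' \<in> Q \<Longrightarrow> T w (q + q') f = T w q f + T w q' f" and "T w (sc c q) f = psc c (T w q f)"
proof -
  have "(\<forall>q'\<in>Q. T w (q + q') f = T w q f + T w q' f) \<and> (\<forall>c. T w (sc c q) f = psc c (T w q f))"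
    using assms
  proof (induction w arbitrary: q f)
    case Nil
    then show ?case by (simp add: \<sigma>_add_left \<sigma>_sc)
  next
    case (Cons n w)
    have IH1: "\<forall>q'\<in>Q. T w (q + q') (\<lambda>v. f (n # v)) = T w q (\<lambda>v. f (n # v)) + T w q' (\<lambda>v. f (n # v))"
       "\<forall>c. T w (sc c q) (\<lambda>v. f (n # v)) = psc c (T w q (\<lambda>v. f (n # v)))"
      using Cons.IH[OF Cons.prems(1) mlin_Cons[OF Cons.prems(2)]] Cons.hyps by auto
    have qqn: "qq (br r n) \<in> Q" "nn (br r n) \<in> N" if "r \<in> Q" for r
      using that Cons.hyps by (auto intro: qq_Q nn_N)
    have IH2: "\<forall>q'\<in>Q. T w (qq (br q n) + q') f = T w (qq (br q n)) f + T w q' f"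
       "\<forall>c. T w (sc c (qq (br q n))) f = psc c (T w (qq (br q n)) f)"
      using Cons.IH[OF qqn(1)[OF Cons.prems(1)] Cons.prems(2)] by auto
    have h: "n' \<in> N \<Longrightarrow> f ((nn (br q n) + n') # w) = f (nn (br q n) # w) + f (n' # w)"
      "f (sc c (nn (br q n)) # w) = psc c (f (nn (br q n) # w))" for n' c
      using mlin_hd[OF Cons.prems(2) Cons.hyps(2) qqn(2)[OF Cons.prems(1)]] by auto
    show ?case
      using IH1 IH2 h qqn
      by (simp add: br_add br_sc nn_linear qq_linear ps.scale_right_diff_distrib)
  qed
  then show "q' \<in> Q \<Longrightarrow> T w (q + q') f = T w q f + T w q' f" "T w (sc c q) f = psc c (T w q f)" by auto
qed

lemma zero_hd: "mlin f \<Longrightarrow> v \<in> lists N \<Longrightarrow> n \<in> N \<Longrightarrow> f (0 # v) = 0"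
  using mlin_hd(2)[of f v n 0] by (simp add: sc_zero)

lemma T_zero: "mlin f \<Longrightarrow> w \<in> lists N \<Longrightarrow> q \<in> Q \<Longrightarrow> T w 0 f = 0"
  using T_left(2)[of w q f 0] by (simp add: sc_zero)

lemma A_add: "mlin f \<Longrightarrow> w \<in> lists N \<Longrightarrow> x \<in> L \<Longrightarrow> y \<in> L \<Longrightarrow> A (x + y) f w = A x f w + A y f w"
  unfolding A_def nn_linear qq_linear
  by (simp add: mlin_hd(1)[OF _ _ nn_N nn_N] T_left(1)[OF _ qq_Q _ qq_Q])

lemma A_sc: "mlin f \<Longrightarrow> w \<in> lists N \<Longrightarrow> x \<in> L \<Longrightarrow> A (sc c x) f w = psc c (A x f w)"
  unfolding A_def nn_linear qq_linear
  by (simp add: mlin_hd(2)[OF _ _ nn_N] T_left(2)[OF _ qq_Q] ps.scale_right_distrib)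

lemma L_uminus: "x \<in> L \<Longrightarrow> - x \<in> L"
  using L_closed(3)[of x "- 1"] by (simp add: sc_uminus)

lemma A_uminus: "mlin f \<Longrightarrow> w \<in> lists N \<Longrightarrow> x \<in> L \<Longrightarrow> A (- x) f w = - A x f w"
  using A_sc[of f w x "- 1"] by (simp add: sc_uminus ps.scale_minus_left)

lemma A_on_Q: "mlin f \<Longrightarrow> w \<in> lists N \<Longrightarrow> q \<in> Q \<Longrightarrow> A q f w = T w q f"
  using zero_hd[of f w "nn q"] nn_N[OF Q_L, of q] by (simp add: A_def nn_on_Q qq_on_Q)

lemma A_on_N: "mlin f \<Longrightarrow> w \<in> lists N \<Longrightarrow> n \<in> N \<Longrightarrow> A n f w = f (n # w)"
  using T_zero[of f w "qq n"] qq_Q[OF N_L, of n] by (simp add: A_def nn_on_N qq_on_N)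

lemma A_cong:
  assumes "w \<in> lists N" "x \<in> L" "\<And>v. v \<in> lists N \<Longrightarrow> f v = g v"
  shows "A x f w = A x g w"
  unfolding A_def using T_cong[OF assms(1) qq_Q[OF assms(2)] assms(3)] assms nn_N[OF assms(2)] by simp

lemma A_fun_add: "w \<in> lists N \<Longrightarrow> x \<in> L \<Longrightarrow> A x (\<lambda>v. f v + g v) w = A x f w + A x g w"
  by (simp add: A_def T_fun_add[OF _ qq_Q])

lemma A_fun_psc: "w \<in> lists N \<Longrightarrow> x \<in> L \<Longrightarrow> A x (\<lambda>v. psc c (f v)) w = psc c (A x f w)"
  by (simp add: A_def T_fun_psc[OF _ qq_Q] ps.scale_right_distrib)

lemma mlinI:
  assumes "\<And>u v n n'. u \<in> lists N \<Longrightarrow> v \<in> lists N \<Longrightarrow> n \<in> N \<Longrightarrow> n' \<in> N \<Longrightarrow> f (u @ (n + n') # v) = f (u @ n # v) + f (u @ n' # v)"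
    and "\<And>u v n c. u \<in> lists N \<Longrightarrow> v \<in> lists N \<Longrightarrow> n \<in> N \<Longrightarrow> f (u @ sc c n # v) = psc c (f (u @ n # v))"
  shows "mlin f"
  using assms unfolding mlin_def by blast

lemma mlin_T:
  assumes "mlin f" "q \<in> Q"
  shows "mlin (\<lambda>w. T w q f)"
proof -
  have "(\<forall>n'\<in>N. T (u @ (n + n') # v) q f = T (u @ n # v) q f + T (u @ n' # v) q f) \<and>
      (\<forall>c. T (u @ sc c n # v) q f = psc c (T (u @ n # v) q f))"
    if "u \<in> lists N" "v \<in> lists N" "n \<in> N" for u v n
    using that(1) assms
  proof (induction u arbitrary: f q)
    case Nil
    have 1: "T v q (\<lambda>w. f ((n + n') # w)) = T v q (\<lambda>w. f (n # w)) + T v q (\<lambda>w. f (n' # w))" if "n' \<in> N" for n'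
    proof -
      have "T v q (\<lambda>w. f ((n + n') # w)) = T v q (\<lambda>w. f (n # w) + f (n' # w))"
        using Nil \<open>v \<in> lists N\<close> \<open>n \<in> N\<close> that by (intro T_cong mlin_hd(1))
      then show ?thesis using Nil \<open>v \<in> lists N\<close> by (simp add: T_fun_add)
    qed
    have 2: "T v q (\<lambda>w. f (sc c n # w)) = psc c (T v q (\<lambda>w. f (n # w)))" for c
    proof -
      have "T v q (\<lambda>w. f (sc c n # w)) = T v q (\<lambda>w. psc c (f (n # w)))"
        using Nil \<open>v \<in> lists N\<close> \<open>n \<in> N\<close> by (intro T_cong mlin_hd(2))
      then show ?thesis using Nil \<open>v \<in> lists N\<close> by (simp add: T_fun_psc)
    qed
    show ?case
      using 1 2 Nil that
      by (simp add: T_Cons br_add br_sc A_add A_sc ps.scale_right_diff_distrib del: T.simps(2))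
  next
    case (Cons m u)
    have m: "qq (br q m) \<in> Q" "nn (br q m) \<in> N" using Cons.hyps Cons.prems by (auto intro: qq_Q nn_N)
    have IH1: "(\<forall>n'\<in>N. T (u @ (n + n') # v) q (\<lambda>w. f (m # w)) = T (u @ n # v) q (\<lambda>w. f (m # w)) + T (u @ n' # v) q (\<lambda>w. f (m # w))) \<and>
        (\<forall>c. T (u @ sc c n # v) q (\<lambda>w. f (m # w)) = psc c (T (u @ n # v) q (\<lambda>w. f (m # w))))"
      using Cons.IH[OF mlin_Cons[OF Cons.prems(1) Cons.hyps(1)] Cons.prems(2)] .
    note IH2 = Cons.IH[OF Cons.prems(1) m(1)]
    have h: "n' \<in> N \<Longrightarrow> f (nn (br q m) # u @ (n + n') # v) = f (nn (br q m) # u @ n # v) + f (nn (br q m) # u @ n' # v)"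
      "f (nn (br q m) # u @ sc c n # v) = psc c (f (nn (br q m) # u @ n # v))" for n' c
      using mlinD[OF Cons.prems(1), of "nn (br q m) # u" v n] m(2) Cons.hyps that by auto
    show ?case using IH1 IH2 h by (simp add: ps.scale_right_diff_distrib)
  qed
  then show ?thesis by (intro mlinI) blast+
qed

lemma mlin_A: "mlin f \<Longrightarrow> x \<in> L \<Longrightarrow> mlin (\<lambda>w. A x f w)"
  unfolding A_def
proof (rule mlinI)
  fix u v n n' c
  assume f: "mlin f" and x: "x \<in> L" and uv: "u \<in> lists N" "v \<in> lists N" "n \<in> N"
  note t = mlinD[OF mlin_T[OF f qq_Q[OF x]] uv]
  note h = mlinD[OF mlin_Cons[OF f nn_N[OF x]] uv]
  show "n' \<in> N \<Longrightarrow> f (nn x # u @ (n + n') # v) + T (u @ (n + n') # v) (qq x) f =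
      f (nn x # u @ n # v) + T (u @ n # v) (qq x) f + (f (nn x # u @ n' # v) + T (u @ n' # v) (qq x) f)"
    using t h by simp
  show "f (nn x # u @ sc c n # v) + T (u @ sc c n # v) (qq x) f = psc c (f (nn x # u @ n # v) + T (u @ n # v) (qq x) f)"
    using t h by (simp add: ps.scale_right_distrib)
qed

text \<open>The commutator of an element of \<open>Q\<close> with an arbitrary element, at a fixed word. The hypothesis for two
  elements of \<open>Q\<close> is proved afterwards by induction on the word, and that induction uses this lemma for
  shorter words.\<close>

lemma commutator_step:
  assumes f: "mlin f" and w: "w \<in> lists N" and q: "q \<in> Q" and x: "x \<in> L"
    and IH: "\<And>q'. q' \<in> Q \<Longrightarrow> T w q (\<lambda>v. T v q' f) - T w q' (\<lambda>v. T v q f) = T w (br q q') f"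
  shows "T w q (A x f) - A x (\<lambda>v. T v q f) w = A (br q x) f w"
proof -
  have nx: "nn x \<in> N" and qx: "qq x \<in> Q" using x by (auto intro: nn_N qq_Q)
  have "T w q (A x f) = T w q (\<lambda>v. f (nn x # v)) + T w q (\<lambda>v. T v (qq x) f)"
    unfolding A_def by (rule T_fun_add[OF w q])
  moreover have "A x (\<lambda>v. T v q f) w = T w q (\<lambda>v. f (nn x # v)) - A (br q (nn x)) f w + T w (qq x) (\<lambda>v. T v q f)"
    by (simp add: A_def)
  moreover have "A (br q x) f w = A (br q (nn x)) f w + A (br q (qq x)) f w"
    using f w q nx qx by (subst decomp[of x, symmetric]) (simp add: br_add A_add Q_L Q_closed(2))
  moreover have "A (br q (qq x)) f w = T w (br q (qq x)) f"
    using f w q qx by (intro A_on_Q Q_closed(2))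
  ultimately show ?thesis using IH[OF qx] by (simp add: algebra_simps)
qed

text \<open>
  Moving two elements of \<open>Q\<close> past the first letter produces commutators with the brackets, which the
  induction hypothesis controls through \<open>commutator_step\<close>; what is left cancels by the Leibniz rule.
\<close>

lemma T_bracket:
  assumes "w \<in> lists N" "mlin f" "q \<in> Q" "q' \<in> Q"
  shows "T w q (\<lambda>v. T v q' f) - T w q' (\<lambda>v. T v q f) = T w (br q q') f"
  using assms
proof (induction w arbitrary: f q q')
  case Nil
  then show ?case by (simp add: \<sigma>_br)
next
  case (Cons n w)
  note f = Cons.prems(1) and q = Cons.prems(2) and q' = Cons.prems(3) and n = Cons.hyps(1) and w = Cons.hyps(2)
  have step: "T (n # w) r (\<lambda>v. T v r' f) =
      T w r (\<lambda>v. T v r' (\<lambda>u. f (n # u))) - T w r (A (br r' n) f) - A (br r n) (\<lambda>v. T v r' f) w"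
    if "r \<in> Q" for r r'
    unfolding T_Cons using T_fun_diff[OF w that] by simp
  have s: "br q n \<in> L" "br q' n \<in> L" using q q' n by simp_all
  have C1: "T w q (A (br q' n) f) - A (br q' n) (\<lambda>v. T v q f) w = A (br q (br q' n)) f w"
    by (rule commutator_step[OF f w q s(2)]) (rule Cons.IH[OF f q])
  have C2: "T w q' (A (br q n) f) - A (br q n) (\<lambda>v. T v q' f) w = A (br q' (br q n)) f w"
    by (rule commutator_step[OF f w q' s(1)]) (rule Cons.IH[OF f q'])
  have "T w q (\<lambda>v. T v q' (\<lambda>u. f (n # u))) - T w q' (\<lambda>v. T v q (\<lambda>u. f (n # u))) = T w (br q q') (\<lambda>u. f (n # u))"
    by (rule Cons.IH[OF mlin_Cons[OF f n] q q'])
  moreover have "A (br (br q q') n) f w = A (br q (br q' n)) f w - A (br q' (br q n)) f w"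
  proof -
    have "br q (br q' n) = br (br q q') n + br q' (br q n)" by (rule br_leibniz)
    moreover have "br (br q q') n \<in> L" "br q' (br q n) \<in> L"
      using q q' n by (simp_all add: Q_closed L_closed(2) Q_L)
    ultimately show ?thesis using A_add[OF f w] by simp
  qed
  ultimately show ?case
    unfolding step[OF q] step[OF q'] T_Cons[of n w "br q q'"] using C1 C2 by (simp add: algebra_simps)
qed

lemma commutator:
  "mlin f \<Longrightarrow> w \<in> lists N \<Longrightarrow> q \<in> Q \<Longrightarrow> x \<in> L \<Longrightarrow> T w q (A x f) - A x (\<lambda>v. T v q f) w = A (br q x) f w"
  by (rule commutator_step) (auto intro: T_bracket)

text \<open>The relation \<open>n n' - n' n = [n, n']\<close>, with the words reversed.\<close>

definition Rel :: "('x list \<Rightarrow> ('m \<Rightarrow>\<^sub>0 complex)) \<Rightarrow> bool" where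
  "Rel f \<longleftrightarrow> (\<forall>v\<in>lists N. \<forall>u\<in>lists N. \<forall>n\<in>N. \<forall>n'\<in>N.
     f (v @ n' # n # u) - f (v @ n # n' # u) = f (v @ br n n' # u))"

lemma RelD: "Rel f \<Longrightarrow> v \<in> lists N \<Longrightarrow> u \<in> lists N \<Longrightarrow> n \<in> N \<Longrightarrow> n' \<in> N \<Longrightarrow>
    f (v @ n' # n # u) - f (v @ n # n' # u) = f (v @ br n n' # u)"
  unfolding Rel_def by blast

lemma Rel_hd: "Rel f \<Longrightarrow> u \<in> lists N \<Longrightarrow> n \<in> N \<Longrightarrow> n' \<in> N \<Longrightarrow> f (n' # n # u) - f (n # n' # u) = f (br n n' # u)"
  using RelD[of f "[]" u n n'] by simp

lemma Rel_Cons: "Rel f \<Longrightarrow> m \<in> N \<Longrightarrow> Rel (\<lambda>v. f (m # v))"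
  unfolding Rel_def by (metis append_Cons lists.Cons)

text \<open>
  The commutator of a general element with an element of \<open>N\<close>: the part in \<open>Q\<close> is the definition of \<open>T\<close> and the
  part in \<open>N\<close> is \<open>Rel\<close>.
\<close>

lemma A_Cons:
  assumes f: "mlin f" "Rel f" and u: "u \<in> lists N" and x: "x \<in> L" and m: "m \<in> N"
  shows "A x (\<lambda>v. f (m # v)) u - A x f (m # u) = A (br x m) f u"
proof -
  have nx: "nn x \<in> N" and qx: "qq x \<in> Q" using x by (auto intro: nn_N qq_Q)
  have "A (br x m) f u = A (br (nn x) m) f u + A (br (qq x) m) f u"
    using f u m nx qx by (subst decomp[of x, symmetric]) (simp add: br_add A_add N_L N_closed(2))
  moreover have "A (br (nn x) m) f u = f (br (nn x) m # u)"
    using f u m nx by (intro A_on_N N_closed(2))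
  moreover have "f (m # nn x # u) - f (nn x # m # u) = f (br (nn x) m # u)"
    using f u m nx by (intro Rel_hd)
  moreover have "A x f (m # u) = f (nn x # m # u) + (T u (qq x) (\<lambda>v. f (m # v)) - A (br (qq x) m) f u)"
    by (simp add: A_def)
  moreover have "A x (\<lambda>v. f (m # v)) u = f (m # nn x # u) + T u (qq x) (\<lambda>v. f (m # v))"
    by (simp add: A_def)
  ultimately show ?thesis by (simp add: algebra_simps)
qed

lemma Rel_T:
  assumes "mlin f" "Rel f" "q \<in> Q"
  shows "Rel (\<lambda>w. T w q f)"
proof -
  have "T (v @ n' # n # u) q f - T (v @ n # n' # u) q f = T (v @ br n n' # u) q f"
    if "v \<in> lists N" and u: "u \<in> lists N" and n: "n \<in> N" and n': "n' \<in> N" for v u n n'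
    using that(1) assms
  proof (induction v arbitrary: f q)
    case Nil
    note f = Nil(1,2) and q = Nil(3)
    have e: "T (a # b # u) q f = T u q (\<lambda>v. f (a # b # v)) - A (br q b) (\<lambda>v. f (a # v)) u - A (br q a) f (b # u)"
      if "a \<in> N" "b \<in> N" for a b
      by (simp only: T_Cons)
    have "T u q (\<lambda>v. f (n' # n # v)) - T u q (\<lambda>v. f (n # n' # v)) = T u q (\<lambda>v. f (n' # n # v) - f (n # n' # v))"
      using T_fun_diff[OF u q] by simp
    also have "\<dots> = T u q (\<lambda>v. f (br n n' # v))"
      using f n n' u q by (intro T_cong Rel_hd)
    finally have 1: "T u q (\<lambda>v. f (n' # n # v)) - T u q (\<lambda>v. f (n # n' # v)) = T u q (\<lambda>v. f (br n n' # v))" .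
    have s: "br q n \<in> L" "br q n' \<in> L" "br (br q n) n' \<in> L" "br (br q n') n \<in> L"
      using q n n' by (simp_all add: L_closed(2) N_L)
    note D = A_Cons[OF f u s(1) n'] A_Cons[OF f u s(2) n]
    have "br q (br n n') = br (br q n) n' + - br (br q n') n"
      using br_leibniz[of q n n'] br_antisym[of n "br q n'"] by simp
    then have "A (br q (br n n')) f u = A (br (br q n) n') f u - A (br (br q n') n) f u"
      using A_add[OF f(1) u s(3) L_uminus[OF s(4)]] A_uminus[OF f(1) u s(4)] by simp
    moreover note 1[unfolded diff_eq_eq] D[unfolded diff_eq_eq]
    ultimately show ?case
      unfolding append_Nil e[OF n' n] e[OF n n'] T_Cons[of "br n n'" u q f] by simp
  next
    case (Cons m v)
    note f = Cons.prems(1,2) and q = Cons.prems(3) and m = Cons.hyps(1)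
    have s: "qq (br q m) \<in> Q" "nn (br q m) \<in> N" using q m by (auto intro: qq_Q nn_N)
    note IH1 = Cons.IH[OF mlin_Cons[OF f(1) m] Rel_Cons[OF f(2) m] q]
    note IH2 = Cons.IH[OF f s(1)]
    have h: "f (nn (br q m) # v @ n' # n # u) - f (nn (br q m) # v @ n # n' # u) = f (nn (br q m) # v @ br n n' # u)"
      using RelD[OF f(2), of "nn (br q m) # v" u n n'] s(2) Cons.hyps u n n' by simp
    show ?case using IH1 IH2 h by (simp add: algebra_simps)
  qed
  then show ?thesis by (simp add: Rel_def)
qed

lemma Rel_A:
  assumes "mlin f" "Rel f" "x \<in> L"
  shows "Rel (\<lambda>w. A x f w)"
  unfolding Rel_def
proof (intro ballI)
  fix v u n n' assume vu: "v \<in> lists N" "u \<in> lists N" "n \<in> N" "n' \<in> N"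
  show "A x f (v @ n' # n # u) - A x f (v @ n # n' # u) = A x f (v @ br n n' # u)"
    using RelD[OF Rel_T[OF assms(1,2) qq_Q[OF assms(3)]] vu] RelD[OF Rel_Cons[OF assms(2) nn_N[OF assms(3)]] vu]
    unfolding A_def by (simp add: algebra_simps)
qed

text \<open>
  The module axiom for brackets, assembled from the two commutators: \<open>commutator\<close> for the part of \<open>x\<close> in \<open>Q\<close>,
  and \<open>A_Cons\<close> for its part in \<open>N\<close>.
\<close>

lemma A_bracket:
  assumes f: "mlin f" "Rel f" and w: "w \<in> lists N" and x: "x \<in> L" and y: "y \<in> L"
  shows "A (br x y) f w = A x (A y f) w - A y (A x f) w"
proof -
  have nx: "nn x \<in> N" and qx: "qq x \<in> Q" using x by (auto intro: nn_N qq_Q)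
  have 1: "A x (A y f) w = A y f (nn x # w) + T w (qq x) (A y f)" by (simp add: A_def)
  have 2: "A y (A x f) w = A y (\<lambda>v. f (nn x # v)) w + A y (\<lambda>v. T v (qq x) f) w"
  proof -
    have "A x f = (\<lambda>v. f (nn x # v) + T v (qq x) f)" by (rule ext) (simp add: A_def)
    then show ?thesis using A_fun_add[OF w y] by simp
  qed
  have 3: "A y (\<lambda>v. f (nn x # v)) w - A y f (nn x # w) = A (br y (nn x)) f w"
    by (rule A_Cons[OF f w y nx])
  have 4: "T w (qq x) (A y f) - A y (\<lambda>v. T v (qq x) f) w = A (br (qq x) y) f w"
    by (rule commutator[OF f(1) w qx y])
  have 5: "A (br x y) f w = A (br (nn x) y) f w + A (br (qq x) y) f w"
    using f w y nx qx by (subst decomp[of x, symmetric]) (simp add: br_add A_add L_closed(2) N_L Q_L)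
  have "A (br (nn x) y) f w = - A (br y (nn x)) f w"
    using f w y nx by (subst br_antisym) (simp add: A_uminus L_closed(2) N_L)
  then show ?thesis using 1 2 3 4 5 by (simp add: algebra_simps)
qed

definition coind :: "('x, 'x list \<Rightarrow> ('m \<Rightarrow>\<^sub>0 complex)) lie_rep" where
  "coind = mk_rep {f. mlin f \<and> Rel f \<and> (\<forall>w. w \<notin> lists N \<longrightarrow> f w = 0)} (\<lambda>w. 0) (\<lambda>f g w. f w + g w)
     (\<lambda>c f w. psc c (f w)) (\<lambda>x f w. if w \<in> lists N then A x f w else 0)"

lemma coind_simps:
  "carrier coind = {f. mlin f \<and> Rel f \<and> (\<forall>w. w \<notin> lists N \<longrightarrow> f w = 0)}" "\<zero>\<^bsub>coind\<^esub> = (\<lambda>w. 0)"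
  "f \<oplus>\<^bsub>coind\<^esub> g = (\<lambda>w. f w + g w)" "c \<odot>\<^bsub>coind\<^esub> f = (\<lambda>w. psc c (f w))"
  "act coind x f = (\<lambda>w. if w \<in> lists N then A x f w else 0)"
  by (simp_all add: coind_def mk_rep_def)

lemma mlin_cong: "(\<And>v. v \<in> lists N \<Longrightarrow> f v = g v) \<Longrightarrow> mlin f = mlin g"
  unfolding mlin_def using N_closed by (intro ball_cong refl conj_cong) (auto simp del: append_in_lists_conv simp: append_in_lists_conv)

lemma Rel_cong: "(\<And>v. v \<in> lists N \<Longrightarrow> f v = g v) \<Longrightarrow> Rel f = Rel g"
  unfolding Rel_def using N_closed by (intro ball_cong refl) auto

lemma coind_cmod: "cmod coind"
proof (rule cmodI)
  show "a \<oplus>\<^bsub>coind\<^esub> b \<in> carrier coind" if "a \<in> carrier coind" "b \<in> carrier coind" for a b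
    using that unfolding coind_simps mlin_def Rel_def by (auto simp: ps.scale_right_distrib add_diff_add)
  show "\<zero>\<^bsub>coind\<^esub> \<in> carrier coind" by (simp add: coind_simps mlin_def Rel_def)
  show "c \<odot>\<^bsub>coind\<^esub> a \<in> carrier coind" if "a \<in> carrier coind" for a c
    using that unfolding coind_simps mlin_def Rel_def
    by (auto simp: ps.scale_right_distrib mult.commute simp flip: ps.scale_right_diff_distrib)
qed (auto simp: coind_simps fun_eq_iff add.assoc add.commute ps.scale_right_distrib ps.scale_left_distrib ps.scale_minus_left)

theorem coind_module: "is_lie_module \<lparr>lie_carrier = L, lie_scale = sc, lie_bracket = br\<rparr> coind"
proof (rule is_lie_moduleI)
  interpret cmod coind by (rule coind_cmod)
  show "cmod coind" by (rule coind_cmod)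
  fix x y f g c
  assume "x \<in> lie_carrier \<lparr>lie_carrier = L, lie_scale = sc, lie_bracket = br\<rparr>" "f \<in> carrier coind"
  then have x: "x \<in> L" and f: "mlin f" "Rel f" "\<And>w. w \<notin> lists N \<Longrightarrow> f w = 0" by (simp_all add: coind_simps)
  have inn: "act coind z h \<in> carrier coind" if "z \<in> L" "mlin h" "Rel h" for z h
  proof -
    have "mlin (\<lambda>w. if w \<in> lists N then A z h w else 0) = mlin (A z h)" by (rule mlin_cong) simp
    moreover have "Rel (\<lambda>w. if w \<in> lists N then A z h w else 0) = Rel (A z h)" by (rule Rel_cong) simp
    ultimately show ?thesis using mlin_A[OF that(2,1)] Rel_A[OF that(2,3,1)] by (simp add: coind_simps)
  qed
  show "act coind x f \<in> carrier coind" by (rule inn[OF x f(1,2)])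
  show "act coind x (c \<odot>\<^bsub>coind\<^esub> f) = c \<odot>\<^bsub>coind\<^esub> act coind x f"
    using x by (auto simp: coind_simps A_fun_psc)
  show "act coind (lie_scale \<lparr>lie_carrier = L, lie_scale = sc, lie_bracket = br\<rparr> c x) f = c \<odot>\<^bsub>coind\<^esub> act coind x f"
    using x f by (auto simp: coind_simps A_sc)
  show "act coind x (f \<oplus>\<^bsub>coind\<^esub> g) = act coind x f \<oplus>\<^bsub>coind\<^esub> act coind x g"
    using x by (auto simp: coind_simps A_fun_add)
  assume "y \<in> lie_carrier \<lparr>lie_carrier = L, lie_scale = sc, lie_bracket = br\<rparr>"
  then have y: "y \<in> L" by simp
  show "act coind (x + y) f = act coind x f \<oplus>\<^bsub>coind\<^esub> act coind y f"
    using x y f by (auto simp: coind_simps A_add)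
  have AA: "A z (\<lambda>w. if w \<in> lists N then A z' f w else 0) w = A z (A z' f) w" if "w \<in> lists N" "z \<in> L" for z z' w
    using that by (intro A_cong) simp_all
  have "act coind (br x y) f \<oplus>\<^bsub>coind\<^esub> act coind y (act coind x f) = act coind x (act coind y f)"
    using x y f by (auto simp: coind_simps AA A_bracket)
  moreover have "act coind x f \<in> carrier coind" "act coind y f \<in> carrier coind" using inn x y f by simp_all
  then have "act coind y (act coind x f) \<in> carrier coind" "act coind x (act coind y f) \<in> carrier coind"
    "act coind (br x y) f \<in> carrier coind"
    using inn x y f L_closed(2)[OF x y] by (auto simp: coind_simps(1))
  ultimately have "act coind (br x y) f = act coind x (act coind y f) \<ominus>\<^bsub>coind\<^esub> act coind y (act coind x f)"
    by (intro crd_eqI) (simp_all, metis add_diff_cancel_right' crd_add)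
  then show "act coind (lie_bracket \<lparr>lie_carrier = L, lie_scale = sc, lie_bracket = br\<rparr> x y) f =
      act coind x (act coind y f) \<ominus>\<^bsub>coind\<^esub> act coind y (act coind x f)" by simp
qed

definition delta :: "('m \<Rightarrow>\<^sub>0 complex) \<Rightarrow> 'x list \<Rightarrow> ('m \<Rightarrow>\<^sub>0 complex)" where
  "delta v = (\<lambda>w. if w = [] then v else 0)"

lemma delta_in: "delta v \<in> carrier coind"
  by (simp add: coind_simps mlin_def Rel_def delta_def)

text \<open>
  The functions concentrated at the empty word are annihilated by \<open>N\<close>. For \<open>q\<close> in \<open>Q\<close> normalizing \<open>N\<close>, the
  image under \<open>q\<close> is again of this kind, since \<open>n q = q n - [q, n]\<close> annihilates the function. So these functions form a copy of the given module, restricted to the normalizer of \<open>N\<close>.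
\<close>

lemma act_delta:
  assumes p: "p \<in> L" and br: "\<And>n. n \<in> N \<Longrightarrow> br (qq p) n \<in> N"
  shows "act coind p (delta v) = delta (\<sigma> (qq p) v)"
proof -
  have m: "mlin (delta v)" using delta_in by (simp add: coind_simps)
  have Q: "qq p \<in> Q" using p by (rule qq_Q)
  have "A p (delta v) w = delta (\<sigma> (qq p) v) w" if w: "w \<in> lists N" for w
  proof (cases w)
    case Nil
    then show ?thesis by (simp add: A_def delta_def)
  next
    case (Cons n w')
    then have n: "n \<in> N" and w': "w' \<in> lists N" using w by auto
    have "T w' (qq p) (\<lambda>v'. delta v (n # v')) = 0" using T_fun_zero[OF w' Q] by (simp add: delta_def)
    moreover have "T w' (qq (br (qq p) n)) (delta v) = 0"
      using T_zero[OF m w' Q] br[OF n] by (simp add: qq_on_N)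
    ultimately show ?thesis using Cons by (simp add: A_def delta_def)
  qed
  then show ?thesis by (auto simp: coind_simps fun_eq_iff) (auto simp: delta_def split: if_splits)
qed

end

context toroidal_setup
begin

definition pos_part :: "nat \<Rightarrow> 'g toroidal \<Rightarrow> 'g toroidal" where
  "pos_part k = (\<lambda>(a, c, d). (Poly_Mapping.mapp (\<lambda>n x. if Poly_Mapping.lookup n k > 0 then x else 0) a, 0, 0))"

definition nonpos_part :: "nat \<Rightarrow> 'g toroidal \<Rightarrow> 'g toroidal" where
  "nonpos_part k = (\<lambda>(a, c, d). (Poly_Mapping.mapp (\<lambda>n x. if Poly_Mapping.lookup n k > 0 then 0 else x) a, c, d))"

lemma part_add: "pos_part k (X + Y) = pos_part k X + pos_part k Y" "nonpos_part k (X + Y) = nonpos_part k X + nonpos_part k Y"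
  by (cases X; cases Y;
      auto simp: pos_part_def nonpos_part_def lookup_mapp lookup_add in_keys_iff when_def intro!: poly_mapping_eqI)+

lemma part_sc: "pos_part k (sc z X) = sc z (pos_part k X)" "nonpos_part k (sc z X) = sc z (nonpos_part k X)"
  by (cases X; auto simp: pos_part_def nonpos_part_def sc_eq lookup_mapp in_keys_iff when_def intro!: poly_mapping_eqI)+

lemma part_decomp: "pos_part k X + nonpos_part k X = X"
  by (cases X) (auto simp: pos_part_def nonpos_part_def lookup_mapp lookup_add in_keys_iff when_def intro!: poly_mapping_eqI)

lemma keys_mapp_if: "Poly_Mapping.keys (Poly_Mapping.mapp (\<lambda>n x. if R n then x else 0) a) \<subseteq> Poly_Mapping.keys a \<inter> {n. R n}"
  "Poly_Mapping.keys (Poly_Mapping.mapp (\<lambda>n x. if R n then 0 else x) a) \<subseteq> Poly_Mapping.keys a \<inter> {n. \<not> R n}"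
  by (auto simp: in_keys_iff lookup_mapp when_def split: if_splits)

abbreviation "posbox k \<equiv> box (exponents k \<inter> {n. Poly_Mapping.lookup n k > 0}) {} {}"
abbreviation "nonposbox k \<equiv> box (exponents k \<inter> {n. Poly_Mapping.lookup n k \<le> 0}) {1..k} {1..k}"

lemma pos_part_in: "X \<in> hat_carrier k \<Longrightarrow> pos_part k X \<in> posbox k"
  using keys_mapp_if(1)[of "\<lambda>n. Poly_Mapping.lookup n k > 0"]
  by (cases X) (fastforce simp: hat_carrier_box box_def pos_part_def)

lemma nonpos_part_in: "X \<in> hat_carrier k \<Longrightarrow> nonpos_part k X \<in> nonposbox k"
  using keys_mapp_if(2)[of "\<lambda>n. Poly_Mapping.lookup n k > 0"]
  by (cases X) (fastforce simp: hat_carrier_box box_def nonpos_part_def not_less)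

lemma pos_part_id: "X \<in> posbox k \<Longrightarrow> pos_part k X = X"
  by (cases X) (auto simp: box_def pos_part_def lookup_mapp in_keys_iff when_def intro!: poly_mapping_eqI)

lemma nonpos_part_id: "X \<in> nonposbox k \<Longrightarrow> nonpos_part k X = X"
  by (cases X) (force simp: box_def nonpos_part_def lookup_mapp in_keys_iff when_def intro!: poly_mapping_eqI)

lemma posbox_br: "X \<in> posbox k \<Longrightarrow> Y \<in> posbox k \<Longrightarrow> br X Y \<in> posbox k"
  and nonposbox_br: "X \<in> nonposbox k \<Longrightarrow> Y \<in> nonposbox k \<Longrightarrow> br X Y \<in> nonposbox k"
proof -
  have E: "br (E n x) (E m y) \<in> posbox k"
    if "n \<in> exponents k \<inter> {n. Poly_Mapping.lookup n k > 0}" "m \<in> exponents k \<inter> {n. Poly_Mapping.lookup n k > 0}" for n m x y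
  proof -
    have p: "Poly_Mapping.lookup (n + m) k > 0" using that by (simp add: lookup_add)
    then have "n + m \<noteq> 0" by auto
    then show ?thesis using that p exponents_add[of n k m] by (simp add: br_gens box_def)
  qed
  have zero: "(0, c, d) = (0 :: 'g toroidal)" if "Poly_Mapping.keys c \<subseteq> {}" "Poly_Mapping.keys d \<subseteq> {}" for c d
    using that by simp
  show "br X Y \<in> posbox k" if X: "X \<in> posbox k" and Y: "Y \<in> posbox k"
    using X
  proof (induction X rule: box_induct)
    case (E n x)
    show ?case using Y
    proof (induction Y rule: box_induct)
      case (E m y)
      then show ?case using \<open>n \<in> _\<close> by (intro \<open>\<And>n m x y. _ \<Longrightarrow> _ \<Longrightarrow> br (E n x) (E m y) \<in> posbox k\<close>)
    next
      case (cd c d)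
      then show ?case by (simp add: box_zero)
    qed (simp add: br_add_right box_add)
  next
    case (cd c d)
    then show ?case by (simp add: box_zero)
  qed (simp add: br_add_left box_add)
  show "br X Y \<in> nonposbox k" if "X \<in> nonposbox k" "Y \<in> nonposbox k"
  proof -
    have "br X Y \<in> box (exponents k \<inter> {n. Poly_Mapping.lookup n k \<le> 0}) {1..k} {}"
      using that by (intro box_br) (auto simp: exponents_add lookup_add, auto simp: exponents_def)
    then show ?thesis by (auto simp: box_def)
  qed
qed

lemma project_pos_part: "project k (pos_part k X) = 0" "ck k (pos_part k X) = 0"
  by (cases X; auto simp: project_def pos_part_def ck_def lookup_mapp when_def simp flip: zero_triple intro!: poly_mapping_eqI)+

lemma nonneg_nonpos_br:
  assumes P: "X \<in> hat_carrier k \<inter> plus_part k" and Y: "Y \<in> posbox k"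
  shows "br (nonpos_part k X) Y \<in> posbox k"
proof -
  have "nonpos_part k X \<in> box (exponents k \<inter> {n. Poly_Mapping.lookup n k = 0}) {1..k} {1..k}"
  proof -
    obtain a c d where X: "X = (a, c, d)" by (cases X)
    have "Poly_Mapping.keys a \<subseteq> exponents k \<inter> {n. Poly_Mapping.lookup n k \<ge> 0}"
      "Poly_Mapping.keys c \<subseteq> {1..k}" "Poly_Mapping.keys d \<subseteq> {1..k}"
      using P unfolding hat_plus_box by (simp_all add: box_def X)
    moreover note keys_mapp_if(2)[of "\<lambda>n. Poly_Mapping.lookup n k > 0" a]
    ultimately show ?thesis unfolding X nonpos_part_def box_def prod.case mem_Collect_eq by fastforce
  qed
  then show ?thesis
  proof (induction rule: box_induct)
    case (E n x)
    show ?case using Y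
    proof (induction Y rule: box_induct)
      case (E m y)
      have p: "Poly_Mapping.lookup (n + m) k > 0" using E \<open>n \<in> _\<close> by (simp add: lookup_add)
      then have "n + m \<noteq> 0" by auto
      then show ?case using E \<open>n \<in> _\<close> p exponents_add[of n k m] by (simp add: br_gens box_def)
    next
      case (cd c d)
      then show ?case by (simp add: box_zero)
    qed (simp add: br_add_right box_add)
  next
    case (cd c d)
    show ?case using Y
    proof (induction Y rule: box_induct)
      case (E m y)
      then show ?case by (simp add: br_gens box_def)
    next
      case (cd c d)
      then show ?case by (simp add: box_zero)
    qed (simp add: br_add_right box_add)
  qed (simp add: br_add_left box_add)
qed

text \<open>
  Terms of negative degree in the last variable can be made to act by zero as well, so the inflated
  module is also a module over the nonpositive part. The module coinduced from there contains a copy of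
  \<open>M\<close>, on which the positive part acts by zero: elements of degree zero normalize the positive part, so
  that \<open>act_delta\<close> applies.
\<close>

theorem ex_injective_hom:
  fixes M :: "('g toroidal, 'm) lie_rep"
  assumes M: "is_lie_module (hat k) M"
  shows "\<exists>(W :: ('g toroidal, 'g toroidal list \<Rightarrow> ('m \<Rightarrow>\<^sub>0 complex)) lie_rep) h.
    is_lie_module (hat (Suc k)) W \<and> h \<in> lie_hom (hatp (Suc k)) (inflate lev (Suc k) M) W \<and> inj_on h (carrier M)"
proof -
  let ?k = "Suc k"
  let ?M = "inflate lev ?k M" and ?Q = "nonposbox ?k" and ?N = "posbox ?k"
  have "is_lie_module (toroidal scale bracket form ?Q) ?M"
  proof (rule inflate_lie_module[OF M])
    show "project ?k X \<in> hat_carrier k" if "X \<in> ?Q" for X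
      using that by (intro project_hat) (auto simp: hat_carrier_box box_def)
    show "?Q \<subseteq> box {n. Poly_Mapping.lookup n ?k \<le> 0} UNIV UNIV" by (auto simp: box_def)
  qed (auto simp: lookup_add)
  then interpret Q: lie_mod "toroidal scale bracket form ?Q" ?M by (rule lie_mod.intro)
  interpret M: lie_mod "hat k" M by (rule lie_mod.intro) (rule M)
  define \<sigma> where "\<sigma> X v = crd ?M (act ?M X (uncrd ?M v))" for X v
  have un: "uncrd ?M v \<in> carrier ?M" for v by (rule Q.uncrd_closed)
  note Qact = Q.act_in[unfolded toroidal_simps] Q.act_add[unfolded toroidal_simps] Q.act_smult[unfolded toroidal_simps]
    Q.act_add_left[unfolded toroidal_simps] Q.act_scale_left[unfolded toroidal_simps] Q.act_bracket[unfolded toroidal_simps]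
  interpret C: coinduction br sc "hat_carrier ?k" ?N ?Q "pos_part ?k" "nonpos_part ?k" \<sigma>
  proof
    show "br (x + y) z = br x z + br y z" "br z (x + y) = br z x + br z y" for x y z by (rule br_add_left br_add_right)+
    show "br (sc c x) y = sc c (br x y)" "br x (sc c y) = sc c (br x y)" for c x y by (rule br_scale_left br_scale_right)+
    show "br x y = - br y x" for x y by (rule br_antisym)
    show "br x (br y z) = br (br x y) z + br y (br x z)" for x y z by (rule br_leibniz)
    show "sc 0 x = 0" for x :: "'g toroidal"
      by (cases x) (auto simp: sc_eq simp flip: zero_triple intro!: poly_mapping_eqI)
    show "sc (- 1) x = - x" for x :: "'g toroidal"
      by (cases x) (auto simp: sc_eq uminus_prod_def intro!: poly_mapping_eqI)
    show "x \<in> hat_carrier ?k \<Longrightarrow> y \<in> hat_carrier ?k \<Longrightarrow> x + y \<in> hat_carrier ?k"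
      "x \<in> hat_carrier ?k \<Longrightarrow> sc c x \<in> hat_carrier ?k" for x y c
      unfolding hat_carrier_box by (auto intro: box_add box_sc)
    show "x \<in> hat_carrier ?k \<Longrightarrow> y \<in> hat_carrier ?k \<Longrightarrow> br x y \<in> hat_carrier ?k" for x y
      using br_hat tilde_subset_hat by blast
    show "x \<in> ?N \<Longrightarrow> y \<in> ?N \<Longrightarrow> x + y \<in> ?N" "x \<in> ?N \<Longrightarrow> sc c x \<in> ?N"
      "x \<in> ?Q \<Longrightarrow> y \<in> ?Q \<Longrightarrow> x + y \<in> ?Q" "x \<in> ?Q \<Longrightarrow> sc c x \<in> ?Q" for x y c
      by (rule box_add box_sc; assumption)+
    show "x \<in> ?N \<Longrightarrow> y \<in> ?N \<Longrightarrow> br x y \<in> ?N" "x \<in> ?Q \<Longrightarrow> y \<in> ?Q \<Longrightarrow> br x y \<in> ?Q" for x y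
      by (rule posbox_br nonposbox_br; assumption)+
    show "x \<in> ?N \<Longrightarrow> x \<in> hat_carrier ?k" "x \<in> ?Q \<Longrightarrow> x \<in> hat_carrier ?k" for x
      by (auto simp: hat_carrier_box box_def)
    show "x \<in> hat_carrier ?k \<Longrightarrow> pos_part ?k x \<in> ?N" "x \<in> hat_carrier ?k \<Longrightarrow> nonpos_part ?k x \<in> ?Q" for x
      by (rule pos_part_in nonpos_part_in; assumption)+
    show "pos_part ?k (x + y) = pos_part ?k x + pos_part ?k y" "pos_part ?k (sc c x) = sc c (pos_part ?k x)"
      "nonpos_part ?k (x + y) = nonpos_part ?k x + nonpos_part ?k y" "nonpos_part ?k (sc c x) = sc c (nonpos_part ?k x)" for x y c
      by (rule part_add part_sc)+
    show "pos_part ?k x + nonpos_part ?k x = x" for x by (rule part_decomp)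
    show "x \<in> ?N \<Longrightarrow> pos_part ?k x = x" "x \<in> ?Q \<Longrightarrow> nonpos_part ?k x = x" for x
      by (rule pos_part_id nonpos_part_id; assumption)+
    fix q q' v w c assume q: "q \<in> ?Q"
    show "\<sigma> q (v + w) = \<sigma> q v + \<sigma> q w" "\<sigma> q (psc c v) = psc c (\<sigma> q v)" "\<sigma> (sc c q) v = psc c (\<sigma> q v)"
      unfolding \<sigma>_def Q.uncrd_add Q.uncrd_psc using q un Qact by (simp_all only: Q.crd_add Q.crd_smult)
    assume q': "q' \<in> ?Q"
    show "\<sigma> (q + q') v = \<sigma> q v + \<sigma> q' v" "\<sigma> (br q q') v = \<sigma> q (\<sigma> q' v) - \<sigma> q' (\<sigma> q v)"
      unfolding \<sigma>_def using q q' un Qact by (simp_all only: Q.crd_add Q.crd_minus Q.uncrd_crd)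
  qed
  define h where "h m = C.delta (crd ?M m)" for m
  have W: "is_lie_module (hat ?k) C.coind" using C.coind_module by (simp add: toroidal_def)
  have "h \<in> lie_hom (hatp ?k) ?M C.coind"
  proof (rule lie_homI)
    fix m m' c p assume m: "m \<in> carrier ?M"
    show "h m \<in> carrier C.coind" unfolding h_def by (rule C.delta_in)
    show "h (c \<odot>\<^bsub>?M\<^esub> m) = c \<odot>\<^bsub>C.coind\<^esub> h m"
      unfolding h_def Q.crd_smult[OF m] by (auto simp: C.coind_simps C.delta_def)
    { assume m': "m' \<in> carrier ?M"
      show "h (m \<oplus>\<^bsub>?M\<^esub> m') = h m \<oplus>\<^bsub>C.coind\<^esub> h m'"
        unfolding h_def Q.crd_add[OF m m'] by (auto simp: C.coind_simps C.delta_def) }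
    assume "p \<in> lie_carrier (hatp ?k)"
    then have p: "p \<in> hat_carrier ?k \<inter> plus_part ?k" by simp
    \<comment> \<open>The positive part of \<open>p\<close> acts by zero on both sides.\<close>
    have "project ?k p = project ?k (nonpos_part ?k p)" "ck ?k p = ck ?k (nonpos_part ?k p)"
      using project_add[of ?k "pos_part ?k p" "nonpos_part ?k p"] ck_add[of ?k "pos_part ?k p" "nonpos_part ?k p"]
      by (simp_all add: project_pos_part part_decomp)
    then have "act ?M p m = act ?M (nonpos_part ?k p) m" by simp
    moreover have "act C.coind p (h m) = C.delta (\<sigma> (nonpos_part ?k p) (crd ?M m))"
      unfolding h_def using p by (intro C.act_delta nonneg_nonpos_br) auto
    ultimately show "h (act ?M p m) = act C.coind p (h m)" by (simp only: h_def \<sigma>_def Q.uncrd_crd[OF m])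
  qed
  moreover have "inj_on h (carrier M)"
  proof (rule inj_onI)
    fix m m' assume m: "m \<in> carrier M" "m' \<in> carrier M" and "h m = h m'"
    \<comment> \<open>The value at the empty word recovers \<open>m\<close>.\<close>
    then have "h m [] = h m' []" by simp
    then have "crd ?M m = crd ?M m'" by (simp add: h_def C.delta_def)
    then show "m = m'" using m Q.crd_inject by simp
  qed
  ultimately show ?thesis using W by blast
qed

end


section \<open>Induction with and without derivations\<close>

lemma (in cmod) eq_minusI: "a \<in> carrier M \<Longrightarrow> b \<in> carrier M \<Longrightarrow> a \<oplus> b = c \<Longrightarrow> a = c \<ominus> b"
  by (intro crd_eqI) auto

lemma (in cmod) smult_zero_left: "m \<in> carrier M \<Longrightarrow> 0 \<odot> m = \<zero>"
  by (rule crd_eqI) simp_all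

context toroidal_setup
begin

lemma inflate_hatp:
  assumes "is_lie_module (hat k) M"
  shows "is_lie_module (hatp (Suc k)) (inflate lev (Suc k) M)"
proof (rule inflate_lie_module[OF assms])
  show "project (Suc k) X \<in> hat_carrier k" if "X \<in> hat_carrier (Suc k) \<inter> plus_part (Suc k)" for X :: "'g toroidal"
    using that by (auto intro: project_hat)
  show "hat_carrier (Suc k) \<inter> plus_part (Suc k) \<subseteq> box {n. Poly_Mapping.lookup n (Suc k) \<ge> 0} UNIV UNIV"
    by (auto simp: hat_plus_box box_def)
qed (auto simp: lookup_add)

lemma inflate_tilp:
  assumes "is_lie_module (til k) M"
  shows "is_lie_module (tilp (Suc k)) (inflate lev (Suc k) M)"
proof (rule inflate_lie_module[OF assms])
  show "project (Suc k) X \<in> tilde_carrier k" if "X \<in> tilde_carrier (Suc k) \<inter> plus_part (Suc k)" for X :: "'g toroidal"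
    using that by (auto intro: project_tilde)
  show "tilde_carrier (Suc k) \<inter> plus_part (Suc k) \<subseteq> box {n. Poly_Mapping.lookup n (Suc k) \<ge> 0} UNIV UNIV"
    by (auto simp: tilde_plus_box box_def)
qed (auto simp: lookup_add)

lemma hat_induction:
  assumes "is_lie_module (hat k) M"
  shows "universe_induction (hat (Suc k)) (hatp (Suc k)) (inflate lev (Suc k) M)"
  by (intro universe_induction.intro induction.intro uea_mod.intro closed_struct.intro lie_mod.intro
      induction_axioms.intro closed_toroidal inflate_hatp[OF assms] substruct_toroidal Int_lower1)

lemma til_induction:
  assumes "is_lie_module (til k) M"
  shows "universe_induction (til (Suc k)) (tilp (Suc k)) (inflate lev (Suc k) M)"
  by (intro universe_induction.intro induction.intro uea_mod.intro closed_struct.intro lie_mod.intro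
      induction_axioms.intro closed_toroidal inflate_tilp[OF assms] substruct_toroidal Int_lower1)

lemma til_sub_hat: "substruct (til k) (hat k)"
  by (rule substruct_toroidal) (rule tilde_subset_hat)

definition derivs :: "nat \<Rightarrow> 'g toroidal set" where
  "derivs k = {(0, 0, d) |d. Poly_Mapping.keys d \<subseteq> {1..k}}"

lemma derivs_hatp: "\<delta> \<in> derivs k \<Longrightarrow> \<delta> \<in> hat_carrier k \<inter> plus_part k"
  by (auto simp: derivs_def hat_carrier_def plus_part_def)

lemma derivs_hat: "\<delta> \<in> derivs k \<Longrightarrow> \<delta> \<in> hat_carrier k"
  using derivs_hatp by blast

lemma derivs_br: "\<delta> \<in> derivs k \<Longrightarrow> \<epsilon> \<in> derivs k \<Longrightarrow> br \<delta> \<epsilon> = 0"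
  by (auto simp: derivs_def br_gens)

lemma derivs_add: "\<delta> \<in> derivs k \<Longrightarrow> \<epsilon> \<in> derivs k \<Longrightarrow> \<delta> + \<epsilon> \<in> derivs k"
  by (auto simp: derivs_def keys_add_subset)

lemma derivs_sc: "\<delta> \<in> derivs k \<Longrightarrow> sc c \<delta> \<in> derivs k"
  by (auto simp: derivs_def sc_cd keys_psc_subset)

lemma derivs_zero: "0 \<in> derivs k"
  unfolding derivs_def by (rule CollectI, rule exI[of _ 0]) simp

text \<open>The square of a module over the algebra without derivations, twisted by a derivation \<open>\<delta>\<close>: a
  homomorphism \<open>a \<mapsto> (a, D a)\<close> into it is the same as an operator \<open>D\<close> whose commutator
  with \<open>x\<close> is the action of \<open>[\<delta>, x]\<close>.\<close>

definition twisted_square :: "('g toroidal, 'm) lie_rep \<Rightarrow> 'g toroidal \<Rightarrow> ('g toroidal, 'm \<times> 'm) lie_rep" where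
  "twisted_square I \<delta> = mk_rep (carrier I \<times> carrier I) (\<zero>\<^bsub>I\<^esub>, \<zero>\<^bsub>I\<^esub>) (\<lambda>(a, b) (a', b'). (a \<oplus>\<^bsub>I\<^esub> a', b \<oplus>\<^bsub>I\<^esub> b'))
     (\<lambda>c (a, b). (c \<odot>\<^bsub>I\<^esub> a, c \<odot>\<^bsub>I\<^esub> b)) (\<lambda>x (a, b). (act I x a, act I x b \<oplus>\<^bsub>I\<^esub> act I (br \<delta> x) a))"

lemma twisted_square_simps:
  "carrier (twisted_square I \<delta>) = carrier I \<times> carrier I" "\<zero>\<^bsub>twisted_square I \<delta>\<^esub> = (\<zero>\<^bsub>I\<^esub>, \<zero>\<^bsub>I\<^esub>)"
  "(a, b) \<oplus>\<^bsub>twisted_square I \<delta>\<^esub> (a', b') = (a \<oplus>\<^bsub>I\<^esub> a', b \<oplus>\<^bsub>I\<^esub> b')"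
  "c \<odot>\<^bsub>twisted_square I \<delta>\<^esub> (a, b) = (c \<odot>\<^bsub>I\<^esub> a, c \<odot>\<^bsub>I\<^esub> b)"
  "act (twisted_square I \<delta>) x (a, b) = (act I x a, act I x b \<oplus>\<^bsub>I\<^esub> act I (br \<delta> x) a)"
  by (simp_all add: twisted_square_def mk_rep_def)

lemma twisted_square_module:
  assumes I: "is_lie_module (til k) I" and d: "\<delta> \<in> hat_carrier k"
  shows "is_lie_module (til k) (twisted_square I \<delta>)"
proof -
  interpret I: lie_mod "til k" I by (rule lie_mod.intro) (rule I)
  note Iact = I.act_in[unfolded toroidal_simps]
  have dx: "br \<delta> x \<in> tilde_carrier k" if "x \<in> tilde_carrier k" for x
    using br_hat[OF d] that tilde_subset_hat by blast
  have xy: "br x y \<in> tilde_carrier k" if "x \<in> tilde_carrier k" "y \<in> tilde_carrier k" for x y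
    using br_hat that tilde_subset_hat by blast
  let ?W = "twisted_square I \<delta>"
  have crdI: "u = v" if "fst u \<in> carrier I" "snd u \<in> carrier I" "fst v \<in> carrier I" "snd v \<in> carrier I"
    "crd I (fst u) = crd I (fst v)" "crd I (snd u) = crd I (snd v)" for u v
    using that I.crd_eqI by (metis prod_eqI)
  have cmod: "cmod ?W"
  proof (rule cmodI)
    fix x y z c d
    assume "x \<in> carrier ?W"
    then obtain a b where x: "x = (a, b)" "a \<in> carrier I" "b \<in> carrier I" by (auto simp: twisted_square_simps)
    show "c \<odot>\<^bsub>?W\<^esub> x \<in> carrier ?W" using x by (simp add: twisted_square_simps)
    show "\<zero>\<^bsub>?W\<^esub> \<oplus>\<^bsub>?W\<^esub> x = x" "- 1 \<odot>\<^bsub>?W\<^esub> x \<oplus>\<^bsub>?W\<^esub> x = \<zero>\<^bsub>?W\<^esub>"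
      "(c + d) \<odot>\<^bsub>?W\<^esub> x = c \<odot>\<^bsub>?W\<^esub> x \<oplus>\<^bsub>?W\<^esub> d \<odot>\<^bsub>?W\<^esub> x" "(c * d) \<odot>\<^bsub>?W\<^esub> x = c \<odot>\<^bsub>?W\<^esub> (d \<odot>\<^bsub>?W\<^esub> x)" "1 \<odot>\<^bsub>?W\<^esub> x = x"
      using x by (simp_all only: twisted_square_simps) (rule crdI; simp add: ps.scale_left_distrib)+
    assume "y \<in> carrier ?W"
    then obtain a' b' where y: "y = (a', b')" "a' \<in> carrier I" "b' \<in> carrier I" by (auto simp: twisted_square_simps)
    show "x \<oplus>\<^bsub>?W\<^esub> y \<in> carrier ?W" using x y by (simp add: twisted_square_simps)
    show "x \<oplus>\<^bsub>?W\<^esub> y = y \<oplus>\<^bsub>?W\<^esub> x" "c \<odot>\<^bsub>?W\<^esub> (x \<oplus>\<^bsub>?W\<^esub> y) = c \<odot>\<^bsub>?W\<^esub> x \<oplus>\<^bsub>?W\<^esub> c \<odot>\<^bsub>?W\<^esub> y"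
      using x y by (simp_all only: twisted_square_simps) (rule crdI; simp add: ps.scale_right_distrib)+
    assume "z \<in> carrier ?W"
    then obtain a'' b'' where z: "z = (a'', b'')" "a'' \<in> carrier I" "b'' \<in> carrier I" by (auto simp: twisted_square_simps)
    show "x \<oplus>\<^bsub>?W\<^esub> y \<oplus>\<^bsub>?W\<^esub> z = x \<oplus>\<^bsub>?W\<^esub> (y \<oplus>\<^bsub>?W\<^esub> z)"
      using x y z by (simp only: twisted_square_simps) (rule crdI; simp)
  qed (simp add: twisted_square_simps)
  show ?thesis
  proof (rule is_lie_moduleI)
    show "cmod ?W" by (rule cmod)
    fix x y u v c
    assume "x \<in> lie_carrier (til k)" "u \<in> carrier ?W"
    then obtain a b where x: "x \<in> tilde_carrier k" and u: "u = (a, b)" "a \<in> carrier I" "b \<in> carrier I"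
      by (auto simp: twisted_square_simps)
    note dxx = dx[OF x]
    show "act ?W x u \<in> carrier ?W" using x u dxx by (simp add: twisted_square_simps Iact)
    show "act ?W x (c \<odot>\<^bsub>?W\<^esub> u) = c \<odot>\<^bsub>?W\<^esub> act ?W x u"
      using x u dxx by (simp only: twisted_square_simps) (rule crdI; simp add: ps.scale_right_distrib)
    show "act ?W (lie_scale (til k) c x) u = c \<odot>\<^bsub>?W\<^esub> act ?W x u"
      using x u dxx I.act_scale_left[unfolded toroidal_simps] box_sc[of x _ _ _ c, folded tilde_carrier_box]
        box_sc[of "br \<delta> x" _ _ _ c, folded tilde_carrier_box]
      by (simp only: twisted_square_simps toroidal_simps br_scale_right) (rule crdI; simp add: ps.scale_right_distrib)
    { assume "v \<in> carrier ?W"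
      then obtain a' b' where v: "v = (a', b')" "a' \<in> carrier I" "b' \<in> carrier I" by (auto simp: twisted_square_simps)
      show "act ?W x (u \<oplus>\<^bsub>?W\<^esub> v) = act ?W x u \<oplus>\<^bsub>?W\<^esub> act ?W x v"
        using x u v dxx by (simp only: twisted_square_simps) (rule crdI; simp) }
    assume "y \<in> lie_carrier (til k)"
    then have y: "y \<in> tilde_carrier k" by simp
    note dyy = dx[OF y]
    note al = I.act_add_left[unfolded toroidal_simps]
    note ab = I.act_bracket[unfolded toroidal_simps]
    have sum: "x + y \<in> tilde_carrier k" "br \<delta> x + br \<delta> y \<in> tilde_carrier k"
      using x y dxx dyy unfolding tilde_carrier_box by (auto intro: box_add)
    show "act ?W (x + y) u = act ?W x u \<oplus>\<^bsub>?W\<^esub> act ?W y u"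
      using x y u dxx dyy sum al by (simp only: twisted_square_simps br_add_right) (rule crdI; simp add: al)
    have b: "br x y \<in> tilde_carrier k" "br (br \<delta> x) y \<in> tilde_carrier k" "br x (br \<delta> y) \<in> tilde_carrier k"
      using x y dxx dyy xy by blast+
    have "act ?W (br x y) u \<oplus>\<^bsub>?W\<^esub> act ?W y (act ?W x u) = act ?W x (act ?W y u)"
      unfolding u twisted_square_simps br_leibniz[of \<delta> x y]
      by (rule crdI) (use x y u dxx dyy b in \<open>simp_all add: al ab Iact\<close>)
    moreover have "act ?W (br x y) u \<in> carrier ?W" "act ?W y (act ?W x u) \<in> carrier ?W"
      using x y u dxx dyy b dx[OF b(1)] by (simp_all add: twisted_square_simps Iact)
    ultimately show "act ?W (lie_bracket (til k) x y) u = act ?W x (act ?W y u) \<ominus>\<^bsub>?W\<^esub> act ?W y (act ?W x u)"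
      using cmod.eq_minusI[OF cmod] by simp
  qed
qed

end

locale tilde_hat_induction = toroidal_setup scale bracket form
  for scale :: "complex \<Rightarrow> 'g::ab_group_add \<Rightarrow> 'g" and bracket form +
  fixes k :: nat and M :: "('g toroidal, ('g toroidal, 'v) universe) lie_rep" and lev :: complex
  assumes M_module: "is_lie_module (hat k) M"
begin

abbreviation "K \<equiv> Suc k"
abbreviation "iM \<equiv> inflate lev (Suc k) M"

lemma M_til: "is_lie_module (til k) M"
  by (rule is_lie_module_substruct[OF til_sub_hat M_module])

sublocale H: universe_induction "hat (Suc k)" "hatp (Suc k)" "inflate lev (Suc k) M"
  by (rule hat_induction[OF M_module])

sublocale S: universe_induction "til (Suc k)" "tilp (Suc k)" "inflate lev (Suc k) M"
  by (rule til_induction[OF M_til])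

sublocale R: lie_mod "til (Suc k)" S.R
  by (rule lie_mod.intro) (rule S.R_module)

sublocale RH: lie_mod "hat (Suc k)" H.R
  by (rule lie_mod.intro) (rule H.R_module)

lemmas R_act = R.act_in[unfolded toroidal_simps] R.act_add[unfolded toroidal_simps] R.act_smult[unfolded toroidal_simps]
lemmas R_left = R.act_add_left[unfolded toroidal_simps] R.act_scale_left[unfolded toroidal_simps]

lemma M_in_R: "m \<in> carrier M \<Longrightarrow> S.j m \<in> carrier S.R"
  using lie_hom_closed[OF S.j_hom] by simp

lemma iM_in: "X \<in> hat_carrier K \<inter> plus_part K \<Longrightarrow> m \<in> carrier M \<Longrightarrow> act iM X m \<in> carrier M"
  using H.P.act_in[unfolded toroidal_simps] by simp

lemma br_deriv: "\<delta> \<in> derivs K \<Longrightarrow> x \<in> tilde_carrier K \<Longrightarrow> br \<delta> x \<in> tilde_carrier K"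
  using br_hat[OF derivs_hat] tilde_subset_hat by blast

definition is_deriv_op where
  "is_deriv_op \<delta> D \<longleftrightarrow> (\<forall>a\<in>carrier S.R. D a \<in> carrier S.R) \<and>
     (\<forall>a\<in>carrier S.R. \<forall>b\<in>carrier S.R. D (a \<oplus>\<^bsub>S.R\<^esub> b) = D a \<oplus>\<^bsub>S.R\<^esub> D b) \<and>
     (\<forall>c. \<forall>a\<in>carrier S.R. D (c \<odot>\<^bsub>S.R\<^esub> a) = c \<odot>\<^bsub>S.R\<^esub> D a) \<and>
     (\<forall>x\<in>tilde_carrier K. \<forall>a\<in>carrier S.R. D (act S.R x a) = act S.R x (D a) \<oplus>\<^bsub>S.R\<^esub> act S.R (br \<delta> x) a) \<and>
     (\<forall>m\<in>carrier M. D (S.j m) = S.j (act iM \<delta> m))"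

text \<open>
  By the universal property, \<open>m \<mapsto> (j m, j (\<delta> m))\<close> extends to a homomorphism into the twisted square. Its
  first component is the identity, because it is so on the generators; its second component is the
  operator.
\<close>

lemma ex_deriv_op:
  assumes d: "\<delta> \<in> derivs K"
  shows "\<exists>D. is_deriv_op \<delta> D"
proof -
  let ?W = "twisted_square S.R \<delta>"
  have W: "is_lie_module (til K) ?W"
    by (rule twisted_square_module[OF S.R_module derivs_hat[OF d]])
  let ?h = "\<lambda>m. (S.j m, S.j (act iM \<delta> m))"
  note dp = derivs_hatp[OF d]
  have h: "?h \<in> lie_hom (tilp K) iM ?W"
  proof (rule lie_homI)
    fix m m' c x
    assume "m \<in> carrier iM"
    then have m: "m \<in> carrier iM" "m \<in> carrier M" "act iM \<delta> m \<in> carrier iM" using iM_in[OF dp] by simp_all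
    show "?h m \<in> carrier ?W" using m by (simp add: twisted_square_simps lie_hom_closed[OF S.j_hom] del: inflate_simps)
    have "act iM \<delta> (c \<odot>\<^bsub>iM\<^esub> m) = c \<odot>\<^bsub>iM\<^esub> act iM \<delta> m"
      using H.P.act_smult[unfolded toroidal_simps, OF dp m(1)] .
    then show "?h (c \<odot>\<^bsub>iM\<^esub> m) = c \<odot>\<^bsub>?W\<^esub> ?h m"
      using m by (simp add: twisted_square_simps lie_hom_smult[OF S.j_hom] del: inflate_simps)
    { assume m': "m' \<in> carrier iM"
      have "act iM \<delta> (m \<oplus>\<^bsub>iM\<^esub> m') = act iM \<delta> m \<oplus>\<^bsub>iM\<^esub> act iM \<delta> m'"
        using H.P.act_add[unfolded toroidal_simps, OF dp m(1) m'] .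
      moreover have "act iM \<delta> m' \<in> carrier iM" using iM_in[OF dp] m' by simp
      ultimately show "?h (m \<oplus>\<^bsub>iM\<^esub> m') = ?h m \<oplus>\<^bsub>?W\<^esub> ?h m'"
        using m m' by (simp add: twisted_square_simps lie_hom_add[OF S.j_hom] del: inflate_simps) }
    assume "x \<in> lie_carrier (tilp K)"
    then have x: "x \<in> tilde_carrier K \<inter> plus_part K" "x \<in> lie_carrier (tilp K)" by simp_all
    have xh: "x \<in> hat_carrier K \<inter> plus_part K" using x tilde_subset_hat by blast
    have bx: "br \<delta> x \<in> tilde_carrier K \<inter> plus_part K" by (rule br_hat_plus[OF dp xh])
    then have bh: "br \<delta> x \<in> hat_carrier K \<inter> plus_part K" using tilde_subset_hat by blast
    have "act iM \<delta> (act iM x m) = act iM x (act iM \<delta> m) \<oplus>\<^bsub>iM\<^esub> act iM (br \<delta> x) m"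
      using H.P.act_commute[unfolded toroidal_simps, OF dp xh bh m(1)] .
    moreover have "act iM x (act iM \<delta> m) \<in> carrier iM" "act iM (br \<delta> x) m \<in> carrier iM"
      using iM_in[OF xh] iM_in[OF bh] m by (simp_all del: inflate_simps(5))
    ultimately show "?h (act iM x m) = act ?W x (?h m)"
      using m x bx by (simp add: twisted_square_simps lie_hom_add[OF S.j_hom] lie_hom_act[OF S.j_hom] del: inflate_simps)
  qed
  obtain g where g: "g \<in> lie_hom (til K) S.R ?W" "\<forall>m\<in>carrier iM. g (S.j m) = ?h m"
    using S.j_universal[OF W h] by (rule bexE)
  have gin: "fst (g a) \<in> carrier S.R" "snd (g a) \<in> carrier S.R" if "a \<in> carrier S.R" for a
    using lie_hom_closed[OF g(1) that] by (auto simp: twisted_square_simps)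
  have gadd: "g (a \<oplus>\<^bsub>S.R\<^esub> b) = (fst (g a) \<oplus>\<^bsub>S.R\<^esub> fst (g b), snd (g a) \<oplus>\<^bsub>S.R\<^esub> snd (g b))"
    if "a \<in> carrier S.R" "b \<in> carrier S.R" for a b
    using lie_hom_add[OF g(1) that] by (cases "g a"; cases "g b") (simp add: twisted_square_simps)
  have gsm: "g (c \<odot>\<^bsub>S.R\<^esub> a) = (c \<odot>\<^bsub>S.R\<^esub> fst (g a), c \<odot>\<^bsub>S.R\<^esub> snd (g a))" if "a \<in> carrier S.R" for a c
    using lie_hom_smult[OF g(1) that] by (cases "g a") (simp add: twisted_square_simps)
  have gact: "g (act S.R x a) = (act S.R x (fst (g a)), act S.R x (snd (g a)) \<oplus>\<^bsub>S.R\<^esub> act S.R (br \<delta> x) (fst (g a)))"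
    if "x \<in> tilde_carrier K" "a \<in> carrier S.R" for x a
    using lie_hom_act[OF g(1) _ that(2), of x] that(1) by (cases "g a") (simp add: twisted_square_simps)
  have fg: "(\<lambda>a. fst (g a)) \<in> lie_hom (til K) S.R S.R"
    by (rule lie_homI) (simp_all add: gin gadd gsm gact)
  \<comment> \<open>The first component is an endomorphism fixing the generators.\<close>
  have fst_g: "fst (g a) = a" if "a \<in> carrier S.R" for a
    by (rule S.hom_ext[OF S.R_module fg lie_hom_id _ that]) (use g(2) in simp)
  have "is_deriv_op \<delta> (\<lambda>a. snd (g a))"
    unfolding is_deriv_op_def using g(2) by (simp add: gin gadd gsm gact fst_g del: inflate_simps) simp
  then show ?thesis by blast
qed

definition Dop where
  "Dop \<delta> = (SOME D. is_deriv_op \<delta> D)"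

lemma is_deriv_Dop: "\<delta> \<in> derivs K \<Longrightarrow> is_deriv_op \<delta> (Dop \<delta>)"
  unfolding Dop_def using someI_ex[OF ex_deriv_op] .

lemma Dop_in: "\<delta> \<in> derivs K \<Longrightarrow> a \<in> carrier S.R \<Longrightarrow> Dop \<delta> a \<in> carrier S.R"
  and Dop_add: "\<delta> \<in> derivs K \<Longrightarrow> a \<in> carrier S.R \<Longrightarrow> b \<in> carrier S.R \<Longrightarrow> Dop \<delta> (a \<oplus>\<^bsub>S.R\<^esub> b) = Dop \<delta> a \<oplus>\<^bsub>S.R\<^esub> Dop \<delta> b"
  and Dop_smult: "\<delta> \<in> derivs K \<Longrightarrow> a \<in> carrier S.R \<Longrightarrow> Dop \<delta> (c \<odot>\<^bsub>S.R\<^esub> a) = c \<odot>\<^bsub>S.R\<^esub> Dop \<delta> a"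
  and Dop_act: "\<delta> \<in> derivs K \<Longrightarrow> x \<in> tilde_carrier K \<Longrightarrow> a \<in> carrier S.R \<Longrightarrow>
    Dop \<delta> (act S.R x a) = act S.R x (Dop \<delta> a) \<oplus>\<^bsub>S.R\<^esub> act S.R (br \<delta> x) a"
  and Dop_j: "\<delta> \<in> derivs K \<Longrightarrow> m \<in> carrier M \<Longrightarrow> Dop \<delta> (S.j m) = S.j (act iM \<delta> m)"
  using is_deriv_Dop unfolding is_deriv_op_def by blast+

text \<open>
  The argument by which relations among the operators \<open>Dop \<delta>\<close> are established: linearity in \<open>\<delta>\<close> and
  commutativity need only be checked on the image of \<open>j\<close>.
\<close>

lemma operator_unique:
  assumes F: "\<And>a. a \<in> carrier S.R \<Longrightarrow> F a \<in> carrier S.R" "\<And>a. a \<in> carrier S.R \<Longrightarrow> G a \<in> carrier S.R"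
    and add: "\<And>a b. a \<in> carrier S.R \<Longrightarrow> b \<in> carrier S.R \<Longrightarrow> F (a \<oplus>\<^bsub>S.R\<^esub> b) = F a \<oplus>\<^bsub>S.R\<^esub> F b"
      "\<And>a b. a \<in> carrier S.R \<Longrightarrow> b \<in> carrier S.R \<Longrightarrow> G (a \<oplus>\<^bsub>S.R\<^esub> b) = G a \<oplus>\<^bsub>S.R\<^esub> G b"
    and smult: "\<And>c a. a \<in> carrier S.R \<Longrightarrow> F (c \<odot>\<^bsub>S.R\<^esub> a) = c \<odot>\<^bsub>S.R\<^esub> F a"
      "\<And>c a. a \<in> carrier S.R \<Longrightarrow> G (c \<odot>\<^bsub>S.R\<^esub> a) = c \<odot>\<^bsub>S.R\<^esub> G a"
    and step: "\<And>x a. x \<in> tilde_carrier K \<Longrightarrow> a \<in> carrier S.R \<Longrightarrow> F a = G a \<Longrightarrow> F (act S.R x a) = G (act S.R x a)"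
    and j: "\<And>m. m \<in> carrier M \<Longrightarrow> F (S.j m) = G (S.j m)"
    and a: "a \<in> carrier S.R"
  shows "F a = G a"
proof -
  have "0 \<odot>\<^bsub>S.R\<^esub> b = \<zero>\<^bsub>S.R\<^esub>" if "b \<in> carrier S.R" for b using that by (intro R.crd_eqI) simp_all
  then have "F \<zero>\<^bsub>S.R\<^esub> = G \<zero>\<^bsub>S.R\<^esub>"
    using smult[OF R.zero_in, of 0] F R.zero_in by metis
  then have "is_lie_submodule (til K) S.R {a \<in> carrier S.R. F a = G a}"
    unfolding R.is_lie_submodule_iff using step by (auto simp: add smult R_act)
  then have "{a \<in> carrier S.R. F a = G a} = carrier S.R"
    by (rule S.j_generates) (use j M_in_R in simp)
  then show ?thesis using a by blast
qed

lemma Dop_left_add: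
  assumes d: "\<delta> \<in> derivs K" "\<epsilon> \<in> derivs K" and a: "a \<in> carrier S.R"
  shows "Dop (\<delta> + \<epsilon>) a = Dop \<delta> a \<oplus>\<^bsub>S.R\<^esub> Dop \<epsilon> a"
proof (rule operator_unique[OF _ _ _ _ _ _ _ _ a])
  note de = derivs_add[OF d]
  note D = Dop_in[OF d(1)] Dop_in[OF d(2)] Dop_in[OF de] Dop_add[OF d(1)] Dop_add[OF d(2)] Dop_add[OF de]
     Dop_smult[OF d(1)] Dop_smult[OF d(2)] Dop_smult[OF de]
  fix a b c
  assume a: "a \<in> carrier S.R"
  show "Dop (\<delta> + \<epsilon>) a \<in> carrier S.R" "Dop \<delta> a \<oplus>\<^bsub>S.R\<^esub> Dop \<epsilon> a \<in> carrier S.R" using a D by simp_all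
  show "Dop (\<delta> + \<epsilon>) (c \<odot>\<^bsub>S.R\<^esub> a) = c \<odot>\<^bsub>S.R\<^esub> Dop (\<delta> + \<epsilon>) a" using a D by simp
  show "Dop \<delta> (c \<odot>\<^bsub>S.R\<^esub> a) \<oplus>\<^bsub>S.R\<^esub> Dop \<epsilon> (c \<odot>\<^bsub>S.R\<^esub> a) = c \<odot>\<^bsub>S.R\<^esub> (Dop \<delta> a \<oplus>\<^bsub>S.R\<^esub> Dop \<epsilon> a)"
    using a D by (intro R.crd_eqI) (simp_all add: ps.scale_right_distrib)
  { assume b: "b \<in> carrier S.R"
    show "Dop (\<delta> + \<epsilon>) (a \<oplus>\<^bsub>S.R\<^esub> b) = Dop (\<delta> + \<epsilon>) a \<oplus>\<^bsub>S.R\<^esub> Dop (\<delta> + \<epsilon>) b" using a b D by simp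
    show "Dop \<delta> (a \<oplus>\<^bsub>S.R\<^esub> b) \<oplus>\<^bsub>S.R\<^esub> Dop \<epsilon> (a \<oplus>\<^bsub>S.R\<^esub> b) = (Dop \<delta> a \<oplus>\<^bsub>S.R\<^esub> Dop \<epsilon> a) \<oplus>\<^bsub>S.R\<^esub> (Dop \<delta> b \<oplus>\<^bsub>S.R\<^esub> Dop \<epsilon> b)"
      using a b D by (intro R.crd_eqI) simp_all }
  fix x :: "'g toroidal" assume x: "x \<in> tilde_carrier K" and eq: "Dop (\<delta> + \<epsilon>) a = Dop \<delta> a \<oplus>\<^bsub>S.R\<^esub> Dop \<epsilon> a"
  show "Dop (\<delta> + \<epsilon>) (act S.R x a) = Dop \<delta> (act S.R x a) \<oplus>\<^bsub>S.R\<^esub> Dop \<epsilon> (act S.R x a)"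
    using x a eq D br_deriv[OF d(1) x] br_deriv[OF d(2) x]
    by (intro R.crd_eqI) (simp_all add: Dop_act d de br_add_left R_left R_act)
next
  fix m assume m: "m \<in> carrier M"
  have "act iM (\<delta> + \<epsilon>) m = act iM \<delta> m \<oplus>\<^bsub>iM\<^esub> act iM \<epsilon> m"
    using H.P.act_add_left[unfolded toroidal_simps, OF derivs_hatp[OF d(1)] derivs_hatp[OF d(2)]] m by (simp del: inflate_simps(3,5))
  moreover have "act iM \<delta> m \<in> carrier iM" "act iM \<epsilon> m \<in> carrier iM" using iM_in[OF derivs_hatp] d m by (simp_all del: inflate_simps(5))
  ultimately show "Dop (\<delta> + \<epsilon>) (S.j m) = Dop \<delta> (S.j m) \<oplus>\<^bsub>S.R\<^esub> Dop \<epsilon> (S.j m)"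
    using m d derivs_add[OF d] by (simp add: Dop_j lie_hom_add[OF S.j_hom] del: inflate_simps)
qed

lemma Dop_left_sc:
  assumes d: "\<delta> \<in> derivs K" and a: "a \<in> carrier S.R"
  shows "Dop (sc z \<delta>) a = z \<odot>\<^bsub>S.R\<^esub> Dop \<delta> a"
proof (rule operator_unique[OF _ _ _ _ _ _ _ _ a])
  note de = derivs_sc[OF d, of z]
  note D = Dop_in[OF d(1)] Dop_in[OF de] Dop_add[OF d(1)] Dop_add[OF de] Dop_smult[OF d(1)] Dop_smult[OF de]
  fix a b c
  assume a: "a \<in> carrier S.R"
  show "Dop (sc z \<delta>) a \<in> carrier S.R" "z \<odot>\<^bsub>S.R\<^esub> Dop \<delta> a \<in> carrier S.R" using a D by simp_all
  show "Dop (sc z \<delta>) (c \<odot>\<^bsub>S.R\<^esub> a) = c \<odot>\<^bsub>S.R\<^esub> Dop (sc z \<delta>) a" using a D by simp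
  show "z \<odot>\<^bsub>S.R\<^esub> Dop \<delta> (c \<odot>\<^bsub>S.R\<^esub> a) = c \<odot>\<^bsub>S.R\<^esub> (z \<odot>\<^bsub>S.R\<^esub> Dop \<delta> a)"
    using a D by (intro R.crd_eqI) (simp_all add: mult.commute)
  { assume b: "b \<in> carrier S.R"
    show "Dop (sc z \<delta>) (a \<oplus>\<^bsub>S.R\<^esub> b) = Dop (sc z \<delta>) a \<oplus>\<^bsub>S.R\<^esub> Dop (sc z \<delta>) b" using a b D by simp
    show "z \<odot>\<^bsub>S.R\<^esub> Dop \<delta> (a \<oplus>\<^bsub>S.R\<^esub> b) = z \<odot>\<^bsub>S.R\<^esub> Dop \<delta> a \<oplus>\<^bsub>S.R\<^esub> z \<odot>\<^bsub>S.R\<^esub> Dop \<delta> b"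
      using a b D by (intro R.crd_eqI) (simp_all add: ps.scale_right_distrib) }
  fix x :: "'g toroidal" assume x: "x \<in> tilde_carrier K" and eq: "Dop (sc z \<delta>) a = z \<odot>\<^bsub>S.R\<^esub> Dop \<delta> a"
  show "Dop (sc z \<delta>) (act S.R x a) = z \<odot>\<^bsub>S.R\<^esub> Dop \<delta> (act S.R x a)"
    using x a eq D br_deriv[OF d(1) x]
    by (intro R.crd_eqI) (simp_all add: Dop_act d de br_scale_left R_left R_act ps.scale_right_distrib)
next
  fix m assume m: "m \<in> carrier M"
  have "act iM (sc z \<delta>) m = z \<odot>\<^bsub>iM\<^esub> act iM \<delta> m"
    using H.P.act_scale_left[unfolded toroidal_simps, OF derivs_hatp[OF d(1)]] m by (simp del: inflate_simps(4,5))
  moreover have "act iM \<delta> m \<in> carrier iM" using iM_in[OF derivs_hatp] d m by (simp del: inflate_simps(5))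
  ultimately show "Dop (sc z \<delta>) (S.j m) = z \<odot>\<^bsub>S.R\<^esub> Dop \<delta> (S.j m)"
    using m d derivs_sc[OF d] by (simp add: Dop_j lie_hom_smult[OF S.j_hom] del: inflate_simps)
qed

lemma Dop_zero: "a \<in> carrier S.R \<Longrightarrow> Dop 0 a = \<zero>\<^bsub>S.R\<^esub>"
proof -
  assume a: "a \<in> carrier S.R"
  have "sc 0 0 = (0 :: 'g toroidal)" by simp
  then have "Dop 0 a = 0 \<odot>\<^bsub>S.R\<^esub> Dop 0 a" using Dop_left_sc[OF derivs_zero a, of 0] by simp
  then have "crd S.R (Dop 0 a) = crd S.R (0 \<odot>\<^bsub>S.R\<^esub> Dop 0 a)" by (rule arg_cong)
  then show ?thesis using Dop_in[OF derivs_zero a] by (intro R.crd_eqI) simp_all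
qed

lemma Dop_commute:
  assumes d: "\<delta> \<in> derivs K" "\<epsilon> \<in> derivs K" and a: "a \<in> carrier S.R"
  shows "Dop \<delta> (Dop \<epsilon> a) = Dop \<epsilon> (Dop \<delta> a)"
proof (rule operator_unique[OF _ _ _ _ _ _ _ _ a])
  note D = Dop_in[OF d(1)] Dop_in[OF d(2)] Dop_add[OF d(1)] Dop_add[OF d(2)]
     Dop_smult[OF d(1)] Dop_smult[OF d(2)]
  fix a b c
  assume a: "a \<in> carrier S.R"
  show "Dop \<delta> (Dop \<epsilon> a) \<in> carrier S.R" "Dop \<epsilon> (Dop \<delta> a) \<in> carrier S.R" using a D by simp_all
  show "Dop \<delta> (Dop \<epsilon> (c \<odot>\<^bsub>S.R\<^esub> a)) = c \<odot>\<^bsub>S.R\<^esub> Dop \<delta> (Dop \<epsilon> a)" "Dop \<epsilon> (Dop \<delta> (c \<odot>\<^bsub>S.R\<^esub> a)) = c \<odot>\<^bsub>S.R\<^esub> Dop \<epsilon> (Dop \<delta> a)"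
    using a D by simp_all
  { assume b: "b \<in> carrier S.R"
    show "Dop \<delta> (Dop \<epsilon> (a \<oplus>\<^bsub>S.R\<^esub> b)) = Dop \<delta> (Dop \<epsilon> a) \<oplus>\<^bsub>S.R\<^esub> Dop \<delta> (Dop \<epsilon> b)"
      "Dop \<epsilon> (Dop \<delta> (a \<oplus>\<^bsub>S.R\<^esub> b)) = Dop \<epsilon> (Dop \<delta> a) \<oplus>\<^bsub>S.R\<^esub> Dop \<epsilon> (Dop \<delta> b)" using a b D by simp_all }
  fix x :: "'g toroidal" assume x: "x \<in> tilde_carrier K" and eq: "Dop \<delta> (Dop \<epsilon> a) = Dop \<epsilon> (Dop \<delta> a)"
  note b = br_deriv[OF d(1) x] br_deriv[OF d(2) x]
  \<comment> \<open>Derivations commute with each other, and hence so do their actions on the algebra.\<close>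
  have comm: "br \<delta> (br \<epsilon> x) = br \<epsilon> (br \<delta> x)"
    using br_leibniz[of \<delta> \<epsilon> x] derivs_br[OF d] by simp
  note bb = br_deriv[OF d(2) b(1)]
  show "Dop \<delta> (Dop \<epsilon> (act S.R x a)) = Dop \<epsilon> (Dop \<delta> (act S.R x a))"
    using x a eq D b bb by (intro R.crd_eqI) (simp_all add: Dop_act d comm R_act algebra_simps)
next
  fix m assume m: "m \<in> carrier M"
  note dp = derivs_hatp[OF d(1)] and ep = derivs_hatp[OF d(2)]
  have mi: "m \<in> carrier iM" and em: "act iM \<epsilon> m \<in> carrier M" "act iM \<delta> m \<in> carrier M" using m iM_in dp ep by simp_all
  have "act iM (br \<delta> \<epsilon>) m = act iM \<delta> (act iM \<epsilon> m) \<ominus>\<^bsub>iM\<^esub> act iM \<epsilon> (act iM \<delta> m)"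
    using H.P.act_bracket[unfolded toroidal_simps, OF dp ep mi] .
  moreover have "act iM (br \<delta> \<epsilon>) m = \<zero>\<^bsub>iM\<^esub>"
  proof -
    have "act iM (sc 0 \<delta>) m = 0 \<odot>\<^bsub>iM\<^esub> act iM \<delta> m"
      using H.P.act_scale_left[unfolded toroidal_simps, OF dp mi] .
    moreover have "sc 0 \<delta> = 0" using derivs_sc[OF d(1), of 0] d(1) by (auto simp: derivs_def sc_cd)
    moreover have "0 \<odot>\<^bsub>iM\<^esub> act iM \<delta> m = \<zero>\<^bsub>iM\<^esub>"
      by (rule H.P.smult_zero_left) (use em(2) in \<open>simp only: inflate_simps(1)\<close>)
    ultimately show ?thesis by (simp add: derivs_br[OF d] del: inflate_simps)
  qed
  ultimately have 0: "\<zero>\<^bsub>iM\<^esub> = act iM \<delta> (act iM \<epsilon> m) \<ominus>\<^bsub>iM\<^esub> act iM \<epsilon> (act iM \<delta> m)" by simp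
  have "act iM \<delta> (act iM \<epsilon> m) = act iM \<epsilon> (act iM \<delta> m)"
  proof (rule H.P.crd_eqI)
    show c: "act iM \<delta> (act iM \<epsilon> m) \<in> carrier iM" "act iM \<epsilon> (act iM \<delta> m) \<in> carrier iM"
      using iM_in[OF dp em(1)] iM_in[OF ep em(2)] by (simp_all only: inflate_simps(1))
    have "crd iM \<zero>\<^bsub>iM\<^esub> = crd iM (act iM \<delta> (act iM \<epsilon> m)) - crd iM (act iM \<epsilon> (act iM \<delta> m))"
      unfolding 0 by (rule H.P.crd_minus[OF c])
    then show "crd iM (act iM \<delta> (act iM \<epsilon> m)) = crd iM (act iM \<epsilon> (act iM \<delta> m))"
      unfolding H.P.crd_zero by simp
  qed
  then show "Dop \<delta> (Dop \<epsilon> (S.j m)) = Dop \<epsilon> (Dop \<delta> (S.j m))"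
    using m d em by (simp only: Dop_j)
qed

definition tl_part :: "'g toroidal \<Rightarrow> 'g toroidal" where "tl_part = (\<lambda>(a, c, d). (a, c, 0))"
definition dd_part :: "'g toroidal \<Rightarrow> 'g toroidal" where "dd_part = (\<lambda>(a, c, d). (0, 0, d))"

lemma part_facts:
  "tl_part (X + Y) = tl_part X + tl_part Y" "dd_part (X + Y) = dd_part X + dd_part Y"
  "tl_part (sc z X) = sc z (tl_part X)" "dd_part (sc z X) = sc z (dd_part X)"
  "tl_part X + dd_part X = X"
  by (cases X; cases Y; auto simp: tl_part_def dd_part_def sc_eq intro!: poly_mapping_eqI)+

lemma part_in: "X \<in> hat_carrier K \<Longrightarrow> tl_part X \<in> tilde_carrier K" "X \<in> hat_carrier K \<Longrightarrow> dd_part X \<in> derivs K"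
  by (auto simp: hat_carrier_def tilde_carrier_def derivs_def tl_part_def dd_part_def)

lemma part_til: "X \<in> tilde_carrier K \<Longrightarrow> tl_part X = X" "X \<in> tilde_carrier K \<Longrightarrow> dd_part X = 0"
  by (auto simp: tilde_carrier_def tl_part_def dd_part_def)

lemma tl_part_plus: "X \<in> hat_carrier K \<inter> plus_part K \<Longrightarrow> tl_part X \<in> tilde_carrier K \<inter> plus_part K"
  by (auto simp: hat_carrier_def tilde_carrier_def plus_part_def tl_part_def)

text \<open>
  The module induced without derivations, made into a module for the algebra with derivations.
\<close>

definition ext :: "('g toroidal, ('g toroidal, 'v) universe) lie_rep" where
  "ext = S.R\<lparr>act := \<lambda>X w. act S.R (tl_part X) w \<oplus>\<^bsub>S.R\<^esub> Dop (dd_part X) w\<rparr>"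

lemma ext_simps:
  "carrier ext = carrier S.R" "\<zero>\<^bsub>ext\<^esub> = \<zero>\<^bsub>S.R\<^esub>" "a \<oplus>\<^bsub>ext\<^esub> b = a \<oplus>\<^bsub>S.R\<^esub> b" "c \<odot>\<^bsub>ext\<^esub> a = c \<odot>\<^bsub>S.R\<^esub> a"
  "act ext X w = act S.R (tl_part X) w \<oplus>\<^bsub>S.R\<^esub> Dop (dd_part X) w" "a \<ominus>\<^bsub>ext\<^esub> b = a \<ominus>\<^bsub>S.R\<^esub> b"
  by (simp_all add: ext_def a_minus_def a_inv_def)

lemma ext_til: "X \<in> tilde_carrier K \<Longrightarrow> w \<in> carrier S.R \<Longrightarrow> act ext X w = act S.R X w"
  by (rule R.crd_eqI) (simp_all add: ext_simps part_til Dop_zero R_act)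

lemma ext_module: "is_lie_module (hat K) ext"
proof (rule is_lie_moduleI)
  show "cmod ext"
    by (rule image_cmod[OF R.cmod_axioms, where f = "\<lambda>m. m"]) (simp_all add: ext_simps)
  fix X Y w v c
  assume "X \<in> lie_carrier (hat K)" "w \<in> carrier ext"
  then have X: "X \<in> hat_carrier K" and w: "w \<in> carrier S.R" by (simp_all add: ext_simps)
  note pX = part_in[OF X]
  note D = Dop_in Dop_add Dop_smult R_act
  show "act ext X w \<in> carrier ext" using pX w by (simp add: ext_simps D)
  show "act ext X (c \<odot>\<^bsub>ext\<^esub> w) = c \<odot>\<^bsub>ext\<^esub> act ext X w"
    unfolding ext_simps using pX w by (intro R.crd_eqI) (simp_all add: D ps.scale_right_distrib)
  show "act ext (lie_scale (hat K) c X) w = c \<odot>\<^bsub>ext\<^esub> act ext X w"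
    unfolding ext_simps toroidal_simps using pX w
    by (intro R.crd_eqI) (simp_all add: D ps.scale_right_distrib part_facts R_left Dop_left_sc)
  { assume "v \<in> carrier ext"
    then have v: "v \<in> carrier S.R" by (simp add: ext_simps)
    show "act ext X (w \<oplus>\<^bsub>ext\<^esub> v) = act ext X w \<oplus>\<^bsub>ext\<^esub> act ext X v"
      unfolding ext_simps using pX w v by (intro R.crd_eqI) (simp_all add: D) }
  assume "Y \<in> lie_carrier (hat K)"
  then have Y: "Y \<in> hat_carrier K" by simp
  note pY = part_in[OF Y]
  show "act ext (X + Y) w = act ext X w \<oplus>\<^bsub>ext\<^esub> act ext Y w"
    unfolding ext_simps using pX pY w
    by (intro R.crd_eqI) (simp_all add: D part_facts R_left Dop_left_add)
  let ?x = "tl_part X" and ?y = "tl_part Y" and ?\<delta> = "dd_part X" and ?\<epsilon> = "dd_part Y"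
  have b: "br ?x ?y \<in> tilde_carrier K" "br ?\<delta> ?y \<in> tilde_carrier K" "br ?\<epsilon> ?x \<in> tilde_carrier K" "br X Y \<in> tilde_carrier K"
    using pX pY X Y br_deriv br_hat tilde_subset_hat by blast+
  have "br X Y = br (?x + ?\<delta>) (?y + ?\<epsilon>)" by (simp add: part_facts)
  also have "\<dots> = br ?x ?y + br ?\<delta> ?y + br ?x ?\<epsilon>"
    by (simp only: br_add_left br_add_right derivs_br[OF pX(2) pY(2)]) simp
  finally have "br X Y + br ?\<epsilon> ?x = br ?x ?y + br ?\<delta> ?y"
    using br_antisym[of ?x ?\<epsilon>] by simp
  then have "act S.R (br X Y + br ?\<epsilon> ?x) w = act S.R (br ?x ?y + br ?\<delta> ?y) w" by simp
  then have key: "act S.R (br X Y) w \<oplus>\<^bsub>S.R\<^esub> act S.R (br ?\<epsilon> ?x) w = act S.R (br ?x ?y) w \<oplus>\<^bsub>S.R\<^esub> act S.R (br ?\<delta> ?y) w"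
    using b w by (simp add: R_left)
  have key': "crd S.R (act S.R (br X Y) w) + crd S.R (act S.R (br ?\<epsilon> ?x) w) =
      crd S.R (act S.R ?x (act S.R ?y w)) - crd S.R (act S.R ?y (act S.R ?x w)) + crd S.R (act S.R (br ?\<delta> ?y) w)"
    using arg_cong[OF key, of "crd S.R"] b w pX pY R.act_bracket[unfolded toroidal_simps, OF pX(1) pY(1) w] by (simp add: R_act)
  have c: "act S.R ?x (act S.R ?y w \<oplus>\<^bsub>S.R\<^esub> Dop ?\<epsilon> w) = act S.R ?x (act S.R ?y w) \<oplus>\<^bsub>S.R\<^esub> act S.R ?x (Dop ?\<epsilon> w)"
    "act S.R ?y (act S.R ?x w \<oplus>\<^bsub>S.R\<^esub> Dop ?\<delta> w) = act S.R ?y (act S.R ?x w) \<oplus>\<^bsub>S.R\<^esub> act S.R ?y (Dop ?\<delta> w)"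
    "Dop ?\<delta> (act S.R ?y w \<oplus>\<^bsub>S.R\<^esub> Dop ?\<epsilon> w) = (act S.R ?y (Dop ?\<delta> w) \<oplus>\<^bsub>S.R\<^esub> act S.R (br ?\<delta> ?y) w) \<oplus>\<^bsub>S.R\<^esub> Dop ?\<delta> (Dop ?\<epsilon> w)"
    "Dop ?\<epsilon> (act S.R ?x w \<oplus>\<^bsub>S.R\<^esub> Dop ?\<delta> w) = (act S.R ?x (Dop ?\<epsilon> w) \<oplus>\<^bsub>S.R\<^esub> act S.R (br ?\<epsilon> ?x) w) \<oplus>\<^bsub>S.R\<^esub> Dop ?\<delta> (Dop ?\<epsilon> w)"
    using pX pY w Dop_commute[OF pX(2) pY(2) w] by (simp_all add: D Dop_act)
  have "act ext (br X Y) w = act S.R (br X Y) w" by (rule ext_til[OF b(4) w])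
  then show "act ext (lie_bracket (hat K) X Y) w = act ext X (act ext Y w) \<ominus>\<^bsub>ext\<^esub> act ext Y (act ext X w)"
    unfolding toroidal_simps ext_simps(1-4,6) unfolding ext_simps(5)[of X] ext_simps(5)[of Y] c
    using key' pX pY w b by (intro R.crd_eqI) (simp_all add: D eq_diff_eq algebra_simps)
qed

lemma j_ext_hom: "S.j \<in> lie_hom (hatp K) iM ext"
proof (rule lie_homI)
  fix m m' c X assume m: "m \<in> carrier iM"
  show "S.j m \<in> carrier ext" using m by (simp add: ext_simps M_in_R)
  show "S.j (c \<odot>\<^bsub>iM\<^esub> m) = c \<odot>\<^bsub>ext\<^esub> S.j m" unfolding ext_simps by (rule lie_hom_smult[OF S.j_hom m])
  show "S.j (m \<oplus>\<^bsub>iM\<^esub> m') = S.j m \<oplus>\<^bsub>ext\<^esub> S.j m'" if "m' \<in> carrier iM"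
    unfolding ext_simps by (rule lie_hom_add[OF S.j_hom m that])
  assume "X \<in> lie_carrier (hatp K)"
  then have X: "X \<in> hat_carrier K \<inter> plus_part K" by simp
  have t: "tl_part X \<in> tilde_carrier K \<inter> plus_part K" "tl_part X \<in> hat_carrier K \<inter> plus_part K" and d: "dd_part X \<in> derivs K"
    using tl_part_plus[OF X] part_in(2)[of X] X tilde_subset_hat[of K] by blast+
  have "act iM (tl_part X + dd_part X) m = act iM (tl_part X) m \<oplus>\<^bsub>iM\<^esub> act iM (dd_part X) m"
    using H.P.act_add_left[unfolded toroidal_simps, OF t(2) derivs_hatp[OF d] m] .
  moreover have "act iM (tl_part X) m \<in> carrier iM" "act iM (dd_part X) m \<in> carrier iM"
    using H.P.act_in[unfolded toroidal_simps, OF t(2) m] H.P.act_in[unfolded toroidal_simps, OF derivs_hatp[OF d] m] by auto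
  ultimately have "S.j (act iM X m) = S.j (act iM (tl_part X) m) \<oplus>\<^bsub>S.R\<^esub> S.j (act iM (dd_part X) m)"
    unfolding part_facts by (simp only: lie_hom_add[OF S.j_hom])
  then show "S.j (act iM X m) = act ext X (S.j m)"
    unfolding ext_simps using t(1) m d lie_hom_act[OF S.j_hom _ m, of "tl_part X"]
    by (simp only: toroidal_simps Dop_j[OF d m[unfolded inflate_simps]])
qed

text \<open>
  Both maps come from universal properties, \<open>\<psi>\<close> from that of the larger algebra with target \<open>ext\<close>. To see that
  \<open>\<phi> \<circ> \<psi>\<close> is the identity one needs \<open>\<phi>\<close> to respect the derivations as well, which is checked on
  generators.
\<close>

lemma tilde_hat_inverse_maps:
  "\<exists>\<phi>\<in>lie_hom (til K) S.R H.R. \<exists>\<psi>\<in>lie_hom (til K) H.R S.R. (\<forall>m\<in>carrier iM. \<phi> (S.j m) = H.j m) \<and>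
     (\<forall>a\<in>carrier S.R. \<psi> (\<phi> a) = a) \<and> (\<forall>b\<in>carrier H.R. \<phi> (\<psi> b) = b)"
proof -
  have RHt: "is_lie_module (til K) H.R" by (rule is_lie_module_substruct[OF til_sub_hat H.R_module])
  have sp: "substruct (tilp K) (hatp K)" by (rule substruct_toroidal) (use tilde_subset_hat in blast)
  have Hj: "H.j \<in> lie_hom (tilp K) iM H.R" by (rule lie_hom_substruct[OF sp H.j_hom])
  obtain \<phi> where \<phi>: "\<phi> \<in> lie_hom (til K) S.R H.R" and \<phi>j: "\<forall>m\<in>carrier iM. \<phi> (S.j m) = H.j m"
    using S.j_universal[OF RHt Hj] by (rule bexE)
  obtain \<psi> where \<psi>: "\<psi> \<in> lie_hom (hat K) H.R ext" and \<psi>j: "\<forall>m\<in>carrier iM. \<psi> (H.j m) = S.j m"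
    using H.j_universal[OF ext_module j_ext_hom] by (rule bexE)
  have \<psi>in: "\<psi> b \<in> carrier S.R" if "b \<in> carrier H.R" for b
    using lie_hom_closed[OF \<psi> that] by (simp add: ext_simps)
  have \<psi>t: "\<psi> \<in> lie_hom (til K) H.R S.R"
  proof (rule lie_homI)
    fix m m' c x assume m: "m \<in> carrier H.R"
    show "\<psi> m \<in> carrier S.R" using m by (rule \<psi>in)
    show "\<psi> (c \<odot>\<^bsub>H.R\<^esub> m) = c \<odot>\<^bsub>S.R\<^esub> \<psi> m" using lie_hom_smult[OF \<psi> m] by (simp add: ext_simps)
    show "\<psi> (m \<oplus>\<^bsub>H.R\<^esub> m') = \<psi> m \<oplus>\<^bsub>S.R\<^esub> \<psi> m'" if "m' \<in> carrier H.R"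
      using lie_hom_add[OF \<psi> m that] by (simp add: ext_simps)
    assume "x \<in> lie_carrier (til K)"
    then have x: "x \<in> tilde_carrier K" "x \<in> hat_carrier K" using tilde_subset_hat[of K] by auto
    then show "\<psi> (act H.R x m) = act S.R x (\<psi> m)"
      using lie_hom_act[OF \<psi> _ m, of x] ext_til[OF x(1) \<psi>in[OF m]] by simp
  qed
  have j_in: "H.j m \<in> carrier H.R" if "m \<in> carrier iM" for m using lie_hom_closed[OF H.j_hom that] .
  have 1: "\<psi> (\<phi> a) = a" if "a \<in> carrier S.R" for a
    by (rule S.hom_ext[OF S.R_module lie_hom_comp[OF S.R_module \<phi> \<psi>t] lie_hom_id _ that]) (use \<phi>j \<psi>j in simp)
  have \<phi>D: "\<phi> (Dop \<delta> a) = act H.R \<delta> (\<phi> a)" if d: "\<delta> \<in> derivs K" and a: "a \<in> carrier S.R" for \<delta> a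
  proof -
    let ?S = "{a \<in> carrier S.R. \<phi> (Dop \<delta> a) = act H.R \<delta> (\<phi> a)}"
    note dh = derivs_hat[OF d]
    note \<phi>s = lie_hom_closed[OF \<phi>] lie_hom_add[OF \<phi>] lie_hom_smult[OF \<phi>]
    have \<phi>a: "\<phi> (act S.R x a) = act H.R x (\<phi> a)" if "x \<in> tilde_carrier K" "a \<in> carrier S.R" for x a
      using lie_hom_act[OF \<phi> _ that(2)] that(1) by simp
    note RHs = RH.act_in[unfolded toroidal_simps] RH.act_add[unfolded toroidal_simps] RH.act_smult[unfolded toroidal_simps]
    have z: "Dop \<delta> \<zero>\<^bsub>S.R\<^esub> = \<zero>\<^bsub>S.R\<^esub>"
    proof -
      have "\<zero>\<^bsub>S.R\<^esub> = 0 \<odot>\<^bsub>S.R\<^esub> \<zero>\<^bsub>S.R\<^esub>" by (rule R.crd_eqI) simp_all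
      then have "Dop \<delta> \<zero>\<^bsub>S.R\<^esub> = 0 \<odot>\<^bsub>S.R\<^esub> Dop \<delta> \<zero>\<^bsub>S.R\<^esub>" using Dop_smult[OF d R.zero_in, of 0] by simp
      then have "crd S.R (Dop \<delta> \<zero>\<^bsub>S.R\<^esub>) = crd S.R (0 \<odot>\<^bsub>S.R\<^esub> Dop \<delta> \<zero>\<^bsub>S.R\<^esub>)" by (rule arg_cong)
      then show ?thesis using Dop_in[OF d R.zero_in] by (intro R.crd_eqI) simp_all
    qed
    have step: "act S.R x a \<in> ?S" if x: "x \<in> tilde_carrier K" and "a \<in> ?S" for x a
    proof -
      have a: "a \<in> carrier S.R" "\<phi> (Dop \<delta> a) = act H.R \<delta> (\<phi> a)" using that(2) by auto
      have xh: "x \<in> hat_carrier K" and bx: "br \<delta> x \<in> tilde_carrier K" "br \<delta> x \<in> hat_carrier K"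
        using x br_deriv[OF d x] tilde_subset_hat[of K] by blast+
      have "\<phi> (Dop \<delta> (act S.R x a)) = act H.R x (act H.R \<delta> (\<phi> a)) \<oplus>\<^bsub>H.R\<^esub> act H.R (br \<delta> x) (\<phi> a)"
        using x a bx Dop_in[OF d a(1)] by (simp add: Dop_act[OF d] \<phi>s \<phi>a R_act)
      also have "\<dots> = act H.R \<delta> (act H.R x (\<phi> a))"
        using RH.act_commute[unfolded toroidal_simps, OF dh xh bx(2) \<phi>s(1)[OF a(1)]] by simp
      finally show ?thesis using x a by (simp add: \<phi>a R_act)
    qed
    have "is_lie_submodule (til K) S.R ?S"
      unfolding R.is_lie_submodule_iff toroidal_simps using step
      by (auto simp: z lie_hom_zero[OF S.R_module RHt \<phi>] RH.act_zero dh \<phi>s RHs Dop_add[OF d] Dop_smult[OF d] Dop_in[OF d])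
    moreover have "S.j m \<in> ?S" if m: "m \<in> carrier iM" for m
    proof -
      have "act iM \<delta> m \<in> carrier iM" using H.P.act_in[unfolded toroidal_simps, OF derivs_hatp[OF d] m] .
      then have "\<phi> (Dop \<delta> (S.j m)) = H.j (act iM \<delta> m)"
        using \<phi>j Dop_j[OF d m[unfolded inflate_simps]] by (simp only:)
      also have "\<dots> = act H.R \<delta> (H.j m)"
        using lie_hom_act[OF H.j_hom _ m, of \<delta>] derivs_hatp[OF d] by (simp only: toroidal_simps)
      finally show ?thesis using \<phi>j m M_in_R by simp
    qed
    ultimately have "?S = carrier S.R" by (rule S.j_generates)
    then show ?thesis using a by blast
  qed
  have \<phi>h: "\<phi> \<in> lie_hom (hat K) ext H.R"
  proof (rule lie_homI; unfold ext_simps)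
    fix m m' c X assume m: "m \<in> carrier S.R"
    show "\<phi> m \<in> carrier H.R" "\<phi> (c \<odot>\<^bsub>S.R\<^esub> m) = c \<odot>\<^bsub>H.R\<^esub> \<phi> m"
      by (rule lie_hom_closed[OF \<phi> m] lie_hom_smult[OF \<phi> m])+
    show "\<phi> (m \<oplus>\<^bsub>S.R\<^esub> m') = \<phi> m \<oplus>\<^bsub>H.R\<^esub> \<phi> m'" if "m' \<in> carrier S.R" by (rule lie_hom_add[OF \<phi> m that])
    assume "X \<in> lie_carrier (hat K)"
    then have X: "X \<in> hat_carrier K" by simp
    note pX = part_in[OF X]
    have "act H.R (tl_part X + dd_part X) (\<phi> m) = act H.R (tl_part X) (\<phi> m) \<oplus>\<^bsub>H.R\<^esub> act H.R (dd_part X) (\<phi> m)"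
      using subsetD[OF tilde_subset_hat pX(1)] derivs_hat[OF pX(2)] lie_hom_closed[OF \<phi> m]
      by (rule RH.act_add_left[unfolded toroidal_simps])
    then show "\<phi> (act S.R (tl_part X) m \<oplus>\<^bsub>S.R\<^esub> Dop (dd_part X) m) = act H.R X (\<phi> m)"
      using pX m lie_hom_act[OF \<phi> _ m, of "tl_part X"]
      by (simp add: part_facts(5) lie_hom_add[OF \<phi>] R_act Dop_in \<phi>D)
  qed
  have 2: "\<phi> (\<psi> b) = b" if "b \<in> carrier H.R" for b
    by (rule H.hom_ext[OF H.R_module lie_hom_comp[OF H.R_module \<psi> \<phi>h] lie_hom_id _ that]) (use \<phi>j \<psi>j in simp)
  show ?thesis using \<phi>j 1 2 by (intro bexI[OF _ \<phi>] bexI[OF _ \<psi>t]) simp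
qed

theorem tilde_hat_isomorphic: "lie_isomorphic (til K) S.R H.R"
  using tilde_hat_inverse_maps by (auto intro: lie_isomorphicI)

text \<open>
  Inducing from the larger algebra adds nothing new: the image of \<open>M\<close> generates already under the
  algebra without derivations, since it does so in the isomorphic module \<open>S.R\<close>.
\<close>

lemma tilde_generates:
  assumes T: "is_lie_submodule (til K) H.R T" and j: "\<And>m. m \<in> carrier M \<Longrightarrow> H.j m \<in> T"
  shows "T = carrier H.R"
proof -
  have RHt: "is_lie_module (til K) H.R" by (rule is_lie_module_substruct[OF til_sub_hat H.R_module])
  obtain \<phi> \<psi> where \<phi>: "\<phi> \<in> lie_hom (til K) S.R H.R" and \<psi>: "\<psi> \<in> lie_hom (til K) H.R S.R"
    and \<phi>j: "\<forall>m\<in>carrier iM. \<phi> (S.j m) = H.j m" and inv: "\<forall>b\<in>carrier H.R. \<phi> (\<psi> b) = b"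
    using tilde_hat_inverse_maps by blast
  have eq: "{a \<in> carrier S.R. \<phi> a \<in> T} = carrier S.R"
    by (rule S.j_generates[OF preimage_submodule[OF S.R_module RHt \<phi> T]]) (use \<phi>j j M_in_R in simp)
  have "b \<in> T" if "b \<in> carrier H.R" for b
    using eq inv lie_hom_closed[OF \<psi> that] that by (metis (mono_tags, lifting) mem_Collect_eq)
  moreover have "T \<subseteq> carrier H.R"
    using T unfolding lie_mod.is_lie_submodule_iff[OF lie_mod.intro[OF RHt]] by (rule conjunct1)
  ultimately show ?thesis by blast
qed

end

context toroidal_setup
begin

lemma inflate_hom:
  assumes "f \<in> lie_hom (til k) M N" "is_lie_module (til k) M"
  shows "f \<in> lie_hom (tilp (Suc k)) (inflate lev (Suc k) M) (inflate lev (Suc k) N)"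
proof -
  interpret M: lie_mod "til k" M by (rule lie_mod.intro) fact
  show ?thesis
  proof (rule lie_homI)
    fix m m' c X assume "m \<in> carrier (inflate lev (Suc k) M)"
    then have m: "m \<in> carrier M" by simp
    show "f m \<in> carrier (inflate lev (Suc k) N)" "f (c \<odot>\<^bsub>inflate lev (Suc k) M\<^esub> m) = c \<odot>\<^bsub>inflate lev (Suc k) N\<^esub> f m"
      using m by (simp_all add: lie_hom_simps[OF assms(1)])
    show "f (m \<oplus>\<^bsub>inflate lev (Suc k) M\<^esub> m') = f m \<oplus>\<^bsub>inflate lev (Suc k) N\<^esub> f m'" if "m' \<in> carrier (inflate lev (Suc k) M)"
      using m that by (simp add: lie_hom_simps[OF assms(1)])
    assume "X \<in> lie_carrier (tilp (Suc k))"
    then have p: "project (Suc k) X \<in> tilde_carrier k" using project_tilde[of X k] by simp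
    show "f (act (inflate lev (Suc k) M) X m) = act (inflate lev (Suc k) N) X (f m)"
      using p m M.act_in[unfolded toroidal_simps] lie_hom_act[OF assms(1), unfolded toroidal_simps]
      by (simp add: lie_hom_add[OF assms(1)] lie_hom_smult[OF assms(1)])
  qed
qed

text \<open>Functoriality of induction.\<close>

lemma til_induction_isomorphic:
  fixes M N :: "('g toroidal, ('g toroidal, 'v) universe) lie_rep"
  assumes M: "is_lie_module (til k) M" and N: "is_lie_module (til k) N" and iso: "lie_isomorphic (til k) M N"
  shows "lie_isomorphic (til (Suc k))
     (realize (induced (til (Suc k)) (tilp (Suc k)) (inflate lev (Suc k) M)) :: ('g toroidal, ('g toroidal, 'v) universe) lie_rep)
     (realize (induced (til (Suc k)) (tilp (Suc k)) (inflate lev (Suc k) N)) :: ('g toroidal, ('g toroidal, 'v) universe) lie_rep)"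
proof -
  interpret A: universe_induction "til (Suc k)" "tilp (Suc k)" "inflate lev (Suc k) M" by (rule til_induction[OF M])
  interpret B: universe_induction "til (Suc k)" "tilp (Suc k)" "inflate lev (Suc k) N" by (rule til_induction[OF N])
  obtain f g where fg: "f \<in> lie_hom (til k) M N" "g \<in> lie_hom (til k) N M"
    "\<And>m. m \<in> carrier M \<Longrightarrow> g (f m) = m" "\<And>n. n \<in> carrier N \<Longrightarrow> f (g n) = n"
    using lie_isomorphicE[OF M iso] by metis
  have f: "(\<lambda>m. B.j (f m)) \<in> lie_hom (tilp (Suc k)) (inflate lev (Suc k) M) B.R"
    by (rule lie_hom_comp[OF A.P.lie_module inflate_hom[OF fg(1) M] B.j_hom])
  have g: "(\<lambda>m. A.j (g m)) \<in> lie_hom (tilp (Suc k)) (inflate lev (Suc k) N) A.R"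
    by (rule lie_hom_comp[OF B.P.lie_module inflate_hom[OF fg(2) N] A.j_hom])
  obtain F where F: "F \<in> lie_hom (til (Suc k)) A.R B.R" and Fj: "\<forall>m\<in>carrier (inflate lev (Suc k) M). F (A.j m) = B.j (f m)"
    using A.j_universal[OF B.R_module f] by (rule bexE)
  obtain G where G: "G \<in> lie_hom (til (Suc k)) B.R A.R" and Gj: "\<forall>m\<in>carrier (inflate lev (Suc k) N). G (B.j m) = A.j (g m)"
    using B.j_universal[OF A.R_module g] by (rule bexE)
  show ?thesis
  proof (rule lie_isomorphicI[OF F G])
    show "G (F a) = a" if "a \<in> carrier A.R" for a
      by (rule A.hom_ext[OF A.R_module lie_hom_comp[OF A.R_module F G] lie_hom_id _ that])
        (use Fj Gj fg(3) lie_hom_closed[OF fg(1)] in simp)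
    show "F (G a) = a" if "a \<in> carrier B.R" for a
      by (rule B.hom_ext[OF B.R_module lie_hom_comp[OF B.R_module G F] lie_hom_id _ that])
        (use Fj Gj fg(4) lie_hom_closed[OF fg(2)] in simp)
  qed
qed

end


section \<open>The maximal submodule of an induced module\<close>

context toroidal_setup
begin

lemma hom_deg_project: "X \<in> hom_deg k e \<Longrightarrow> e \<noteq> 0 \<Longrightarrow> project k X = 0 \<and> ck k X = 0"
proof -
  assume X: "X \<in> hom_deg k e" and e: "e \<noteq> 0"
  obtain a c d where Xe: "X = (a, c, d)" by (cases X)
  have "c = 0" "d = 0" using hom_degD(2,3)[OF X[unfolded Xe] e] by simp_all
  moreover have "Poly_Mapping.mapp (\<lambda>n x. if Poly_Mapping.lookup n k = 0 then x else 0) a = 0"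
    using hom_degD(1)[OF X[unfolded Xe]] e by (intro poly_mapping_eqI) (auto simp: lookup_mapp when_def)
  ultimately show ?thesis by (simp add: Xe project_def ck_def)
qed

lemma dk_hat: "dk (Suc k) \<in> hat_carrier (Suc k)"
  by (auto simp: hat_carrier_def)

lemma dk_hom_deg: "dk (Suc k) \<in> hom_deg (Suc k) 0"
  using dk_hat by (rule cd_hom_deg)

lemma box_mono: "A \<subseteq> A' \<Longrightarrow> C \<subseteq> C' \<Longrightarrow> D \<subseteq> D' \<Longrightarrow> box A C D \<subseteq> box A' C' D'"
  by (auto simp: box_def)

lemma exponents_Suc: "exponents k \<subseteq> exponents (Suc k) \<inter> {n. Poly_Mapping.lookup n (Suc k) \<ge> 0}"
proof
  fix n assume n: "n \<in> exponents k"
  then have "Suc k \<notin> Poly_Mapping.keys n" by (auto simp: exponents_def)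
  then have "Poly_Mapping.lookup n (Suc k) = 0" by (simp add: in_keys_iff)
  then show "n \<in> exponents (Suc k) \<inter> {n. Poly_Mapping.lookup n (Suc k) \<ge> 0}"
    using n by (auto simp: exponents_def)
qed

lemma hat_carrier_plus: "(hat_carrier k :: 'g toroidal set) \<subseteq> hat_carrier (Suc k) \<inter> plus_part (Suc k)"
  unfolding hat_plus_box unfolding hat_carrier_box by (rule box_mono[OF exponents_Suc]) auto

lemma hat_carrier_mono: "(hat_carrier k :: 'g toroidal set) \<subseteq> hat_carrier (Suc k)"
  using hat_carrier_plus by blast

lemma tilde_carrier_mono: "(tilde_carrier k :: 'g toroidal set) \<subseteq> tilde_carrier (Suc k)"
  unfolding tilde_carrier_box by (rule box_mono) (use exponents_Suc in auto)

end

context cmod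
begin

text \<open>
  Sums of finitely many components, indexed by a list of the degrees that may occur. Lists with
  repetitions are harmless, and a decomposition with a distinguished degree split off is provided by
  \<open>sum_set_split\<close>.
\<close>

primrec sum_list_set :: "(int \<Rightarrow> 'm set) \<Rightarrow> int list \<Rightarrow> 'm set" where
  "sum_list_set G [] = {\<zero>}"
| "sum_list_set G (l # ls) = {g \<oplus> b |g b. g \<in> G l \<and> b \<in> sum_list_set G ls}"

context
  fixes G :: "int \<Rightarrow> 'm set"
  assumes G: "\<And>i. submodule (G i) complex_ring M"
begin

lemma G_in: "g \<in> G i \<Longrightarrow> g \<in> carrier M"
  by (rule submodule_subset[OF G])

lemma sls_in: "w \<in> sum_list_set G ls \<Longrightarrow> w \<in> carrier M"
  by (induction ls arbitrary: w) (auto simp: G_in)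

lemma sls_zero: "\<zero> \<in> sum_list_set G ls"
proof (induction ls)
  case (Cons l ls)
  have "\<zero> = \<zero> \<oplus> \<zero>" by (rule crd_eqI) simp_all
  then show ?case using Cons submodule_zero[OF G] by (simp, blast)
qed simp

lemma sls_add: "v \<in> sum_list_set G ls \<Longrightarrow> w \<in> sum_list_set G ls \<Longrightarrow> v \<oplus> w \<in> sum_list_set G ls"
proof (induction ls arbitrary: v w)
  case Nil
  then have "v \<oplus> w = \<zero>" by (intro crd_eqI) simp_all
  then show ?case by simp
next
  case (Cons l ls)
  then obtain g b g' b' where gb: "v = g \<oplus> b" "g \<in> G l" "b \<in> sum_list_set G ls" "w = g' \<oplus> b'" "g' \<in> G l" "b' \<in> sum_list_set G ls"
    by auto
  have "v \<oplus> w = (g \<oplus> g') \<oplus> (b \<oplus> b')"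
    using gb by (intro crd_eqI) (simp_all add: G_in sls_in algebra_simps)
  then show ?case using submodule_add[OF G gb(2,5)] Cons.IH[OF gb(3,6)] by (simp, blast)
qed

lemma sls_smult: "w \<in> sum_list_set G ls \<Longrightarrow> c \<odot> w \<in> sum_list_set G ls"
proof (induction ls arbitrary: w)
  case Nil
  then have "c \<odot> w = \<zero>" by (intro crd_eqI) simp_all
  then show ?case by simp
next
  case (Cons l ls)
  then obtain g b where gb: "w = g \<oplus> b" "g \<in> G l" "b \<in> sum_list_set G ls" by auto
  have "c \<odot> w = (c \<odot> g) \<oplus> (c \<odot> b)"
    using gb by (intro crd_eqI) (simp_all add: G_in sls_in ps.scale_right_distrib)
  then show ?case using submodule_smult[OF G gb(2)] Cons.IH[OF gb(3)] by (simp, blast)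
qed

lemma sls_absorb: "l \<in> set ls \<Longrightarrow> g \<in> G l \<Longrightarrow> g \<in> sum_list_set G ls"
proof (induction ls)
  case (Cons l' ls)
  show ?case
  proof (cases "l = l'")
    case True
    have "g = g \<oplus> \<zero>" using Cons.prems by (intro crd_eqI) (simp_all add: G_in)
    then show ?thesis using True Cons.prems sls_zero[of ls] by (simp, blast)
  next
    case False
    then have g: "g \<in> sum_list_set G ls" using Cons by simp
    have "g = \<zero> \<oplus> g" using Cons.prems by (intro crd_eqI) (simp_all add: G_in)
    then show ?thesis using g submodule_zero[OF G, of l'] by (simp, blast)
  qed
qed simp

lemma sls_mono: "set ls \<subseteq> set ls' \<Longrightarrow> w \<in> sum_list_set G ls \<Longrightarrow> w \<in> sum_list_set G ls'"
proof (induction ls arbitrary: w)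
  case Nil
  then show ?case using sls_zero by simp
next
  case (Cons l ls)
  then obtain g b where gb: "w = g \<oplus> b" "g \<in> G l" "b \<in> sum_list_set G ls" by auto
  show ?case unfolding gb(1)
    using Cons.prems(1) by (intro sls_add sls_absorb[OF _ gb(2)] Cons.IH[OF _ gb(3)]) auto
qed

definition sum_set :: "'m set" where
  "sum_set = {w. \<exists>ls. w \<in> sum_list_set G ls}"

lemma sum_set_submodule: "submodule sum_set complex_ring M"
proof -
  have "v \<oplus> w \<in> sum_list_set G (ls @ ls')" if "v \<in> sum_list_set G ls" "w \<in> sum_list_set G ls'" for v w ls ls'
    by (rule sls_add; rule sls_mono[rotated], fact, simp)
  then show ?thesis
    unfolding submodule_iff sum_set_def using sls_in sls_zero sls_smult by blast
qed

lemma G_sum_set: "g \<in> G i \<Longrightarrow> g \<in> sum_set"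
  unfolding sum_set_def using sls_absorb[of i "[i]" g] by (intro CollectI exI[of _ "[i]"]) (simp del: sum_list_set.simps)

lemma sum_set_split: "w \<in> sum_set \<Longrightarrow> \<exists>g b ls. g \<in> G i \<and> i \<notin> set ls \<and> b \<in> sum_list_set G ls \<and> w = g \<oplus> b"
proof -
  assume "w \<in> sum_set"
  then obtain ls where "w \<in> sum_list_set G ls" by (auto simp: sum_set_def)
  then have "w \<in> sum_list_set G (i # filter (\<lambda>l. l \<noteq> i) ls)"
    by (rule sls_mono[rotated]) auto
  moreover have "i \<notin> set (filter (\<lambda>l. l \<noteq> i) ls)" by simp
  ultimately show ?thesis by (auto simp del: set_filter)
qed

end

lemma sls_family_mono: "(\<And>i. G i \<subseteq> G' i) \<Longrightarrow> w \<in> sum_list_set G ls \<Longrightarrow> w \<in> sum_list_set G' ls"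
  by (induction ls arbitrary: w) (simp, force)

end

text \<open>
  The induction step: \<open>M\<close> is the module in \<open>k\<close> variables, \<open>I\<close> the induced one in \<open>K = k + 1\<close> variables.
  \<open>Mk\<close> and \<open>MK\<close> are their greatest proper submodules under the algebras with derivations, and \<open>Mk\<close> is
  assumed to be maximal without derivations.
\<close>

locale maximal_induction = tilde_hat_induction scale bracket form k M lev
  for scale :: "complex \<Rightarrow> 'g::ab_group_add \<Rightarrow> 'g" and bracket form k
    and M :: "('g toroidal, ('g toroidal, 'v) universe) lie_rep" and lev +
  assumes M_max: "is_maximal_submodule (til k) M (sum_proper_submodules (hat k) M)"
begin

abbreviation "I \<equiv> H.R"
abbreviation "Mk \<equiv> sum_proper_submodules (hat k) M"
abbreviation "MK \<equiv> sum_proper_submodules (hat K) I"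

interpretation Mm: lie_mod "hat k" M by (rule lie_mod.intro) (rule M_module)

lemmas IA = RH.act_in[unfolded toroidal_simps] RH.act_add[unfolded toroidal_simps] RH.act_smult[unfolded toroidal_simps]

lemma I_til: "is_lie_module (til K) I"
  by (rule is_lie_module_substruct[OF til_sub_hat H.R_module])

lemma j_in: "m \<in> carrier M \<Longrightarrow> H.j m \<in> carrier I"
  using lie_hom_closed[OF H.j_hom] by simp

lemma j_add: "m \<in> carrier M \<Longrightarrow> m' \<in> carrier M \<Longrightarrow> H.j (m \<oplus>\<^bsub>M\<^esub> m') = H.j m \<oplus>\<^bsub>I\<^esub> H.j m'"
  using lie_hom_add[OF H.j_hom] by simp

lemma j_smult: "m \<in> carrier M \<Longrightarrow> H.j (c \<odot>\<^bsub>M\<^esub> m) = c \<odot>\<^bsub>I\<^esub> H.j m"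
  using lie_hom_smult[OF H.j_hom] by simp

lemma j_zero: "H.j \<zero>\<^bsub>M\<^esub> = \<zero>\<^bsub>I\<^esub>"
proof -
  have "H.j (0 \<odot>\<^bsub>M\<^esub> \<zero>\<^bsub>M\<^esub>) = 0 \<odot>\<^bsub>I\<^esub> H.j \<zero>\<^bsub>M\<^esub>" by (rule j_smult) simp
  then show ?thesis by (simp add: Mm.smult_zero_left RH.smult_zero_left j_in)
qed

lemma j_act: "X \<in> hat_carrier K \<inter> plus_part K \<Longrightarrow> m \<in> carrier M \<Longrightarrow> act I X (H.j m) = H.j (act iM X m)"
  using lie_hom_act[OF H.j_hom, of X m] by (simp del: inflate_simps(5))

text \<open>
  Any homomorphism of \<open>M\<close> to a module of the large algebra factors through \<open>j\<close>; the injection into the coinduced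
  module is one.
\<close>

lemma j_inj: "inj_on H.j (carrier M)"
proof -
  obtain W :: "('g toroidal, 'g toroidal list \<Rightarrow> (('g toroidal, 'v) universe \<Rightarrow>\<^sub>0 complex)) lie_rep" and h
    where W: "is_lie_module (hat K) W" "h \<in> lie_hom (hatp K) iM W" "inj_on h (carrier M)"
    using ex_injective_hom[OF M_module] by blast
  obtain g where g: "\<forall>m\<in>carrier iM. g (H.j m) = h m"
    using H.j_universal[OF W(1,2)] by blast
  show ?thesis
  proof (rule inj_onI)
    fix m m' assume m: "m \<in> carrier M" "m' \<in> carrier M" "H.j m = H.j m'"
    then have "h m = h m'" using bspec[OF g, of m] bspec[OF g, of m'] by (simp only: inflate_simps(1))
    then show "m = m'" using W(3) m by (auto dest: inj_onD)
  qed
qed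

lemma j_hom_hat: "H.j \<in> lie_hom (hat k) M I"
proof (rule lie_homI)
  fix m m' c X assume m: "m \<in> carrier M"
  show "H.j m \<in> carrier I" "H.j (c \<odot>\<^bsub>M\<^esub> m) = c \<odot>\<^bsub>I\<^esub> H.j m" using m by (simp_all add: j_in j_smult)
  show "H.j (m \<oplus>\<^bsub>M\<^esub> m') = H.j m \<oplus>\<^bsub>I\<^esub> H.j m'" if "m' \<in> carrier M" using m that by (rule j_add)
  assume "X \<in> lie_carrier (hat k)"
  then have X: "X \<in> hat_carrier k" by simp
  have "act iM X m = act M X m"
    using X m Mm.act_in[unfolded toroidal_simps] by (intro Mm.crd_eqI) (simp_all add: project_id ck_hat)
  then show "H.j (act M X m) = act I X (H.j m)"
    using j_act[OF subsetD[OF hat_carrier_plus X] m] by (simp only:)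
qed

lemma hat_sub: "substruct (hat k) (hat K)" and til_sub: "substruct (til k) (til K)"
  by (rule substruct_toroidal, rule hat_carrier_mono, rule substruct_toroidal, rule tilde_carrier_mono)

lemma pre_hat: "is_lie_submodule (hat K) I S \<Longrightarrow> is_lie_submodule (hat k) M {m \<in> carrier M. H.j m \<in> S}"
  by (rule preimage_submodule[OF M_module is_lie_module_substruct[OF hat_sub H.R_module] j_hom_hat])
    (rule is_lie_submodule_substruct[OF hat_sub])

lemma pre_til: "is_lie_submodule (til K) I S \<Longrightarrow> is_lie_submodule (til k) M {m \<in> carrier M. H.j m \<in> S}"
  by (rule preimage_submodule[OF M_til is_lie_module_substruct[OF til_sub I_til] lie_hom_substruct[OF til_sub_hat j_hom_hat]])
    (rule is_lie_submodule_substruct[OF til_sub])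

text \<open>
  Components of degree \<open>- i\<close> of the span of \<open>B\<close>, placed in degree \<open>- r\<close>, under elements of nonpositive degree,
  enlarged by a submodule \<open>Z\<close>. Indices are the negatives of degrees, so that they are nonnegative for \<open>I\<close>.
  If elements of positive degree map \<open>B\<close> into \<open>Z\<close> (\<open>admissible\<close>), these components add up to a
  submodule (\<open>span_submodule\<close>), and below index \<open>r\<close> there is nothing but \<open>Z\<close> (\<open>gen_low\<close>). This is used
  for \<open>B = j M\<close>, which gives the grading of \<open>I\<close>, for \<open>B = j Mk\<close>, and for a single homogeneous element modulo
  \<open>MK\<close>.
\<close>

inductive gen :: "('g toroidal, 'v) universe set \<Rightarrow> int \<Rightarrow> ('g toroidal, 'v) universe set \<Rightarrow> int \<Rightarrow> ('g toroidal, 'v) universe \<Rightarrow> bool"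
  for B r Z where
  base: "b \<in> B \<Longrightarrow> gen B r Z r b"
| Z: "z \<in> Z \<Longrightarrow> gen B r Z i z"
| act: "gen B r Z i w \<Longrightarrow> y \<in> hom_deg K (- n) \<Longrightarrow> n \<ge> 0 \<Longrightarrow> gen B r Z (i + n) (act I y w)"
| add: "gen B r Z i v \<Longrightarrow> gen B r Z i w \<Longrightarrow> gen B r Z i (v \<oplus>\<^bsub>I\<^esub> w)"
| smult: "gen B r Z i w \<Longrightarrow> gen B r Z i (c \<odot>\<^bsub>I\<^esub> w)"

abbreviation "piece B r Z i \<equiv> {w. gen B r Z i w}"

definition admissible :: "('g toroidal, 'v) universe set \<Rightarrow> ('g toroidal, 'v) universe set \<Rightarrow> bool" where
  "admissible B Z \<longleftrightarrow> B \<subseteq> carrier I \<and> is_lie_submodule (hat K) I Z \<and>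
     (\<forall>e>0. \<forall>y\<in>hom_deg K e. \<forall>b\<in>B. act I y b \<in> Z)"

context
  fixes B and r :: int and Z
  assumes adm: "admissible B Z"
begin

lemma Z_sub: "is_lie_submodule (hat K) I Z"
  using adm by (simp add: admissible_def)

lemma Z_facts: "z \<in> Z \<Longrightarrow> z \<in> carrier I" "\<zero>\<^bsub>I\<^esub> \<in> Z" "y \<in> hom_deg K e \<Longrightarrow> z \<in> Z \<Longrightarrow> act I y z \<in> Z"
  "z \<in> Z \<Longrightarrow> z' \<in> Z \<Longrightarrow> z \<oplus>\<^bsub>I\<^esub> z' \<in> Z" "z \<in> Z \<Longrightarrow> c \<odot>\<^bsub>I\<^esub> z \<in> Z"
  using Z_sub hom_deg_hat unfolding RH.is_lie_submodule_iff toroidal_simps by blast+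

lemma gen_in: "gen B r Z i w \<Longrightarrow> w \<in> carrier I"
proof (induction rule: gen.induct)
  case (base b)
  then show ?case using adm by (auto simp: admissible_def)
qed (simp_all add: Z_facts IA hom_deg_hat)

lemma piece_submodule: "submodule (piece B r Z i) complex_ring I"
  unfolding RH.submodule_iff using gen_in gen.Z[OF Z_facts(2)] gen.add gen.smult by blast

text \<open>
  An element of positive degree is commuted to the right until it reaches \<open>B\<close>, where it yields an element of
  \<open>Z\<close>; the brackets met on the way are covered by the induction hypothesis, which is for all degrees.
\<close>

lemma gen_stable: "gen B r Z i w \<Longrightarrow> y \<in> hom_deg K e \<Longrightarrow> gen B r Z (i - e) (act I y w)"
proof (induction arbitrary: y e rule: gen.induct)
  case (base b)
  show ?case
  proof (cases "e > 0")
    case True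
    then have "act I y b \<in> Z" using adm base unfolding admissible_def by blast
    then show ?thesis by (rule gen.Z)
  next
    case False
    then show ?thesis using gen.act[OF gen.base[OF base(1)], of y "- e" r Z] base(2) by simp
  qed
next
  case (Z z i)
  then show ?case by (intro gen.Z Z_facts(3))
next
  case (act i w z n)
  have w: "w \<in> carrier I" using act.hyps(1) by (rule gen_in)
  have yz: "br y z \<in> hom_deg K (e - n)" using hom_deg_br[OF act.prems act.hyps(2)] by simp
  have "act I y (act I z w) = act I z (act I y w) \<oplus>\<^bsub>I\<^esub> act I (br y z) w"
    using RH.act_commute[unfolded toroidal_simps, OF _ _ _ w] act.prems act.hyps(2) yz hom_deg_hat by blast
  moreover have "gen B r Z (i - e + n) (act I z (act I y w))"
    by (rule gen.act[OF act.IH[OF act.prems] act.hyps(2,3)])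
  moreover have "gen B r Z (i - (e - n)) (act I (br y z) w)"
    by (rule act.IH[OF yz])
  moreover have "i - e + n = i + n - e" "i - (e - n) = i + n - e" by simp_all
  ultimately show ?case using gen.add by simp
next
  case (add i v w)
  have "act I y (v \<oplus>\<^bsub>I\<^esub> w) = act I y v \<oplus>\<^bsub>I\<^esub> act I y w"
    using add gen_in hom_deg_hat by (intro IA) auto
  then show ?case using gen.add[OF add.IH(1)[OF add.prems] add.IH(2)[OF add.prems]] by simp
next
  case (smult i w c)
  have "act I y (c \<odot>\<^bsub>I\<^esub> w) = c \<odot>\<^bsub>I\<^esub> act I y w"
    using smult gen_in hom_deg_hat by (intro IA) auto
  then show ?case using gen.smult[OF smult.IH[OF smult.prems]] by simp
qed

lemma gen_low: "gen B r Z i w \<Longrightarrow> i < r \<Longrightarrow> w \<in> Z"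
  by (induction rule: gen.induct) (auto intro: Z_facts)

lemma sls_act:
  assumes "w \<in> RH.sum_list_set (piece B r Z) ls" "y \<in> hom_deg K e"
  shows "act I y w \<in> RH.sum_list_set (piece B r Z) (map (\<lambda>l. l - e) ls)"
  using assms(1)
proof (induction ls arbitrary: w)
  case Nil
  then show ?case using assms(2) hom_deg_hat RH.act_zero[unfolded toroidal_simps] by simp
next
  case (Cons l ls)
  then obtain g b where gb: "w = g \<oplus>\<^bsub>I\<^esub> b" "gen B r Z l g" "b \<in> RH.sum_list_set (piece B r Z) ls" by auto
  have "act I y w = act I y g \<oplus>\<^bsub>I\<^esub> act I y b"
    unfolding gb(1) using hom_deg_hat[OF assms(2)] gen_in[OF gb(2)] RH.sls_in[OF piece_submodule gb(3)] by (rule IA)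
  then show ?case using gen_stable[OF gb(2) assms(2)] Cons.IH[OF gb(3)] by (simp, blast)
qed

lemma span_submodule: "is_lie_submodule (hat K) I (RH.sum_set (piece B r Z))"
proof -
  let ?Y = "RH.sum_set (piece B r Z)"
  have sub: "submodule ?Y complex_ring I" by (rule RH.sum_set_submodule) (rule piece_submodule)
  have "\<forall>w\<in>?Y. act I X w \<in> ?Y" if "X \<in> hat_carrier K" for X
    using that
  proof (induction X rule: hat_homogeneous_induct)
    case (hom X e)
    show ?case
      using sls_act[OF _ hom] unfolding RH.sum_set_def[OF piece_submodule] by blast
  next
    case (add X X')
    show ?case
    proof
      fix w assume w: "w \<in> ?Y"
      have "act I (X + X') w = act I X w \<oplus>\<^bsub>I\<^esub> act I X' w"
        using add(1,2) RH.submodule_subset[OF sub w] by (rule RH.act_add_left[unfolded toroidal_simps])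
      then show "act I (X + X') w \<in> ?Y" using add w RH.submodule_add[OF sub] by simp
    qed
  qed
  then show ?thesis using sub by (simp add: is_lie_submodule_def)
qed

end

lemma zero_submodule: "is_lie_submodule (hat K) I {\<zero>\<^bsub>I\<^esub>}"
  by (rule RH.is_lie_submodule_zero)

lemma j_act_pos: "y \<in> hom_deg K e \<Longrightarrow> e > 0 \<Longrightarrow> m \<in> carrier M \<Longrightarrow> act I y (H.j m) = \<zero>\<^bsub>I\<^esub>"
proof -
  assume y: "y \<in> hom_deg K e" and e: "e > 0" and m: "m \<in> carrier M"
  have p: "project K y = 0" "ck K y = 0" using hom_deg_project[OF y] e by simp_all
  have "act M 0 m = \<zero>\<^bsub>M\<^esub>"
  proof -
    have "act M (sc 0 0) m = 0 \<odot>\<^bsub>M\<^esub> act M 0 m"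
      using Mm.act_scale_left[unfolded toroidal_simps] m box_zero unfolding hat_carrier_box by blast
    moreover have "act M 0 m \<in> carrier M"
      using Mm.act_in[unfolded toroidal_simps] m box_zero unfolding hat_carrier_box by blast
    ultimately show ?thesis by (simp add: Mm.smult_zero_left)
  qed
  then have "act iM y m = \<zero>\<^bsub>M\<^esub>" using m p by (intro Mm.crd_eqI) simp_all
  moreover have "act I y (H.j m) = H.j (act iM y m)" using hom_deg_plus[OF y] e m by (intro j_act) auto
  ultimately show ?thesis by (simp add: j_zero)
qed

lemma adm_j: "S \<subseteq> carrier M \<Longrightarrow> admissible (H.j ` S) {\<zero>\<^bsub>I\<^esub>}"
  unfolding admissible_def using zero_submodule j_act_pos j_in by blast

text \<open>
  The homogeneous components of \<open>I\<close>: \<open>Gr i\<close> is the component of degree \<open>- i\<close>.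
\<close>

abbreviation "Gr \<equiv> piece (H.j ` carrier M) 0 {\<zero>\<^bsub>I\<^esub>}"

lemma adm_Gr: "admissible (H.j ` carrier M) {\<zero>\<^bsub>I\<^esub>}"
  by (rule adm_j) simp

lemma Gr_sub: "submodule (Gr i) complex_ring I"
  by (rule piece_submodule[OF adm_Gr])

text \<open>
  The elements of degree zero come from elements of degree zero alone, because \<open>gen\<close> never raises degrees
  and the components of positive degree vanish. On the image of \<open>j\<close>, elements of degree zero act through the
  projection to the algebra in \<open>k\<close> variables.
\<close>

lemma gen_j_zero:
  assumes S: "is_lie_submodule (hat k) M S"
  shows "gen (H.j ` S) 0 {\<zero>\<^bsub>I\<^esub>} i w \<Longrightarrow> i = 0 \<Longrightarrow> w \<in> H.j ` S"
proof (induction rule: gen.induct)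
  have S': "S \<subseteq> carrier M" "\<zero>\<^bsub>M\<^esub> \<in> S" "\<And>a b. a \<in> S \<Longrightarrow> b \<in> S \<Longrightarrow> a \<oplus>\<^bsub>M\<^esub> b \<in> S" "\<And>c a. a \<in> S \<Longrightarrow> c \<odot>\<^bsub>M\<^esub> a \<in> S"
    "\<And>X a. X \<in> hat_carrier k \<Longrightarrow> a \<in> S \<Longrightarrow> act M X a \<in> S"
    using S unfolding Mm.is_lie_submodule_iff toroidal_simps by blast+
  {
    case (base b)
    then show ?case by simp
  next
    case (Z z i)
    then show ?case using S'(2) j_zero by (auto intro: rev_image_eqI)
  next
    case (act i w y n)
    show ?case
    proof (cases "n = 0")
      case True
      then have y: "y \<in> hom_deg K 0" and "w \<in> H.j ` S" using act by simp_all
      then obtain m where m: "m \<in> S" "w = H.j m" by blast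
      have yp: "y \<in> hat_carrier K \<inter> plus_part K" using hom_deg_plus[OF y] by simp
      have "act iM y m \<in> S" using m yp S' project_hat[of y k] by simp
      then show ?thesis using j_act[OF yp, of m] m S'(1) by auto
    next
      case False
      then have "w = \<zero>\<^bsub>I\<^esub>" using gen_low[OF adm_j[OF S'(1)] act.hyps(1)] act by simp
      then have "act I y w = \<zero>\<^bsub>I\<^esub>" using RH.act_zero[unfolded toroidal_simps] act.hyps(2) hom_deg_hat by simp
      then show ?thesis using S'(2) j_zero by (auto intro: rev_image_eqI)
    qed
  next
    case (add i v w)
    then obtain m m' where "m \<in> S" "v = H.j m" "m' \<in> S" "w = H.j m'" by blast
    then have "m \<oplus>\<^bsub>M\<^esub> m' \<in> S" "v \<oplus>\<^bsub>I\<^esub> w = H.j (m \<oplus>\<^bsub>M\<^esub> m')"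
      by (simp_all add: S'(3) j_add subsetD[OF S'(1)])
    then show ?case by blast
  next
    case (smult i w c)
    then obtain m where "m \<in> S" "w = H.j m" by blast
    then have "c \<odot>\<^bsub>M\<^esub> m \<in> S" "c \<odot>\<^bsub>I\<^esub> w = H.j (c \<odot>\<^bsub>M\<^esub> m)"
      by (simp_all add: S'(4) j_smult subsetD[OF S'(1)])
    then show ?case by blast
  }
qed

lemma Gr_zero: "w \<in> Gr 0 \<Longrightarrow> \<exists>m\<in>carrier M. w = H.j m"
  using gen_j_zero[OF Mm.is_lie_submodule_carrier] by auto

lemma j_Gr: "m \<in> carrier M \<Longrightarrow> H.j m \<in> Gr 0"
  by (auto intro: gen.base)

lemma Gr_neg: "w \<in> Gr i \<Longrightarrow> i < 0 \<Longrightarrow> w = \<zero>\<^bsub>I\<^esub>"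
  using gen_low[OF adm_Gr] by auto

lemma Gr_eigen: "gen (H.j ` carrier M) 0 {\<zero>\<^bsub>I\<^esub>} i w \<Longrightarrow> act I (dk K) w = (of_int (- i)) \<odot>\<^bsub>I\<^esub> w"
proof (induction rule: gen.induct)
  case (base b)
  then obtain m where m: "m \<in> carrier M" "b = H.j m" by blast
  have dp: "dk K \<in> hat_carrier K \<inter> plus_part K" using hom_deg_plus[OF dk_hom_deg] by simp
  have u: "Poly_Mapping.update K 0 (Poly_Mapping.single K 1) = (0 :: nat \<Rightarrow>\<^sub>0 complex)"
    by (rule poly_mapping_eqI) (simp add: lookup_update lookup_single when_def)
  have p: "project K (dk K) = 0" by (simp add: project_cd u)
  have "act M 0 m \<in> carrier M"
    using Mm.act_in[unfolded toroidal_simps] m box_zero unfolding hat_carrier_box by blast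
  moreover have "act M (sc 0 0) m = 0 \<odot>\<^bsub>M\<^esub> act M 0 m"
    using Mm.act_scale_left[unfolded toroidal_simps] m box_zero unfolding hat_carrier_box by blast
  ultimately have "act M 0 m = \<zero>\<^bsub>M\<^esub>" by (simp add: Mm.smult_zero_left)
  then have "act iM (dk K) m = \<zero>\<^bsub>M\<^esub>" using m p by (intro Mm.crd_eqI) (simp_all add: ck_def)
  then show ?case using j_act[OF dp m(1)] m j_in by (simp add: j_zero RH.smult_zero_left)
next
  case (Z z i)
  then show ?case using RH.act_zero[unfolded toroidal_simps, OF dk_hat] by (auto intro!: RH.crd_eqI)
next
  case (act i w y n)
  have w: "w \<in> carrier I" using gen_in[OF adm_Gr act.hyps(1)] .
  have y: "y \<in> hat_carrier K" using act.hyps(2) by (rule hom_deg_hat)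
  have b: "br (dk K) y = sc (of_int (- n)) y" using act.hyps(2) by (simp add: hom_deg_def)
  have bh: "br (dk K) y \<in> hat_carrier K" using br_hat[OF dk_hat y] tilde_subset_hat by blast
  have "act I (dk K) (act I y w) = act I y (act I (dk K) w) \<oplus>\<^bsub>I\<^esub> act I (br (dk K) y) w"
    using RH.act_commute[unfolded toroidal_simps, OF dk_hat y bh w] .
  also have "\<dots> = act I y (of_int (- i) \<odot>\<^bsub>I\<^esub> w) \<oplus>\<^bsub>I\<^esub> of_int (- n) \<odot>\<^bsub>I\<^esub> act I y w"
    unfolding act.IH b using RH.act_scale_left[unfolded toroidal_simps, OF y w] by simp
  also have "\<dots> = of_int (- (i + n)) \<odot>\<^bsub>I\<^esub> act I y w"
    using y w by (intro RH.crd_eqI) (simp_all add: IA ps.scale_left_diff_distrib ps.scale_minus_left)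
  finally show ?case .
next
  case (add i v w)
  then show ?case using gen_in[OF adm_Gr] dk_hat
    by (intro RH.crd_eqI) (simp_all add: IA ps.scale_right_distrib)
next
  case (smult i w c)
  then show ?case using gen_in[OF adm_Gr] dk_hat
    by (intro RH.crd_eqI) (simp_all add: IA mult.commute)
qed

text \<open>
  The usual argument with eigenvectors: applying the last derivation plus \<open>l\<close> removes the component \<open>g\<close> of
  index \<open>l\<close> and multiplies \<open>h\<close> by the nonzero scalar \<open>l - i\<close>. The remainder \<open>b'\<close> is changed, but
  only within the components listed in \<open>ls\<close>.
\<close>

lemma graded:
  assumes S: "submodule S complex_ring I" "\<And>w. w \<in> S \<Longrightarrow> act I (dk K) w \<in> S"
  shows "h \<in> Gr i \<Longrightarrow> b \<in> RH.sum_list_set Gr ls \<Longrightarrow> i \<notin> set ls \<Longrightarrow> h \<oplus>\<^bsub>I\<^esub> b \<in> S \<Longrightarrow> h \<in> S"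
proof (induction ls arbitrary: h b)
  case Nil
  have "h \<oplus>\<^bsub>I\<^esub> b = h" using Nil gen_in[OF adm_Gr] by (intro RH.crd_eqI) auto
  then show ?case using Nil by simp
next
  case (Cons l ls)
  then obtain g b' where gb: "b = g \<oplus>\<^bsub>I\<^esub> b'" "g \<in> Gr l" "b' \<in> RH.sum_list_set Gr ls" by auto
  have c: "h \<in> carrier I" "g \<in> carrier I" "b' \<in> carrier I"
    using gen_in[OF adm_Gr] Cons.prems(1) gb(2) RH.sls_in[OF Gr_sub gb(3)] by auto
  have eig: "act I (dk K) h = of_int (- i) \<odot>\<^bsub>I\<^esub> h" "act I (dk K) g = of_int (- l) \<odot>\<^bsub>I\<^esub> g"
    using Gr_eigen Cons.prems(1) gb(2) by auto
  have db: "act I (dk K) b' \<in> RH.sum_list_set Gr ls"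
    using sls_act[OF adm_Gr gb(3) dk_hom_deg] by simp
  have dc: "act I (dk K) b' \<in> carrier I" using dk_hat c by (simp add: IA)
  let ?v = "h \<oplus>\<^bsub>I\<^esub> (g \<oplus>\<^bsub>I\<^esub> b')"
  have vS: "?v \<in> S" using Cons.prems(4) gb by simp
  \<comment> \<open>On the right, \<open>g\<close> has disappeared.\<close>
  have "act I (dk K) ?v \<oplus>\<^bsub>I\<^esub> of_int l \<odot>\<^bsub>I\<^esub> ?v =
      of_int (l - i) \<odot>\<^bsub>I\<^esub> h \<oplus>\<^bsub>I\<^esub> (act I (dk K) b' \<oplus>\<^bsub>I\<^esub> of_int l \<odot>\<^bsub>I\<^esub> b')"
  proof -
    have "act I (dk K) ?v = of_int (- i) \<odot>\<^bsub>I\<^esub> h \<oplus>\<^bsub>I\<^esub> (of_int (- l) \<odot>\<^bsub>I\<^esub> g \<oplus>\<^bsub>I\<^esub> act I (dk K) b')"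
      using c dk_hat by (simp add: IA eig)
    then show ?thesis using c dc
      by (intro RH.crd_eqI) (simp_all add: ps.scale_right_distrib ps.scale_left_diff_distrib ps.scale_minus_left)
  qed
  moreover have "act I (dk K) ?v \<oplus>\<^bsub>I\<^esub> of_int l \<odot>\<^bsub>I\<^esub> ?v \<in> S"
    using RH.submodule_add[OF S(1) S(2)[OF vS] RH.submodule_smult[OF S(1) vS]] .
  ultimately have sumS: "of_int (l - i) \<odot>\<^bsub>I\<^esub> h \<oplus>\<^bsub>I\<^esub> (act I (dk K) b' \<oplus>\<^bsub>I\<^esub> of_int l \<odot>\<^bsub>I\<^esub> b') \<in> S"
    by (simp only:)
  have "i \<notin> set ls" using Cons.prems(3) by simp
  then have "of_int (l - i) \<odot>\<^bsub>I\<^esub> h \<in> S"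
    using Cons.IH[OF RH.submodule_smult[OF Gr_sub Cons.prems(1)] RH.sls_add[OF Gr_sub db RH.sls_smult[OF Gr_sub gb(3)]] _ sumS]
    by blast
  then have "(1 / of_int (l - i)) \<odot>\<^bsub>I\<^esub> (of_int (l - i) \<odot>\<^bsub>I\<^esub> h) \<in> S"
    by (rule RH.submodule_smult[OF S(1)])
  moreover have "(1 / of_int (l - i)) \<odot>\<^bsub>I\<^esub> (of_int (l - i) \<odot>\<^bsub>I\<^esub> h) = h"
    using c Cons.prems(3) by (intro RH.crd_eqI) simp_all
  ultimately show ?case by simp
qed

lemma graded_hat: "is_lie_submodule (hat K) I S \<Longrightarrow>
    h \<in> Gr i \<Longrightarrow> b \<in> RH.sum_list_set Gr ls \<Longrightarrow> i \<notin> set ls \<Longrightarrow> h \<oplus>\<^bsub>I\<^esub> b \<in> S \<Longrightarrow> h \<in> S"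
  using graded[of S h i b ls] dk_hat by (simp add: is_lie_submodule_def)

lemma span_Gr: "RH.sum_set Gr = carrier I"
  by (rule H.j_generates[OF span_submodule[OF adm_Gr]]) (rule RH.G_sum_set[OF Gr_sub], rule j_Gr, simp)

lemma Mk_hat: "is_lie_submodule (hat k) M Mk"
  by (rule Mm.sum_proper_submodule)

lemma Mk_sub: "submodule Mk complex_ring M"
  using Mk_hat by (simp add: is_lie_submodule_def)

lemma Mk_proper: "Mk \<noteq> carrier M"
  using M_max by (simp add: is_maximal_submodule_def)

text \<open>
  The elements with component of degree zero in \<open>j Mk\<close>. This space need not be a submodule, but it contains
  every proper submodule (\<open>proper_top\<close>), hence their sum; therefore the sum is proper.
\<close>

definition top_in_Mk :: "('g toroidal, 'v) universe set" where
  "top_in_Mk = {H.j m \<oplus>\<^bsub>I\<^esub> b |m b ls. m \<in> Mk \<and> 0 \<notin> set ls \<and> b \<in> RH.sum_list_set Gr ls}"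

lemma Mk_in: "m \<in> Mk \<Longrightarrow> m \<in> carrier M"
  by (rule Mm.submodule_subset[OF Mk_sub])

lemma top_in_Mk_submodule: "submodule top_in_Mk complex_ring I"
  unfolding RH.submodule_iff
proof (intro conjI subsetI ballI allI)
  fix w assume "w \<in> top_in_Mk"
  then obtain m b ls where w: "m \<in> Mk" "0 \<notin> set ls" "b \<in> RH.sum_list_set Gr ls" "w = H.j m \<oplus>\<^bsub>I\<^esub> b"
    unfolding top_in_Mk_def by blast
  note c = j_in[OF Mk_in[OF w(1)]] RH.sls_in[OF Gr_sub w(3)]
  show "w \<in> carrier I" using w c by simp
  fix a
  have "a \<odot>\<^bsub>I\<^esub> w = H.j (a \<odot>\<^bsub>M\<^esub> m) \<oplus>\<^bsub>I\<^esub> a \<odot>\<^bsub>I\<^esub> b"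
    unfolding w(4) using c Mk_in[OF w(1)] by (intro RH.crd_eqI) (simp_all add: j_smult ps.scale_right_distrib)
  then show "a \<odot>\<^bsub>I\<^esub> w \<in> top_in_Mk"
    unfolding top_in_Mk_def using w Mm.submodule_smult[OF Mk_sub w(1)] RH.sls_smult[OF Gr_sub w(3)] by blast
next
  have "\<zero>\<^bsub>I\<^esub> = H.j \<zero>\<^bsub>M\<^esub> \<oplus>\<^bsub>I\<^esub> \<zero>\<^bsub>I\<^esub>" unfolding j_zero by (rule RH.crd_eqI) simp_all
  moreover have "(0::int) \<notin> set []" "\<zero>\<^bsub>I\<^esub> \<in> RH.sum_list_set Gr []" by simp_all
  ultimately show "\<zero>\<^bsub>I\<^esub> \<in> top_in_Mk"
    unfolding top_in_Mk_def using Mm.submodule_zero[OF Mk_sub] by blast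
next
  fix v w assume "v \<in> top_in_Mk" "w \<in> top_in_Mk"
  then obtain m b ls m' b' ls' where w: "m \<in> Mk" "0 \<notin> set ls" "b \<in> RH.sum_list_set Gr ls" "v = H.j m \<oplus>\<^bsub>I\<^esub> b"
      "m' \<in> Mk" "0 \<notin> set ls'" "b' \<in> RH.sum_list_set Gr ls'" "w = H.j m' \<oplus>\<^bsub>I\<^esub> b'"
    unfolding top_in_Mk_def by blast
  note c = j_in[OF Mk_in[OF w(1)]] RH.sls_in[OF Gr_sub w(3)] j_in[OF Mk_in[OF w(5)]] RH.sls_in[OF Gr_sub w(7)]
  have "v \<oplus>\<^bsub>I\<^esub> w = H.j (m \<oplus>\<^bsub>M\<^esub> m') \<oplus>\<^bsub>I\<^esub> (b \<oplus>\<^bsub>I\<^esub> b')"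
    unfolding w(4,8) using c Mk_in[OF w(1)] Mk_in[OF w(5)] by (intro RH.crd_eqI) (simp_all add: j_add)
  moreover have "b \<oplus>\<^bsub>I\<^esub> b' \<in> RH.sum_list_set Gr (ls @ ls')"
    using RH.sls_mono[OF Gr_sub _ w(3), of "ls @ ls'"] RH.sls_mono[OF Gr_sub _ w(7), of "ls @ ls'"]
    by (intro RH.sls_add[OF Gr_sub]) auto
  moreover have "0 \<notin> set (ls @ ls')" using w by simp
  ultimately show "v \<oplus>\<^bsub>I\<^esub> w \<in> top_in_Mk"
    unfolding top_in_Mk_def using Mm.submodule_add[OF Mk_sub w(1,5)] by blast
qed

lemma j_top_in_Mk: "m \<in> carrier M \<Longrightarrow> H.j m \<in> top_in_Mk \<Longrightarrow> m \<in> Mk"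
proof -
  assume m: "m \<in> carrier M" and "H.j m \<in> top_in_Mk"
  then obtain m' b ls where w: "m' \<in> Mk" "0 \<notin> set ls" "b \<in> RH.sum_list_set Gr ls" "H.j m = H.j m' \<oplus>\<^bsub>I\<^esub> b"
    unfolding top_in_Mk_def by blast
  have m': "m' \<in> carrier M" using w(1) by (rule Mk_in)
  note c = j_in[OF m] j_in[OF m'] RH.sls_in[OF Gr_sub w(3)]
  have d: "H.j m' \<ominus>\<^bsub>I\<^esub> H.j m \<in> Gr 0"
    using RH.submodule_minus[OF Gr_sub j_Gr[OF m'] j_Gr[OF m]] .
  have "(H.j m' \<ominus>\<^bsub>I\<^esub> H.j m) \<oplus>\<^bsub>I\<^esub> b = \<zero>\<^bsub>I\<^esub>"
  proof (rule RH.crd_eqI)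
    have "crd I (H.j m) = crd I (H.j m') + crd I b" using c arg_cong[OF w(4), of "crd I"] by simp
    then show "crd I ((H.j m' \<ominus>\<^bsub>I\<^esub> H.j m) \<oplus>\<^bsub>I\<^esub> b) = crd I \<zero>\<^bsub>I\<^esub>" using c by simp
  qed (use c in simp_all)
  then have "H.j m' \<ominus>\<^bsub>I\<^esub> H.j m \<in> {\<zero>\<^bsub>I\<^esub>}"
    using graded_hat[OF zero_submodule d w(3,2)] by simp
  then have "crd I (H.j m' \<ominus>\<^bsub>I\<^esub> H.j m) = 0" by simp
  then have "H.j m' = H.j m" using c by (intro RH.crd_eqI) simp_all
  then have "m' = m" using j_inj m m' by (auto dest: inj_onD)
  then show "m \<in> Mk" using w by simp
qed

text \<open>
  A submodule contains the components of its elements. If its elements of degree zero did not lie in \<open>j Mk\<close>,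
  its preimage under \<open>j\<close> would be all of \<open>M\<close>, whose image generates \<open>I\<close>.
\<close>

lemma proper_top: "is_lie_submodule (hat K) I S \<Longrightarrow> S \<noteq> carrier I \<Longrightarrow> S \<subseteq> top_in_Mk"
proof
  fix w assume S: "is_lie_submodule (hat K) I S" and ne: "S \<noteq> carrier I" and w: "w \<in> S"
  have "w \<in> carrier I" using S w unfolding RH.is_lie_submodule_iff by blast
  then have "w \<in> RH.sum_set Gr" by (simp add: span_Gr)
  then obtain g b ls where gb: "g \<in> Gr 0" "0 \<notin> set ls" "b \<in> RH.sum_list_set Gr ls" "w = g \<oplus>\<^bsub>I\<^esub> b"
    using RH.sum_set_split[where G = Gr and w = w and i = 0, OF Gr_sub] by blast
  have gS: "g \<in> S" using graded_hat[OF S gb(1,3,2)] w gb(4) by simp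
  obtain m where m: "m \<in> carrier M" "g = H.j m" using Gr_zero[OF gb(1)] by blast
  have "{m \<in> carrier M. H.j m \<in> S} \<noteq> carrier M"
    using H.j_generates[OF S] ne by fastforce
  then have "{m \<in> carrier M. H.j m \<in> S} \<subseteq> Mk" by (rule Mm.proper_subset_sum[OF pre_hat[OF S]])
  then have "m \<in> Mk" using m gS by blast
  then show "w \<in> top_in_Mk" unfolding top_in_Mk_def using gb m by blast
qed

lemma MK_hat: "is_lie_submodule (hat K) I MK"
  by (rule RH.sum_proper_submodule)

lemma MK_sub: "submodule MK complex_ring I"
  using MK_hat by (simp add: is_lie_submodule_def)

lemma MK_top: "MK \<subseteq> top_in_Mk"
proof -
  have "\<Union>{N. is_lie_submodule (hat K) I N \<and> N \<noteq> carrier I} \<subseteq> carrier I"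
    by (auto simp: RH.is_lie_submodule_iff)
  then show ?thesis
    unfolding sum_proper_submodules_def
    by (rule RH.submodule_lin_hull(3)[OF _ top_in_Mk_submodule]) (use proper_top in blast)
qed

lemma ex_outside: "\<exists>m\<in>carrier M. m \<notin> Mk"
  using Mk_proper Mk_in by blast

lemma MK_proper: "MK \<noteq> carrier I"
proof -
  obtain m where m: "m \<in> carrier M" "m \<notin> Mk" using ex_outside by blast
  then have "H.j m \<notin> MK" using MK_top j_top_in_Mk by blast
  then show ?thesis using j_in[OF m(1)] by blast
qed

text \<open>
  The submodule generated by \<open>j Mk\<close> has \<open>j Mk\<close> as its component of degree zero, so it is proper.
\<close>

lemma j_Mk: "m \<in> Mk \<Longrightarrow> H.j m \<in> MK"
proof -
  assume m: "m \<in> Mk"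
  let ?G = "piece (H.j ` Mk) 0 {\<zero>\<^bsub>I\<^esub>}"
  \<comment> \<open>Being annihilated by positive degrees is inherited from \<open>j M\<close>; stability of \<open>Mk\<close> enters in \<open>gen_j_zero\<close>.\<close>
  have adm: "admissible (H.j ` Mk) {\<zero>\<^bsub>I\<^esub>}" by (rule adm_j) (use Mk_in in blast)
  note sub = piece_submodule[OF adm]
  let ?Y = "RH.sum_set ?G"
  have Y: "is_lie_submodule (hat K) I ?Y" by (rule span_submodule[OF adm])
  have mono: "gen (H.j ` Mk) 0 {\<zero>\<^bsub>I\<^esub>} i w \<Longrightarrow> gen (H.j ` carrier M) 0 {\<zero>\<^bsub>I\<^esub>} i w" for i w
    by (induction rule: gen.induct) (auto intro: gen.intros Mk_in)
  have "?Y \<subseteq> top_in_Mk"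
  proof
    fix w assume "w \<in> ?Y"
    then obtain g b ls where gb: "g \<in> ?G 0" "0 \<notin> set ls" "b \<in> RH.sum_list_set ?G ls" "w = g \<oplus>\<^bsub>I\<^esub> b"
      using RH.sum_set_split[where G = ?G and w = w and i = 0, OF sub] by blast
    have "b \<in> RH.sum_list_set Gr ls" by (rule RH.sls_family_mono[OF _ gb(3)]) (use mono in blast)
    moreover obtain m' where "m' \<in> Mk" "g = H.j m'" using gen_j_zero[OF Mk_hat] gb(1) by blast
    ultimately show "w \<in> top_in_Mk" unfolding top_in_Mk_def using gb by blast
  qed
  then have "?Y \<noteq> carrier I" using ex_outside j_top_in_Mk j_in by blast
  then have "?Y \<subseteq> MK" by (rule RH.proper_subset_sum[OF Y])
  moreover have "H.j m \<in> ?Y" by (rule RH.G_sum_set[OF sub]) (use m in \<open>auto intro: gen.base\<close>)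
  ultimately show ?thesis by blast
qed

text \<open>
  Otherwise the submodule generated by \<open>g\<close> and \<open>MK\<close> has no elements in degrees above \<open>- r\<close> except those of
  \<open>MK\<close>. In degree zero it then agrees with \<open>MK\<close>, so it is proper and contained in \<open>MK\<close>.
\<close>

lemma ex_raising:
  assumes g: "g \<in> Gr r" and r: "r > 0" and ng: "g \<notin> MK"
  shows "\<exists>e>0. \<exists>y\<in>hom_deg K e. act I y g \<notin> MK"
proof (rule ccontr)
  assume "\<not> ?thesis"
  \<comment> \<open>The negated claim is precisely that \<open>g\<close> is annihilated, modulo \<open>MK\<close>, by all positive degrees.\<close>
  then have adm: "admissible {g} MK"
    unfolding admissible_def using gen_in[OF adm_Gr] g MK_hat by blast
  let ?A = "piece {g} r MK"
  note sub = piece_submodule[OF adm]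
  let ?Y = "RH.sum_set ?A"
  have Y: "is_lie_submodule (hat K) I ?Y" by (rule span_submodule[OF adm])
  note MKs = RH.submodule_subset[OF MK_sub] RH.submodule_zero[OF MK_sub] RH.submodule_add[OF MK_sub] RH.submodule_smult[OF MK_sub]
  have MK_act: "act I y z \<in> MK" if "y \<in> hom_deg K e" "z \<in> MK" for y z e
    using MK_hat that hom_deg_hat unfolding RH.is_lie_submodule_iff toroidal_simps by blast
  \<comment> \<open>Modulo \<open>MK\<close> the new components are contained in those of \<open>I\<close>.\<close>
  have A: "\<exists>z\<in>MK. \<exists>h. h \<in> Gr i \<and> w = z \<oplus>\<^bsub>I\<^esub> h" if "gen {g} r MK i w" for i w
    using that
  proof (induction rule: gen.induct)
    case (base b)
    then have "b = \<zero>\<^bsub>I\<^esub> \<oplus>\<^bsub>I\<^esub> g" using g gen_in[OF adm_Gr] by (intro RH.crd_eqI) auto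
    then show ?case using g MKs(2) by blast
  next
    case (Z z i)
    then have "z = z \<oplus>\<^bsub>I\<^esub> \<zero>\<^bsub>I\<^esub>" using MKs(1) by (intro RH.crd_eqI) auto
    then show ?case using Z RH.submodule_zero[OF Gr_sub] by blast
  next
    case (act i w y n)
    then obtain z h where zh: "z \<in> MK" "h \<in> Gr i" "w = z \<oplus>\<^bsub>I\<^esub> h" by blast
    have "act I y w = act I y z \<oplus>\<^bsub>I\<^esub> act I y h"
      unfolding zh(3) using zh MKs(1) gen_in[OF adm_Gr] act.hyps(2) hom_deg_hat by (intro IA) auto
    moreover have "act I y h \<in> Gr (i + n)" using zh(2) act.hyps by (auto intro: gen.act)
    ultimately show ?case using MK_act[OF act.hyps(2) zh(1)] by blast
  next
    case (add i v w)
    then obtain z h z' h' where zh: "z \<in> MK" "h \<in> Gr i" "v = z \<oplus>\<^bsub>I\<^esub> h" "z' \<in> MK" "h' \<in> Gr i" "w = z' \<oplus>\<^bsub>I\<^esub> h'" by blast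
    have "v \<oplus>\<^bsub>I\<^esub> w = (z \<oplus>\<^bsub>I\<^esub> z') \<oplus>\<^bsub>I\<^esub> (h \<oplus>\<^bsub>I\<^esub> h')"
      unfolding zh(3,6) using zh(1,4) RH.submodule_subset[OF Gr_sub zh(2)] RH.submodule_subset[OF Gr_sub zh(5)] MKs(1)
      by (intro RH.crd_eqI) (simp_all add: algebra_simps)
    then show ?case using MKs(3)[OF zh(1,4)] RH.submodule_add[OF Gr_sub zh(2,5)] by blast
  next
    case (smult i w c)
    then obtain z h where zh: "z \<in> MK" "h \<in> Gr i" "w = z \<oplus>\<^bsub>I\<^esub> h" by blast
    have "c \<odot>\<^bsub>I\<^esub> w = (c \<odot>\<^bsub>I\<^esub> z) \<oplus>\<^bsub>I\<^esub> (c \<odot>\<^bsub>I\<^esub> h)"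
      unfolding zh(3) using zh(1) RH.submodule_subset[OF Gr_sub zh(2)] MKs(1)
      by (intro RH.crd_eqI) (simp_all add: ps.scale_right_distrib)
    then show ?case using MKs(4)[OF zh(1)] RH.submodule_smult[OF Gr_sub zh(2)] by blast
  qed
  \<comment> \<open>Indices below \<open>r\<close> contribute to \<open>MK\<close> only, by \<open>gen_low\<close>.\<close>
  have split: "\<exists>z\<in>MK. \<exists>b. b \<in> RH.sum_list_set Gr (filter (\<lambda>l. l \<ge> r) ls) \<and> w = z \<oplus>\<^bsub>I\<^esub> b"
    if "w \<in> RH.sum_list_set ?A ls" for w ls
    using that
  proof (induction ls arbitrary: w)
    case Nil
    have "w = \<zero>\<^bsub>I\<^esub> \<oplus>\<^bsub>I\<^esub> \<zero>\<^bsub>I\<^esub>" using Nil by (intro RH.crd_eqI) auto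
    then show ?case using MKs(2) by (simp, blast)
  next
    case (Cons l ls)
    then obtain a v where av: "w = a \<oplus>\<^bsub>I\<^esub> v" "gen {g} r MK l a" "v \<in> RH.sum_list_set ?A ls" by auto
    obtain z b where zb: "z \<in> MK" "b \<in> RH.sum_list_set Gr (filter (\<lambda>l. l \<ge> r) ls)" "v = z \<oplus>\<^bsub>I\<^esub> b"
      using Cons.IH[OF av(3)] by blast
    have bc: "b \<in> carrier I" using RH.sls_in[OF Gr_sub zb(2)] .
    show ?case
    proof (cases "l \<ge> r")
      case True
      obtain z' h where zh: "z' \<in> MK" "h \<in> Gr l" "a = z' \<oplus>\<^bsub>I\<^esub> h" using A[OF av(2)] by blast
      have "w = (z' \<oplus>\<^bsub>I\<^esub> z) \<oplus>\<^bsub>I\<^esub> (h \<oplus>\<^bsub>I\<^esub> b)"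
        unfolding av(1) zh(3) zb(3) using zh(1) zb(1) bc RH.submodule_subset[OF Gr_sub zh(2)] MKs(1)
        by (intro RH.crd_eqI) (simp_all add: algebra_simps)
      moreover have "h \<oplus>\<^bsub>I\<^esub> b \<in> RH.sum_list_set Gr (filter (\<lambda>l. l \<ge> r) (l # ls))"
        using True zh(2) zb(2) by auto
      ultimately show ?thesis using MKs(3)[OF zh(1) zb(1)] by blast
    next
      case False
      then have a: "a \<in> MK" using gen_low[OF adm av(2)] by simp
      have "w = (a \<oplus>\<^bsub>I\<^esub> z) \<oplus>\<^bsub>I\<^esub> b"
        unfolding av(1) zb(3) using a zb(1) bc MKs(1) by (intro RH.crd_eqI) (simp_all add: algebra_simps)
      then show ?thesis using False zb(2) MKs(3)[OF a zb(1)] by auto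
    qed
  qed
  have "?Y \<noteq> carrier I"
  proof
    assume all: "?Y = carrier I"
    have "H.j m \<in> MK" if m: "m \<in> carrier M" for m
    proof -
      obtain ls where "H.j m \<in> RH.sum_list_set ?A ls"
        using all j_in[OF m] unfolding RH.sum_set_def[OF sub] by blast
      then obtain z b where zb: "z \<in> MK" "b \<in> RH.sum_list_set Gr (filter (\<lambda>l. l \<ge> r) ls)" "H.j m = z \<oplus>\<^bsub>I\<^esub> b"
        using split by blast
      have c: "b \<in> carrier I" "z \<in> carrier I" using RH.sls_in[OF Gr_sub zb(2)] MKs(1)[OF zb(1)] .
      have "H.j m \<oplus>\<^bsub>I\<^esub> (- 1) \<odot>\<^bsub>I\<^esub> b = z"
        unfolding zb(3) using c by (intro RH.crd_eqI) (simp_all add: ps.scale_minus_left)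
      \<comment> \<open>Since \<open>r > 0\<close>, the remainder \<open>b\<close> has no component of index zero, and \<open>MK\<close> is graded.\<close>
      then show ?thesis
        using graded_hat[OF MK_hat j_Gr[OF m] RH.sls_smult[OF Gr_sub zb(2), of "- 1"]] zb(1) r by simp
    qed
    then have "MK = carrier I" by (intro H.j_generates[OF MK_hat]) (simp only: inflate_simps(1))
    then show False using MK_proper by simp
  qed
  then have "?Y \<subseteq> MK" by (rule RH.proper_subset_sum[OF Y])
  moreover have "g \<in> ?Y" by (rule RH.G_sum_set[OF sub]) (auto intro: gen.base)
  ultimately show False using ng by blast
qed

lemma sls_negative: "(\<And>l. l \<in> set ls \<Longrightarrow> l < 0) \<Longrightarrow> w \<in> RH.sum_list_set Gr ls \<Longrightarrow> w = \<zero>\<^bsub>I\<^esub>"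
proof (induction ls arbitrary: w)
  case (Cons l ls)
  then obtain g b where gb: "w = g \<oplus>\<^bsub>I\<^esub> b" "g \<in> Gr l" "b \<in> RH.sum_list_set Gr ls" by auto
  have "g = \<zero>\<^bsub>I\<^esub>" using Gr_neg[OF gb(2)] Cons.prems(1) by simp
  moreover have "b = \<zero>\<^bsub>I\<^esub>" using Cons.IH[OF _ gb(3)] Cons.prems(1) by simp
  ultimately show ?case unfolding gb(1) by (intro RH.crd_eqI) simp_all
qed simp

text \<open>
  Induction on the largest index in \<open>v\<close>, that is, on the depth of its lowest component \<open>g\<close>. Either \<open>g\<close> is in
  \<open>MK\<close> and can be dropped, or it is raised, together with \<open>v\<close>, by \<open>ex_raising\<close>. An interval of indices
  \<open>[lo..hi]\<close> is a form of the support that is preserved by both operations. Negative indices may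
  occur in it after raising, but the components there are zero.
\<close>

lemma reach_top:
  assumes S: "is_lie_submodule (til K) I S" and MKS: "MK \<subseteq> S"
  shows "v \<in> S \<Longrightarrow> v \<notin> MK \<Longrightarrow> v \<in> RH.sum_list_set Gr [lo..hi] \<Longrightarrow> m \<in> carrier M \<Longrightarrow> H.j m \<in> S"
\<comment> \<open>The summand \<open>1\<close> keeps the step from \<open>hi = 0\<close> to \<open>hi = - 1\<close> decreasing.\<close>
proof (induction "nat (hi + 1)" arbitrary: v lo hi rule: less_induct)
  case less
  have Ssub: "submodule S complex_ring I" using S by (simp add: is_lie_submodule_def)
  have zero: "\<zero>\<^bsub>I\<^esub> \<in> MK" by (rule RH.submodule_zero[OF MK_sub])
  have hi: "hi \<ge> 0" and lohi: "lo \<le> hi"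
  proof -
    show "hi \<ge> 0"
    proof (rule ccontr)
      assume "\<not> hi \<ge> 0"
      then have "v = \<zero>\<^bsub>I\<^esub>" by (intro sls_negative[OF _ less.prems(3)]) simp
      then show False using zero less.prems(2) by simp
    qed
    show "lo \<le> hi"
    proof (rule ccontr)
      assume "\<not> lo \<le> hi"
      then have "v = \<zero>\<^bsub>I\<^esub>" using less.prems(3) by simp
      then show False using zero less.prems(2) by simp
    qed
  qed
  \<comment> \<open>The largest index is moved to the front.\<close>
  have "v \<in> RH.sum_list_set Gr (hi # [lo..hi - 1])"
    by (rule RH.sls_mono[OF Gr_sub _ less.prems(3)]) auto
  then obtain g b where gb: "v = g \<oplus>\<^bsub>I\<^esub> b" "g \<in> Gr hi" "b \<in> RH.sum_list_set Gr [lo..hi - 1]" by auto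
  have c: "g \<in> carrier I" "b \<in> carrier I" using RH.submodule_subset[OF Gr_sub gb(2)] RH.sls_in[OF Gr_sub gb(3)] .
  show ?case
  proof (cases "g \<in> MK")
    case True
    have "b \<oplus>\<^bsub>I\<^esub> g = v" using c gb(1) by (intro RH.crd_eqI) (simp_all add: add.commute)
    then have "b \<in> S" using RH.submodule_cancel[OF Ssub _ c(2)] True MKS less.prems(1) by blast
    moreover have "b \<notin> MK"
      using RH.submodule_add[OF MK_sub True] less.prems(2) gb(1) by blast
    ultimately show ?thesis using less.hyps[of "hi - 1" b lo] hi gb(3) less.prems(4) by simp
  next
    case False
    show ?thesis
    \<comment> \<open>In degree zero, maximality of \<open>Mk\<close> without derivations takes over.\<close>
    proof (cases "hi = 0")
      case True
      then have "b = \<zero>\<^bsub>I\<^esub>" by (intro sls_negative[OF _ gb(3)]) simp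
      then have "v = g" using c gb(1) by (intro RH.crd_eqI) simp_all
      then obtain m0 where m0: "m0 \<in> carrier M" "v = H.j m0" using Gr_zero gb(2) True by auto
      let ?T = "{m \<in> carrier M. H.j m \<in> S}"
      have "is_lie_submodule (til k) M ?T" by (rule pre_til[OF S])
      moreover have "Mk \<subseteq> ?T" using Mk_in j_Mk MKS by blast
      moreover have "?T \<noteq> Mk" using m0 less.prems(1,2) j_Mk by blast
      ultimately have "?T = carrier M" using M_max unfolding is_maximal_submodule_def by blast
      then show ?thesis using less.prems(4) by blast
    next
      case False
      then obtain e y where e: "e > 0" and y: "y \<in> hom_deg K e" and yg: "act I y g \<notin> MK"
        using ex_raising[OF gb(2)] hi \<open>g \<notin> MK\<close> by force
      \<comment> \<open>Here it matters that \<open>y\<close> has nonzero degree: it involves no derivation, and so preserves \<open>S\<close>.\<close>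
      have yt: "y \<in> tilde_carrier K" using hom_deg_tilde[OF y] e by simp
      have yv: "act I y v = act I y g \<oplus>\<^bsub>I\<^esub> act I y b"
        unfolding gb(1) using hom_deg_hat[OF y] c by (rule IA)
      have ygr: "act I y g \<in> Gr (hi - e)" using gen_stable[OF adm_Gr _ y] gb(2) by simp
      have "act I y v \<in> S"
        using S yt less.prems(1) by (simp add: is_lie_submodule_def)
      \<comment> \<open>The component \<open>y g\<close> of \<open>y v\<close> would be in the graded submodule \<open>MK\<close>.\<close>
      moreover have "act I y v \<notin> MK"
      proof
        assume "act I y v \<in> MK"
        then have "act I y g \<in> MK"
          unfolding yv by (rule graded_hat[OF MK_hat ygr sls_act[OF adm_Gr gb(3) y], rotated]) auto
        then show False using yg by simp
      qed
      moreover have "act I y v \<in> RH.sum_list_set Gr [lo - e..hi - e]"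
        by (rule RH.sls_mono[OF Gr_sub _ sls_act[OF adm_Gr less.prems(3) y]]) auto
      ultimately show ?thesis using less.hyps[of "hi - e" "act I y v" "lo - e"] hi e less.prems(4) by simp
    qed
  qed
qed

theorem MK_maximal: "is_maximal_submodule (til K) I MK"
  unfolding is_maximal_submodule_def
proof (intro conjI allI impI)
  show "is_lie_submodule (til K) I MK" by (rule is_lie_submodule_substruct[OF til_sub_hat MK_hat])
  show "MK \<noteq> carrier I" by (rule MK_proper)
  fix S assume S: "is_lie_submodule (til K) I S \<and> S \<noteq> carrier I \<and> MK \<subseteq> S"
  show "S = MK"
  proof (rule ccontr)
    assume "S \<noteq> MK"
    then obtain v where v: "v \<in> S" "v \<notin> MK" using S by blast
    have "v \<in> carrier I" using S v(1) cmod.submodule_subset[OF RH.cmod_axioms] by (auto simp: is_lie_submodule_def)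
    then have "v \<in> RH.sum_set Gr" by (simp add: span_Gr)
    then obtain ls where ls: "v \<in> RH.sum_list_set Gr ls" by (auto simp: RH.sum_set_def[OF Gr_sub])
    have "v \<in> RH.sum_list_set Gr [Min (insert 0 (set ls))..Max (insert 0 (set ls))]"
      by (rule RH.sls_mono[OF Gr_sub _ ls]) auto
    then have "H.j m \<in> S" if "m \<in> carrier M" for m
      using reach_top[of S v _ _ m] S v that by blast
    then have "S = carrier I" using tilde_generates S by blast
    then show False using S by blast
  qed
qed

end


section \<open>The modules with upper index equal to the lower index\<close>

lemma irreducible_sum_proper:
  assumes "is_irreducible L M"
  shows "sum_proper_submodules L M = {\<zero>\<^bsub>M\<^esub>}" "is_maximal_submodule L M {\<zero>\<^bsub>M\<^esub>}"
proof -
  interpret lie_mod L M using assms by (intro lie_mod.intro) (simp add: is_irreducible_def)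
  have ne: "carrier M \<noteq> {\<zero>\<^bsub>M\<^esub>}" and simple: "\<And>N. is_lie_submodule L M N \<Longrightarrow> N = {\<zero>\<^bsub>M\<^esub>} \<or> N = carrier M"
    using assms by (auto simp: is_irreducible_def)
  show "is_maximal_submodule L M {\<zero>\<^bsub>M\<^esub>}"
    using is_lie_submodule_zero ne simple unfolding is_maximal_submodule_def by blast
  have X: "\<Union>{N. is_lie_submodule L M N \<and> N \<noteq> carrier M} \<subseteq> carrier M" by (auto simp: is_lie_submodule_iff)
  have "sum_proper_submodules L M \<subseteq> {\<zero>\<^bsub>M\<^esub>}"
    unfolding sum_proper_submodules_def
    by (rule submodule_lin_hull(3)[OF X]) (use is_lie_submodule_zero simple in \<open>auto simp: is_lie_submodule_def\<close>)
  moreover have "\<zero>\<^bsub>M\<^esub> \<in> sum_proper_submodules L M"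
    using sum_proper_submodule by (auto simp: is_lie_submodule_iff)
  ultimately show "sum_proper_submodules L M = {\<zero>\<^bsub>M\<^esub>}" by blast
qed

lemma realize_head:
  fixes M :: "('x::ab_group_add, ('x, 'v) universe) lie_rep"
  assumes L: "struct_closed L" "is_lie_module L M"
  shows "is_lie_module L (realize (head L M) :: ('x, ('x, 'v) universe) lie_rep)"
    "lie_isomorphic L (head L M) (realize (head L M) :: ('x, ('x, 'v) universe) lie_rep)"
proof -
  interpret lie_mod L M by (rule lie_mod.intro) fact
  have Q: "is_lie_module L (head L M)"
    unfolding head_def by (rule quotient_lie_module[OF L sum_proper_submodule])
  have inj: "inj_on (SOME f :: _ \<Rightarrow> ('x, 'v) universe. inj_on f (carrier (head L M))) (carrier (head L M))"
    unfolding head_def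
    by (rule someI_ex[of "\<lambda>f. inj_on f (carrier (quotient_rep M (sum_proper_submodules L M)))", OF ex_inj_on_quotient_rep])
  show "is_lie_module L (realize (head L M) :: ('x, ('x, 'v) universe) lie_rep)"
    unfolding realize_def by (rule transport_lie_module[OF L(1) Q inj])
  show "lie_isomorphic L (head L M) (realize (head L M) :: ('x, ('x, 'v) universe) lie_rep)"
    unfolding realize_def by (rule lie_isomorphic_transport[OF Q inj])
qed

lemma lie_isomorphic_substruct: "substruct P L \<Longrightarrow> lie_isomorphic L M N \<Longrightarrow> lie_isomorphic P M N"
  unfolding lie_isomorphic_def using lie_hom_substruct by blast

lemma is_quotient_of_isomorphic:
  assumes "is_lie_module L M" "lie_isomorphic L M M'" "is_quotient_of L N M'"
  shows "is_quotient_of L N M"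
proof -
  obtain f g where f: "f \<in> lie_hom L M M'" "bij_betw f (carrier M) (carrier M')" and g: "g \<in> lie_hom L M' N" "g ` carrier M' = carrier N"
    using assms(2,3) by (auto simp: lie_isomorphic_def is_quotient_of_def)
  have "(\<lambda>m. g (f m)) ` carrier M = carrier N" using f(2) g(2) by (auto simp: bij_betw_def image_image[symmetric])
  then show ?thesis
    unfolding is_quotient_of_def using lie_hom_comp[OF assms(1) f(1) g(1)] by blast
qed

context toroidal_setup
begin

lemma hat_carrier_0: "X \<in> hat_carrier 0 \<Longrightarrow> \<exists>x. X = E 0 x"
proof -
  assume X: "X \<in> hat_carrier 0"
  obtain a c d where Xe: "X = (a, c, d)" by (cases X)
  have k: "Poly_Mapping.keys a \<subseteq> {0}" "c = 0" "d = 0"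
    using X by (auto simp: Xe hat_carrier_def exponents_def)
  have "a = Poly_Mapping.single 0 (Poly_Mapping.lookup a 0)"
    using k(1) by (intro poly_mapping_eqI) (auto simp: lookup_single when_def in_keys_iff)
  then show ?thesis using k(2,3) Xe by blast
qed

lemma tilde_carrier_0: "tilde_carrier 0 = hat_carrier 0"
  by (auto simp: tilde_carrier_def hat_carrier_def)

lemma E_in_hat_carrier_0: "E 0 x \<in> hat_carrier 0"
  by (auto simp: hat_carrier_def exponents_def)

text \<open>
  In zero variables the only exponent is zero, so the toroidal algebra is \<open>'g\<close> itself.
\<close>

lemma base_module_irreducible:
  fixes V :: "('g, 'v) lie_rep"
  assumes V: "is_irreducible \<lparr>lie_carrier = UNIV, lie_scale = scale, lie_bracket = bracket\<rparr> V"
  shows "is_irreducible (hat 0) (base_module V)"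
proof -
  let ?g = "\<lparr>lie_carrier = UNIV, lie_scale = scale, lie_bracket = bracket\<rparr>"
  let ?V = "mk_rep (carrier V) \<zero>\<^bsub>V\<^esub> (add V) (smult V) (\<lambda>(a, c, d). act V (Poly_Mapping.lookup a 0)) :: ('g toroidal, 'v) lie_rep"
  have Vm: "is_lie_module ?g V" using V by (simp add: is_irreducible_def)
  interpret V: lie_mod ?g V by (rule lie_mod.intro) (rule Vm)
  have simps: "carrier ?V = carrier V" "\<zero>\<^bsub>?V\<^esub> = \<zero>\<^bsub>V\<^esub>" "v \<oplus>\<^bsub>?V\<^esub> w = v \<oplus>\<^bsub>V\<^esub> w" "z \<odot>\<^bsub>?V\<^esub> v = z \<odot>\<^bsub>V\<^esub> v"
    "act ?V (E 0 x) v = act V x v" for v w z x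
    by (simp_all add: mk_rep_def)
  have cmod: "cmod ?V"
    by (rule image_cmod[OF V.cmod_axioms, where f = "\<lambda>m. m"]) (simp_all only: simps image_ident)
  then interpret W0: cmod ?V .
  have minus: "v \<ominus>\<^bsub>?V\<^esub> w = v \<ominus>\<^bsub>V\<^esub> w" if "v \<in> carrier V" "w \<in> carrier V" for v w
  proof (rule V.eq_minusI)
    have vw: "v \<in> carrier ?V" "w \<in> carrier ?V" using that by (simp_all only: simps)
    then show "v \<ominus>\<^bsub>?V\<^esub> w \<in> carrier V" using W0.minus_in by (simp only: simps)
    have "(v \<ominus>\<^bsub>?V\<^esub> w) \<oplus>\<^bsub>?V\<^esub> w = v" using vw by (intro W0.crd_eqI) simp_all
    then show "(v \<ominus>\<^bsub>?V\<^esub> w) \<oplus>\<^bsub>V\<^esub> w = v" by (simp only: simps)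
  qed (rule that)
  have m: "is_lie_module (hat 0) ?V"
  proof (rule is_lie_moduleI)
    show "cmod ?V" by (rule cmod)
    fix X Y v w c assume "X \<in> lie_carrier (hat 0)" "v \<in> carrier ?V"
    then have X0: "X \<in> hat_carrier 0" and v: "v \<in> carrier V" by (simp_all only: simps toroidal_simps)
    obtain x where X: "X = E 0 x" using hat_carrier_0[OF X0] by (rule exE)
    show "act ?V X v \<in> carrier ?V" "act ?V X (c \<odot>\<^bsub>?V\<^esub> v) = c \<odot>\<^bsub>?V\<^esub> act ?V X v"
      "act ?V (lie_scale (hat 0) c X) v = c \<odot>\<^bsub>?V\<^esub> act ?V X v"
      unfolding X toroidal_simps sc_E simps using v V.act_scale_left[of x v c] by simp_all
    show "act ?V X (v \<oplus>\<^bsub>?V\<^esub> w) = act ?V X v \<oplus>\<^bsub>?V\<^esub> act ?V X w" if "w \<in> carrier ?V"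
      using that v unfolding X simps by simp
    assume "Y \<in> lie_carrier (hat 0)"
    then have Y0: "Y \<in> hat_carrier 0" by (simp only: toroidal_simps)
    obtain y where Y: "Y = E 0 y" using hat_carrier_0[OF Y0] by (rule exE)
    have s: "X + Y = E 0 (x + y)" unfolding X Y by (simp add: single_add)
    have b: "br X Y = E 0 (bracket x y)" unfolding X Y by (auto simp: br_gens intro!: poly_mapping_eqI)
    show "act ?V (X + Y) v = act ?V X v \<oplus>\<^bsub>?V\<^esub> act ?V Y v"
      unfolding s unfolding X Y simps using v V.act_add_left[of x y v] by simp
    show "act ?V (lie_bracket (hat 0) X Y) v = act ?V X (act ?V Y v) \<ominus>\<^bsub>?V\<^esub> act ?V Y (act ?V X v)"
      unfolding toroidal_simps b unfolding X Y simps using v V.act_bracket[of x y v] by (simp add: minus)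
  qed
  interpret W: lie_mod "hat 0" ?V by (rule lie_mod.intro) (rule m)
  have "is_lie_submodule ?g V N" if "is_lie_submodule (hat 0) ?V N" for N
  proof -
    have "act V x v \<in> N" if "v \<in> N" for x v
    proof -
      have "act ?V (E 0 x) v \<in> N"
        using \<open>is_lie_submodule (hat 0) ?V N\<close> that E_in_hat_carrier_0 unfolding W.is_lie_submodule_iff toroidal_simps by blast
      then show ?thesis by (simp only: simps)
    qed
    then show ?thesis
      using that unfolding W.is_lie_submodule_iff V.is_lie_submodule_iff simps by simp
  qed
  then have irr: "is_irreducible (hat 0) ?V"
    using V m unfolding is_irreducible_def simps by blast
  have inj: "inj_on (Base :: 'v \<Rightarrow> ('g toroidal, 'v) universe) (carrier ?V)" by (auto intro: inj_onI)
  show ?thesis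
    unfolding base_module_def
    by (rule irreducible_isomorphic[OF irr transport_lie_module[OF closed_toroidal(1) m inj] lie_isomorphic_transport[OF m inj]])
qed

context
  fixes p :: nat and h :: complex and V :: "('g, 'v) lie_rep"
  assumes V: "is_irreducible \<lparr>lie_carrier = UNIV, lie_scale = scale, lie_bracket = bracket\<rparr> V"
begin

abbreviation "Eh \<equiv> E_hat scale bracket form p h V"
abbreviation "Et \<equiv> E_tilde scale bracket form p h V (\<lambda>k. Eh k k)"

lemma Eh_step: "j \<le> k \<Longrightarrow> Eh (Suc k) j = realize (induced (hat (Suc k)) (hatp (Suc k)) (inflate (level p h (Suc k)) (Suc k) (Eh k j)))"
  by (simp add: Ind_hat_def)

lemma Et_step: "j \<le> k \<Longrightarrow> Et (Suc k) j = realize (induced (til (Suc k)) (tilp (Suc k)) (inflate (level p h (Suc k)) (Suc k) (Et k j)))"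
  by (simp add: Ind_tilde_def)

lemma Eh_diagonal: "Eh (Suc k) (Suc k) = realize (head (hat (Suc k)) (Eh (Suc k) 0))"
  by simp

lemma Et_diagonal: "Et k k = Eh k k"
  by (cases k) simp_all

lemma Eh_module: "j \<le> k \<Longrightarrow> is_lie_module (hat k) (Eh k j)"
proof (induction k arbitrary: j)
  case 0
  show ?case using base_module_irreducible[OF V] by (simp add: is_irreducible_def)
next
  case (Suc k)
  have low: "is_lie_module (hat (Suc k)) (Eh (Suc k) j)" if "j \<le> k" for j
  proof -
    interpret universe_induction "hat (Suc k)" "hatp (Suc k)" "inflate (level p h (Suc k)) (Suc k) (Eh k j)"
      by (rule hat_induction[OF Suc.IH[OF that]])
    show ?thesis unfolding Eh_step[OF that] by (rule R_module)
  qed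
  show ?case
  proof (cases "j \<le> k")
    case True
    then show ?thesis by (rule low)
  next
    case False
    then have "j = Suc k" using Suc.prems by simp
    then show ?thesis
      using realize_head(1)[OF closed_toroidal(1) low[of 0]] by (simp only: Eh_diagonal le0)
  qed
qed

lemma Eh_module_til: "j \<le> k \<Longrightarrow> is_lie_module (til k) (Eh k j)"
  by (rule is_lie_module_substruct[OF til_sub_hat Eh_module])

text \<open>
  In zero variables there are no derivations and the module is irreducible, so its maximal submodule is
  zero.
\<close>

lemma Eh_maximal: "is_maximal_submodule (til k) (Eh k 0) (sum_proper_submodules (hat k) (Eh k 0))"
proof (induction k)
  case 0
  have irr: "is_irreducible (hat 0) (Eh 0 0)" using base_module_irreducible[OF V] by simp
  show ?case
    using irreducible_sum_proper[OF irr] by (simp only: tilde_carrier_0)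
next
  case (Suc k)
  interpret maximal_induction scale bracket form k "Eh k 0" "level p h (Suc k)"
    by unfold_locales (rule Eh_module[OF le0], rule Suc)
  show ?case unfolding Eh_step[OF le0] by (rule MK_maximal)
qed

lemma Eh_irreducible: "is_irreducible (til k) (Eh k k)"
proof (cases k)
  case 0
  then show ?thesis using base_module_irreducible[OF V] by (simp add: tilde_carrier_0)
next
  case (Suc n)
  have "is_irreducible (til (Suc n)) (head (hat (Suc n)) (Eh (Suc n) 0))"
    unfolding head_def by (rule quotient_irreducible[OF closed_toroidal(2) Eh_module_til[OF le0] Eh_maximal])
  moreover have "lie_isomorphic (til (Suc n)) (head (hat (Suc n)) (Eh (Suc n) 0)) (Eh (Suc n) (Suc n))"
    unfolding Eh_diagonal
    by (rule lie_isomorphic_substruct[OF til_sub_hat realize_head(2)[OF closed_toroidal(1) Eh_module[OF le0]]])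
  ultimately show ?thesis
    using irreducible_isomorphic Eh_module_til[of "Suc n" "Suc n"] Suc by blast
qed

text \<open>
  Replacing the module by an isomorphic one and then adding derivations are the two steps at each stage
  of the recursion.
\<close>

lemma Et_isomorphic: "j \<le> k \<Longrightarrow> is_lie_module (til k) (Et k j) \<and> lie_isomorphic (til k) (Et k j) (Eh k j)"
proof (induction k arbitrary: j)
  case 0
  then show ?case using Eh_module_til[of 0 0] by (simp add: lie_isomorphic_refl)
next
  case (Suc k)
  show ?case
  proof (cases "j \<le> k")
    case True
    note IH = Suc.IH[OF True]
    interpret A: universe_induction "til (Suc k)" "tilp (Suc k)" "inflate (level p h (Suc k)) (Suc k) (Et k j)"
      by (rule til_induction) (use IH in blast)
    interpret B: tilde_hat_induction scale bracket form k "Eh k j" "level p h (Suc k)"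
      by unfold_locales (rule Eh_module[OF True])
    have "lie_isomorphic (til (Suc k)) A.R B.S.R"
      using til_induction_isomorphic[OF _ Eh_module_til[OF True]] IH by blast
    then have "lie_isomorphic (til (Suc k)) A.R B.H.R"
      by (rule lie_isomorphic_trans[OF A.R_module _ B.tilde_hat_isomorphic])
    then show ?thesis unfolding Eh_step[OF True] Et_step[OF True] using A.R_module by blast
  next
    case False
    then have "j = Suc k" using Suc.prems by simp
    then show ?thesis using Eh_module_til[of "Suc k" "Suc k"] by (simp only: Et_diagonal lie_isomorphic_refl le_refl)
  qed
qed

text \<open>
  The chosen quotient is by construction a quotient of the module defined with derivations, and it is carried over
  to the module defined without them by \<open>Et_isomorphic\<close>.
\<close>

lemma Eh_quotient: "is_quotient_of (til (Suc k)) (Eh (Suc k) (Suc k)) (Et (Suc k) 0)"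
proof -
  let ?M = "Eh (Suc k) 0"
  have M: "is_lie_module (hat (Suc k)) ?M" by (rule Eh_module[OF le0])
  interpret M: lie_mod "hat (Suc k)" ?M by (rule lie_mod.intro) (rule M)
  let ?N = "sum_proper_submodules (hat (Suc k)) ?M"
  have "(\<lambda>a. ?N +>\<^bsub>?M\<^esub> a) \<in> lie_hom (hat (Suc k)) ?M (head (hat (Suc k)) ?M)"
    unfolding head_def by (rule quotient_map_hom[OF M M.sum_proper_submodule])
  then have q: "(\<lambda>a. ?N +>\<^bsub>?M\<^esub> a) \<in> lie_hom (til (Suc k)) ?M (head (hat (Suc k)) ?M)"
    by (rule lie_hom_substruct[OF til_sub_hat])
  have surj: "(\<lambda>a. ?N +>\<^bsub>?M\<^esub> a) ` carrier ?M = carrier (head (hat (Suc k)) ?M)"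
    by (simp only: head_def quotient_rep_carrier)
  obtain f where f: "f \<in> lie_hom (til (Suc k)) (head (hat (Suc k)) ?M) (Eh (Suc k) (Suc k))"
    "bij_betw f (carrier (head (hat (Suc k)) ?M)) (carrier (Eh (Suc k) (Suc k)))"
    using lie_isomorphic_substruct[OF til_sub_hat realize_head(2)[OF closed_toroidal(1) M]]
    unfolding Eh_diagonal lie_isomorphic_def by blast
  have "(\<lambda>a. f (?N +>\<^bsub>?M\<^esub> a)) ` carrier ?M = carrier (Eh (Suc k) (Suc k))"
    using surj f(2) unfolding bij_betw_def by (metis image_image)
  then have "is_quotient_of (til (Suc k)) (Eh (Suc k) (Suc k)) ?M"
    unfolding is_quotient_of_def using lie_hom_comp[OF Eh_module_til[OF le0] q f(1)] by blast
  then show ?thesis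
    using is_quotient_of_isomorphic Et_isomorphic[of 0 "Suc k"] by blast
qed

end

end

theorem proposition10:
  fixes scale :: "complex \<Rightarrow> 'g::ab_group_add \<Rightarrow> 'g" and bracket :: "'g \<Rightarrow> 'g \<Rightarrow> 'g"
    and form :: "'g \<Rightarrow> 'g \<Rightarrow> complex" and t :: "'g set" and \<Delta> :: "('g \<Rightarrow> complex) set"
    and \<theta> lam :: "'g \<Rightarrow> complex" and p :: nat and V :: "('g, 'v) lie_rep"
  assumes "simple_lie_setup scale bracket form t \<Delta> \<theta>"
    and "prime p"
    and "lie_algebra.is_dominant_integral scale form t \<Delta> lam"
    and "is_highest_weight_module scale bracket t \<Delta> lam V"
  shows
    "let h = lie_algebra.dual_coxeter scale bracket form t \<Delta> \<theta>;
         g_hat = (\<lambda>k. toroidal scale bracket form (hat_carrier k));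
         g_tilde = (\<lambda>k. toroidal scale bracket form (tilde_carrier k));
         Ehat = E_hat scale bracket form p h V;
         C = (\<lambda>k. Ehat k k);
         E = E_tilde scale bracket form p h V C
     in
       (\<forall>k\<ge>1. is_irreducible (g_tilde (k - 1)) (Ehat (k - 1) (k - 1)) \<longrightarrow>
          is_maximal_submodule (g_tilde k) (Ehat k 0) (sum_proper_submodules (g_hat k) (Ehat k 0)) \<and>
          is_irreducible (g_tilde k) (Ehat k k)) \<and>
       (\<forall>k. is_irreducible (g_tilde k) (Ehat k k)) \<and>
       (\<forall>k\<ge>1. is_quotient_of (g_tilde k) (C k) (E k 0)) \<and>
       (\<forall>k. \<forall>k'\<le>k. lie_isomorphic (g_tilde k) (E k k') (Ehat k k'))"
proof -
  interpret simple_lie_setup scale bracket form t \<Delta> \<theta> by fact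
  interpret toroidal_setup scale bracket form
    by unfold_locales (rule invariant_form)
  have V: "is_irreducible \<lparr>lie_carrier = UNIV, lie_scale = scale, lie_bracket = bracket\<rparr> V"
    using assms(4) by (simp add: is_highest_weight_module_def)
  have quotient: "is_quotient_of (til k) (E_hat scale bracket form p h V k k)
      (E_tilde scale bracket form p h V (\<lambda>k. E_hat scale bracket form p h V k k) k 0)" if "k \<ge> 1" for k h
    using Eh_quotient[OF V, where p = p and h = h and k = "k - 1"] that by simp
  show ?thesis
    unfolding Let_def
    using Eh_maximal[OF V] Eh_irreducible[OF V] quotient Et_isomorphic[OF V] by blast
qed

end
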